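(* There exist constants $\alpha>1$ (namely $\alpha=2(c_S+2)$, where $c_S>1$ is the fixed constant such that for every $n\ge 16$ the auxiliary space used by SquareSort on $n$ items, not counting the arrays $A$ and $D$, is at most $c_S n$), $c\ge 64$ and $\beta>\alpha$ such that for every block size $B>\beta$, every cache size $M\ge B^2$ and every $n\ge 1$, $$T(n)\le \frac{cn}{B}\Bigl(2\max(\log_{M/\alpha} n,1)-1\Bigr)+\frac{c}{16},$$ where $T(n)$ is the expected number of IOs performed by SquareSort on an input of $n$ distinct items (expectation over the algorithm's randomness). In particular the expected IO complexity of SquareSort is $O\bigl(\frac{n}{B}\log_{M/B} n\bigr)$.
   Context: Cache-oblivious (external memory) model: external memory consists of cells, each holding one item, an integer or a pointer, partitioned into blocks of $B$ consecutive cells. A cache holds $M$ cells organized as $M/B$ blocks. Any access to a memory cell requires the whole block containing it to be in the cache; transferring a block between memory and cache (including writing back a modified evicted block) is one IO. The paging (replacement) strategy is assumed optimal for the given sequence of memory accesses. The algorithm does not know $M$ or $B$. Function parameters, local variables and locally allocated arrays are stored on a contiguous call stack in external memory; arrays are passed as a pointer to their first element. SquareSort$(A,D,n)$ sorts the $n$ distinct items of array $A$ into array $D$ (the contents of $A$ may be permuted). If $n\le 16$ it sorts directly. Otherwise let $m=\lceil\sqrt n\rceil$; the $i$-th column ($i=1,\dots,m$) is the index range $[1+\min((i-1)m,n),\,1+\min(im,n))$. Each column of $A$ is sorted recursively by SquareSort into the same index range of $D$. Then a uniformly random set $P$ of $m-1$ distinct elements of $D$ other than $\min(D)$ is chosen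 (by sampling $m-1$ indices uniformly with replacement, sorting the sampled elements with MergeSort, and resampling everything if they are not distinct or include $\min(D)$), and $P\cup\{\infty\}$ is sorted into $pivots[1..m]$; with $pivots[0]=-\infty$, bucket $j$ consists of the elements in $[pivots[j-1],pivots[j])$. The starting position of each bucket in the sorted order is computed by scanning each sorted column together with the pivots. Then a skew transposition moves the elements of $D$ into $A$ so that each bucket occupies a contiguous segment of $A$, buckets in increasing order; the skew transposition is the recursive procedure that, given $\ell$ sorted sub-columns and $k$ pivots with write positions for their buckets, either (if $\ell<4$ or $k<4$) for each pivot index $i=1..k$ and each sub-column $j=1..\ell$ moves the leading elements of sub-column $j$ lying in bucket $i$ into the next free slots of bucket $i$, or else splits into four recursive calls on (first $\lfloor\ell/2\rfloor$ sub-columns, first $\lfloor k/2\rfloor$ pivots), (remaining sub-columns, first pivots), (first sub-columns, remaining pivots), (remaining sub-columns, remaining pivots), in this order, with sub-column and bucket positions updated in place. Finally each bucket in $A$ is sorted recursively by SquareSort into the same index range of $D$. *)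

theory Defs
  imports "HOL-Probability.Probability" "HOL-Library.Extended"
begin

no_notation Pinf (\<open>\<infinity>\<close>)
no_notation Minf (\<open>-\<infinity>\<close>)

section \<open>External memory and optimal paging\<close>

text \<open>
  A cell holds an item (an integer) or a pointer (an integer address), both as \<open>Fin\<close>, or one of the
  sentinels \<open>Minf\<close>, \<open>Pinf\<close> that bound the list of pivots. Block \<open>k\<close> consists of the cells with
  addresses \<open>k * B, \<dots>, k * B + B - 1\<close>.
\<close>

type_synonym addr = int
type_synonym cell = "int extended"
type_synonym mem = "addr \<Rightarrow> cell"

datatype access = Read addr | Write addr

fun addr_of :: "access \<Rightarrow> addr" where
  "addr_of (Read x) = x"
| "addr_of (Write x) = x"

text \<open>
  \<open>paging K B C W t k\<close>: a cache of \<open>K\<close> blocks that currently holds the blocks in \<open>C\<close>, those in \<open>W\<close>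
  being modified, can serve the access sequence \<open>t\<close> with \<open>k\<close> IOs. The replacement decisions are
  arbitrary, so the optimal (offline) strategy attains the least such \<open>k\<close>.
\<close>

inductive paging :: "nat \<Rightarrow> nat \<Rightarrow> int set \<Rightarrow> int set \<Rightarrow> access list \<Rightarrow> nat \<Rightarrow> bool"
  for K B :: nat where
  finish: "paging K B C W [] 0"
| load: "b \<notin> C \<Longrightarrow> card C < K \<Longrightarrow> paging K B (insert b C) W t k \<Longrightarrow> paging K B C W t (Suc k)"
| evict: "b \<in> C \<Longrightarrow> b \<notin> W \<Longrightarrow> paging K B (C - {b}) W t k \<Longrightarrow> paging K B C W t k"
| write_back: "b \<in> C \<Longrightarrow> b \<in> W \<Longrightarrow> paging K B (C - {b}) (W - {b}) t k \<Longrightarrow> paging K B C W t (Suc k)"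
| serve_read: "x div int B \<in> C \<Longrightarrow> paging K B C W t k \<Longrightarrow> paging K B C W (Read x # t) k"
| serve_write: "x div int B \<in> C \<Longrightarrow> paging K B C (insert (x div int B) W) t k
    \<Longrightarrow> paging K B C W (Write x # t) k"

definition opt_ios :: "nat \<Rightarrow> nat \<Rightarrow> access list \<Rightarrow> nat" where
  "opt_ios M B t = (LEAST k. paging (M div B) B {} {} t k)"


section \<open>A procedural language whose variables live on the call stack\<close>

text \<open>
  Every occurrence of a variable is an access to a cell of the current stack frame; only intermediate
  results of the evaluation of a single expression are held outside the external memory.
  \<open>Alloc x e\<close> reserves a local array of \<open>e\<close> cells on top of the stack and stores the pointer to its
  first cell in \<open>x\<close>; \<open>Random x e\<close> stores a uniformly random element of \<open>{0..<e}\<close> in \<open>x\<close>.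
\<close>

type_synonym vname = string

datatype pname = SquareSort | MergeSort | SkewTranspose

datatype expr =
    Const cell
  | V vname
  | Deref expr
  | Plus expr expr  (infixl \<open>\<oplus>\<close> 65)
  | Minus expr expr  (infixl \<open>\<ominus>\<close> 65)
  | Times expr expr  (infixl \<open>\<odot>\<close> 70)
  | Half expr
  | MinE expr expr
  | CeilSqrt expr

datatype bexpr =
    Less expr expr  (infix \<open>\<prec>\<close> 50)
  | Equal expr expr  (infix \<open>\<doteq>\<close> 50)
  | NotB bexpr
  | And bexpr bexpr  (infixr \<open>AND\<close> 35)
  | Or bexpr bexpr  (infixr \<open>OR\<close> 30)

datatype com =
    SKIP
  | Assign vname expr  (\<open>(_ ::= _)\<close> [61, 61] 61)
  | Store expr expr  (\<open>(_ :*= _)\<close> [61, 61] 61)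
  | Alloc vname expr
  | Random vname expr
  | Seq com com  (\<open>(_;;/ _)\<close> [60, 61] 60)
  | Cond bexpr com com  (\<open>(IF _/ THEN _/ ELSE _)\<close> [0, 0, 61] 61)
  | While bexpr com  (\<open>(WHILE _/ DO _)\<close> [0, 61] 61)
  | Call pname "expr list"

datatype proc = Proc (params: "vname list") (locals: "vname list") (body: com)

abbreviation N :: "int \<Rightarrow> expr" where "N i \<equiv> Const (Fin i)"

abbreviation Elem :: "expr \<Rightarrow> expr \<Rightarrow> expr"  (\<open>_[[_]]\<close> [100, 0] 100) where
  "X[[i]] \<equiv> Deref (X \<oplus> i)"

fun int_of :: "cell \<Rightarrow> int" where
  "int_of (Fin i) = i"
| "int_of _ = 0"

fun aval :: "(vname \<Rightarrow> addr) \<Rightarrow> mem \<Rightarrow> expr \<Rightarrow> cell" where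
  "aval \<rho> \<sigma> (Const v) = v"
| "aval \<rho> \<sigma> (V x) = \<sigma> (\<rho> x)"
| "aval \<rho> \<sigma> (Deref e) = \<sigma> (int_of (aval \<rho> \<sigma> e))"
| "aval \<rho> \<sigma> (e1 \<oplus> e2) = Fin (int_of (aval \<rho> \<sigma> e1) + int_of (aval \<rho> \<sigma> e2))"
| "aval \<rho> \<sigma> (e1 \<ominus> e2) = Fin (int_of (aval \<rho> \<sigma> e1) - int_of (aval \<rho> \<sigma> e2))"
| "aval \<rho> \<sigma> (e1 \<odot> e2) = Fin (int_of (aval \<rho> \<sigma> e1) * int_of (aval \<rho> \<sigma> e2))"
| "aval \<rho> \<sigma> (Half e) = Fin (int_of (aval \<rho> \<sigma> e) div 2)"
| "aval \<rho> \<sigma> (MinE e1 e2) = min (aval \<rho> \<sigma> e1) (aval \<rho> \<sigma> e2)"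
| "aval \<rho> \<sigma> (CeilSqrt e) = Fin \<lceil>sqrt (real_of_int (int_of (aval \<rho> \<sigma> e)))\<rceil>"

fun aval_acc :: "(vname \<Rightarrow> addr) \<Rightarrow> mem \<Rightarrow> expr \<Rightarrow> access list" where
  "aval_acc \<rho> \<sigma> (Const v) = []"
| "aval_acc \<rho> \<sigma> (V x) = [Read (\<rho> x)]"
| "aval_acc \<rho> \<sigma> (Deref e) = aval_acc \<rho> \<sigma> e @ [Read (int_of (aval \<rho> \<sigma> e))]"
| "aval_acc \<rho> \<sigma> (e1 \<oplus> e2) = aval_acc \<rho> \<sigma> e1 @ aval_acc \<rho> \<sigma> e2"
| "aval_acc \<rho> \<sigma> (e1 \<ominus> e2) = aval_acc \<rho> \<sigma> e1 @ aval_acc \<rho> \<sigma> e2"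
| "aval_acc \<rho> \<sigma> (e1 \<odot> e2) = aval_acc \<rho> \<sigma> e1 @ aval_acc \<rho> \<sigma> e2"
| "aval_acc \<rho> \<sigma> (Half e) = aval_acc \<rho> \<sigma> e"
| "aval_acc \<rho> \<sigma> (MinE e1 e2) = aval_acc \<rho> \<sigma> e1 @ aval_acc \<rho> \<sigma> e2"
| "aval_acc \<rho> \<sigma> (CeilSqrt e) = aval_acc \<rho> \<sigma> e"

fun bval :: "(vname \<Rightarrow> addr) \<Rightarrow> mem \<Rightarrow> bexpr \<Rightarrow> bool" where
  "bval \<rho> \<sigma> (e1 \<prec> e2) = (aval \<rho> \<sigma> e1 < aval \<rho> \<sigma> e2)"
| "bval \<rho> \<sigma> (e1 \<doteq> e2) = (aval \<rho> \<sigma> e1 = aval \<rho> \<sigma> e2)"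
| "bval \<rho> \<sigma> (NotB b) = (\<not> bval \<rho> \<sigma> b)"
| "bval \<rho> \<sigma> (b1 AND b2) = (bval \<rho> \<sigma> b1 \<and> bval \<rho> \<sigma> b2)"
| "bval \<rho> \<sigma> (b1 OR b2) = (bval \<rho> \<sigma> b1 \<or> bval \<rho> \<sigma> b2)"

fun bval_acc :: "(vname \<Rightarrow> addr) \<Rightarrow> mem \<Rightarrow> bexpr \<Rightarrow> access list" where
  "bval_acc \<rho> \<sigma> (e1 \<prec> e2) = aval_acc \<rho> \<sigma> e1 @ aval_acc \<rho> \<sigma> e2"
| "bval_acc \<rho> \<sigma> (e1 \<doteq> e2) = aval_acc \<rho> \<sigma> e1 @ aval_acc \<rho> \<sigma> e2"
| "bval_acc \<rho> \<sigma> (NotB b) = bval_acc \<rho> \<sigma> b"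
| "bval_acc \<rho> \<sigma> (b1 AND b2) = bval_acc \<rho> \<sigma> b1 @ (if bval \<rho> \<sigma> b1 then bval_acc \<rho> \<sigma> b2 else [])"
| "bval_acc \<rho> \<sigma> (b1 OR b2) = bval_acc \<rho> \<sigma> b1 @ (if bval \<rho> \<sigma> b1 then [] else bval_acc \<rho> \<sigma> b2)"

text \<open>
  The frame of a procedure activated with stack pointer \<open>sp\<close> starts at address \<open>sp\<close>: first the
  parameters, then the local variables. The stack grows upwards.
\<close>

fun index_of :: "'a list \<Rightarrow> 'a \<Rightarrow> nat" where
  "index_of [] y = 0"
| "index_of (x # xs) y = (if x = y then 0 else Suc (index_of xs y))"

definition frame_vars :: "proc \<Rightarrow> vname list" where
  "frame_vars p = params p @ locals p"

definition frame :: "proc \<Rightarrow> addr \<Rightarrow> vname \<Rightarrow> addr" where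
  "frame p sp x = sp + int (index_of (frame_vars p) x)"

fun write_list :: "mem \<Rightarrow> addr \<Rightarrow> cell list \<Rightarrow> mem" where
  "write_list \<sigma> x [] = \<sigma>"
| "write_list \<sigma> x (v # vs) = write_list (\<sigma>(x := v)) (x + 1) vs"

text \<open>
  The result of an execution is the final memory, the final stack pointer and the sequence of memory
  accesses. The mass missing in the subprobability distribution is the probability of divergence.
\<close>

context
  fixes \<pi> :: "pname \<Rightarrow> proc"
begin

(* the derivation of exec.fixp_induct exceeds the default bound *)
declare [[unify_search_bound = 600]]

partial_function (spmf) exec ::
  "(vname \<Rightarrow> addr) \<Rightarrow> com \<Rightarrow> mem \<Rightarrow> addr \<Rightarrow> (mem \<times> addr \<times> access list) spmf"
where
  "exec \<rho> c \<sigma> sp = (case c of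
      SKIP \<Rightarrow> return_spmf (\<sigma>, sp, [])
    | Assign x e \<Rightarrow>
        return_spmf (\<sigma>(\<rho> x := aval \<rho> \<sigma> e), sp, aval_acc \<rho> \<sigma> e @ [Write (\<rho> x)])
    | Store e1 e2 \<Rightarrow>
        return_spmf (\<sigma>(int_of (aval \<rho> \<sigma> e1) := aval \<rho> \<sigma> e2), sp,
          aval_acc \<rho> \<sigma> e1 @ aval_acc \<rho> \<sigma> e2 @ [Write (int_of (aval \<rho> \<sigma> e1))])
    | Alloc x e \<Rightarrow>
        return_spmf (\<sigma>(\<rho> x := Fin sp), sp + int_of (aval \<rho> \<sigma> e), aval_acc \<rho> \<sigma> e @ [Write (\<rho> x)])
    | Random x e \<Rightarrow>
        map_spmf (\<lambda>r. (\<sigma>(\<rho> x := Fin r), sp, aval_acc \<rho> \<sigma> e @ [Write (\<rho> x)]))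
          (spmf_of_set {0..<int_of (aval \<rho> \<sigma> e)})
    | Seq c1 c2 \<Rightarrow>
        bind_spmf (exec \<rho> c1 \<sigma> sp) (\<lambda>(\<sigma>1, sp1, t1).
          map_spmf (\<lambda>(\<sigma>2, sp2, t2). (\<sigma>2, sp2, t1 @ t2)) (exec \<rho> c2 \<sigma>1 sp1))
    | Cond b c1 c2 \<Rightarrow>
        map_spmf (\<lambda>(\<sigma>', sp', t). (\<sigma>', sp', bval_acc \<rho> \<sigma> b @ t))
          (exec \<rho> (if bval \<rho> \<sigma> b then c1 else c2) \<sigma> sp)
    | While b c1 \<Rightarrow>
        map_spmf (\<lambda>(\<sigma>', sp', t). (\<sigma>', sp', bval_acc \<rho> \<sigma> b @ t))
          (exec \<rho> (if bval \<rho> \<sigma> b then Seq c1 (While b c1) else SKIP) \<sigma> sp)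
    | Call p es \<Rightarrow>
        map_spmf (\<lambda>(\<sigma>', sp', t). (\<sigma>', sp,
            concat (map (aval_acc \<rho> \<sigma>) es) @ map (\<lambda>i. Write (sp + int i)) [0..<length es] @ t))
          (exec (frame (\<pi> p) sp) (body (\<pi> p)) (write_list \<sigma> sp (map (aval \<rho> \<sigma>) es))
            (sp + int (length (frame_vars (\<pi> p))))))"

end


section \<open>SquareSort\<close>

text \<open>
  Arrays are indexed from 0, so column \<open>i\<close> (for \<open>i < m\<close>) is the index range
  \<open>[min (i * m) n, min ((i + 1) * m) n)\<close>, except that \<open>pivots\<close> has indices \<open>0, \<dots>, m\<close>.
\<close>

text \<open>\<open>DirectSort\<close> is insertion of the items of \<open>A\<close> into \<open>D\<close>, one by one.\<close>

definition DirectSort :: com where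
  "DirectSort =
    ''i'' ::= N 0;;
    WHILE V ''i'' \<prec> V ''n'' DO (
      ''x'' ::= (V ''A'')[[V ''i'']];;
      ''j'' ::= V ''i'';;
      WHILE N 0 \<prec> V ''j'' AND V ''x'' \<prec> (V ''D'')[[V ''j'' \<ominus> N 1]] DO (
        V ''D'' \<oplus> V ''j'' :*= (V ''D'')[[V ''j'' \<ominus> N 1]];;
        ''j'' ::= V ''j'' \<ominus> N 1);;
      V ''D'' \<oplus> V ''j'' :*= V ''x'';;
      ''i'' ::= V ''i'' \<oplus> N 1)"

definition SortColumns :: com where
  "SortColumns =
    ''i'' ::= N 0;;
    WHILE V ''i'' \<prec> V ''m'' DO (
      ''s'' ::= MinE (V ''i'' \<odot> V ''m'') (V ''n'');;
      ''e'' ::= MinE ((V ''i'' \<oplus> N 1) \<odot> V ''m'') (V ''n'');;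
      Call SquareSort [V ''A'' \<oplus> V ''s'', V ''D'' \<oplus> V ''s'', V ''e'' \<ominus> V ''s''];;
      ''i'' ::= V ''i'' \<oplus> N 1)"

definition ChoosePivots :: com where
  "ChoosePivots =
    ''x'' ::= (V ''D'')[[N 0]];;
    ''i'' ::= N 1;;
    WHILE V ''i'' \<prec> V ''n'' DO (
      ''x'' ::= MinE (V ''x'') ((V ''D'')[[V ''i'']]);;
      ''i'' ::= V ''i'' \<oplus> N 1);;
    Alloc ''pivots'' (V ''m'' \<oplus> N 1);;
    V ''pivots'' :*= Const Minf;;
    V ''pivots'' \<oplus> V ''m'' :*= Const Pinf;;
    ''ok'' ::= N 0;;
    WHILE V ''ok'' \<doteq> N 0 DO (
      ''i'' ::= N 1;;
      WHILE V ''i'' \<prec> V ''m'' DO (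
        Random ''j'' (V ''n'');;
        V ''pivots'' \<oplus> V ''i'' :*= (V ''D'')[[V ''j'']];;
        ''i'' ::= V ''i'' \<oplus> N 1);;
      Call MergeSort [V ''pivots'' \<oplus> N 1, V ''m'' \<ominus> N 1];;
      ''ok'' ::= N 1;;
      ''i'' ::= N 1;;
      WHILE V ''i'' \<prec> V ''m'' DO (
        (IF (V ''pivots'')[[V ''i'']] \<doteq> V ''x'' OR
            (V ''pivots'')[[V ''i'']] \<doteq> (V ''pivots'')[[V ''i'' \<ominus> N 1]]
         THEN ''ok'' ::= N 0 ELSE SKIP);;
        ''i'' ::= V ''i'' \<oplus> N 1))"

text \<open>
  \<open>bs[i]\<close> first counts the elements of bucket \<open>i\<close>; after the prefix summation bucket \<open>i\<close>
  (for \<open>1 \<le> i \<le> m\<close>) has the index range \<open>[bs[i - 1], bs[i])\<close>.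
\<close>

definition BucketStarts :: com where
  "BucketStarts =
    Alloc ''bs'' (V ''m'' \<oplus> N 1);;
    ''i'' ::= N 0;;
    WHILE V ''i'' \<prec> V ''m'' \<oplus> N 1 DO (
      V ''bs'' \<oplus> V ''i'' :*= N 0;;
      ''i'' ::= V ''i'' \<oplus> N 1);;
    ''j'' ::= N 0;;
    WHILE V ''j'' \<prec> V ''m'' DO (
      ''s'' ::= MinE (V ''j'' \<odot> V ''m'') (V ''n'');;
      ''e'' ::= MinE ((V ''j'' \<oplus> N 1) \<odot> V ''m'') (V ''n'');;
      ''i'' ::= N 1;;
      WHILE V ''s'' \<prec> V ''e'' DO (
        WHILE NotB ((V ''D'')[[V ''s'']] \<prec> (V ''pivots'')[[V ''i'']]) DO
          ''i'' ::= V ''i'' \<oplus> N 1;;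
        V ''bs'' \<oplus> V ''i'' :*= (V ''bs'')[[V ''i'']] \<oplus> N 1;;
        ''s'' ::= V ''s'' \<oplus> N 1);;
      ''j'' ::= V ''j'' \<oplus> N 1);;
    ''i'' ::= N 1;;
    WHILE V ''i'' \<prec> V ''m'' \<oplus> N 1 DO (
      V ''bs'' \<oplus> V ''i'' :*= (V ''bs'')[[V ''i'']] \<oplus> (V ''bs'')[[V ''i'' \<ominus> N 1]];;
      ''i'' ::= V ''i'' \<oplus> N 1)"

text \<open>
  \<open>C[j]\<close> and \<open>E[j]\<close> point to the first remaining element and to the end of sub-column \<open>j\<close> of \<open>D\<close>;
  \<open>W[i]\<close> points to the next free slot of the \<open>i\<close>-th bucket in \<open>A\<close>.
\<close>

definition MoveToBuckets :: com where
  "MoveToBuckets =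
    Alloc ''C'' (V ''m'');;
    Alloc ''E'' (V ''m'');;
    Alloc ''W'' (V ''m'');;
    ''i'' ::= N 0;;
    WHILE V ''i'' \<prec> V ''m'' DO (
      V ''C'' \<oplus> V ''i'' :*= V ''D'' \<oplus> MinE (V ''i'' \<odot> V ''m'') (V ''n'');;
      V ''E'' \<oplus> V ''i'' :*= V ''D'' \<oplus> MinE ((V ''i'' \<oplus> N 1) \<odot> V ''m'') (V ''n'');;
      V ''W'' \<oplus> V ''i'' :*= V ''A'' \<oplus> (V ''bs'')[[V ''i'']];;
      ''i'' ::= V ''i'' \<oplus> N 1);;
    Call SkewTranspose [V ''C'', V ''E'', V ''m'', V ''pivots'' \<oplus> N 1, V ''W'', V ''m'']"

definition SortBuckets :: com where
  "SortBuckets =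
    ''i'' ::= N 0;;
    WHILE V ''i'' \<prec> V ''m'' DO (
      ''s'' ::= (V ''bs'')[[V ''i'']];;
      ''e'' ::= (V ''bs'')[[V ''i'' \<oplus> N 1]];;
      Call SquareSort [V ''A'' \<oplus> V ''s'', V ''D'' \<oplus> V ''s'', V ''e'' \<ominus> V ''s''];;
      ''i'' ::= V ''i'' \<oplus> N 1)"

definition SquareSort_proc :: proc where
  "SquareSort_proc = Proc [''A'', ''D'', ''n'']
    [''m'', ''i'', ''j'', ''x'', ''s'', ''e'', ''ok'', ''pivots'', ''bs'', ''C'', ''E'', ''W'']
    (IF V ''n'' \<prec> N 17 THEN DirectSort
     ELSE (
      ''m'' ::= CeilSqrt (V ''n'');;
      SortColumns;;
      ChoosePivots;;
      BucketStarts;;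
      MoveToBuckets;;
      SortBuckets))"

text \<open>\<open>MergeSort\<close> sorts the array \<open>X\<close> of \<open>k\<close> cells, merging the sorted halves via a local array.\<close>

definition MergeSort_proc :: proc where
  "MergeSort_proc = Proc [''X'', ''k''] [''h'', ''i'', ''j'', ''t'', ''Y'']
    (IF V ''k'' \<prec> N 2 THEN SKIP
     ELSE (
      ''h'' ::= Half (V ''k'');;
      Call MergeSort [V ''X'', V ''h''];;
      Call MergeSort [V ''X'' \<oplus> V ''h'', V ''k'' \<ominus> V ''h''];;
      Alloc ''Y'' (V ''k'');;
      ''i'' ::= N 0;;
      ''j'' ::= V ''h'';;
      ''t'' ::= N 0;;
      WHILE V ''t'' \<prec> V ''k'' DO (
        (IF V ''i'' \<prec> V ''h'' AND
            (NotB (V ''j'' \<prec> V ''k'') OR NotB ((V ''X'')[[V ''j'']] \<prec> (V ''X'')[[V ''i'']]))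
         THEN
          (V ''Y'' \<oplus> V ''t'' :*= (V ''X'')[[V ''i'']];;
           ''i'' ::= V ''i'' \<oplus> N 1)
         ELSE
          (V ''Y'' \<oplus> V ''t'' :*= (V ''X'')[[V ''j'']];;
           ''j'' ::= V ''j'' \<oplus> N 1));;
        ''t'' ::= V ''t'' \<oplus> N 1);;
      ''t'' ::= N 0;;
      WHILE V ''t'' \<prec> V ''k'' DO (
        V ''X'' \<oplus> V ''t'' :*= (V ''Y'')[[V ''t'']];;
        ''t'' ::= V ''t'' \<oplus> N 1)))"

definition SkewTranspose_proc :: proc where
  "SkewTranspose_proc = Proc [''C'', ''E'', ''l'', ''P'', ''W'', ''k''] [''i'', ''j'', ''hl'', ''hk'']
    (IF V ''l'' \<prec> N 4 OR V ''k'' \<prec> N 4 THEN (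
      ''i'' ::= N 0;;
      WHILE V ''i'' \<prec> V ''k'' DO (
        ''j'' ::= N 0;;
        WHILE V ''j'' \<prec> V ''l'' DO (
          WHILE (V ''C'')[[V ''j'']] \<prec> (V ''E'')[[V ''j'']] AND
              Deref ((V ''C'')[[V ''j'']]) \<prec> (V ''P'')[[V ''i'']] DO (
            (V ''W'')[[V ''i'']] :*= Deref ((V ''C'')[[V ''j'']]);;
            V ''W'' \<oplus> V ''i'' :*= (V ''W'')[[V ''i'']] \<oplus> N 1;;
            V ''C'' \<oplus> V ''j'' :*= (V ''C'')[[V ''j'']] \<oplus> N 1);;
          ''j'' ::= V ''j'' \<oplus> N 1);;
        ''i'' ::= V ''i'' \<oplus> N 1))
     ELSE (
      ''hl'' ::= Half (V ''l'');;
      ''hk'' ::= Half (V ''k'');;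
      Call SkewTranspose
        [V ''C'', V ''E'', V ''hl'',
         V ''P'', V ''W'', V ''hk''];;
      Call SkewTranspose
        [V ''C'' \<oplus> V ''hl'', V ''E'' \<oplus> V ''hl'', V ''l'' \<ominus> V ''hl'',
         V ''P'', V ''W'', V ''hk''];;
      Call SkewTranspose
        [V ''C'', V ''E'', V ''hl'',
         V ''P'' \<oplus> V ''hk'', V ''W'' \<oplus> V ''hk'', V ''k'' \<ominus> V ''hk''];;
      Call SkewTranspose
        [V ''C'' \<oplus> V ''hl'', V ''E'' \<oplus> V ''hl'', V ''l'' \<ominus> V ''hl'',
         V ''P'' \<oplus> V ''hk'', V ''W'' \<oplus> V ''hk'', V ''k'' \<ominus> V ''hk'']))"

fun squaresort_prog :: "pname \<Rightarrow> proc" where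
  "squaresort_prog SquareSort = SquareSort_proc"
| "squaresort_prog MergeSort = MergeSort_proc"
| "squaresort_prog SkewTranspose = SkewTranspose_proc"


section \<open>Expected IO complexity and auxiliary space\<close>

text \<open>
  \<open>valid_input n \<sigma> a d s\<close>: in memory \<open>\<sigma>\<close> the array \<open>A\<close> at address \<open>a\<close> holds \<open>n\<close> distinct items, and
  \<open>A\<close>, the array \<open>D\<close> at address \<open>d\<close> and the stack, whose first cell is \<open>s\<close>, do not overlap.
\<close>

definition valid_input :: "nat \<Rightarrow> mem \<Rightarrow> addr \<Rightarrow> addr \<Rightarrow> addr \<Rightarrow> bool" where
  "valid_input n \<sigma> a d s \<longleftrightarrow>
    inj_on \<sigma> {a..<a + int n} \<and> \<sigma> ` {a..<a + int n} \<subseteq> range Fin \<and>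
    {a..<a + int n} \<inter> {d..<d + int n} = {} \<and> a + int n \<le> s \<and> d + int n \<le> s"

text \<open>The run starts with the caller storing the three arguments on the stack.\<close>

definition squaresort_run ::
  "nat \<Rightarrow> mem \<Rightarrow> addr \<Rightarrow> addr \<Rightarrow> addr \<Rightarrow> (mem \<times> addr \<times> access list) spmf" where
  "squaresort_run n \<sigma> a d s =
    exec squaresort_prog (\<lambda>_. s) (Call SquareSort [N a, N d, N (int n)]) \<sigma> s"

text \<open>Divergence counts as infinitely many IOs.\<close>

definition expected_ios :: "nat \<Rightarrow> nat \<Rightarrow> (mem \<times> addr \<times> access list) spmf \<Rightarrow> ennreal" where
  "expected_ios M B p =
    (\<integral>\<^sup>+ r. (case r of None \<Rightarrow> top | Some (\<sigma>, sp, t) \<Rightarrow> of_nat (opt_ios M B t)) \<partial>measure_pmf p)"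

definition squaresort_T :: "nat \<Rightarrow> nat \<Rightarrow> nat \<Rightarrow> ennreal" where
  "squaresort_T M B n =
    (SUP (\<sigma>, a, d, s) \<in> {(\<sigma>, a, d, s). valid_input n \<sigma> a d s}.
      expected_ios M B (squaresort_run n \<sigma> a d s))"

text \<open>The number of stack cells in use up to the highest one that is ever accessed.\<close>

definition aux_space :: "addr \<Rightarrow> access list \<Rightarrow> int" where
  "aux_space s t = Max (insert 0 ((\<lambda>x. addr_of x + 1 - s) ` set t))"

definition squaresort_space_const :: "real \<Rightarrow> bool" where
  "squaresort_space_const cS \<longleftrightarrow>
    (\<forall>n \<sigma> a d s \<sigma>' sp t. 16 \<le> n \<longrightarrow> valid_input n \<sigma> a d s \<longrightarrow>
      (\<sigma>', sp, t) \<in> set_spmf (squaresort_run n \<sigma> a d s) \<longrightarrow>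
      real_of_int (aux_space s t) \<le> cS * real n)"

end

theory Submission
  imports Defs
begin

text \<open>
  The cost of a trace is the cheapest service by some paging strategy that starts and ends with an
  empty cache; it is subadditive under concatenation, bounds the optimal number of IOs, and is at most
  twice the number of touched blocks whenever these fit into the cache. A loop that scans a bounded
  number of arrays costs \<open>O(1 + e / B)\<close>, and the skew transposition of \<open>m\<close> columns into \<open>m\<close> buckets
  costs \<open>O(m + m^2 / B)\<close> because its recursion switches to scanning once its pointers fit.

  A round of pivot sampling is accepted with probability at least \<open>1/3\<close>, and the expected sum of the
  squared bucket sizes of a round is at most \<open>4 n m\<close>. Hence, if \<open>T b <= A1 b + A2 b^2 + A3\<close> for all
  \<open>b < n\<close>, the buckets cost at most \<open>A1 n + A3 m + 12 A2 n m\<close>. With \<open>L = M / 28\<close> inputs of size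
  at most \<open>L\<close> fit into the cache together with their stack. For larger \<open>n\<close> the bound
  \<open>log b <= log (sqrt n) + b / sqrt n\<close> makes \<open>b\<close> times a logarithm quadratic in \<open>b\<close>, and the
  recurrence closes because the two halves of the logarithm leave a slack of order \<open>n / B\<close>, as
  \<open>M >= B^2\<close> gives \<open>sqrt n = O(n / B)\<close>.
\<close>

text \<open>Cost, space and correctness depend on each other: the bucket phase relies on sorted
  columns and distinct items, inputs that fit are charged by the cells they touch, and all of this
  presupposes that the sampling loop terminates. Hence one expectation carries everything:
  divergence, a wrong result or an access outside a declared address set counts as infinite cost, so
  every finite bound also yields termination, space and correctness. A call on \<open>n\<close>
  items is confined to about \<open>13 * n\<close> cells, arrays included, which is less than half
  of a cache of \<open>28 * n\<close> cells; hence the 28. That the minimum of \<open>D\<close> is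
  never a pivot makes every bucket nonempty, so a bucket has at most \<open>n + 1 - m\<close> items;
  the induction on the size and the stack bound both rest on this. Squares are tractable because the
  squared bucket sizes count pairs of items that no sampled value separates. The base of the
  logarithm used in the analysis is exchanged for \<open>M / \<alpha>\<close> only at the end, at
  the price of a constant factor.\<close>

definition blocks :: "nat => addr set => int set" where
 "blocks B X = (%x. x div int B) ` X"

abbreviation addrs :: "access list => addr set" where
 "addrs t \<equiv> addr_of ` set t"

section \<open>Paging: serving traces from an empty cache\<close>

text \<open>Only the modified blocks among the evicted ones cost an IO, hence at most one per
  block.\<close>

lemma paging_evict_set:
 assumes "finite D" "D <= C" "paging K B (C - D) (W - D) t k"
 shows "EX k'<=k + card D. paging K B C W t k'"
 using assms
proof (induction D arbitrary: C W)
 case empty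
 thus ?case by auto
next
 case (insert b D)
 have eq: "C - {b} - D = C - insert b D" "W - {b} - D = W - insert b D" by auto
 have "EX k'<=k + card D. paging K B (C - {b}) (W - {b}) t k'"
 by (rule insert.IH) (use insert.prems insert.hyps eq in auto)
 then obtain k' where k': "k' <= k + card D" "paging K B (C - {b}) (W - {b}) t k'" by blast
 show ?case
 proof (cases "b \<in> W")
 case True
 hence "paging K B C W t (Suc k')"
 using paging.write_back[of b C W] insert.prems k' by auto
 thus ?thesis using k' insert.hyps by (intro exI[of _ "Suc k'"]) auto
 next
 case False
 hence "paging K B C W t k'"
 using paging.evict[of b C W] insert.prems k' by auto
 thus ?thesis using k' insert.hyps by (intro exI[of _ k']) auto
 qed
qed

text \<open>Even the final content fits into the cache, so there is room before every single
  load.\<close>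

lemma paging_load_set:
 assumes "finite D" "finite C" "D Int C = {}" "card (C Un D) <= K" "paging K B (C Un D) W t k"
 shows "paging K B C W t (k + card D)"
 using assms
proof (induction D arbitrary: C)
 case empty
 thus ?case by auto
next
 case (insert b D)
 have eq: "insert b C Un D = C Un insert b D" by auto
 have "card C < card (C Un insert b D)"
 by (rule psubset_card_mono) (use insert in auto)
 hence "card C < K" using insert.prems by linarith
 moreover have "paging K B (insert b C) W t (k + card D)"
 by (rule insert.IH) (use insert.prems insert.hyps eq in auto)
 ultimately show ?case
 using paging.load[of b C K B W t "k + card D"] insert.prems insert.hyps by auto
qed

text \<open>
 \<open>serves K B t k\<close>: starting and ending with an empty cache, \<open>t\<close> can be served with \<open>k\<close> IOs,
 so that costs are subadditive under concatenation of traces.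
\<close>

definition serves :: "nat => nat => access list => nat => bool" where
 "serves K B t k \<longleftrightarrow> (ALL u k'. paging K B {} {} u k' --> (EX l<=k + k'. paging K B {} {} (t @ u) l))"

lemma serves_append:
 assumes "serves K B t k" "serves K B t' k'"
 shows "serves K B (t @ t') (k + k')"
 unfolding serves_def
proof (intro allI impI)
 fix u j assume "paging K B {} {} u j"
 then obtain l where l: "l <= k' + j" "paging K B {} {} (t' @ u) l"
 using assms(2) unfolding serves_def by blast
 then obtain l' where "l' <= k + l" "paging K B {} {} (t @ t' @ u) l'"
 using assms(1) unfolding serves_def by blast
 thus "EX l<=k + k' + j. paging K B {} {} ((t @ t') @ u) l"
 using l by (intro exI[of _ l']) auto
qed

text \<open>The empty continuation is served from an empty cache without any IO.\<close>

lemma opt_ios_le_serves: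
 assumes "serves (M div B) B t k"
 shows "opt_ios M B t <= k"
proof -
 obtain l where "l <= k" "paging (M div B) B {} {} t l"
 using assms paging.finish unfolding serves_def by (metis add.right_neutral append.right_neutral)
 thus ?thesis unfolding opt_ios_def by (meson Least_le le_trans)
qed

section \<open>Traces generated by advancing pointers\<close>

text \<open>Pointer \<open>p\<close> stands at \<open>c p\<close> and moves upwards only, one cell
  at a time and free of charge; every access hits \<open>S\<close> or a cell under some pointer.
  Unit steps make the crossings of block boundaries visible one by one. Agreement with
  \<open>c'\<close> is required on \<open>I\<close> only, so the values of \<open>c\<close>
  elsewhere are arbitrary.\<close>

inductive strm :: "addr set => 'i set => ('i => addr) => access list => ('i => addr) => bool"
 for S :: "addr set" and I :: "'i set" where
 stop: "(!!p. p \<in> I ==> c p = c' p) ==> strm S I c [] c'"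
| acc: "addr_of x \<in> S Un c ` I ==> strm S I c t c' ==> strm S I c (x # t) c'"
| adv: "p \<in> I ==> strm S I (c(p := c p + 1)) t c' ==> strm S I c t c'"

lemma strm_cong_start:
 assumes "strm S I c t c'" "!!p. p \<in> I ==> d p = c p"
 shows "strm S I d t c'"
 using assms
proof (induction arbitrary: d)
 case (stop c c')
 thus ?case by (auto intro: strm.stop)
next
 case (acc x c t c')
 have "d ` I = c ` I" using acc.prems by auto
 thus ?case using acc by (auto intro: strm.acc)
next
 case (adv p c t c')
 show ?case
 by (rule strm.adv[of p], rule adv.hyps, rule adv.IH) (use adv.prems in auto)
qed

lemma strm_append:
 assumes "strm S I c t c'" "strm S I c' t' c''"
 shows "strm S I c (t @ t') c''"
 using assms
proof (induction)
 case (stop c c')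
 thus ?case using strm_cong_start[of S I c' t' c'' c] by simp
next
 case (acc x c t c')
 thus ?case by (simp add: strm.acc)
next
 case (adv p c t c')
 show ?case by (rule strm.adv[OF adv.hyps(1) adv.IH[OF adv.prems]])
qed

lemma strm_mono:
 assumes "strm S I c t c'" "S <= S'" "I <= J" "!!p. p \<in> I ==> d p = c p" "!!p. p \<in> I ==> d' p = c' p"
 "!!p. p \<in> J - I ==> d p = d' p"
 shows "strm S' J d t d'"
 using assms
proof (induction arbitrary: d)
 case (stop c c')
 thus ?case by (intro strm.stop) (metis DiffI)
next
 case (acc x c t c')
 have "c ` I <= d ` J" using acc.prems by (metis image_mono image_cong)
 hence "addr_of x \<in> S' Un d ` J" using acc by auto
 thus ?case using acc by (intro strm.acc) auto
next
 case (adv p c t c')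
 show ?case
 by (rule strm.adv[of p], use adv.prems adv.hyps in blast, rule adv.IH)
 (use adv.prems adv.hyps in auto)
qed

text \<open>The number of remaining unit steps, summed over all pointers, decreases with each
  step.\<close>

lemma strm_advance:
 assumes "finite I" "!!p. p \<in> I ==> c p <= c' p"
 shows "strm S I c [] c'"
 using assms
proof (induction "nat (\<Sum>p\<in>I. c' p - c p)" arbitrary: c rule: less_induct)
 case less
 show ?case
 proof (cases "\<forall>p\<in>I. c p = c' p")
 case True
 thus ?thesis by (intro strm.stop) auto
 next
 case False
 then obtain p where p: "p \<in> I" "c p < c' p" using less.prems by fastforce
 let ?d = "c(p := c p + 1)"
 have "(\<Sum>q\<in>I. c' q - ?d q) < (\<Sum>q\<in>I. c' q - c q)"
 by (rule sum_strict_mono_ex1) (use less.prems p in auto)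
 moreover have "(\<Sum>q\<in>I. c' q - ?d q) \<ge> 0"
 by (rule sum_nonneg) (use less.prems p in auto)
 ultimately have "strm S I ?d [] c'"
 by (intro less.hyps) (use less.prems p in auto)
 thus ?thesis by (rule strm.adv[OF p(1)])
 qed
qed

lemma strm_static:
 assumes "addrs t <= S Un c ` I"
 shows "strm S I c t c"
 using assms by (induction t) (auto intro: strm.stop strm.acc)

lemma strm_step:
 assumes "finite I" "addrs t <= S Un c ` I" "!!p. p \<in> I ==> c p <= c' p"
 shows "strm S I c t c'"
 using strm_append[OF strm_static[OF assms(2)] strm_advance[OF assms(1,3)]] by simp

lemma strm_le:
 assumes "strm S I c t c'" "p \<in> I"
 shows "c p <= c' p"
 using assms
proof (induction)
 case (adv q c t c')
 thus ?case by (cases "p = q") auto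
qed auto

lemma strm_addrs:
 assumes "strm S I c t c'"
 shows "addrs t <= S Un (\<Union>p\<in>I. {c p..c' p})"
 using assms
proof (induction)
 case (stop c c')
 thus ?case by simp
next
 case (acc x c t c')
 have "c ` I <= (\<Union>p\<in>I. {c p..c' p})" using strm_le[OF acc.hyps(2)] by auto
 hence "addr_of x \<in> S Un (\<Union>p\<in>I. {c p..c' p})" using acc.hyps(1) by blast
 thus ?case using acc.IH by simp
next
 case (adv p c t c')
 have "(\<Union>q\<in>I. {(c(p := c p + 1)) q..c' q}) <= (\<Union>q\<in>I. {c q..c' q})"
 by (intro UN_mono) auto
 thus ?case using adv.IH by blast
qed

text \<open>Between boundary crossings of a pointer the cache keeps the blocks of \<open>S\<close> and of all pointers.\<close>

lemma strm_paging:
 assumes "strm S I c t c'" "finite I" "finite (blocks B S)" "card (blocks B S) + card I <= K"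
 "paging K B {} {} u k" "W <= blocks B S Un blocks B (c ` I)"
 shows "EX l. int l <= int (card (blocks B S) + card I) + 2 * (\<Sum>p\<in>I. c' p div B - c p div B) + k &
 paging K B (blocks B S Un blocks B (c ` I)) W (t @ u) l"
 using assms
proof (induction arbitrary: W)
 case (stop c c')
 let ?C = "blocks B S Un blocks B (c ` I)"
 have fin: "finite ?C" using stop by (auto simp: blocks_def)
 have "card ?C <= card (blocks B S) + card (blocks B (c ` I))" by (rule card_Un_le)
 also have "card (blocks B (c ` I)) <= card I"
 unfolding blocks_def image_image by (rule card_image_le) (use stop.prems in auto)
 finally have cd: "card ?C <= card (blocks B S) + card I" by linarith
 have "EX l<=k + card ?C. paging K B ?C W u l"
 proof (rule paging_evict_set[OF fin order_refl])
 have "W - ?C = {}" using stop.prems(5) by blast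
 with stop.prems(4) show "paging K B (?C - ?C) (W - ?C) u k" by (simp only: Diff_cancel)
 qed
 moreover have "(\<Sum>p\<in>I. c' p div B - c p div B) = 0" using stop by (intro sum.neutral) auto
 moreover obtain l where "l <= k + card ?C" "paging K B ?C W u l" using calculation by blast
 ultimately show ?case using cd by (intro exI[of _ l] conjI) (linarith, simp only: append_Nil)
next
 case (acc x c t c')
 let ?C = "blocks B S Un blocks B (c ` I)"
 have x: "addr_of x div int B \<in> ?C" using acc.hyps by (auto simp: blocks_def)
 show ?case
 proof (cases x)
 case (Read y)
 hence "y div int B \<in> ?C" using x by simp
 from paging.serve_read[OF this] acc.IH[OF acc.prems] Read show ?thesis
 unfolding append_Cons by blast
 next
 case (Write y)
 have "insert (y div int B) W <= ?C" using x Write acc.prems by auto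
 note IH = acc.IH[OF acc.prems(1-4) this]
 have "y div int B \<in> ?C" using x Write by simp
 from paging.serve_write[OF this] IH Write show ?thesis
 unfolding append_Cons by blast
 qed
next
 case (adv p c t c')
 let ?d = "c(p := c p + 1)"
 let ?C = "blocks B S Un blocks B (c ` I)" and ?D = "blocks B S Un blocks B (?d ` I)"
 have sum: "(\<Sum>q\<in>I. c' q div B - c q div B) =
 (\<Sum>q\<in>I. c' q div B - ?d q div B) + ((c p + 1) div B - c p div B)"
 proof -
 have "(\<Sum>q\<in>I. c' q div B - c q div B) - (\<Sum>q\<in>I. c' q div B - ?d q div B) =
 (\<Sum>q\<in>I. if q = p then (c p + 1) div B - c p div B else 0)"
 unfolding sum_subtractf[symmetric] by (intro sum.cong) auto
 thus ?thesis using adv.prems(1) adv.hyps(1) by simp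
 qed
 have mono: "c p div int B <= (c p + 1) div int B"
 by (cases "B = 0") (auto intro: zdiv_mono1)
 show ?case
 \<comment> \<open>Only a step into a new block changes the required cache content. It then loses at
   most one block and gains at most one, which costs at most two IOs.\<close>
 proof (cases "(c p + 1) div int B = c p div int B")
 case True
 have "blocks B (?d ` I) = blocks B (c ` I)"
 unfolding blocks_def image_image by (intro image_cong) (auto simp: True)
 hence eq: "?D = ?C" by (simp only:)
 have "(\<Sum>q\<in>I. c' q div B - c q div B) = (\<Sum>q\<in>I. c' q div B - ?d q div B)"
 using sum True by linarith
 thus ?thesis using adv.IH[OF adv.prems(1-4), of W] adv.prems(5) unfolding eq by (simp only:)
 next
 case False
 have finC: "finite ?C" and finD: "finite ?D" using adv.prems by (auto simp: blocks_def)
 have "blocks B (c ` I) <= insert (c p div int B) (blocks B (?d ` I))"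
 proof
 fix x assume "x \<in> blocks B (c ` I)"
 then obtain q where "q \<in> I" "x = c q div int B" by (auto simp: blocks_def)
 thus "x \<in> insert (c p div int B) (blocks B (?d ` I))"
 by (cases "q = p") (auto simp: blocks_def image_image)
 qed
 hence CD: "?C - ?D <= {c p div int B}" by blast
 have "blocks B (?d ` I) <= insert ((c p + 1) div int B) (blocks B (c ` I))"
 by (auto simp: blocks_def)
 hence DC: "?D - ?C <= {(c p + 1) div int B}" by blast
 have "card ?D <= card (blocks B S) + card (blocks B (?d ` I))" by (rule card_Un_le)
 also have "card (blocks B (?d ` I)) <= card I"
 unfolding blocks_def image_image by (rule card_image_le) (use adv.prems in auto)
 finally have cd: "card ?D <= K" using adv.prems by linarith
 \<comment> \<open>The block that is left behind gets written back, so it no longer counts as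
   modified.\<close>
 let ?W = "W - (?C - ?D)"
 have "?W <= ?D" using adv.prems by auto
 from adv.IH[OF adv.prems(1-4) this] obtain l where
 l: "int l <= int (card (blocks B S) + card I) + 2 * (\<Sum>p\<in>I. c' p div B - ?d p div B) + k"
 "paging K B ?D ?W (t @ u) l" by blast
 have eq1: "(?C Int ?D) Un (?D - ?C) = ?D" "?C - (?C - ?D) = ?C Int ?D" by auto
 have "paging K B (?C Int ?D) ?W (t @ u) (l + card (?D - ?C))"
 proof (rule paging_load_set)
 show "card (?C Int ?D Un (?D - ?C)) <= K" "paging K B (?C Int ?D Un (?D - ?C)) ?W (t @ u) l"
 unfolding eq1 by (fact cd l)+
 qed (use finC finD in blast)+
 hence "EX l'<=l + card (?D - ?C) + card (?C - ?D). paging K B ?C W (t @ u) l'"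
 by (intro paging_evict_set) (use finC in \<open>simp_all only: eq1 finite_Diff Diff_subset\<close>)
 moreover have "card (?D - ?C) <= 1" "card (?C - ?D) <= 1"
 using card_mono[OF _ DC] card_mono[OF _ CD] by auto
 ultimately obtain l' where "l' <= l + card (?D - ?C) + card (?C - ?D)"
 and pl': "paging K B ?C W (t @ u) l'" and "card (?D - ?C) <= 1" "card (?C - ?D) <= 1"
 by blast
 hence l': "l' <= l + 2" "paging K B ?C W (t @ u) l'" by linarith+
 have "(c p + 1) div int B - c p div int B \<ge> 1" using mono False by linarith
 thus ?thesis using l l' sum by (intro exI[of _ l']) auto
 qed
qed

text \<open>Loading the initial blocks and evicting the final ones costs at most
  \<open>card (blocks B S) + card I\<close> each, whence the first factor 2; the second one is for a
  load and a write-back at each boundary crossing.\<close>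

lemma strm_serves:
 assumes "strm S I c t c'" "finite I" "finite S" "card (blocks B S) + card I <= K"
 shows "EX l. int l <= 2 * int (card (blocks B S) + card I) + 2 * (\<Sum>p\<in>I. c' p div B - c p div B) &
 serves K B t l"
proof -
 let ?C = "blocks B S Un blocks B (c ` I)"
 define l where "l = nat (2 * int (card (blocks B S) + card I) + 2 * (\<Sum>p\<in>I. c' p div B - c p div B))"
 have le: "c p div int B <= c' p div int B" if "p \<in> I" for p
 using strm_le[OF assms(1) that] by (cases "B = 0") (auto intro: zdiv_mono1)
 have nn: "0 <= (\<Sum>p\<in>I. c' p div B - c p div B)" by (intro sum_nonneg) (use le in auto)
 have finC: "finite ?C" using assms by (auto simp: blocks_def)
 have "card ?C <= card (blocks B S) + card (blocks B (c ` I))" by (rule card_Un_le)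
 also have "card (blocks B (c ` I)) <= card I"
 unfolding blocks_def image_image by (rule card_image_le) (use assms in auto)
 finally have cd: "card ?C <= card (blocks B S) + card I" by linarith
 have "serves K B t l" unfolding serves_def
 proof (intro allI impI)
 fix u k assume "paging K B {} {} u k"
 from strm_paging[OF assms(1,2) _ assms(4) this, of "{}"] assms obtain j where
 j: "int j <= int (card (blocks B S) + card I) + 2 * (\<Sum>p\<in>I. c' p div B - c p div B) + k"
 "paging K B ?C {} (t @ u) j" by (auto simp: blocks_def)
 have "paging K B {} {} (t @ u) (j + card ?C)"
 by (rule paging_load_set) (use finC cd assms j in auto)
 thus "EX j<=l + k. paging K B {} {} (t @ u) j"
 using j cd nn by (intro exI[of _ "j + card ?C"]) (auto simp: l_def)
 qed
 moreover have "int l = 2 * int (card (blocks B S) + card I) + 2 * (\<Sum>p\<in>I. c' p div B - c p div B)"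
 using nn by (simp add: l_def)
 ultimately show ?thesis by (intro exI[of _ l]) auto
qed

text \<open>Adding the remainders of \<open>x\<close> and \<open>y - x\<close> carries at most
  once.\<close>

lemma card_blocks_interval:
 assumes "B > 0" "x <= y"
 shows "int (card (blocks B {x..y})) <= (y - x) div B + 2"
proof -
 have "blocks B {x..y} <= {x div B..y div B}"
 by (auto simp: blocks_def intro!: zdiv_mono1 assms)
 hence "card (blocks B {x..y}) <= card {x div B..y div B}" by (intro card_mono) auto
 also have "int ... = y div B + 1 - x div B"
 using assms by (simp add: zdiv_mono1)
 also have "y div B <= x div B + (y - x) div B + 1"
 proof -
 have "y = x + (y - x)" by simp
 hence "y div int B = x div B + (y - x) div B + ((x mod B + (y - x) mod B) div B)"
 by (metis div_add1_eq)
 moreover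
 let ?r = "x mod int B + (y - x) mod int B"
 have "?r < 2 * int B"
 using assms pos_mod_bound[of "int B" x] pos_mod_bound[of "int B" "y-x"] by linarith
 hence "?r div int B <= 1"
 proof -
 have "?r <= 1 * int B + (int B - 1)" using \<open>?r < 2 * int B\<close> by linarith
 hence "?r div int B <= (1 * int B + (int B - 1)) div int B"
 using assms by (intro zdiv_mono1) auto
 also have "... = 1 + (int B - 1) div int B"
 using assms by (subst add.commute, subst div_mult_self3) auto
 also have "(int B - 1) div int B = 0" using assms by (intro div_pos_pos_trivial) auto
 finally show ?thesis by simp
 qed
 ultimately show ?thesis by linarith
 qed
 finally show ?thesis by linarith
qed

lemma card_blocks_Un: "card (blocks B (X Un Y)) <= card (blocks B X) + card (blocks B Y)"
 unfolding blocks_def image_Un by (rule card_Un_le)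

section \<open>Costs of traces in a tall cache\<close>

text \<open>\<open>K\<close> is the number of blocks in the cache, so \<open>K \<ge> B\<close> is
  the tall cache condition. The 1000 leaves room for frames, for constant numbers of blocks and for
  rounding terms.\<close>

locale cache =
 fixes K B :: nat
 assumes B_large: "B \<ge> 1000" and K_ge_B: "K \<ge> B"
begin

definition cst :: "access list => nat" where
 "cst t = (LEAST k. serves K B t k)"

lemma serves_static:
 assumes "addrs t <= S" "finite S" "card (blocks B S) <= K"
 shows "serves K B t (2 * card (blocks B S))"
proof -
 have "strm S ({}::nat set) (%_. 0) t (%_. 0)" using strm_static[of t S _ "{}"] assms by auto
 from strm_serves[OF this _ assms(2), of B K] assms(3) obtain l where
 "int l <= 2 * int (card (blocks B S))" "serves K B t l" by auto
 hence "l <= 2 * card (blocks B S)" by linarith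
 with \<open>serves K B t l\<close> show ?thesis unfolding serves_def by (meson add_right_mono le_trans)
qed

text \<open>Serving each access on its own always works, so a least cost exists.\<close>

lemma serves_exists: "EX k. serves K B t k"
proof (induction t)
 case Nil
 have "serves K B [] 0" by (auto simp: serves_def)
 thus ?case ..
next
 case (Cons x t)
 have "serves K B [x] (2 * card (blocks B {addr_of x}))"
 by (rule serves_static) (use B_large K_ge_B in \<open>auto simp: blocks_def\<close>)
 from serves_append[OF this] Cons show ?case by force
qed

lemma serves_cst: "serves K B t (cst t)"
 unfolding cst_def using serves_exists by (rule LeastI_ex)

lemma cst_le: "serves K B t k ==> cst t <= k"
 unfolding cst_def by (rule Least_le)

lemma cst_append: "cst (t @ t') <= cst t + cst t'"
 by (intro cst_le serves_append serves_cst)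

lemma cst_Nil [simp]: "cst [] = 0"
 using cst_le[of "[]" 0] by (auto simp: serves_def)

lemma cst_static:
 assumes "addrs t <= S" "finite S" "card (blocks B S) <= K"
 shows "cst t <= 2 * card (blocks B S)"
 using serves_static[OF assms] by (rule cst_le)

lemma card_blocks_short:
 assumes "y - x < int B"
 shows "card (blocks B {x..y}) <= 2"
proof (cases "x <= y")
 case True
 hence "(y - x) div int B = 0" using assms by simp
 thus ?thesis using card_blocks_interval[of B x y] True B_large by simp
qed (auto simp: blocks_def)

text \<open>An interval shorter than a block meets at most two blocks, each of which is loaded and
  evicted once.\<close>

lemma cst_local:
 assumes "addrs t <= {x..y}" "y - x < int B"
 shows "cst t <= 4"
 using cst_static[of t "{x..y}"] card_blocks_short[OF assms(2)] assms B_large K_ge_B by auto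

text \<open>A pointer that moves over \<open>k\<close> cells crosses at most
  \<open>k / B + 1\<close> boundaries. With two IOs for each crossing and two for loading its first
  and evicting its last block, it costs \<open>4 + 2 * k / B\<close>.\<close>

lemma cst_streams:
 assumes "strm S I c t c'" "finite I" "finite S" "card (blocks B S) <= b" "b + card I <= K"
 "(\<Sum>p\<in>I. c' p - c p) <= e"
 shows "real (cst t) <= 2 * real b + 4 * real (card I) + 2 * real_of_int e / real B"
proof -
 obtain l where l: "int l <= 2 * int (card (blocks B S) + card I) + 2 * (\<Sum>p\<in>I. c' p div B - c p div B)"
 "serves K B t l" using strm_serves[OF assms(1-3), of B K] assms(4,5) by auto
 have B0: "B > 0" using B_large by simp
 have "real_of_int (\<Sum>p\<in>I. c' p div B - c p div B) <= (\<Sum>p\<in>I. real_of_int (c' p - c p) / B + 1)"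
 unfolding of_int_sum
 proof (rule sum_mono)
 fix p
 have "real_of_int (c' p div B) <= real_of_int (c' p) / B"
 by (metis floor_divide_of_int_eq of_int_floor_le of_int_of_nat_eq)
 moreover have "real_of_int (c p) / B < real_of_int (c p div B) + 1"
 by (metis floor_divide_of_int_eq of_int_of_nat_eq real_of_int_floor_add_one_gt)
 ultimately show "real_of_int (c' p div B - c p div B) <= real_of_int (c' p - c p) / B + 1"
 by (simp add: diff_divide_distrib)
 qed
 also have "... = real_of_int (\<Sum>p\<in>I. c' p - c p) / B + card I"
 by (simp add: sum.distrib sum_divide_distrib)
 also have "... <= real_of_int e / B + card I"
 using assms(6) B0 by (intro add_right_mono divide_right_mono) (auto simp only: of_int_le_iff of_nat_0_le_iff)
 finally have "real_of_int (\<Sum>p\<in>I. c' p div B - c p div B) <= real_of_int e / B + card I" .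
 moreover have "real l <= 2 * real (card (blocks B S) + card I) + 2 * real_of_int (\<Sum>p\<in>I. c' p div B - c p div B)"
 using l(1) by linarith
 moreover have "real (cst t) <= real l" "real (card (blocks B S)) <= real b"
 using cst_le[OF l(2)] assms(4) by auto
 ultimately show ?thesis by (simp add: of_nat_add)
qed

end

section \<open>Expectations that charge divergence\<close>

text \<open>Divergence has the value \<top>, so a finite expectation excludes it almost
  surely.\<close>

definition wpp :: "'a spmf => ('a => ennreal) => ennreal" where
 "wpp p f = (\<integral>\<^sup>+ r. (case r of None => \<top> | Some x => f x) \<partial>measure_pmf p)"

lemma wpp_return [simp]: "wpp (return_spmf x) f = f x"
 by (simp add: wpp_def)

lemma wpp_bind: "wpp (bind_spmf p g) f = wpp p (%x. wpp (g x) f)"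
 unfolding wpp_def bind_spmf_def nn_integral_bind_pmf
 by (intro nn_integral_cong) (auto split: option.splits)

lemma wpp_map: "wpp (map_spmf g p) f = wpp p (%x. f (g x))"
 unfolding wpp_def nn_integral_map_pmf
 by (intro nn_integral_cong) (auto split: option.splits)

lemma wpp_mono:
 assumes "!!x. x \<in> set_spmf p ==> f x <= g x"
 shows "wpp p f <= wpp p g"
 unfolding wpp_def using assms
 by (intro nn_integral_mono_AE) (auto simp: AE_measure_pmf_iff in_set_spmf split: option.splits)

lemma wpp_add_const: "wpp p (%x. c + f x) = c + wpp p f"
proof -
 have "wpp p (%x. c + f x) =
 (\<integral>\<^sup>+ r. c + (case r of None => \<top> | Some x => f x) \<partial>measure_pmf p)"
 unfolding wpp_def by (intro nn_integral_cong) (auto split: option.splits)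
 also have "... = c + wpp p f"
 unfolding wpp_def by (subst nn_integral_add) (auto simp: measure_pmf.emeasure_space_1[simplified])
 finally show ?thesis .
qed

lemma wpp_add: "wpp p (%x. f x + g x) = wpp p f + wpp p g"
proof -
 have "wpp p (%x. f x + g x) = (\<integral>\<^sup>+ r. (case r of None => \<top> | Some x => f x) +
 (case r of None => \<top> | Some x => g x) \<partial>measure_pmf p)"
 unfolding wpp_def by (intro nn_integral_cong) (auto split: option.splits)
 also have "... = wpp p f + wpp p g"
 unfolding wpp_def by (subst nn_integral_add) auto
 finally show ?thesis .
qed

lemma wpp_cmult: "c ~= 0 ==> wpp p (%x. c * f x) = c * wpp p f"
proof -
 assume "c ~= 0"
 hence "wpp p (%x. c * f x) = (\<integral>\<^sup>+ r. c * (case r of None => \<top> | Some x => f x) \<partial>measure_pmf p)"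
 unfolding wpp_def by (intro nn_integral_cong) (auto simp: ennreal_mult_top split: option.splits)
 also have "... = c * wpp p f"
 unfolding wpp_def by (subst nn_integral_cmult) auto
 finally show ?thesis .
qed

text \<open>The support is that of the underlying distribution on options, so \<open>None\<close>,
  the divergent outcome, is excluded as well.\<close>

definition AS :: "'a spmf => ('a => bool) => bool" where
 "AS p Q \<longleftrightarrow> (\<forall>r\<in>set_pmf p. EX x. r = Some x & Q x)"

lemma AS_return [simp]: "AS (return_spmf x) Q \<longleftrightarrow> Q x"
 by (simp add: AS_def)

lemma AS_bind: "AS (bind_spmf p g) Q \<longleftrightarrow> AS p (%x. AS (g x) Q)"
 unfolding AS_def bind_spmf_def by (force split: option.splits)

lemma AS_map: "AS (map_spmf g p) Q \<longleftrightarrow> AS p (%x. Q (g x))"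
 unfolding AS_def by (force split: option.splits)

lemma AS_mono: "AS p Q ==> (!!x. Q x ==> Q' x) ==> AS p Q'"
 unfolding AS_def by blast

lemma AS_set_spmf: "AS p Q ==> x \<in> set_spmf p ==> Q x"
 unfolding AS_def in_set_spmf by blast

lemma wpp_AS_mono:
 assumes "AS p Q" "!!x. Q x ==> f x <= g x"
 shows "wpp p f <= wpp p g"
 by (rule wpp_mono) (use assms AS_set_spmf in fast)

lemma wpp_AS_le:
 assumes "AS p Q" "!!x. Q x ==> f x <= b"
 shows "wpp p f <= b"
proof -
 have "wpp p f <= (\<integral>\<^sup>+ r. b \<partial>measure_pmf p)"
 unfolding wpp_def using assms
 by (intro nn_integral_mono_AE) (fastforce simp: AE_measure_pmf_iff AS_def)
 thus ?thesis by (simp add: measure_pmf.emeasure_space_1[simplified])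
qed

text \<open>A nonnegative function with a finite expectation is finite almost everywhere. This turns
  a requirement whose violation is charged with \<top> back into a property of all outcomes.\<close>

lemma AS_of_wpp:
 assumes "wpp p f < \<top>" "!!x. ~ Q x ==> f x = \<top>"
 shows "AS p Q"
proof -
 have "AE r in measure_pmf p. (case r of None => \<top> | Some x => f x) ~= \<infinity>"
 by (rule nn_integral_PInf_AE) (use assms(1) in \<open>auto simp: wpp_def less_top\<close>)
 thus ?thesis
 using assms(2) unfolding AS_def AE_measure_pmf_iff by (force split: option.splits)
qed

section \<open>Rules for sure and for expected properties of executions\<close>

abbreviation ex :: "(vname => addr) => com => mem => addr => (mem \<times> addr \<times> access list) spmf" where
 "ex \<equiv> exec squaresort_prog"

definition ae :: "(vname => addr) => com => mem => addr => (mem => addr => access list => bool) => bool" where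
 "ae fr c H sp Q = AS (ex fr c H sp) (%(H', sp', t). Q H' sp' t)"

definition ew :: "(vname => addr) => com => mem => addr => (mem => addr => access list => ennreal) => ennreal" where
 "ew fr c H sp f = wpp (ex fr c H sp) (%(H', sp', t). f H' sp' t)"

lemma exec_SKIP: "exec \<pi> fr SKIP H sp = return_spmf (H, sp, [])"
 by (subst exec.simps) simp

lemma exec_Assign: "exec \<pi> fr (x ::= e) H sp =
 return_spmf (H(fr x := aval fr H e), sp, aval_acc fr H e @ [Write (fr x)])"
 by (subst exec.simps) simp

lemma exec_Store: "exec \<pi> fr (e1 :*= e2) H sp =
 return_spmf (H(int_of (aval fr H e1) := aval fr H e2), sp,
 aval_acc fr H e1 @ aval_acc fr H e2 @ [Write (int_of (aval fr H e1))])"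
 by (subst exec.simps) simp

lemma exec_Alloc: "exec \<pi> fr (Alloc x e) H sp =
 return_spmf (H(fr x := Fin sp), sp + int_of (aval fr H e), aval_acc fr H e @ [Write (fr x)])"
 by (subst exec.simps) simp

lemma exec_Random: "exec \<pi> fr (Random x e) H sp =
 map_spmf (%r. (H(fr x := Fin r), sp, aval_acc fr H e @ [Write (fr x)]))
 (spmf_of_set {0..<int_of (aval fr H e)})"
 by (subst exec.simps) simp

lemma exec_Seq: "exec \<pi> fr (c1;; c2) H sp =
 bind_spmf (exec \<pi> fr c1 H sp) (%(H1, sp1, t1).
 map_spmf (%(H2, sp2, t2). (H2, sp2, t1 @ t2)) (exec \<pi> fr c2 H1 sp1))"
 by (subst exec.simps) simp

lemma exec_Cond: "exec \<pi> fr (IF b THEN c1 ELSE c2) H sp =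
 map_spmf (%(H', sp', t). (H', sp', bval_acc fr H b @ t))
 (exec \<pi> fr (if bval fr H b then c1 else c2) H sp)"
 by (subst exec.simps) simp

lemma exec_While: "exec \<pi> fr (WHILE b DO c) H sp =
 map_spmf (%(H', sp', t). (H', sp', bval_acc fr H b @ t))
 (exec \<pi> fr (if bval fr H b then c;; WHILE b DO c else SKIP) H sp)"
 by (subst exec.simps) simp

lemma exec_Call: "exec \<pi> fr (Call p es) H sp =
 map_spmf (%(H', sp', t). (H', sp,
 concat (map (aval_acc fr H) es) @ map (%i. Write (sp + int i)) [0..<length es] @ t))
 (exec \<pi> (frame (\<pi> p) sp) (body (\<pi> p)) (write_list H sp (map (aval fr H) es))
 (sp + int (length (frame_vars (\<pi> p)))))"
 by (subst exec.simps) simp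

lemma ae_SKIP: "ae fr SKIP H sp Q = Q H sp []"
 by (simp add: ae_def exec_SKIP)

lemma ae_Assign: "ae fr (x ::= e) H sp Q =
 Q (H(fr x := aval fr H e)) sp (aval_acc fr H e @ [Write (fr x)])"
 by (simp add: ae_def exec_Assign)

lemma ae_Store: "ae fr (e1 :*= e2) H sp Q =
 Q (H(int_of (aval fr H e1) := aval fr H e2)) sp
 (aval_acc fr H e1 @ aval_acc fr H e2 @ [Write (int_of (aval fr H e1))])"
 by (simp add: ae_def exec_Store)

lemma ae_Alloc: "ae fr (Alloc x e) H sp Q =
 Q (H(fr x := Fin sp)) (sp + int_of (aval fr H e)) (aval_acc fr H e @ [Write (fr x)])"
 by (simp add: ae_def exec_Alloc)

lemma ae_Seq: "ae fr (c1;; c2) H sp Q =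
 ae fr c1 H sp (%H1 sp1 t1. ae fr c2 H1 sp1 (%H2 sp2 t2. Q H2 sp2 (t1 @ t2)))"
 by (simp add: ae_def exec_Seq AS_bind AS_map case_prod_unfold)

lemma ae_Cond: "ae fr (IF b THEN c1 ELSE c2) H sp Q =
 ae fr (if bval fr H b then c1 else c2) H sp (%H' sp' t. Q H' sp' (bval_acc fr H b @ t))"
 by (simp add: ae_def exec_Cond AS_map case_prod_unfold)

lemma ae_Call: "ae fr (Call p es) H sp Q =
 ae (frame (squaresort_prog p) sp) (body (squaresort_prog p)) (write_list H sp (map (aval fr H) es))
 (sp + int (length (frame_vars (squaresort_prog p))))
 (%H' sp' t. Q H' sp (concat (map (aval_acc fr H) es) @
 map (%i. Write (sp + int i)) [0..<length es] @ t))"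
 by (simp add: ae_def exec_Call AS_map case_prod_unfold)

lemmas ae_simps = ae_SKIP ae_Assign ae_Store ae_Alloc ae_Seq ae_Cond

lemma ae_mono:
 assumes "ae fr c H sp Q" "!!H' sp' t. Q H' sp' t ==> Q' H' sp' t"
 shows "ae fr c H sp Q'"
 using AS_mono[OF assms(1)[unfolded ae_def]] assms(2) unfolding ae_def by (auto simp: case_prod_unfold)

lemma ae_While_unfold: "ae fr (WHILE b DO c) H sp Q =
 (if bval fr H b
 then ae fr c H sp (%H1 sp1 t1. ae fr (WHILE b DO c) H1 sp1
 (%H2 sp2 t2. Q H2 sp2 (bval_acc fr H b @ t1 @ t2)))
 else Q H sp (bval_acc fr H b))"
proof -
 have "ae fr (WHILE b DO c) H sp Q =
 ae fr (if bval fr H b then c;; WHILE b DO c else SKIP) H sp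
 (%H' sp' t. Q H' sp' (bval_acc fr H b @ t))"
 unfolding ae_def exec_While[of _ _ b c H] AS_map by (simp add: case_prod_unfold)
 thus ?thesis by (simp add: ae_Seq ae_SKIP)
qed

text \<open>The invariant speaks of the whole trace since the loop was entered, because streams and
  address sets are properties of accumulated traces; the termination measure depends on the memory
  alone.\<close>

lemma ae_While:
 fixes \<mu> :: "mem => nat"
 assumes "I [] H sp"
 and step: "!!t H sp. I t H sp ==> bval fr H b ==>
 ae fr c H sp (%H' sp' t'. I (t @ bval_acc fr H b @ t') H' sp' & \<mu> H' < \<mu> H)"
 and exit: "!!t H sp. I t H sp ==> ~ bval fr H b ==> Q H sp (t @ bval_acc fr H b)"
 shows "ae fr (WHILE b DO c) H sp Q"
proof -
 have "I t H sp ==> ae fr (WHILE b DO c) H sp (%H' sp' t'. Q H' sp' (t @ t'))" for t H sp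
 proof (induction "\<mu> H" arbitrary: t H sp rule: less_induct)
 case less
 show ?case
 proof (cases "bval fr H b")
 case True
 have "ae fr c H sp (%H1 sp1 t1. ae fr (WHILE b DO c) H1 sp1
 (%H2 sp2 t2. Q H2 sp2 (t @ bval_acc fr H b @ t1 @ t2)))"
 proof (rule ae_mono[OF step[OF less.prems True]])
 fix H1 sp1 t1
 assume *: "I (t @ bval_acc fr H b @ t1) H1 sp1 & \<mu> H1 < \<mu> H"
 show "ae fr (WHILE b DO c) H1 sp1 (%H2 sp2 t2. Q H2 sp2 (t @ bval_acc fr H b @ t1 @ t2))"
 using less.hyps[of H1 "t @ bval_acc fr H b @ t1" sp1] * by simp
 qed
 thus ?thesis by (subst ae_While_unfold) (simp add: True)
 next
 case False
 thus ?thesis by (subst ae_While_unfold) (simp add: exit[OF less.prems])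
 qed
 qed
 from this[OF assms(1)] show ?thesis by simp
qed

lemma ew_Seq: "ew fr (c1;; c2) H sp f =
 ew fr c1 H sp (%H1 sp1 t1. ew fr c2 H1 sp1 (%H2 sp2 t2. f H2 sp2 (t1 @ t2)))"
 by (simp add: ew_def exec_Seq wpp_bind wpp_map case_prod_unfold)

lemma ew_Cond: "ew fr (IF b THEN c1 ELSE c2) H sp f =
 ew fr (if bval fr H b then c1 else c2) H sp (%H' sp' t. f H' sp' (bval_acc fr H b @ t))"
 by (simp add: ew_def exec_Cond wpp_map case_prod_unfold)

lemma ew_Assign: "ew fr (x ::= e) H sp f =
 f (H(fr x := aval fr H e)) sp (aval_acc fr H e @ [Write (fr x)])"
 by (simp add: ew_def exec_Assign)

lemma ew_SKIP: "ew fr SKIP H sp f = f H sp []"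
 by (simp add: ew_def exec_SKIP)

lemma ew_Call: "ew fr (Call p es) H sp f =
 ew (frame (squaresort_prog p) sp) (body (squaresort_prog p)) (write_list H sp (map (aval fr H) es))
 (sp + int (length (frame_vars (squaresort_prog p))))
 (%H' sp' t. f H' sp (concat (map (aval_acc fr H) es) @
 map (%i. Write (sp + int i)) [0..<length es] @ t))"
 by (simp add: ew_def exec_Call wpp_map case_prod_unfold)

lemma ew_While_unfold: "ew fr (WHILE b DO c) H sp f =
 (if bval fr H b
 then ew fr c H sp (%H1 sp1 t1. ew fr (WHILE b DO c) H1 sp1
 (%H2 sp2 t2. f H2 sp2 (bval_acc fr H b @ t1 @ t2)))
 else f H sp (bval_acc fr H b))"
proof -
 have "ew fr (WHILE b DO c) H sp f =
 ew fr (if bval fr H b then c;; WHILE b DO c else SKIP) H sp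
 (%H' sp' t. f H' sp' (bval_acc fr H b @ t))"
 unfolding ew_def exec_While[of _ _ b c H] wpp_map by (simp add: case_prod_unfold)
 thus ?thesis by (simp add: ew_Seq ew_SKIP)
qed

lemma ew_mono:
 assumes "!!H' sp' t. f H' sp' t <= g H' sp' t"
 shows "ew fr c H sp f <= ew fr c H sp g"
 unfolding ew_def by (rule wpp_mono) (auto intro: assms)

lemma ew_ae_le:
 assumes "ae fr c H sp Q" "!!H' sp' t. Q H' sp' t ==> f H' sp' t <= b"
 shows "ew fr c H sp f <= b"
 unfolding ew_def by (rule wpp_AS_le[OF assms(1)[unfolded ae_def]]) (use assms(2) in auto)

lemma ew_add_const: "ew fr c H sp (%H' sp' t. k + f H' sp' t) = k + ew fr c H sp f"
 unfolding ew_def wpp_add_const[symmetric] by (simp add: case_prod_unfold)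

lemma ew_add: "ew fr c H sp (%H' sp' t. f H' sp' t + g H' sp' t) = ew fr c H sp f + ew fr c H sp g"
 unfolding ew_def wpp_add[symmetric] by (simp add: case_prod_unfold)

lemma ew_cmult: "k ~= 0 ==> ew fr c H sp (%H' sp' t. k * f H' sp' t) = k * ew fr c H sp f"
 unfolding ew_def by (subst wpp_cmult[symmetric]) (simp_all add: case_prod_unfold)

lemma ae_of_ew:
 assumes "ew fr c H sp f < \<top>" "!!H' sp' t. ~ Q H' sp' t ==> f H' sp' t = \<top>"
 shows "ae fr c H sp Q"
 unfolding ae_def by (rule AS_of_wpp[OF assms(1)[unfolded ew_def]]) (use assms(2) in auto)

section \<open>Costs with obligations, and loops left with constant probability\<close>

text \<open>Finiteness of \<open>u\<close> is essential: \<open>u = \<top>\<close> satisfies the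
  second inequality for every \<open>A\<close>.\<close>

lemma ennreal_le_fixpoint:
 fixes u A :: ennreal
 assumes "u < \<top>" "u <= A + ennreal (2/3) * u"
 shows "u <= 3 * A"
proof (cases A)
 case (real a)
 obtain r where r: "u = ennreal r" "r \<ge> 0" using assms(1) by (cases u) auto
 have "ennreal r <= ennreal (a + 2/3 * r)"
 using assms(2) real r by (simp add: ennreal_mult[symmetric] ennreal_plus)
 hence "r <= a + 2/3 * r" using r real by (subst (asm) ennreal_le_iff) auto
 hence "r <= 3 * a" by simp
 hence "ennreal r <= ennreal (3 * a)" by (rule ennreal_leI)
 thus ?thesis using real r by (simp add: ennreal_mult)
qed (simp add: ennreal_mult_top)

lemma min_add_le_ennreal: "min z (x + y) <= x + min z (y::ennreal)"
 by (simp add: min_def add_increasing)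

context cache
begin

text \<open>Leaving the address set \<open>U\<close> or missing the postcondition \<open>Q\<close>
  costs \<top>, and \<open>F\<close> charges in advance for the code that follows. A bound on the
  expectation of \<open>pc\<close> is therefore a statement on space, correctness and cost at
  once.\<close>

definition pc :: "addr set => (mem => addr => bool) => (mem => ennreal) => mem => addr => access list => ennreal" where
 "pc U Q F H sp t = (if addrs t <= U & Q H sp then of_nat (cst t) + F H else \<top>)"

lemma pc_append:
 assumes "addrs t1 <= U"
 shows "pc U Q F H sp (t1 @ t2) <= of_nat (cst t1) + pc U Q F H sp t2"
proof -
 have "of_nat (cst (t1 @ t2)) <= (of_nat (cst t1) + of_nat (cst t2) :: ennreal)"
 unfolding of_nat_add[symmetric] using cst_append by (intro of_nat_mono)
 thus ?thesis using assms by (auto simp: pc_def image_Un add.assoc[symmetric] intro: add_right_mono)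
qed

lemma ew_prefix_pc:
 assumes "addrs t1 <= U" "ew fr c H sp (pc U Q F) <= b"
 shows "ew fr c H sp (%H' sp' t. pc U Q F H' sp' (t1 @ t)) <= of_nat (cst t1) + b"
proof -
 have "ew fr c H sp (%H' sp' t. pc U Q F H' sp' (t1 @ t)) <=
 ew fr c H sp (%H' sp' t. of_nat (cst t1) + pc U Q F H' sp' t)"
 by (intro ew_mono pc_append assms)
 thus ?thesis using assms(2) by (simp add: ew_add_const add_left_mono order_trans)
qed

text \<open>The bound for the second command, as a function of the memory in which it starts, is the
  charge \<open>F\<close> of the first. It may thus depend on random values such as bucket
  sizes.\<close>

lemma ew_Seq_pc:
 assumes "ew fr c1 H sp (pc U Q F) <= b"
 and "!!H1 sp1. Q H1 sp1 ==> ew fr c2 H1 sp1 (pc U R G) <= F H1"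
 shows "ew fr (c1;; c2) H sp (pc U R G) <= b"
proof -
 have "ew fr c2 H1 sp1 (%H2 sp2 t2. pc U R G H2 sp2 (t1 @ t2)) <= pc U Q F H1 sp1 t1" for H1 sp1 t1
 proof (cases "addrs t1 <= U & Q H1 sp1")
 case True
 thus ?thesis using ew_prefix_pc[OF _ assms(2)[of H1 sp1], of t1] unfolding pc_def by simp
 next
 case False
 hence "pc U Q F H1 sp1 t1 = \<top>" unfolding pc_def by (rule if_not_P)
 thus ?thesis by simp
 qed
 thus ?thesis unfolding ew_Seq by (intro order_trans[OF ew_mono assms(1)])
qed

lemma ew_of_ae_pc:
 assumes "ae fr c H sp (%H' sp' t. addrs t <= U & Q H' sp' & real (cst t) <= k & F H' <= f)"
 shows "ew fr c H sp (pc U Q F) <= ennreal k + f"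
 by (rule ew_ae_le[OF assms])
 (auto simp: pc_def ennreal_of_nat_eq_real_of_nat intro!: add_mono ennreal_leI)

lemma ew_pc_mono:
 assumes "ew fr c H sp (pc U Q F) <= b" "U <= U'" "!!H sp. Q H sp ==> Q' H sp"
 "!!H sp. Q H sp ==> F' H <= F H"
 shows "ew fr c H sp (pc U' Q' F') <= b"
 by (rule order_trans[OF ew_mono assms(1)]) (use assms(2-4) in \<open>auto simp: pc_def intro!: add_left_mono\<close>)

lemma ew_pc_add_const:
 "ew fr c H sp (pc U Q (%H. f + F H)) = f + ew fr c H sp (pc U Q F)"
proof -
 have "pc U Q (%H. f + F H) = (%H sp t. f + pc U Q F H sp t)"
 by (intro ext) (auto simp: pc_def ac_simps)
 thus ?thesis by (simp add: ew_add_const)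
qed

text \<open>
 A loop that is left with probability at least 1/3 in every round: truncating the cost makes
 the supremum \<open>u\<close> over the loop states finite, and \<open>u <= 2 * g + a + 2/3 * u\<close> can be solved for \<open>u\<close>.
\<close>

lemma ew_retry:
 assumes inv: "Inv H0" "bval fr H0 b"
 and step: "!!H. Inv H ==> bval fr H b ==>
 ew fr c H sp (pc U (%H' sp'. Inv H' & sp' = sp) (%H'. if bval fr H' b then 0 else F H')) <= a"
 and prob: "!!H. Inv H ==> bval fr H b ==>
 ew fr c H sp (%H' sp' t. if bval fr H' b then 1 else 0) <= ennreal (2/3)"
 and guard: "!!H. Inv H ==> addrs (bval_acc fr H b) <= U & cst (bval_acc fr H b) <= g"
 shows "ew fr (WHILE b DO c) H0 sp (pc U (%H' sp'. Inv H' & sp' = sp & ~ bval fr H' b) F)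
 <= 3 * (2 * of_nat g + a)"
proof -
 define h where "h = pc U (%H' sp'. Inv H' & sp' = sp & ~ bval fr H' b) F"
 \<comment> \<open>\<open>tr N\<close> is the expected cost cut off at \<open>N\<close>, with
   divergence counted as \<open>N\<close>. Unlike the cost itself it is finite in advance when
   \<open>N\<close> is.\<close>
 define tr where "tr N p f = (\<integral>\<^sup>+ r. min N (case r of None => \<top> | Some (H', sp', t) => f H' sp' t) \<partial>measure_pmf p)"
 for N :: ennreal and p :: "(mem \<times> addr \<times> access list) spmf" and f
 let ?L = "WHILE b DO c"
 have tr_prefix: "tr N p (%H' sp' t. h H' sp' (t1 @ t)) <= of_nat (cst t1) + tr N p h"
 if "addrs t1 <= U" for N p t1
 proof -
 have "tr N p (%H' sp' t. h H' sp' (t1 @ t)) <=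
 (\<integral>\<^sup>+ r. of_nat (cst t1) + min N (case r of None => \<top> | Some (H', sp', t) => h H' sp' t) \<partial>measure_pmf p)"
 unfolding tr_def
 proof (rule nn_integral_mono)
 fix r
 have "(case r of None => \<top> | Some (H', sp', t) => h H' sp' (t1 @ t)) <=
 of_nat (cst t1) + (case r of None => \<top> | Some (H', sp', t) => h H' sp' t)"
 using pc_append[OF that] by (auto simp: h_def split: option.splits)
 hence "min N (case r of None => \<top> | Some (H', sp', t) => h H' sp' (t1 @ t)) <=
 min N (of_nat (cst t1) + (case r of None => \<top> | Some (H', sp', t) => h H' sp' t))"
 by (intro min.mono) auto
 also note min_add_le_ennreal
 finally show "min N (case r of None => \<top> | Some (H', sp', t) => h H' sp' (t1 @ t)) <=
 of_nat (cst t1) + min N (case r of None => \<top> | Some (H', sp', t) => h H' sp' t)" .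
 qed
 also have "... = of_nat (cst t1) + tr N p h"
 unfolding tr_def by (subst nn_integral_add) (auto simp: measure_pmf.emeasure_space_1[simplified])
 finally show ?thesis .
 qed
 have tr_le: "tr N p f <= N" for N p f
 proof -
 have "tr N p f <= (\<integral>\<^sup>+ r. N \<partial>measure_pmf p)" unfolding tr_def by (intro nn_integral_mono) auto
 thus ?thesis by (simp add: measure_pmf.emeasure_space_1[simplified])
 qed
 have tr_ret: "tr N (ex fr ?L H sp) h <= of_nat g + F H" if "Inv H" "~ bval fr H b" for N H
 proof -
 have "of_nat (cst (bval_acc fr H b)) <= (of_nat g :: ennreal)" using guard[OF that(1)] by (intro of_nat_mono) simp
 thus ?thesis
 unfolding tr_def exec_While using that guard[OF that(1)]
 by (auto simp: exec_SKIP h_def pc_def min_le_iff_disj intro!: add_right_mono)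
 qed
 have tr_eq: "tr N (ex fr ?L H sp) f = wpp (ex fr c H sp)
 (%(H1, sp1, t1). tr N (ex fr ?L H1 sp1) (%H2 sp2 t2. f H2 sp2 (bval_acc fr H b @ t1 @ t2)))"
 if "bval fr H b" "None ~: set_pmf (ex fr c H sp)" for N f H
 proof -
 have "tr N (ex fr ?L H sp) f = tr N (ex fr (c;; ?L) H sp) (%H2 sp2 t2. f H2 sp2 (bval_acc fr H b @ t2))"
 unfolding tr_def exec_While[of _ _ _ _ H] using that
 by (auto intro!: nn_integral_cong split: option.splits)
 also have "... = (\<integral>\<^sup>+ r. (case r of None => N | Some (H1, sp1, t1) =>
 tr N (ex fr ?L H1 sp1) (%H2 sp2 t2. f H2 sp2 (bval_acc fr H b @ t1 @ t2))) \<partial>measure_pmf (ex fr c H sp))"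
 unfolding tr_def exec_Seq bind_spmf_def nn_integral_bind_pmf
 by (intro nn_integral_cong) (auto intro!: nn_integral_cong split: option.splits)
 also have "... = wpp (ex fr c H sp)
 (%(H1, sp1, t1). tr N (ex fr ?L H1 sp1) (%H2 sp2 t2. f H2 sp2 (bval_acc fr H b @ t1 @ t2)))"
 unfolding wpp_def
 by (intro nn_integral_cong_AE) (use that(2) in \<open>auto simp: AE_measure_pmf_iff split: option.splits\<close>)
 finally show ?thesis .
 qed
 have bound: "tr (of_nat N) (ex fr ?L H0 sp) h <= 3 * (2 * of_nat g + a)" for N :: nat
 proof (cases "a = \<top>")
 case True
 thus ?thesis by (simp add: ennreal_mult_top)
 next
 case False
 \<comment> \<open>One supremum bounds the truncated cost of the remaining rounds, whatever the
   state in which they begin.\<close>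
 define u where "u = (SUP H\<in>{H. Inv H & bval fr H b}. tr (of_nat N) (ex fr ?L H sp) h)"
 have "u <= of_nat N" unfolding u_def by (intro SUP_least tr_le)
 hence fin: "u < \<top>" by (simp add: le_less_trans of_nat_less_top)
 have "tr (of_nat N) (ex fr ?L H sp) h <= (2 * of_nat g + a) + ennreal (2/3) * u"
 if I: "Inv H" "bval fr H b" for H
 proof -
 let ?P = "pc U (%H' sp'. Inv H' & sp' = sp) (%H'. if bval fr H' b then 0 else F H')"
 have "ew fr c H sp ?P < \<top>" using step[OF I] False by (simp add: le_less_trans less_top)
 hence AE: "ae fr c H sp (%H' sp' t. addrs t <= U & Inv H' & sp' = sp)"
 by (rule ae_of_ew) (auto simp: pc_def)
 hence "None ~: set_pmf (ex fr c H sp)" unfolding ae_def AS_def by blast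
 note tr_eq[OF I(2) this, of "of_nat N" h]
 \<comment> \<open>\<open>2 * g\<close> pays for the guard before the round and for the guard that
   may end the loop after it.\<close>
 also have "wpp (ex fr c H sp) (%(H1, sp1, t1). tr (of_nat N) (ex fr ?L H1 sp1)
 (%H2 sp2 t2. h H2 sp2 (bval_acc fr H b @ t1 @ t2))) <=
 ew fr c H sp (%H1 sp1 t1. 2 * of_nat g + (?P H1 sp1 t1 + u * (if bval fr H1 b then 1 else 0)))"
 unfolding ew_def
 proof (rule wpp_AS_mono[OF AE[unfolded ae_def]], clarify)
 fix H1 sp1 t1 assume t1: "addrs t1 <= U" "Inv H1"
 let ?t = "bval_acc fr H b @ t1"
 have U: "addrs ?t <= U" using t1 guard[OF I(1)] by (auto simp: image_Un)
 have "cst ?t <= g + cst t1" using cst_append[of "bval_acc fr H b" t1] guard[OF I(1)] by linarith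
 hence ct: "of_nat (cst ?t) <= (of_nat g + of_nat (cst t1) :: ennreal)"
 unfolding of_nat_add[symmetric] by (intro of_nat_mono)
 have "tr (of_nat N) (ex fr ?L H1 sp) (%H2 sp2 t2. h H2 sp2 (?t @ t2)) <=
 of_nat (cst ?t) + tr (of_nat N) (ex fr ?L H1 sp) h" by (rule tr_prefix[OF U])
 also have "tr (of_nat N) (ex fr ?L H1 sp) h <= (if bval fr H1 b then u else of_nat g + F H1)"
 using tr_ret[OF t1(2)] t1(2) by (auto simp: u_def intro!: SUP_upper)
 finally have "tr (of_nat N) (ex fr ?L H1 sp) (%H2 sp2 t2. h H2 sp2 (?t @ t2)) <=
 of_nat (cst ?t) + (if bval fr H1 b then u else of_nat g + F H1)"
 by (simp only: add_left_mono)
 also have "of_nat (cst ?t) + (if bval fr H1 b then u else of_nat g + F H1) <=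
 of_nat g + of_nat (cst t1) + (if bval fr H1 b then u else of_nat g + F H1)"
 by (rule add_right_mono[OF ct])
 also have "... <= 2 * of_nat g + (?P H1 sp t1 + u * (if bval fr H1 b then 1 else 0))"
 proof -
 have "(of_nat g :: ennreal) <= 2 * of_nat g" by (simp add: mult_2)
 thus ?thesis using t1
 by (auto simp: pc_def add.assoc mult_2 intro!: add_left_mono)
 qed
 finally show "tr (of_nat N) (ex fr ?L H1 sp) (%H2 sp2 t2. h H2 sp2 (bval_acc fr H b @ t1 @ t2)) <=
 2 * of_nat g + (?P H1 sp t1 + u * (if bval fr H1 b then 1 else 0))"
 by (simp only: append.assoc)
 qed
 also have "... = 2 * of_nat g + (ew fr c H sp ?P + ew fr c H sp (%H1 sp1 t1. u * (if bval fr H1 b then 1 else 0)))"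
 by (simp only: ew_add_const ew_add)
 also have "ew fr c H sp (%H1 sp1 t1. u * (if bval fr H1 b then 1 else 0)) <= u * ennreal (2/3)"
 proof (cases "u = 0")
 case True
 have "ew fr c H sp (%H1 sp1 t1. u * (if bval fr H1 b then 1 else 0)) <= 0"
 by (rule ew_ae_le[OF AE]) (simp add: True)
 thus ?thesis by simp
 next
 case False
 show ?thesis unfolding ew_cmult[OF False] by (intro mult_left_mono prob I) simp
 qed
 also have "2 * of_nat g + (ew fr c H sp ?P + u * ennreal (2/3)) <= 2 * of_nat g + (a + u * ennreal (2/3))"
 by (intro add_left_mono add_right_mono step I)
 finally show ?thesis by (simp add: ac_simps)
 qed
 hence "u <= (2 * of_nat g + a) + ennreal (2/3) * u"
 by (subst u_def, intro SUP_least) simp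
 hence "u <= 3 * (2 * of_nat g + a)" by (rule ennreal_le_fixpoint[OF fin])
 moreover have "tr (of_nat N) (ex fr ?L H0 sp) h <= u" unfolding u_def using inv by (intro SUP_upper) auto
 ultimately show ?thesis by (rule order_trans[rotated])
 qed
 \<comment> \<open>The truncations increase to the cost itself, so the bound that is uniform in
   \<open>N\<close> survives by monotone convergence.\<close>
 have sup: "(SUP N::nat. min (of_nat N) x) = x" for x :: ennreal
 proof -
 have "(SUP N::nat. min x (of_nat N)) = min x (SUP N::nat. of_nat N)"
 by (simp add: inf_min[symmetric] inf_SUP)
 thus ?thesis by (simp add: ennreal_SUP_of_nat_eq_top min.commute)
 qed
 have "ew fr ?L H0 sp h = (\<integral>\<^sup>+ r. (SUP N::nat. min (of_nat N) (case r of None => \<top> | Some (H', sp', t) => h H' sp' t))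
 \<partial>measure_pmf (ex fr ?L H0 sp))"
 unfolding sup ew_def wpp_def ..
 also have "... = (SUP N::nat. tr (of_nat N) (ex fr ?L H0 sp) h)"
 unfolding tr_def
 proof (rule nn_integral_monotone_convergence_SUP)
 show "incseq (%N::nat. %r. min (of_nat N) (case r of None => \<top> | Some (H', sp', t) => h H' sp' t))"
 unfolding incseq_def le_fun_def by (intro allI impI min.mono of_nat_mono order_refl)
 qed simp
 also have "... <= 3 * (2 * of_nat g + a)" by (intro SUP_least bound)
 finally show ?thesis unfolding h_def .
qed

end

section \<open>Arrays in memory and worst-case triples\<close>

definition arr :: "mem => addr => nat => cell list" where
 "arr H x n = map (%i. H (x + int i)) [0..<n]"

lemma length_arr [simp]: "length (arr H x n) = n"
 by (simp add: arr_def)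

lemma arr_0 [simp]: "arr H x 0 = []"
 by (simp add: arr_def)

lemma arr_Suc: "arr H x (Suc n) = arr H x n @ [H (x + int n)]"
 by (simp add: arr_def)

lemma nth_arr [simp]: "i < n ==> arr H x n ! i = H (x + int i)"
 by (simp add: arr_def)

lemma set_arr: "set (arr H x n) = H ` {x..<x + int n}"
proof -
 have "{x..<x + int n} = (%i. x + int i) ` {0..<n}"
 proof (intro equalityI subsetI)
 fix y assume "y \<in> {x..<x + int n}"
 hence "y = x + int (nat (y - x))" "nat (y - x) \<in> {0..<n}" by auto
 thus "y \<in> (%i. x + int i) ` {0..<n}" by blast
 qed auto
 thus ?thesis by (simp add: arr_def image_image)
qed

lemma arr_cong:
 assumes "!!y. x <= y ==> y < x + int n ==> H y = H' y"
 shows "arr H x n = arr H' x n"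
 unfolding arr_def using assms by (intro map_cong) auto

lemma arr_append:
 assumes "m <= n"
 shows "arr H x n = arr H x m @ arr H (x + int m) (n - m)"
proof (rule nth_equalityI)
 show "length (arr H x n) = length (arr H x m @ arr H (x + int m) (n - m))" using assms by simp
 fix i assume "i < length (arr H x n)"
 thus "arr H x n ! i = (arr H x m @ arr H (x + int m) (n - m)) ! i"
 using assms by (cases "i < m") (auto simp: nth_append add.assoc simp flip: of_nat_add)
qed

lemma sorted_arrD: "sorted (arr H x n) ==> i <= j ==> j < n ==> H (x + int i) <= H (x + int j)"
 using sorted_nth_mono[of "arr H x n" i j] by simp

lemma ae_Seq_rule:
 assumes "ae fr c1 H sp Q1"
 "!!H1 sp1 t1. Q1 H1 sp1 t1 ==> ae fr c2 H1 sp1 (%H2 sp2 t2. Q H2 sp2 (t1 @ t2))"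
 shows "ae fr (c1;; c2) H sp Q"
 unfolding ae_Seq by (rule ae_mono[OF assms(1)]) (rule assms(2))

context cache
begin

text \<open>Touched cells and cost are bounded separately, because a touched set that is small
  enough may later replace the cost bound.\<close>

definition aq :: "addr set => real => (vname => addr) => com => mem => addr => (mem => addr => bool) => bool" where
 "aq U k fr c H sp Q \<longleftrightarrow>
 ae fr c H sp (%H' sp' t. addrs t <= U & real (cst t) <= k & Q H' sp')"

lemma aq_mono:
 assumes "aq U k fr c H sp Q" "U <= U'" "k <= k'" "!!H' sp'. Q H' sp' ==> Q' H' sp'"
 shows "aq U' k' fr c H sp Q'"
 using assms unfolding aq_def by (auto elim!: ae_mono)

lemma aq_Seq:
 assumes "aq U k1 fr c1 H sp Q1" "!!H1 sp1. Q1 H1 sp1 ==> aq U k2 fr c2 H1 sp1 Q"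
 shows "aq U (k1 + k2) fr (c1;; c2) H sp Q"
 unfolding aq_def
proof (rule ae_Seq_rule[OF assms(1)[unfolded aq_def]])
 fix H1 sp1 t1 assume *: "addrs t1 <= U & real (cst t1) <= k1 & Q1 H1 sp1"
 hence "ae fr c2 H1 sp1 (%H' sp' t. addrs t <= U & real (cst t) <= k2 & Q H' sp')"
 using assms(2) by (auto simp: aq_def)
 thus "ae fr c2 H1 sp1 (%H2 sp2 t2. addrs (t1 @ t2) <= U & real (cst (t1 @ t2)) <= k1 + k2 & Q H2 sp2)"
 proof (rule ae_mono)
 fix H2 sp2 t2 assume "addrs t2 <= U & real (cst t2) <= k2 & Q H2 sp2"
 moreover have "real (cst (t1 @ t2)) <= real (cst t1) + real (cst t2)" using cst_append[of t1 t2] by linarith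
 ultimately show "addrs (t1 @ t2) <= U & real (cst (t1 @ t2)) <= k1 + k2 & Q H2 sp2"
 using * by (auto simp: image_Un)
 qed
qed

lemma aq_local:
 assumes "ae fr c H sp (%H' sp' t. addrs t <= {f..g} & Q H' sp')" "g - f < int B" "{f..g} <= U"
 shows "aq U 4 fr c H sp Q"
 unfolding aq_def
proof (rule ae_mono[OF assms(1)])
 fix H' sp' t assume *: "addrs t <= {f..g} & Q H' sp'"
 hence "cst t <= 4" using assms(2) cst_local by blast
 thus "addrs t <= U & real (cst t) <= 4 & Q H' sp'" using * assms(3) by auto
qed

lemma cst_call_prefix:
 assumes "addrs t <= {f..g}" "g - f < int B" "n <= 10"
 shows "cst (t @ map (%i. Write (sp + int i)) [0..<n]) <= 8"
proof -
 let ?w = "map (%i. Write (sp + int i)) [0..<n]"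
 have "addrs ?w <= {sp..sp + 10}" using assms(3) by auto
 hence "cst ?w <= 4" using cst_local[of ?w sp "sp + 10"] B_large by auto
 moreover have "cst t <= 4" using assms cst_local by blast
 ultimately show ?thesis using cst_append[of t ?w] by linarith
qed

lemma aq_Call:
 assumes "aq U k (frame (squaresort_prog p) sp) (body (squaresort_prog p))
 (write_list H sp (map (aval fr H) es)) (sp + int (length (frame_vars (squaresort_prog p))))
 (%H' sp'. Q H' sp)"
 and "addrs (concat (map (aval_acc fr H) es)) <= {f..g}" "g - f < int B" "{f..g} <= U"
 and "{sp..<sp + int (length es)} <= U" "length es <= 10"
 shows "aq U (8 + k) fr (Call p es) H sp Q"
 unfolding aq_def ae_Call
proof (rule ae_mono[OF assms(1)[unfolded aq_def]])
 fix H' sp' t assume *: "addrs t <= U & real (cst t) <= k & Q H' sp"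
 let ?a = "concat (map (aval_acc fr H) es) @ map (%i. Write (sp + int i)) [0..<length es]"
 have "cst ?a <= 8" using cst_call_prefix[OF assms(2,3,6)] .
 moreover have "cst (?a @ t) <= cst ?a + cst t" by (rule cst_append)
 moreover have "addrs ?a <= U" using assms(2,4,5) by (auto simp: image_Un)
 ultimately have "addrs (?a @ t) <= U & real (cst (?a @ t)) <= 8 + k & Q H' sp"
 using * by (auto simp: image_Un)
 thus "addrs (concat (map (aval_acc fr H) es) @ map (%i. Write (sp + int i)) [0..<length es] @ t) <= U &
 real (cst (concat (map (aval_acc fr H) es) @ map (%i. Write (sp + int i)) [0..<length es] @ t)) <= 8 + k & Q H' sp"
 by simp
qed

lemma aq_streaming:
 fixes I :: "'i set"
 assumes "ae fr c H sp (%H' sp' t. Q H' sp' & strm S I c0 t (c1 H'))"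
 and "finite I" "finite S" "card (blocks B S) <= b" "b + card I <= K"
 and "!!H' sp'. Q H' sp' ==> (\<Sum>p\<in>I. c1 H' p - c0 p) <= e"
 and "!!H' sp' p. Q H' sp' ==> p \<in> I ==> {c0 p..c1 H' p} <= U" "S <= U"
 shows "aq U (2 * real b + 4 * real (card I) + 2 * real_of_int e / real B) fr c H sp Q"
 unfolding aq_def
proof (rule ae_mono[OF assms(1)])
 fix H' sp' t assume *: "Q H' sp' & strm S I c0 t (c1 H')"
 hence "real (cst t) <= 2 * real b + 4 * real (card I) + 2 * real_of_int e / real B"
 using cst_streams assms by blast
 moreover have "addrs t <= U" using strm_addrs[of S I c0 t "c1 H'"] * assms(7,8) by blast
 ultimately show "addrs t <= U & real (cst t) <= 2 * real b + 4 * real (card I) + 2 * real_of_int e / real B & Q H' sp'"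
 using * by blast
qed

end

section \<open>Merge sort\<close>

definition merge_loop :: com where
 "merge_loop =
 WHILE V ''t'' \<prec> V ''k'' DO (
 (IF V ''i'' \<prec> V ''h'' AND
 (NotB (V ''j'' \<prec> V ''k'') OR NotB ((V ''X'')[[V ''j'']] \<prec> (V ''X'')[[V ''i'']]))
 THEN
 (V ''Y'' \<oplus> V ''t'' :*= (V ''X'')[[V ''i'']];;
 ''i'' ::= V ''i'' \<oplus> N 1)
 ELSE
 (V ''Y'' \<oplus> V ''t'' :*= (V ''X'')[[V ''j'']];;
 ''j'' ::= V ''j'' \<oplus> N 1));;
 ''t'' ::= V ''t'' \<oplus> N 1)"

definition copy_loop :: com where
 "copy_loop =
 WHILE V ''t'' \<prec> V ''k'' DO (
 V ''X'' \<oplus> V ''t'' :*= (V ''Y'')[[V ''t'']];;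
 ''t'' ::= V ''t'' \<oplus> N 1)"

lemma frame_MergeSort [simp]:
 "frame MergeSort_proc s ''X'' = s" "frame MergeSort_proc s ''k'' = s + 1"
 "frame MergeSort_proc s ''h'' = s + 2" "frame MergeSort_proc s ''i'' = s + 3"
 "frame MergeSort_proc s ''j'' = s + 4" "frame MergeSort_proc s ''t'' = s + 5"
 "frame MergeSort_proc s ''Y'' = s + 6" "length (frame_vars MergeSort_proc) = 7"
 by (simp_all add: frame_def frame_vars_def MergeSort_proc_def)

abbreviation ptr3 :: "addr => addr => addr => nat => addr" where
 "ptr3 a b c \<equiv> (%p. if p = 0 then a else if p = 1 then b else c)"

lemma image_ptr3: "ptr3 a b c ` {0, 1, 2} = {a, b, c}"
 by auto

text \<open>The heads of the two halves and the end of the output are the three pointers. Every item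
  already in the output is at most each remaining head, which keeps the output sorted.\<close>

lemma merge_loop_ae:
 assumes vars: "H s = Fin x" "H (s + 1) = Fin (int k)" "H (s + 2) = Fin (int h)" "H (s + 6) = Fin y"
 "H (s + 3) = Fin 0" "H (s + 4) = Fin (int h)" "H (s + 5) = Fin 0"
 and lay: "h <= k" "x + int k <= s" "s + 7 <= y"
 and srt: "sorted (arr H x h)" "sorted (arr H (x + int h) (k - h))"
 shows "ae (frame MergeSort_proc s) merge_loop H sp (%H' sp' t.
 (sp' = sp & (ALL z. z ~: {s+3..s+5} --> z ~: {y..<y + int k} --> H' z = H z) &
 sorted (arr H' y k) & mset (arr H' y k) = mset (arr H x k) &
 H' (s + 3) = Fin (int h) & H' (s + 4) = Fin (int k) & H' (s + 5) = Fin (int k)) &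
 strm {s..s+6} {0::nat, 1, 2} (ptr3 x (x + int h) y) t (ptr3 (x + int h) (x + int k) (y + int k)))"
proof -
 define Inv where "Inv t H' sp' \<longleftrightarrow> sp' = sp &
 (ALL z. z ~: {s+3..s+5} --> z ~: {y..<y + int k} --> H' z = H z) &
 (EX i j. i <= h & j <= k - h & H' (s + 3) = Fin (int i) & H' (s + 4) = Fin (int (h + j)) &
 H' (s + 5) = Fin (int (i + j)) & sorted (arr H' y (i + j)) &
 mset (arr H' y (i + j)) = mset (arr H x i) + mset (arr H (x + int h) j) &
 (\<forall>v\<in>set (arr H' y (i + j)). (i < h --> v <= H (x + int i)) & (j < k - h --> v <= H (x + int h + int j))) &
 strm {s..s+6} {0::nat, 1, 2} (ptr3 x (x + int h) y) t
 (ptr3 (x + int i) (x + int h + int j) (y + int (i + j))))" for t H' sp'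
 show ?thesis unfolding merge_loop_def
 proof (rule ae_While[where I = Inv and \<mu> = "%H'. nat (int k - int_of (H' (s + 5)))"])
 show "Inv [] H sp" unfolding Inv_def using vars lay
 by (auto intro!: exI[of _ 0] strm.stop)
 next
 fix t H' sp'
 assume I: "Inv t H' sp'" and b: "bval (frame MergeSort_proc s) H' (V ''t'' \<prec> V ''k'')"
 then obtain i j where ij: "i <= h" "j <= k - h" "H' (s + 3) = Fin (int i)" "H' (s + 4) = Fin (int (h + j))"
 "H' (s + 5) = Fin (int (i + j))" "sorted (arr H' y (i + j))"
 "mset (arr H' y (i + j)) = mset (arr H x i) + mset (arr H (x + int h) j)"
 and le: "!!v. v\<in>set (arr H' y (i + j)) ==> (i < h --> v <= H (x + int i)) & (j < k - h --> v <= H (x + int h + int j))"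
 and st: "strm {s..s+6} {0::nat, 1, 2} (ptr3 x (x + int h) y) t
 (ptr3 (x + int i) (x + int h + int j) (y + int (i + j)))"
 and sp': "sp' = sp" and same: "!!z. z ~: {s+3..s+5} ==> z ~: {y..<y + int k} ==> H' z = H z"
 unfolding Inv_def by blast
 have v: "H' s = Fin x" "H' (s + 1) = Fin (int k)" "H' (s + 2) = Fin (int h)" "H' (s + 6) = Fin y"
 using same[of s] same[of "s+1"] same[of "s+2"] same[of "s+6"] vars lay by auto
 have xs: "H' (x + int q) = H (x + int q)" if "q < k" for q
 using same[of "x + int q"] that lay by auto
 have lt: "i + j < k" using b v ij by simp
 let ?c = "i < h & (~ j < k - h \<or> ~ H (x + int h + int j) < H (x + int i))"
 let ?cond = "V ''i'' \<prec> V ''h'' AND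
 (NotB (V ''j'' \<prec> V ''k'') OR NotB ((V ''X'')[[V ''j'']] \<prec> (V ''X'')[[V ''i'']]))"
 have bv: "bval (frame MergeSort_proc s) H' ?cond = ?c"
 using v ij xs[of "h + j"] xs[of i] lay by (auto simp: add.assoc)
 define H'' where "H'' = (if ?c then H'(y + int (i + j) := H (x + int i), s + 3 := Fin (int (i + 1)), s + 5 := Fin (int (i + j + 1)))
 else H'(y + int (i + j) := H (x + int h + int j), s + 4 := Fin (int (h + j + 1)), s + 5 := Fin (int (i + j + 1))))"
 define i' where "i' = (if ?c then i + 1 else i)"
 define j' where "j' = (if ?c then j else j + 1)"
 have ij': "i' <= h" "j' <= k - h" "i' + j' = Suc (i + j)"
 using ij lt lay by (auto simp: i'_def j'_def)
 define v0 where "v0 = (if ?c then H (x + int i) else H (x + int h + int j))"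
 have ar: "arr H'' y (i + j) = arr H' y (i + j)"
 using lay by (intro arr_cong) (auto simp: H''_def)
 have ar2: "H'' (y + int (i + j)) = v0" using lay by (auto simp: H''_def v0_def)
 have arS: "arr H'' y (i' + j') = arr H' y (i + j) @ [v0]"
 unfolding ij'(3) arr_Suc ar ar2 ..
 have v0ge: "v <= v0" if "v \<in> set (arr H' y (i + j))" for v
 using le[OF that] lt ij lay by (auto simp: v0_def split: if_splits)
 have srt': "sorted (arr H'' y (i' + j'))"
 unfolding arS using ij(6) v0ge by (auto simp: sorted_append)
 have ms': "mset (arr H'' y (i' + j')) = mset (arr H x i') + mset (arr H (x + int h) j')"
 unfolding arS using ij(7) by (auto simp: i'_def j'_def v0_def arr_Suc)
 \<comment> \<open>The halves are sorted, so the item just written is also at most the new head of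
   its own half.\<close>
 have up: "(i' < h --> v0 <= H (x + int i')) & (j' < k - h --> v0 <= H (x + int h + int j'))"
 proof (cases ?c)
 case True
 have "H (x + int i) <= H (x + int (i + 1))" if "i + 1 < h"
 using sorted_arrD[OF srt(1), of i "i + 1"] that by simp
 thus ?thesis using True by (auto simp: i'_def j'_def v0_def)
 next
 case False
 hence jk: "j < k - h" using lt ij by auto
 have "H (x + int h + int j) <= H (x + int h + int (j + 1))" if "j + 1 < k - h"
 using sorted_arrD[OF srt(2), of j "j + 1"] that by simp
 thus ?thesis using False jk by (auto simp: i'_def j'_def v0_def)
 qed
 have le': "(i' < h --> v <= H (x + int i')) & (j' < k - h --> v <= H (x + int h + int j'))"
 if "v \<in> set (arr H'' y (i' + j'))" for v
 using that up v0ge unfolding arS by (auto intro: order_trans)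
 have same': "H'' z = H z" if "z ~: {s+3..s+5}" "z ~: {y..<y + int k}" for z
 using same[OF that] that lt by (auto simp: H''_def)
 have vars': "H'' (s + 3) = Fin (int i')" "H'' (s + 4) = Fin (int (h + j'))" "H'' (s + 5) = Fin (int (i' + j'))"
 using ij lay by (auto simp: H''_def i'_def j'_def)
 have fin: "Inv (t @ t') H'' sp & nat (int k - int_of (H'' (s + 5))) < nat (int k - int_of (H' (s + 5)))"
 if "addrs t' <= {s..s+6} Un {x + int i, x + int h + int j, y + int (i + j)}" for t'
 proof -
 have "strm {s..s+6} {0::nat, 1, 2} (ptr3 (x + int i) (x + int h + int j) (y + int (i + j))) t'
 (ptr3 (x + int i') (x + int h + int j') (y + int (i' + j')))"
 by (rule strm_step)
 (use that in \<open>auto simp only: image_ptr3\<close>, auto simp: i'_def j'_def)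
 hence "strm {s..s+6} {0::nat, 1, 2} (ptr3 x (x + int h) y) (t @ t')
 (ptr3 (x + int i') (x + int h + int j') (y + int (i' + j')))"
 by (rule strm_append[OF st])
 thus ?thesis unfolding Inv_def using same' vars' ij' srt' ms' le' ij(5) lt by auto
 qed
 let ?body = "(IF ?cond THEN
 (V ''Y'' \<oplus> V ''t'' :*= (V ''X'')[[V ''i'']];;
 ''i'' ::= V ''i'' \<oplus> N 1)
 ELSE
 (V ''Y'' \<oplus> V ''t'' :*= (V ''X'')[[V ''j'']];;
 ''j'' ::= V ''j'' \<oplus> N 1));;
 ''t'' ::= V ''t'' \<oplus> N 1"
 have E: "ae (frame MergeSort_proc s) ?body H' sp' (%H2 sp2 t'. H2 = H'' & sp2 = sp &
 addrs t' <= {s..s+6} Un {x + int i, x + int h + int j, y + int (i + j)})"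
 proof (cases ?c)
 case True
 thus ?thesis unfolding ae_Seq ae_Cond bv
 using lay v ij xs[of i] sp' by (auto simp: ae_simps H''_def add_ac)
 next
 case False
 have xj: "H' (x + (int h + int j)) = H (x + (int h + int j))"
 using xs[of "h + j"] False lt ij by (auto simp: add_ac)
 show ?thesis unfolding ae_Seq ae_Cond bv if_not_P[OF False]
 using lay v ij xj sp' False by (simp add: ae_simps H''_def add_ac) auto
 qed
 show "ae (frame MergeSort_proc s) (?body) H' sp'
 (%H2 sp2 t'. Inv (t @ bval_acc (frame MergeSort_proc s) H' (V ''t'' \<prec> V ''k'') @ t') H2 sp2 &
 nat (int k - int_of (H2 (s + 5))) < nat (int k - int_of (H' (s + 5))))"
 by (rule ae_mono[OF E]) (use fin in \<open>auto simp: image_Un\<close>)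
 next
 fix t H' sp'
 assume I: "Inv t H' sp'" and b: "~ bval (frame MergeSort_proc s) H' (V ''t'' \<prec> V ''k'')"
 then obtain i j where ij: "i <= h" "j <= k - h" "H' (s + 3) = Fin (int i)" "H' (s + 4) = Fin (int (h + j))"
 "H' (s + 5) = Fin (int (i + j))" "sorted (arr H' y (i + j))"
 "mset (arr H' y (i + j)) = mset (arr H x i) + mset (arr H (x + int h) j)"
 and st: "strm {s..s+6} {0::nat, 1, 2} (ptr3 x (x + int h) y) t
 (ptr3 (x + int i) (x + int h + int j) (y + int (i + j)))"
 and sp': "sp' = sp" and same: "!!z. z ~: {s+3..s+5} ==> z ~: {y..<y + int k} ==> H' z = H z"
 unfolding Inv_def by blast
 have "H' (s + 1) = Fin (int k)" using same[of "s+1"] vars lay by auto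
 hence "i + j \<ge> k" using b ij by simp
 hence e: "i = h" "x + int h + int j = x + int k" "h + j = k" and j: "j = k - h" using ij lay by auto
 have "strm {s..s+6} {0::nat, 1, 2} (ptr3 (x + int i) (x + int h + int j) (y + int (i + j)))
 (bval_acc (frame MergeSort_proc s) H' (V ''t'' \<prec> V ''k''))
 (ptr3 (x + int i) (x + int h + int j) (y + int (i + j)))"
 by (rule strm_static) auto
 from strm_append[OF st this]
 show "(sp' = sp & (ALL z. z ~: {s+3..s+5} --> z ~: {y..<y + int k} --> H' z = H z) &
 sorted (arr H' y k) & mset (arr H' y k) = mset (arr H x k) &
 H' (s + 3) = Fin (int h) & H' (s + 4) = Fin (int k) & H' (s + 5) = Fin (int k)) &
 strm {s..s+6} {0::nat, 1, 2} (ptr3 x (x + int h) y)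
 (t @ bval_acc (frame MergeSort_proc s) H' (V ''t'' \<prec> V ''k'')) (ptr3 (x + int h) (x + int k) (y + int k))"
 using ij sp' same lay arr_append[OF lay(1), of H x] unfolding e using j e by auto
 qed
qed

text \<open>The third pointer repeats the second, so that the cost rule for three pointers
  applies.\<close>

lemma copy_loop_ae:
 assumes vars: "H s = Fin x" "H (s + 1) = Fin (int k)" "H (s + 6) = Fin y" "H (s + 5) = Fin 0"
 and lay: "x + int k <= s" "s + 7 <= y"
 shows "ae (frame MergeSort_proc s) copy_loop H sp (%H' sp' t.
 (sp' = sp & (ALL z. z ~= s+5 --> z ~: {x..<x + int k} --> H' z = H z) & arr H' x k = arr H y k) &
 strm {s..s+6} {0::nat, 1, 2} (ptr3 x y y) t (ptr3 (x + int k) (y + int k) (y + int k)))"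
proof -
 define Inv where "Inv t H' sp' \<longleftrightarrow> sp' = sp &
 (ALL z. z ~= s+5 --> z ~: {x..<x + int k} --> H' z = H z) &
 (EX i. i <= k & H' (s + 5) = Fin (int i) & arr H' x i = arr H y i &
 strm {s..s+6} {0::nat, 1, 2} (ptr3 x y y) t (ptr3 (x + int i) (y + int i) (y + int i)))" for t H' sp'
 show ?thesis unfolding copy_loop_def
 proof (rule ae_While[where I = Inv and \<mu> = "%H'. nat (int k - int_of (H' (s + 5)))"])
 show "Inv [] H sp" unfolding Inv_def using vars lay
 by (auto intro!: exI[of _ 0] strm.stop)
 next
 fix t H' sp'
 assume I: "Inv t H' sp'" and b: "bval (frame MergeSort_proc s) H' (V ''t'' \<prec> V ''k'')"
 then obtain i where ij: "i <= k" "H' (s + 5) = Fin (int i)" "arr H' x i = arr H y i"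
 and st: "strm {s..s+6} {0::nat, 1, 2} (ptr3 x y y) t (ptr3 (x + int i) (y + int i) (y + int i))"
 and sp': "sp' = sp" and same: "!!z. z ~= s+5 ==> z ~: {x..<x + int k} ==> H' z = H z"
 unfolding Inv_def by blast
 have v: "H' s = Fin x" "H' (s + 1) = Fin (int k)" "H' (s + 6) = Fin y"
 using same[of s] same[of "s+1"] same[of "s+6"] vars lay by auto
 have lt: "i < k" using b v ij by simp
 have yi: "H' (y + int i) = H (y + int i)" using same[of "y + int i"] lay lt by auto
 define H'' where "H'' = H'(x + int i := H (y + int i), s + 5 := Fin (int i + 1))"
 have "arr H'' x i = arr H' x i" using lay lt by (intro arr_cong) (auto simp: H''_def)
 moreover have "H'' (x + int i) = H (y + int i)" using lay lt by (auto simp: H''_def)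
 ultimately have ar: "arr H'' x (Suc i) = arr H y (Suc i)" by (simp add: arr_Suc ij)
 have same': "H'' z = H z" if "z ~= s+5" "z ~: {x..<x + int k}" for z
 using same[OF that] that lt by (auto simp: H''_def)
 have fin: "Inv (t @ t') H'' sp & nat (int k - int_of (H'' (s + 5))) < nat (int k - int_of (H' (s + 5)))"
 if "addrs t' <= {s..s+6} Un {x + int i, y + int i, y + int i}" for t'
 proof -
 have "strm {s..s+6} {0::nat, 1, 2} (ptr3 (x + int i) (y + int i) (y + int i)) t'
 (ptr3 (x + int (Suc i)) (y + int (Suc i)) (y + int (Suc i)))"
 by (rule strm_step) (use that in \<open>auto simp only: image_ptr3\<close>, auto)
 hence "strm {s..s+6} {0::nat, 1, 2} (ptr3 x y y) (t @ t')
 (ptr3 (x + int (Suc i)) (y + int (Suc i)) (y + int (Suc i)))"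
 by (rule strm_append[OF st])
 thus ?thesis unfolding Inv_def using same' lt ar ij
 by (auto simp: H''_def intro!: exI[of _ "Suc i"])
 qed
 let ?body = "V ''X'' \<oplus> V ''t'' :*= (V ''Y'')[[V ''t'']];; ''t'' ::= V ''t'' \<oplus> N 1"
 have E: "ae (frame MergeSort_proc s) ?body H' sp' (%H2 sp2 t'. H2 = H'' & sp2 = sp &
 addrs t' <= {s..s+6} Un {x + int i, y + int i, y + int i})"
 using v ij yi sp' lay lt by (simp add: ae_simps H''_def)
 show "ae (frame MergeSort_proc s) (?body) H' sp'
 (%H2 sp2 t'. Inv (t @ bval_acc (frame MergeSort_proc s) H' (V ''t'' \<prec> V ''k'') @ t') H2 sp2 &
 nat (int k - int_of (H2 (s + 5))) < nat (int k - int_of (H' (s + 5))))"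
 by (rule ae_mono[OF E]) (use fin in \<open>auto simp: image_Un\<close>)
 next
 fix t H' sp'
 assume I: "Inv t H' sp'" and b: "~ bval (frame MergeSort_proc s) H' (V ''t'' \<prec> V ''k'')"
 then obtain i where ij: "i <= k" "H' (s + 5) = Fin (int i)" "arr H' x i = arr H y i"
 and st: "strm {s..s+6} {0::nat, 1, 2} (ptr3 x y y) t (ptr3 (x + int i) (y + int i) (y + int i))"
 and sp': "sp' = sp" and same: "!!z. z ~= s+5 ==> z ~: {x..<x + int k} ==> H' z = H z"
 unfolding Inv_def by blast
 have "H' (s + 1) = Fin (int k)" using same[of "s+1"] vars lay by auto
 hence e: "i = k" using b ij by simp
 have "strm {s..s+6} {0::nat, 1, 2} (ptr3 (x + int i) (y + int i) (y + int i))
 (bval_acc (frame MergeSort_proc s) H' (V ''t'' \<prec> V ''k'')) (ptr3 (x + int i) (y + int i) (y + int i))"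
 by (rule strm_static) auto
 from strm_append[OF st this]
 show "(sp' = sp & (ALL z. z ~= s+5 --> z ~: {x..<x + int k} --> H' z = H z) & arr H' x k = arr H y k) &
 strm {s..s+6} {0::nat, 1, 2} (ptr3 x y y)
 (t @ bval_acc (frame MergeSort_proc s) H' (V ''t'' \<prec> V ''k'')) (ptr3 (x + int k) (y + int k) (y + int k))"
 using ij sp' same unfolding e by auto
 qed
qed


text \<open>The program text with its sequences regrouped to match the stages of the analysis; since
  concatenation of traces is associative, regrouping changes nothing.\<close>

definition merge_sort_code :: com where
 "merge_sort_code = (IF V ''k'' \<prec> N 2 THEN SKIP ELSE
 (''h'' ::= Half (V ''k'');;
 (Call MergeSort [V ''X'', V ''h''];;
 (Call MergeSort [V ''X'' \<oplus> V ''h'', V ''k'' \<ominus> V ''h''];;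
 ((Alloc ''Y'' (V ''k'');; ''i'' ::= N 0;; ''j'' ::= V ''h'';; ''t'' ::= N 0);;
 (merge_loop;;
 (''t'' ::= N 0;; copy_loop)))))))"

lemma ae_MergeSort_body:
 "ae fr (body MergeSort_proc) H sp Q = ae fr merge_sort_code H sp Q"
 by (cases "bval fr H (V ''k'' \<prec> N 2)")
 (simp_all del: bval.simps add: MergeSort_proc_def merge_sort_code_def merge_loop_def copy_loop_def ae_Cond ae_Seq)

text \<open>Halving the size halves the total of the squares, up to 1/2 for odd \<open>k\<close>. A
  quadratic cost bound thus gains a constant factor at each level, which absorbs the work of
  merging.\<close>

lemma square_halves_le:
 fixes k :: nat
 shows "(real (k div 2))^2 + (real (k - k div 2))^2 <= ((real k)^2 + 1) / 2"
proof (cases "even k")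
 case True
 then obtain l where "k = 2 * l" by (elim evenE)
 thus ?thesis by (simp add: power2_eq_square field_simps)
next
 case False
 then obtain l where "k = 2 * l + 1" by (elim oddE)
 thus ?thesis by (simp add: power2_eq_square field_simps)
qed

context cache
begin

lemma aq_streaming3:
 assumes "ae fr c H sp (%H' sp' t. Q H' sp' & strm S {0::nat, 1, 2} (ptr3 x y z) t (ptr3 x' y' z'))"
 and "finite S" "card (blocks B S) <= 2" "S <= U" "{x..x'} <= U" "{y..y'} <= U" "{z..z'} <= U"
 and "(x' - x) + (y' - y) + (z' - z) <= e"
 shows "aq U (16 + 2 * real_of_int e / B) fr c H sp Q"
proof -
 have "aq U (2 * real 2 + 4 * real (card {0::nat, 1, 2}) + 2 * real_of_int e / real B) fr c H sp Q"
 proof (rule aq_streaming[OF assms(1)])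
 fix p assume "p \<in> {0::nat, 1, 2}"
 then consider "p = 0" | "p = 1" | "p = 2" by blast
 thus "{ptr3 x y z p..ptr3 x' y' z' p} <= U" by cases (simp_all only: assms(5-7) if_True if_False, use assms(5-7) in auto)
 next
 have "(\<Sum>p\<in>{0::nat, 1, 2}. ptr3 x' y' z' p - ptr3 x y z p) = (x' - x) + (y' - y) + (z' - z)" by simp
 thus "(\<Sum>p\<in>{0::nat, 1, 2}. ptr3 x' y' z' p - ptr3 x y z p) <= e" using assms(8) by linarith
 have "card {0::nat, 1, 2} = 3" by simp
 thus "2 + card {0::nat, 1, 2} <= K" using B_large K_ge_B by linarith
 qed (use assms in auto)
 thus ?thesis by simp
qed

lemma aq_Cond:
 assumes "aq U k fr (if bval fr H b then c1 else c2) H sp Q"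
 and "addrs (bval_acc fr H b) <= {f..g}" "g - f < int B" "{f..g} <= U"
 shows "aq U (4 + k) fr (IF b THEN c1 ELSE c2) H sp Q"
 unfolding aq_def ae_Cond
proof (rule ae_mono[OF assms(1)[unfolded aq_def]])
 fix H' sp' t assume *: "addrs t <= U & real (cst t) <= k & Q H' sp'"
 have "cst (bval_acc fr H b) <= 4" by (rule cst_local[OF assms(2,3)])
 moreover have "cst (bval_acc fr H b @ t) <= cst (bval_acc fr H b) + cst t" by (rule cst_append)
 ultimately show "addrs (bval_acc fr H b @ t) <= U & real (cst (bval_acc fr H b @ t)) <= 4 + k & Q H' sp'"
 using * assms(2,4) by (auto simp: image_Un)
qed

text \<open>Adding up the costs of the steps is wasteful when all touched blocks fit into the cache
  together: the touched set alone then bounds the cost.\<close>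

lemma aq_cost_static:
 assumes "aq U k fr c H sp Q" "finite U" "card (blocks B U) <= b" "b <= K"
 shows "aq U (2 * real b) fr c H sp Q"
 unfolding aq_def
proof (rule ae_mono[OF assms(1)[unfolded aq_def]])
 fix H' sp' t assume *: "addrs t <= U & real (cst t) <= k & Q H' sp'"
 have "cst t <= 2 * card (blocks B U)" by (rule cst_static) (use * assms in auto)
 thus "addrs t <= U & real (cst t) <= 2 * real b & Q H' sp'"
 using * assms(3) by (auto simp flip: of_nat_mult)
qed

text \<open>The linear stack range is coarse: a frame of 7 cells per level and a buffer of
  \<open>k\<close> cells stay within it, because the recursion continues on halves and a call
  releases its stack when it returns.\<close>

definition msort_space :: "addr => nat => addr => addr set" where
 "msort_space x k s = {x..x + int k} Un {s..s + 10 * int k + 10}"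

text \<open>A quadratic bound is enough, since only \<open>m - 1\<close> sampled items are sorted
  and \<open>m^2\<close> is of order \<open>n\<close>; it keeps logarithms out of the
  induction.\<close>

lemma MergeSort_aq:
 assumes "H s = Fin x" "H (s + 1) = Fin (int k)" "x + int k <= s"
 shows "aq (msort_space x k s) (100 + 100 * (real k)^2 / B) (frame MergeSort_proc s) (body MergeSort_proc) H (s + 7)
 (%H' sp'. (ALL y<s. y ~: {x..<x + int k} --> H' y = H y) &
 sorted (arr H' x k) & mset (arr H' x k) = mset (arr H x k))"
 using assms
proof (induction k arbitrary: H s x rule: less_induct)
 case (less k)
 let ?fr = "frame MergeSort_proc s"
 let ?U = "msort_space x k s"
 let ?Q = "%H' sp'. (ALL y<s. y ~: {x..<x + int k} --> H' y = H y) &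
 sorted (arr H' x k) & mset (arr H' x k) = mset (arr H x k)"
 have Bb: "int B \<ge> 1000" using B_large by simp
 have aq_body: "aq U c ?fr (body MergeSort_proc) H (s + 7) Q = aq U c ?fr merge_sort_code H (s + 7) Q" for U c Q
 unfolding aq_def ae_MergeSort_body ..
 have fr: "{s..s + 10} <= ?U" by (auto simp: msort_space_def)
 show ?case
 proof (cases "k < 2")
 case True
 have "arr H x k = [] \<or> (EX v. arr H x k = [v])" using True
 by (metis One_nat_def arr_0 arr_Suc append_Nil less_2_cases)
 hence "sorted (arr H x k)" by auto
 hence "aq ?U 4 ?fr (body MergeSort_proc) H (s + 7) ?Q"
 using less.prems True Bb fr
 by (intro aq_local[of _ _ _ _ s "s + 10"]) (auto simp: ae_MergeSort_body merge_sort_code_def ae_simps)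
 thus ?thesis by (rule aq_mono) auto
 next
 case False
 define h where "h = k div 2"
 have h: "h < k" "k - h < k" "h <= k" "int k div 2 = int h" using False by (auto simp: h_def zdiv_int)
 define A where "A = 100 + 100 * (real h)^2 / B"
 define A' where "A' = 100 + 100 * (real (k - h))^2 / B"
 define V1 where "V1 H' sp' \<longleftrightarrow> H' s = Fin x & H' (s + 1) = Fin (int k) & H' (s + 2) = Fin (int h) &
 sp' = s + 7 & (ALL z<s. z ~: {x..<x + int k} --> H' z = H z)" for H' sp'
 have st1: "aq ?U 4 ?fr (''h'' ::= Half (V ''k'')) H (s + 7)
 (%H' sp'. V1 H' sp' & mset (arr H' x k) = mset (arr H x k))"
 using less.prems h Bb fr
 by (intro aq_local[of _ _ _ _ s "s + 10"]) (auto simp: ae_simps V1_def intro!: arg_cong[of _ _ mset] arr_cong)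
 have st2: "aq ?U (8 + A) ?fr (Call MergeSort [V ''X'', V ''h'']) H1 sp1
 (%H' sp'. V1 H' sp' & mset (arr H' x k) = mset (arr H x k) & sorted (arr H' x h))"
 if "V1 H1 sp1 & mset (arr H1 x k) = mset (arr H x k)" for H1 sp1
 proof -
 let ?H = "H1(s + 7 := Fin x, s + 7 + 1 := Fin (int h))"
 have *: "aq (msort_space x h (s + 7)) A (frame MergeSort_proc (s + 7)) (body MergeSort_proc) ?H (s + 7 + 7)
 (%H' sp'. (ALL y<s + 7. y ~: {x..<x + int h} --> H' y = ?H y) &
 sorted (arr H' x h) & mset (arr H' x h) = mset (arr ?H x h))"
 unfolding A_def by (rule less.IH) (use h less.prems in auto)
 have fin: "V1 H' (s + 7) & mset (arr H' x k) = mset (arr H x k) & sorted (arr H' x h)"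
 if p: "(ALL y<s + 7. y ~: {x..<x + int h} --> H' y = ?H y) &
 sorted (arr H' x h) & mset (arr H' x h) = mset (arr ?H x h)" for H'
 proof -
 have eq: "H' y = H1 y" if "y < s + 7" "y ~: {x..<x + int h}" for y using p that by auto
 have "V1 H' (s + 7)" using \<open>V1 H1 sp1 & _\<close> eq h less.prems by (auto simp: V1_def)
 moreover have "arr ?H x h = arr H1 x h" using less.prems h by (intro arr_cong) auto
 moreover have "arr H' (x + int h) (k - h) = arr H1 (x + int h) (k - h)"
 using less.prems h by (intro arr_cong eq) auto
 ultimately show ?thesis using p that \<open>V1 H1 sp1 & _\<close>
 arr_append[OF h(3), of H' x] arr_append[OF h(3), of H1 x] by auto
 qed
 show ?thesis
 proof (rule aq_Call[where f = s and g = "s + 10"])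
 show "aq ?U A (frame (squaresort_prog MergeSort) sp1) (body (squaresort_prog MergeSort))
 (write_list H1 sp1 (map (aval ?fr H1) [V ''X'', V ''h'']))
 (sp1 + int (length (frame_vars (squaresort_prog MergeSort))))
 (%H' sp'. V1 H' sp1 & mset (arr H' x k) = mset (arr H x k) & sorted (arr H' x h))"
 proof -
 have "aq ?U A (frame MergeSort_proc (s + 7)) (body MergeSort_proc) ?H (s + 7 + 7)
 (%H' sp'. V1 H' (s + 7) & mset (arr H' x k) = mset (arr H x k) & sorted (arr H' x h))"
 by (rule aq_mono[OF * _ order_refl fin]) (use h in \<open>auto simp: msort_space_def\<close>)
 thus ?thesis using that by (simp add: V1_def[of H1])
 qed
 qed (use that fr Bb False in \<open>auto simp: V1_def msort_space_def\<close>)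
 qed
 have st3: "aq ?U (8 + A') ?fr (Call MergeSort [V ''X'' \<oplus> V ''h'', V ''k'' \<ominus> V ''h'']) H1 sp1
 (%H' sp'. V1 H' sp' & mset (arr H' x k) = mset (arr H x k) & sorted (arr H' x h) &
 sorted (arr H' (x + int h) (k - h)))"
 if "V1 H1 sp1 & mset (arr H1 x k) = mset (arr H x k) & sorted (arr H1 x h)" for H1 sp1
 proof -
 let ?H = "H1(s + 7 := Fin (x + int h), s + 7 + 1 := Fin (int k - int h))"
 have *: "aq (msort_space (x + int h) (k - h) (s + 7)) A' (frame MergeSort_proc (s + 7)) (body MergeSort_proc) ?H (s + 7 + 7)
 (%H' sp'. (ALL y<s + 7. y ~: {x + int h..<x + int h + int (k - h)} --> H' y = ?H y) &
 sorted (arr H' (x + int h) (k - h)) & mset (arr H' (x + int h) (k - h)) = mset (arr ?H (x + int h) (k - h)))"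
 unfolding A'_def by (rule less.IH) (use h False less.prems in \<open>auto simp: h_def\<close>)
 have fin: "V1 H' (s + 7) & mset (arr H' x k) = mset (arr H x k) & sorted (arr H' x h) &
 sorted (arr H' (x + int h) (k - h))"
 if p: "(ALL y<s + 7. y ~: {x + int h..<x + int h + int (k - h)} --> H' y = ?H y) &
 sorted (arr H' (x + int h) (k - h)) & mset (arr H' (x + int h) (k - h)) = mset (arr ?H (x + int h) (k - h))" for H'
 proof -
 have eq: "H' y = H1 y" if "y < s + 7" "y ~: {x + int h..<x + int k}" for y
 using p that h by auto
 have "V1 H' (s + 7)" using \<open>V1 H1 sp1 & _\<close> eq h less.prems by (auto simp: V1_def)
 moreover have "arr ?H (x + int h) (k - h) = arr H1 (x + int h) (k - h)"
 using less.prems h by (intro arr_cong) auto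
 moreover have "arr H' x h = arr H1 x h"
 using less.prems h by (intro arr_cong eq) auto
 ultimately show ?thesis using p \<open>V1 H1 sp1 & _\<close>
 arr_append[OF h(3), of H' x] arr_append[OF h(3), of H1 x] by auto
 qed
 show ?thesis
 proof (rule aq_Call[where f = s and g = "s + 10"])
 show "aq ?U A' (frame (squaresort_prog MergeSort) sp1) (body (squaresort_prog MergeSort))
 (write_list H1 sp1 (map (aval ?fr H1) [V ''X'' \<oplus> V ''h'', V ''k'' \<ominus> V ''h'']))
 (sp1 + int (length (frame_vars (squaresort_prog MergeSort))))
 (%H' sp'. V1 H' sp1 & mset (arr H' x k) = mset (arr H x k) & sorted (arr H' x h) &
 sorted (arr H' (x + int h) (k - h)))"
 proof -
 have "aq ?U A' (frame MergeSort_proc (s + 7)) (body MergeSort_proc) ?H (s + 7 + 7)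
 (%H' sp'. V1 H' (s + 7) & mset (arr H' x k) = mset (arr H x k) & sorted (arr H' x h) &
 sorted (arr H' (x + int h) (k - h)))"
 by (rule aq_mono[OF * _ order_refl fin]) (use h in \<open>auto simp: msort_space_def\<close>)
 thus ?thesis using that by (simp add: V1_def[of H1])
 qed
 qed (use that fr Bb False in \<open>auto simp: V1_def msort_space_def\<close>)
 qed
 define V2 where "V2 H' sp' \<longleftrightarrow> H' s = Fin x & H' (s + 1) = Fin (int k) & H' (s + 2) = Fin (int h) &
 H' (s + 6) = Fin (s + 7) & (ALL z<s. z ~: {x..<x + int k} --> H' z = H z)" for H' and sp' :: addr
 have st4: "aq ?U 4 ?fr (Alloc ''Y'' (V ''k'');; ''i'' ::= N 0;; ''j'' ::= V ''h'';; ''t'' ::= N 0) H1 sp1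
 (%H' sp'. V2 H' sp' & mset (arr H' x k) = mset (arr H x k) & sorted (arr H' x h) &
 sorted (arr H' (x + int h) (k - h)) & H' (s + 3) = Fin 0 & H' (s + 4) = Fin (int h) & H' (s + 5) = Fin 0)"
 if "V1 H1 sp1 & mset (arr H1 x k) = mset (arr H x k) & sorted (arr H1 x h) &
 sorted (arr H1 (x + int h) (k - h))" for H1 sp1
 proof -
 let ?H = "H1(s + 6 := Fin (s + 7), s + 3 := Fin 0, s + 4 := Fin (int h), s + 5 := Fin 0)"
 have "arr ?H x k = arr H1 x k" "arr ?H x h = arr H1 x h"
 "arr ?H (x + int h) (k - h) = arr H1 (x + int h) (k - h)"
 using less.prems h by (auto intro!: arr_cong)
 thus ?thesis using that Bb fr
 by (intro aq_local[of _ _ _ _ s "s + 10"]) (auto simp: ae_simps V1_def V2_def)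
 qed
 have bS: "card (blocks B {s..s + 6}) <= 2" by (rule card_blocks_short) (use Bb in simp)
 have st5: "aq ?U (16 + 2 * real_of_int (2 * int k) / B) ?fr merge_loop H1 sp1
 (%H' sp'. V2 H' sp' & mset (arr H' (s + 7) k) = mset (arr H x k) & sorted (arr H' (s + 7) k))"
 if pre: "V2 H1 sp1 & mset (arr H1 x k) = mset (arr H x k) & sorted (arr H1 x h) &
 sorted (arr H1 (x + int h) (k - h)) & H1 (s + 3) = Fin 0 & H1 (s + 4) = Fin (int h) & H1 (s + 5) = Fin 0"
 for H1 sp1
 proof (rule aq_streaming3)
 show "ae ?fr merge_loop H1 sp1 (%H' sp' t. (V2 H' sp' & mset (arr H' (s + 7) k) = mset (arr H x k) & sorted (arr H' (s + 7) k)) &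
 strm {s..s+6} {0::nat, 1, 2} (ptr3 x (x + int h) (s + 7)) t (ptr3 (x + int h) (x + int k) (s + 7 + int k)))"
 by (rule ae_mono[OF merge_loop_ae[of H1 s x k h "s + 7" sp1]])
 (use pre h less.prems in \<open>auto simp: V2_def\<close>)
 qed (use bS h(3) False in \<open>simp_all add: msort_space_def subset_iff\<close>)
 have st6: "aq ?U 4 ?fr (''t'' ::= N 0) H1 sp1
 (%H' sp'. V2 H' sp' & mset (arr H' (s + 7) k) = mset (arr H x k) & sorted (arr H' (s + 7) k) & H' (s + 5) = Fin 0)"
 if "V2 H1 sp1 & mset (arr H1 (s + 7) k) = mset (arr H x k) & sorted (arr H1 (s + 7) k)" for H1 sp1
 proof -
 have "arr (H1(s + 5 := Fin 0)) (s + 7) k = arr H1 (s + 7) k" by (auto intro!: arr_cong)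
 thus ?thesis using that Bb fr
 by (intro aq_local[of _ _ _ _ s "s + 10"]) (auto simp: ae_simps V2_def)
 qed
 have st7: "aq ?U (16 + 2 * real_of_int (3 * int k) / B) ?fr copy_loop H1 sp1 ?Q"
 if pre: "V2 H1 sp1 & mset (arr H1 (s + 7) k) = mset (arr H x k) & sorted (arr H1 (s + 7) k) & H1 (s + 5) = Fin 0"
 for H1 sp1
 proof (rule aq_streaming3)
 show "ae ?fr copy_loop H1 sp1 (%H' sp' t. ?Q H' sp' &
 strm {s..s+6} {0::nat, 1, 2} (ptr3 x (s + 7) (s + 7)) t (ptr3 (x + int k) (s + 7 + int k) (s + 7 + int k)))"
 by (rule ae_mono[OF copy_loop_ae[of H1 s x k "s + 7" sp1]])
 (use pre h less.prems in \<open>auto simp: V2_def\<close>)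
 qed (use bS h(3) False in \<open>simp_all add: msort_space_def subset_iff\<close>)
 define c where "c = 4 + (4 + (8 + A + (8 + A' + (4 + ((16 + 2 * real_of_int (2 * int k) / B) +
 (4 + (16 + 2 * real_of_int (3 * int k) / B)))))))"
 have full: "aq ?U c ?fr (body MergeSort_proc) H (s + 7) ?Q"
 unfolding aq_body merge_sort_code_def c_def
 proof (rule aq_Cond[where f = s and g = "s + 10"])
 have nb: "~ bval ?fr H (V ''k'' \<prec> N 2)" using False less.prems by simp
 show "aq ?U (4 + (8 + A + (8 + A' + (4 + ((16 + 2 * real_of_int (2 * int k) / B) +
 (4 + (16 + 2 * real_of_int (3 * int k) / B))))))) ?fr
 (if bval ?fr H (V ''k'' \<prec> N 2) then SKIP
 else ''h'' ::= Half (V ''k'');;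
 (Call MergeSort [V ''X'', V ''h''];;
 (Call MergeSort [V ''X'' \<oplus> V ''h'', V ''k'' \<ominus> V ''h''];;
 ((Alloc ''Y'' (V ''k'');; ''i'' ::= N 0;; ''j'' ::= V ''h'';; ''t'' ::= N 0);;
 (merge_loop;;
 (''t'' ::= N 0;; copy_loop)))))) H (s + 7) ?Q"
 unfolding if_not_P[OF nb]
 by (rule aq_Seq, rule st1, rule aq_Seq, erule st2, rule aq_Seq, erule st3,
 rule aq_Seq, erule st4, rule aq_Seq, erule st5, rule aq_Seq, erule st6, erule st7)
 qed (use fr Bb in auto)
 show ?thesis
 \<comment> \<open>If both touched intervals are shorter than a block, four blocks hold everything.
   Otherwise \<open>B <= 11 * k\<close>, so that additive constants are paid by
   \<open>k^2 / B\<close>.\<close>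
 proof (cases "10 * int k + 10 < int B")
 case True
 have "card (blocks B ?U) <= 4"
 unfolding msort_space_def
 using card_blocks_Un[of B "{x..x + int k}" "{s..s + 10 * int k + 10}"]
 card_blocks_short[of "x + int k" x] card_blocks_short[of "s + 10 * int k + 10" s] True by linarith
 hence "aq ?U (2 * real 4) ?fr (body MergeSort_proc) H (s + 7) ?Q"
 by (intro aq_cost_static[OF full]) (use B_large K_ge_B in \<open>auto simp: msort_space_def\<close>)
 thus ?thesis by (rule aq_mono) auto
 next
 case big: False
 define q where "q = (real k)^2 / B"
 have B0: "real B \<ge> 1000" using B_large by simp
 have k99: "real k \<ge> 99" "real B <= 11 * real k" using big B_large by linarith+
 have "real k * real B <= real k * (11 * real k)" using k99 by (intro mult_left_mono) auto
 hence q: "real k <= 11 * q" using B0 unfolding q_def by (simp add: field_simps power2_eq_square)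
 have "real k <= (real k)^2" using k99 by (simp add: power2_eq_square)
 hence kB: "real k / B <= q" unfolding q_def using B0 by (intro divide_right_mono) auto
 have "A + A' = 200 + 100 * ((real (k div 2))^2 + (real (k - k div 2))^2) / B"
 unfolding A_def A'_def h_def by (simp add: add_divide_distrib algebra_simps)
 also have "... <= 200 + 100 * (((real k)^2 + 1) / 2) / B"
 using B0 square_halves_le[of k] by (intro add_left_mono divide_right_mono mult_left_mono) auto
 also have "... = 200 + 50 * q + 50 / B" unfolding q_def by (simp add: add_divide_distrib)
 also have "... <= 201 + 50 * q" using B0 by simp
 finally have AA: "A + A' <= 201 + 50 * q" .
 have "c = 64 + (A + A') + 10 * (real k / B)" unfolding c_def by simp
 hence "c <= 265 + 60 * q" using AA kB by linarith
 also have "... <= 100 + 100 * q" using q k99 by linarith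
 finally show ?thesis by (intro aq_mono[OF full]) (auto simp: q_def)
 qed
 qed
qed

end

section \<open>Skew transposition\<close>

text \<open>
 \<open>pos j i\<close> is the address of the first element of sub-column \<open>j\<close> that is not below pivot \<open>i - 1\<close>, and
 \<open>wpos i j\<close> the slot of bucket \<open>i\<close> that receives the first element from sub-column \<open>j\<close>;
 sub-column \<open>j\<close> ends at \<open>en j\<close>.
\<close>

definition geo :: "mem => addr => addr => nat => addr => addr => nat =>
 (nat => nat => addr) => (nat => nat => addr) => (nat => addr) => bool" where
 "geo H Ca Ea l Pa Wa k pos wpos en \<longleftrightarrow>
 Pa + int k <= Ca & Ca + int l <= Ea & Ea + int l <= Wa &
 (ALL j<l. H (Ea + int j) = Fin (en j) & en j <= Pa) &
 (ALL j<l. ALL i<k. pos j i <= pos j (Suc i) & pos j (Suc i) <= en j &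
 (ALL q. pos j i <= q --> q < pos j (Suc i) --> H q < H (Pa + int i)) &
 (pos j (Suc i) < en j --> ~ H (pos j (Suc i)) < H (Pa + int i))) &
 (ALL j<l. ALL i<k. ALL q. pos j 0 <= q --> q < en j --> ~ (wpos i 0 <= q & q < wpos i l)) &
 (ALL i<k. ALL j<l. wpos i (Suc j) = wpos i j + (pos j (Suc i) - pos j i)) &
 (ALL i<k. ALL i'<k. i < i' --> wpos i l <= wpos i' 0) &
 (ALL i<k. wpos i l <= Pa)"

lemma geo_pos_mono:
 assumes "geo H Ca Ea l Pa Wa k pos wpos en" "j < l" "i <= i'" "i' <= k"
 shows "pos j i <= pos j i'"
 using assms(3,4)
proof (induction i' rule: dec_induct)
 case (step n)
 hence "pos j n <= pos j (Suc n)" using assms(1,2) unfolding geo_def by auto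
 thus ?case using step by auto
qed simp

lemma geo_wpos_mono:
 assumes "geo H Ca Ea l Pa Wa k pos wpos en" "i < k" "j <= j'" "j' <= l"
 shows "wpos i j <= wpos i j'"
 using assms(3,4)
proof (induction j' rule: dec_induct)
 case (step n)
 hence "wpos i (Suc n) = wpos i n + (pos n (Suc i) - pos n i)" "pos n i <= pos n (Suc i)"
 using assms(1,2) unfolding geo_def by auto
 thus ?case using step by auto
qed simp

text \<open>Slots are grouped by bucket and, within a bucket, by sub-column, both in increasing
  order. This is what protects items already moved from later writes.\<close>

lemma geo_slot_unique:
 assumes g: "geo H Ca Ea l Pa Wa k pos wpos en" and "i < k" "i' < k" "j < l" "j0 <= j1" "j1 <= l"
 and "wpos i j <= x" "x < wpos i (Suc j)" "wpos i' j0 <= x" "x < wpos i' j1"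
 shows "i' = i & j0 <= j & j < j1"
proof -
 have m: "wpos a b <= wpos a c" if "a < k" "b <= c" "c <= l" for a b c
 using geo_wpos_mono[OF g that] .
 have d: "wpos a l <= wpos b 0" if "a < b" "b < k" for a b
 using g that unfolding geo_def by (meson order.strict_trans)
 have "i' = i"
 proof (rule ccontr)
 assume "i' ~= i"
 then consider "i < i'" | "i' < i" by linarith
 thus False
 proof cases
 case 1
 have "x < wpos i l" using m[of i "Suc j" l] assms by linarith
 also have "... <= wpos i' 0" using d 1 assms by blast
 also have "... <= wpos i' j0" using m[of i' 0 j0] assms by linarith
 finally show False using assms by linarith
 next
 case 2
 have "x < wpos i' l" using m[of i' j1 l] assms by linarith
 also have "... <= wpos i 0" using d 2 assms by blast
 also have "... <= wpos i j" using m[of i 0 j] assms by linarith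
 finally show False using assms by linarith
 qed
 qed
 moreover have "j0 <= j"
 proof (rule ccontr)
 assume "~ j0 <= j"
 hence "wpos i (Suc j) <= wpos i j0" using m[of i "Suc j" j0] assms by linarith
 thus False using assms \<open>i' = i\<close> by simp
 qed
 moreover have "j < j1"
 proof (rule ccontr)
 assume "~ j < j1"
 hence "wpos i j1 <= wpos i j" using m[of i j1 j] assms by linarith
 thus False using assms \<open>i' = i\<close> by simp
 qed
 ultimately show ?thesis by blast
qed

text \<open>A recursive call works on a rectangle of consecutive sub-columns and pivots. The layout
  passes to it with shifted indices and unchanged addresses.\<close>

lemma geo_sub:
 assumes g: "geo H Ca Ea l Pa Wa k pos wpos en" and r: "jo + lo <= l" "io + ko <= k"
 shows "geo H (Ca + int jo) (Ea + int jo) lo (Pa + int io) (Wa + int io) ko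
 (%j i. pos (jo + j) (io + i)) (%i j. wpos (io + i) (jo + j)) (%j. en (jo + j))"
proof -
 have m: "wpos a b <= wpos a c" if "a < k" "b <= c" "c <= l" for a b c
 using geo_wpos_mono[OF g that] .
 have d: "wpos a l <= wpos b 0" if "a < b" "b < k" for a b
 using g that unfolding geo_def by (meson order.strict_trans)
 have lay: "Pa + int k <= Ca" "Ca + int l <= Ea" "Ea + int l <= Wa" using g unfolding geo_def by auto
 have E: "H (Ea + int j) = Fin (en j)" "en j <= Pa" if "j < l" for j using g that unfolding geo_def by auto
 have c: "pos j i <= pos j (Suc i) & pos j (Suc i) <= en j &
 (ALL q. pos j i <= q --> q < pos j (Suc i) --> H q < H (Pa + int i)) &
 (pos j (Suc i) < en j --> ~ H (pos j (Suc i)) < H (Pa + int i))" if "j < l" "i < k" for i j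
 using g that unfolding geo_def by auto
 have dis: "~ (wpos i 0 <= q & q < wpos i l)" if "j < l" "i < k" "pos j 0 <= q" "q < en j" for i j q
 using g that unfolding geo_def by blast
 have ws: "wpos i (Suc j) = wpos i j + (pos j (Suc i) - pos j i)" if "i < k" "j < l" for i j
 using g that unfolding geo_def by auto
 have wP: "wpos i l <= Pa" if "i < k" for i using g that unfolding geo_def by auto
 show ?thesis unfolding geo_def
 proof (intro conjI allI impI)
 show "Pa + int io + int ko <= Ca + int jo" "Ca + int jo + int lo <= Ea + int jo" "Ea + int jo + int lo <= Wa + int io"
 using lay r by linarith+
 next
 fix j assume j: "j < lo"
 show "H (Ea + int jo + int j) = Fin (en (jo + j))" "en (jo + j) <= Pa + int io"
 using E[of "jo + j"] j r by (auto simp: add.assoc)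
 fix i assume i: "i < ko"
 note cc = c[of "jo + j" "io + i"]
 show "pos (jo + j) (io + i) <= pos (jo + j) (io + Suc i)" "pos (jo + j) (io + Suc i) <= en (jo + j)"
 using cc i j r by auto
 show "H q < H (Pa + int io + int i)" if "pos (jo + j) (io + i) <= q" "q < pos (jo + j) (io + Suc i)" for q
 using cc i j r that by (auto simp: add.assoc)
 show "~ H (pos (jo + j) (io + Suc i)) < H (Pa + int io + int i)" if "pos (jo + j) (io + Suc i) < en (jo + j)"
 using cc i j r that by (auto simp: add.assoc)
 show "~ (wpos (io + i) (jo + 0) <= q & q < wpos (io + i) (jo + lo))"
 if "pos (jo + j) (io + 0) <= q" "q < en (jo + j)" for q
 proof -
 have "pos (jo + j) 0 <= pos (jo + j) (io + 0)" using geo_pos_mono[OF g, of "jo + j" 0 "io"] r i j by simp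
 hence "~ (wpos (io + i) 0 <= q & q < wpos (io + i) l)" using dis[of "jo + j" "io + i" q] r that i j by simp
 thus ?thesis using m[of "io + i" 0 jo] m[of "io + i" "jo + lo" l] r i j by auto
 qed
 next
 fix i j assume "i < ko" "j < lo"
 thus "wpos (io + i) (jo + Suc j) = wpos (io + i) (jo + j) + (pos (jo + j) (io + Suc i) - pos (jo + j) (io + i))"
 using ws[of "io + i" "jo + j"] r by simp
 next
 fix i i' assume "i < ko" "i' < ko" "i < i'"
 thus "wpos (io + i) (jo + lo) <= wpos (io + i') (jo + 0)"
 using m[of "io + i" "jo + lo" l] d[of "io + i" "io + i'"] m[of "io + i'" 0 jo] r by simp
 next
 fix i assume "i < ko"
 thus "wpos (io + i) (jo + lo) <= Pa + int io"
 using m[of "io + i" "jo + lo" l] wP[of "io + i"] r by simp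
 qed
qed

text \<open>\<open>ci j\<close> is the number of pivots already processed for sub-column
  \<open>j\<close>, and \<open>wi i\<close> the number of sub-columns already processed for bucket
  \<open>i\<close>. From \<open>s\<close> on the memory is stack, and the frame clause leaves it
  open.\<close>

definition progress :: "addr => addr => nat => addr => nat => (nat => nat => addr) => (nat => nat => addr) =>
 mem => mem => (nat => nat) => (nat => nat) => bool" where
 "progress s Ca l Wa k pos wpos H H' ci wi \<longleftrightarrow>
 (ALL j<l. H' (Ca + int j) = Fin (pos j (ci j))) &
 (ALL i<k. H' (Wa + int i) = Fin (wpos i (wi i))) &
 (ALL i<k. ALL j<l. i < ci j --> (ALL r. pos j i <= r --> r < pos j (Suc i) --> H' (wpos i j + (r - pos j i)) = H r)) &
 (ALL x<s. x ~: {Ca..<Ca + int l} --> x ~: {Wa..<Wa + int k} -->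
 (ALL i<k. x ~: {wpos i 0..<wpos i (wi i)}) --> H' x = H x)"

text \<open>Filled slots lie below the pivots and away from the source segments, and apart from them
  only \<open>C\<close> and \<open>W\<close> change. Pivots, column ends and source items thus
  remain readable.\<close>

lemma progress_static:
 assumes g: "geo H Ca Ea l Pa Wa k pos wpos en" and p: "progress s Ca l Wa k pos wpos H H' ci wi"
 and "!!i. i < k ==> wi i <= l" "Wa + int k <= s"
 shows "!!j. j < l ==> H' (Ea + int j) = H (Ea + int j)"
 "!!i. i < k ==> H' (Pa + int i) = H (Pa + int i)"
 "!!j q. j < l ==> pos j 0 <= q ==> q < en j ==> H' q = H q"
proof -
 have m: "wpos i 0 <= wpos i (wi i)" "wpos i (wi i) <= wpos i l" "wpos i l <= Pa" if "i < k" for i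
 using geo_wpos_mono[OF g that] assms(3)[OF that] g that unfolding geo_def by auto
 have lay: "Pa + int k <= Ca" "Ca + int l <= Ea" "Ea + int l <= Wa" using g unfolding geo_def by auto
 have u: "H' x = H x" if "x < s" "x ~: {Ca..<Ca + int l}" "x ~: {Wa..<Wa + int k}"
 "!!i. i < k ==> x ~: {wpos i 0..<wpos i (wi i)}" for x using p that unfolding progress_def by blast
 show "H' (Ea + int j) = H (Ea + int j)" if "j < l" for j
 by (rule u) (use m lay that assms(4) in fastforce)+
 show "H' (Pa + int i) = H (Pa + int i)" if "i < k" for i
 by (rule u) (use m lay that assms(4) in fastforce)+
 show "H' q = H q" if "j < l" "pos j 0 <= q" "q < en j" for j q
 proof (rule u)
 have "en j <= Pa" using g that unfolding geo_def by auto
 thus "q < s" "q ~: {Ca..<Ca + int l}" "q ~: {Wa..<Wa + int k}" using lay that assms(4) by auto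
 fix i assume i: "i < k"
 have "~ (wpos i 0 <= q & q < wpos i l)" using g that i unfolding geo_def by blast
 thus "q ~: {wpos i 0..<wpos i (wi i)}" using m[OF i] by auto
 qed
qed

lemma geo_cong:
 assumes g: "geo H Ca Ea l Pa Wa k pos wpos en"
 and "!!j. j < l ==> H' (Ea + int j) = H (Ea + int j)"
 "!!i. i < k ==> H' (Pa + int i) = H (Pa + int i)"
 "!!j q. j < l ==> pos j 0 <= q ==> q < en j ==> H' q = H q"
 shows "geo H' Ca Ea l Pa Wa k pos wpos en"
proof -
 have "pos j i <= pos j (Suc i) & pos j (Suc i) <= en j &
 (ALL q. pos j i <= q --> q < pos j (Suc i) --> H' q < H' (Pa + int i)) &
 (pos j (Suc i) < en j --> ~ H' (pos j (Suc i)) < H' (Pa + int i))" if ji: "j < l" "i < k" for i j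
 proof -
 have c: "pos j i <= pos j (Suc i)" "pos j (Suc i) <= en j"
 "!!q. pos j i <= q ==> q < pos j (Suc i) ==> H q < H (Pa + int i)"
 "pos j (Suc i) < en j ==> ~ H (pos j (Suc i)) < H (Pa + int i)"
 using g ji unfolding geo_def by auto
 have "pos j 0 <= pos j i" using geo_pos_mono[OF g ji(1), of 0 i] ji by simp
 hence eq: "H' q = H q" if "pos j i <= q" "q < en j" for q using assms(4)[OF ji(1)] that by simp
 thus ?thesis using c assms(3)[OF ji(2)] by simp
 qed
 thus ?thesis using g assms(2) unfolding geo_def by simp
qed

text \<open>A finished rectangle is merged into the progress made so far. It must begin where its
  sub-columns and its buckets currently stand, which the order of the recursive calls ensures. The
  same lemma serves the base case, with rectangles of size one.\<close>

lemma progress_step: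
 assumes g: "geo H Ca Ea l Pa Wa k pos wpos en" and p: "progress s Ca l Wa k pos wpos H H1 ci wi"
 and lay: "Wa + int k <= s" "s <= s'"
 and r: "jo + lo <= l" "io + ko <= k"
 and ci: "!!j. jo <= j ==> j < jo + lo ==> ci j = io"
 and wi: "!!i. io <= i ==> i < io + ko ==> wi i = jo" "!!i. i < k ==> wi i <= l"
 and q: "progress s' (Ca + int jo) lo (Wa + int io) ko (%j i. pos (jo + j) (io + i)) (%i j. wpos (io + i) (jo + j))
 H1 H2 (%_. ko) (%_. lo)"
 shows "progress s Ca l Wa k pos wpos H H2
 (%j. if jo <= j & j < jo + lo then io + ko else ci j) (%i. if io <= i & i < io + ko then jo + lo else wi i)"
proof -
 have m: "wpos i a <= wpos i b" if "i < k" "a <= b" "b <= l" for i a b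
 using geo_wpos_mono[OF g] that by simp
 have wP: "wpos i l <= Pa" if "i < k" for i using g that unfolding geo_def by auto
 have lay2: "Pa + int k <= Ca" "Ca + int l <= Ea" "Ea + int l <= Wa" using g unfolding geo_def by auto
 have u1: "H1 x = H x" if "x < s" "x ~: {Ca..<Ca + int l}" "x ~: {Wa..<Wa + int k}"
 "!!i. i < k ==> x ~: {wpos i 0..<wpos i (wi i)}" for x using p that unfolding progress_def by blast
 have u2: "H2 x = H1 x" if "x < s" "x ~: {Ca + int jo..<Ca + int jo + int lo}" "x ~: {Wa + int io..<Wa + int io + int ko}"
 "!!i. io <= i ==> i < io + ko ==> x ~: {wpos i jo..<wpos i (jo + lo)}" for x
 proof -
 have "x < s'" using that lay by simp
 moreover have "ALL i<ko. x ~: {wpos (io + i) (jo + 0)..<wpos (io + i) (jo + lo)}" using that(4) by simp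
 ultimately show ?thesis using q that(2,3) unfolding progress_def by blast
 qed
 have C1: "H1 (Ca + int j) = Fin (pos j (ci j))" if "j < l" for j using p that unfolding progress_def by blast
 have W1: "H1 (Wa + int i) = Fin (wpos i (wi i))" if "i < k" for i using p that unfolding progress_def by blast
 have Pbelow: "x ~: {wpos i jo..<wpos i (jo + lo)}" if "Pa <= x" "i < k" for x i
 using m[of i "jo + lo" l] wP[of i] r that by auto
 show ?thesis unfolding progress_def
 proof (intro conjI allI impI)
 fix j assume j: "j < l"
 show "H2 (Ca + int j) = Fin (pos j (if jo <= j & j < jo + lo then io + ko else ci j))"
 proof (cases "jo <= j & j < jo + lo")
 case True
 have "ALL j<lo. H2 (Ca + int jo + int j) = Fin (pos (jo + j) (io + ko))"
 using q unfolding progress_def by blast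
 from this[rule_format, of "j - jo"] True show ?thesis by (auto simp: add.assoc)
 next
 case False
 have "H2 (Ca + int j) = H1 (Ca + int j)"
 by (rule u2) (use j lay lay2 r False Pbelow in auto)
 thus ?thesis using C1[OF j] False by auto
 qed
 next
 fix i assume i: "i < k"
 show "H2 (Wa + int i) = Fin (wpos i (if io <= i & i < io + ko then jo + lo else wi i))"
 proof (cases "io <= i & i < io + ko")
 case True
 have "ALL i<ko. H2 (Wa + int io + int i) = Fin (wpos (io + i) (jo + lo))"
 using q unfolding progress_def by blast
 from this[rule_format, of "i - io"] True show ?thesis by (auto simp: add.assoc)
 next
 case False
 have "H2 (Wa + int i) = H1 (Wa + int i)"
 by (rule u2) (use i lay lay2 r False Pbelow in auto)
 thus ?thesis using W1[OF i] False by auto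
 qed
 next
 fix i j x assume ij: "i < k" "j < l" and new: "i < (if jo <= j & j < jo + lo then io + ko else ci j)"
 and x: "pos j i <= x" "x < pos j (Suc i)"
 have ws: "wpos i (Suc j) = wpos i j + (pos j (Suc i) - pos j i)" using g ij unfolding geo_def by auto
 let ?y = "wpos i j + (x - pos j i)"
 have y: "wpos i j <= ?y" "?y < wpos i (Suc j)" using ws x by auto
 show "H2 ?y = H x"
 \<comment> \<open>Items moved earlier lie outside the slots of the rectangle; items moved now are
   still in their original place when the rectangle is started.\<close>
 proof (cases "i < ci j")
 case True
 have "H1 ?y = H x" using p ij True x unfolding progress_def by blast
 moreover have "H2 ?y = H1 ?y"
 proof (rule u2)
 have "?y < Pa" using y m[of i "Suc j" l] wP[of i] ij by linarith
 thus "?y < s" "?y ~: {Ca + int jo..<Ca + int jo + int lo}" "?y ~: {Wa + int io..<Wa + int io + int ko}"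
 using lay lay2 r by auto
 fix i' assume i': "io <= i'" "i' < io + ko"
 show "?y ~: {wpos i' jo..<wpos i' (jo + lo)}"
 proof
 assume "?y \<in> {wpos i' jo..<wpos i' (jo + lo)}"
 hence "i' = i & jo <= j & j < jo + lo"
 using geo_slot_unique[OF g ij(1) _ ij(2) _ _ y, of i' jo "jo + lo"] r i' by auto
 thus False using ci[of j] True i' by auto
 qed
 qed
 ultimately show ?thesis by simp
 next
 case False
 hence j: "jo <= j" "j < jo + lo" and "i < io + ko" using new by (auto split: if_splits)
 hence i: "io <= i" "i < io + ko" using False ci[of j] by auto
 have "pos (jo + (j - jo)) (io + (i - io)) <= x" "x < pos (jo + (j - jo)) (io + Suc (i - io))"
 using x i j by auto
 moreover have "ALL i<ko. ALL j<lo. i < ko --> (ALL r. pos (jo + j) (io + i) <= r --> r < pos (jo + j) (io + Suc i) -->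
 H2 (wpos (io + i) (jo + j) + (r - pos (jo + j) (io + i))) = H1 r)"
 using q unfolding progress_def by blast
 moreover have "i - io < ko" "j - jo < lo" using i j by auto
 ultimately have "H2 (wpos (io + (i - io)) (jo + (j - jo)) + (x - pos (jo + (j - jo)) (io + (i - io)))) = H1 x"
 by blast
 moreover have "H1 x = H x"
 proof (rule progress_static(3)[OF g p wi(2) lay(1) ij(2)])
 show "pos j 0 <= x" using geo_pos_mono[OF g ij(2), of 0 i] ij x by simp
 show "x < en j" using g ij x unfolding geo_def by fastforce
 qed
 ultimately show ?thesis using i j by simp
 qed
 next
 fix x assume x: "x < s" "x ~: {Ca..<Ca + int l}" "x ~: {Wa..<Wa + int k}"
 and n: "ALL i<k. x ~: {wpos i 0..<wpos i (if io <= i & i < io + ko then jo + lo else wi i)}"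
 have "H2 x = H1 x"
 proof (rule u2)
 fix i assume i: "io <= i" "i < io + ko"
 hence "x ~: {wpos i 0..<wpos i (jo + lo)}" using n[rule_format, of i] i r by auto
 thus "x ~: {wpos i jo..<wpos i (jo + lo)}" using m[of i 0 jo] i r by auto
 qed (use x r in auto)
 also have "H1 x = H x"
 proof (rule u1)
 fix i assume i: "i < k"
 show "x ~: {wpos i 0..<wpos i (wi i)}"
 proof (cases "io <= i & i < io + ko")
 case True
 hence "x ~: {wpos i 0..<wpos i (jo + lo)}" using n[rule_format, of i] i by auto
 thus ?thesis using m[of i jo "jo + lo"] wi(1)[of i] True i r by auto
 next
 case False
 thus ?thesis using n[rule_format, of i] i by auto
 qed
 qed (use x in auto)
 finally show "H2 x = H x" .
 qed
qed

lemma frame_Skew [simp]: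
 "frame SkewTranspose_proc s ''C'' = s" "frame SkewTranspose_proc s ''E'' = s + 1"
 "frame SkewTranspose_proc s ''l'' = s + 2" "frame SkewTranspose_proc s ''P'' = s + 3"
 "frame SkewTranspose_proc s ''W'' = s + 4" "frame SkewTranspose_proc s ''k'' = s + 5"
 "frame SkewTranspose_proc s ''i'' = s + 6" "frame SkewTranspose_proc s ''j'' = s + 7"
 "frame SkewTranspose_proc s ''hl'' = s + 8" "frame SkewTranspose_proc s ''hk'' = s + 9"
 "length (frame_vars SkewTranspose_proc) = 10"
 by (simp_all add: frame_def frame_vars_def SkewTranspose_proc_def)

definition skew_vars :: "addr => addr => addr => nat => addr => addr => nat => mem => bool" where
 "skew_vars s Ca Ea l Pa Wa k H \<longleftrightarrow> H s = Fin Ca & H (s + 1) = Fin Ea & H (s + 2) = Fin (int l) &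
 H (s + 3) = Fin Pa & H (s + 4) = Fin Wa & H (s + 5) = Fin (int k)"

definition move_guard :: bexpr where
 "move_guard = ((V ''C'')[[V ''j'']] \<prec> (V ''E'')[[V ''j'']] AND
 Deref ((V ''C'')[[V ''j'']]) \<prec> (V ''P'')[[V ''i'']])"

definition move_body :: com where
 "move_body = ((V ''W'')[[V ''i'']] :*= Deref ((V ''C'')[[V ''j'']]);;
 V ''W'' \<oplus> V ''i'' :*= (V ''W'')[[V ''i'']] \<oplus> N 1;;
 V ''C'' \<oplus> V ''j'' :*= (V ''C'')[[V ''j'']] \<oplus> N 1)"

text \<open>The pointers of this stream are themselves stored in memory, so a pointer is named by
  the cell that holds it, and its position is the content of that cell.\<close>

abbreviation ptrs :: "mem => addr => addr" where
 "ptrs H \<equiv> %p. int_of (H p)"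

text \<open>\<open>q1\<close> is where the guard first fails. The target slots avoid the unread part
  of the sub-column, so the items read are the original ones.\<close>

lemma move_loop_ae:
 assumes v: "skew_vars s Ca Ea l Pa Wa k H" "H (s + 6) = Fin (int i)" "H (s + 7) = Fin (int j)"
 and c: "H (Ca + int j) = Fin q0" "H (Wa + int i) = Fin w0" "H (Ea + int j) = Fin e"
 and lay: "Pa + int k <= Ca" "Ca + int l <= Ea" "Ea + int l <= Wa" "Wa + int k <= s" "i < k" "j < l"
 "w0 + (q1 - q0) <= Pa" "e <= Pa"
 and q: "q0 <= q1" "q1 <= e" "!!q. q0 <= q ==> q < q1 ==> H q < H (Pa + int i)"
 "q1 < e ==> ~ H q1 < H (Pa + int i)"
 "!!q. q0 <= q ==> q < e ==> ~ (w0 <= q & q < w0 + (q1 - q0))"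
 shows "ae (frame SkewTranspose_proc s) (WHILE move_guard DO move_body) H sp (%H' sp' t.
 sp' = sp & H' (Ca + int j) = Fin q1 & H' (Wa + int i) = Fin (w0 + (q1 - q0)) &
 (ALL r. q0 <= r --> r < q1 --> H' (w0 + (r - q0)) = H r) &
 (ALL x. x ~= Ca + int j --> x ~= Wa + int i --> x ~: {w0..<w0 + (q1 - q0)} --> H' x = H x) &
 strm ({s..s+9} Un {Pa + int i, Ca + int j, Ea + int j, Wa + int i}) {Ca + int j, Wa + int i}
 (ptrs H) t (ptrs H'))"
proof -
 let ?S = "{s..s+9} Un {Pa + int i, Ca + int j, Ea + int j, Wa + int i}"
 let ?I = "{Ca + int j, Wa + int i}"
 define Inv where "Inv t H' sp' \<longleftrightarrow> sp' = sp & (EX q. q0 <= q & q <= q1 &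
 H' (Ca + int j) = Fin q & H' (Wa + int i) = Fin (w0 + (q - q0)) &
 (ALL r. q0 <= r --> r < q --> H' (w0 + (r - q0)) = H r)) &
 (ALL x. x ~= Ca + int j --> x ~= Wa + int i --> x ~: {w0..<w0 + (q1 - q0)} --> H' x = H x) &
 strm ?S ?I (ptrs H) t (ptrs H')" for t H' sp'
 let ?fr = "frame SkewTranspose_proc s"
 have common: "EX q. q0 <= q & q <= q1 & sp' = sp &
 H' (Ca + int j) = Fin q & H' (Wa + int i) = Fin (w0 + (q - q0)) & skew_vars s Ca Ea l Pa Wa k H' &
 H' (s + 6) = Fin (int i) & H' (s + 7) = Fin (int j) & H' (Ea + int j) = Fin e &
 H' (Pa + int i) = H (Pa + int i) & (q < e --> H' q = H q) &
 (ALL r. q0 <= r --> r < q --> H' (w0 + (r - q0)) = H r) & (bval ?fr H' move_guard \<longleftrightarrow> q < q1) &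
 addrs (bval_acc ?fr H' move_guard) <= ?S Un {q}"
 if I: "Inv t H' sp'" for t H' sp'
 proof -
 obtain a where a: "q0 <= a" "a <= q1" "sp' = sp" "H' (Ca + int j) = Fin a" "H' (Wa + int i) = Fin (w0 + (a - q0))"
 "ALL r. q0 <= r --> r < a --> H' (w0 + (r - q0)) = H r"
 and same: "!!x. x ~= Ca + int j ==> x ~= Wa + int i ==> x ~: {w0..<w0 + (q1 - q0)} ==> H' x = H x"
 using I unfolding Inv_def by blast
 have s': "skew_vars s Ca Ea l Pa Wa k H'" "H' (s + 6) = Fin (int i)" "H' (s + 7) = Fin (int j)"
 using same[of s] same[of "s+1"] same[of "s+2"] same[of "s+3"] same[of "s+4"] same[of "s+5"] same[of "s+6"] same[of "s+7"]
 v lay by (auto simp: skew_vars_def)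
 have e': "H' (Ea + int j) = Fin e" "H' (Pa + int i) = H (Pa + int i)"
 using same[of "Ea + int j"] same[of "Pa + int i"] c lay by auto
 have d': "H' a = H a" if "a < e"
 by (rule same) (use lay q(5)[of a] a that in auto)
 have g: "bval ?fr H' move_guard \<longleftrightarrow> a < e & H a < H (Pa + int i)"
 using s' e' d' a by (auto simp: move_guard_def skew_vars_def)
 have "bval ?fr H' move_guard \<longleftrightarrow> a < q1"
 unfolding g using q(2) q(3)[of a] q(4) a by (cases "a = q1") auto
 moreover have "addrs (bval_acc ?fr H' move_guard) <= ?S Un {a}"
 using s' e' a by (auto simp: move_guard_def skew_vars_def)
 ultimately show ?thesis using a s' e' d' by blast
 qed
 show ?thesis
 proof (rule ae_While[where I = Inv and \<mu> = "%H'. nat (q1 - int_of (H' (Ca + int j)))"])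
 show "Inv [] H sp" unfolding Inv_def using c q by (auto intro!: exI[of _ q0] strm.stop)
 next
 fix t H' sp' assume I: "Inv t H' sp'" and b: "bval ?fr H' move_guard"
 from common[OF I] b obtain a where a: "q0 <= a" "a < q1" "sp' = sp"
 "H' (Ca + int j) = Fin a" "H' (Wa + int i) = Fin (w0 + (a - q0))" "skew_vars s Ca Ea l Pa Wa k H'"
 "H' (s + 6) = Fin (int i)" "H' (s + 7) = Fin (int j)" "H' (Ea + int j) = Fin e" "H' a = H a"
 "!!r. q0 <= r ==> r < a ==> H' (w0 + (r - q0)) = H r"
 and ac: "addrs (bval_acc ?fr H' move_guard) <= ?S Un {a}" using q(2) by auto
 have same: "!!x. x ~= Ca + int j ==> x ~= Wa + int i ==> x ~: {w0..<w0 + (q1 - q0)} ==> H' x = H x"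
 and st: "strm ?S ?I (ptrs H) t (ptrs H')" using I unfolding Inv_def by auto
 define H'' where "H'' = H'(w0 + (a - q0) := H a, Wa + int i := Fin (w0 + (a - q0) + 1), Ca + int j := Fin (a + 1))"
 have E: "ae ?fr move_body H' sp' (%H2 sp2 t'. H2 = H'' & sp2 = sp & addrs t' <= ?S Un {a, w0 + (a - q0)})"
 using a lay unfolding move_body_def skew_vars_def by (auto simp: ae_simps H''_def)
 have new: "H'' (Ca + int j) = Fin (a + 1)" "H'' (Wa + int i) = Fin (w0 + (a + 1 - q0))"
 using lay by (auto simp: H''_def)
 have moved: "H'' (w0 + (r - q0)) = H r" if "q0 <= r" "r < a + 1" for r
 proof (cases "r = a")
 case True
 thus ?thesis using lay a by (auto simp: H''_def)
 next
 case False
 thus ?thesis using lay a(11)[of r] a(1,2) that by (auto simp: H''_def)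
 qed
 have same'': "H'' x = H x" if "x ~= Ca + int j" "x ~= Wa + int i" "x ~: {w0..<w0 + (q1 - q0)}" for x
 using same[OF that] that a by (auto simp: H''_def)
 have fin: "Inv (t @ t') H'' sp" if "addrs t' <= ?S Un {a, w0 + (a - q0)}" for t'
 proof -
 have "strm ?S ?I (ptrs H') t' (ptrs H'')"
 by (rule strm_step) (use that a new in auto)
 from strm_append[OF st this] show ?thesis
 unfolding Inv_def using a(1,2) new moved same'' by (auto intro!: exI[of _ "a + 1"])
 qed
 show "ae ?fr move_body H' sp' (%H2 sp2 t'. Inv (t @ bval_acc ?fr H' move_guard @ t') H2 sp2 &
 nat (q1 - int_of (H2 (Ca + int j))) < nat (q1 - int_of (H' (Ca + int j))))"
 proof (rule ae_mono[OF E], elim conjE)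
 fix H2 sp2 t' assume *: "H2 = H''" "sp2 = sp" "addrs t' <= ?S Un {a, w0 + (a - q0)}"
 have "addrs (bval_acc ?fr H' move_guard @ t') <= ?S Un {a, w0 + (a - q0)}"
 using * ac by (auto simp: image_Un)
 from fin[OF this] show "Inv (t @ bval_acc ?fr H' move_guard @ t') H2 sp2 &
 nat (q1 - int_of (H2 (Ca + int j))) < nat (q1 - int_of (H' (Ca + int j)))"
 using * new a by simp
 qed
 next
 fix t H' sp' assume I: "Inv t H' sp'" and b: "~ bval ?fr H' move_guard"
 from common[OF I] b obtain a where a: "q0 <= a" "a = q1" "sp' = sp"
 "H' (Ca + int j) = Fin a" "H' (Wa + int i) = Fin (w0 + (a - q0))"
 "!!r. q0 <= r ==> r < a ==> H' (w0 + (r - q0)) = H r"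
 and ac: "addrs (bval_acc ?fr H' move_guard) <= ?S Un {a}" using q(1) by force
 have same: "!!x. x ~= Ca + int j ==> x ~= Wa + int i ==> x ~: {w0..<w0 + (q1 - q0)} ==> H' x = H x"
 and st: "strm ?S ?I (ptrs H) t (ptrs H')" using I unfolding Inv_def by auto
 have "strm ?S ?I (ptrs H') (bval_acc ?fr H' move_guard) (ptrs H')"
 by (rule strm_static) (use ac a in auto)
 from strm_append[OF st this] show "sp' = sp & H' (Ca + int j) = Fin q1 & H' (Wa + int i) = Fin (w0 + (q1 - q0)) &
 (ALL r. q0 <= r --> r < q1 --> H' (w0 + (r - q0)) = H r) &
 (ALL x. x ~= Ca + int j --> x ~= Wa + int i --> x ~: {w0..<w0 + (q1 - q0)} --> H' x = H x) &
 strm ?S ?I (ptrs H) (t @ bval_acc ?fr H' move_guard) (ptrs H')"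
 using a same by auto
 qed
qed


text \<open>Progress concerns only cells below \<open>s\<close>, so writes to the local variables of
  the frame at \<open>s\<close> are harmless.\<close>

lemma progress_cong:
 assumes g: "geo H Ca Ea l Pa Wa k pos wpos en" and p: "progress s Ca l Wa k pos wpos H H' ci wi"
 and lay: "Wa + int k <= s" and eq: "!!x. x < s ==> \<tau> x = H x" "!!x. x < s ==> \<tau>' x = H' x"
 shows "progress s Ca l Wa k pos wpos \<tau> \<tau>' ci wi"
proof -
 have lay2: "Pa + int k <= Ca" "Ca + int l <= Ea" "Ea + int l <= Wa" using g unfolding geo_def by auto
 have mv: "\<tau>' (wpos i j + (r - pos j i)) = \<tau> r" if ij: "i < k" "j < l" "i < ci j" and r: "pos j i <= r" "r < pos j (Suc i)" for i j r
 proof -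
 have "wpos i (Suc j) = wpos i j + (pos j (Suc i) - pos j i)" "pos j (Suc i) <= en j" "en j <= Pa"
 using g ij unfolding geo_def by auto
 moreover have "wpos i (Suc j) <= wpos i l" "wpos i l <= Pa"
 using geo_wpos_mono[OF g ij(1), of "Suc j" l] g ij unfolding geo_def by auto
 ultimately have "wpos i j + (r - pos j i) < s" "r < s" using r lay lay2 by linarith+
 moreover have "H' (wpos i j + (r - pos j i)) = H r" using p ij r unfolding progress_def by blast
 ultimately show ?thesis using eq by simp
 qed
 have "\<tau>' (Ca + int j) = H' (Ca + int j)" if "j < l" for j using eq lay lay2 that by auto
 moreover have "\<tau>' (Wa + int i) = H' (Wa + int i)" if "i < k" for i using eq lay lay2 that by auto
 ultimately show ?thesis using p mv eq unfolding progress_def by auto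
qed

text \<open>\<open>h\<close> is the height of the stack part: 9 for the frame alone,
  \<open>10 * int l + 10\<close> with nested calls, since each of these adds a frame of 10 cells and
  has at least one sub-column less.\<close>

definition skew_cells :: "addr => int => addr => addr => nat => addr => addr => nat => addr set" where
 "skew_cells s h Ca Ea l Pa Wa k = {s..s + h} Un {Ca..Ca + int l} Un {Ea..Ea + int l} Un {Pa..Pa + int k} Un {Wa..Wa + int k}"

definition skew_ptrs :: "addr => nat => addr => nat => addr set" where
 "skew_ptrs Ca l Wa k = {Ca..<Ca + int l} Un {Wa..<Wa + int k}"

definition col_loop :: com where
 "col_loop = WHILE V ''j'' \<prec> V ''l'' DO ((WHILE move_guard DO move_body);; ''j'' ::= V ''j'' \<oplus> N 1)"

definition pivot_loop :: com where
 "pivot_loop = WHILE V ''i'' \<prec> V ''k'' DO (''j'' ::= N 0;; col_loop;; ''i'' ::= V ''i'' \<oplus> N 1)"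

lemma col_loop_ae:
 assumes g: "geo H Ca Ea l Pa Wa k pos wpos en" and lay: "Wa + int k <= s"
 and v: "skew_vars s Ca Ea l Pa Wa k H1" "H1 (s + 6) = Fin (int i)" "H1 (s + 7) = Fin 0" and i: "i < k"
 and p: "progress s Ca l Wa k pos wpos H H1 (%j. i) (%i'. if i' < i then l else 0)"
 shows "ae (frame SkewTranspose_proc s) col_loop H1 sp (%H' sp' t. sp' = sp &
 skew_vars s Ca Ea l Pa Wa k H' & H' (s + 6) = Fin (int i) &
 progress s Ca l Wa k pos wpos H H' (%j. Suc i) (%i'. if i' < Suc i then l else 0) &
 strm (skew_cells s 9 Ca Ea l Pa Wa k) (skew_ptrs Ca l Wa k) (ptrs H1) t (ptrs H'))"
proof -
 let ?fr = "frame SkewTranspose_proc s"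
 let ?S = "skew_cells s 9 Ca Ea l Pa Wa k" and ?I = "skew_ptrs Ca l Wa k"
 \<comment> \<open>When the loop reaches sub-column \<open>j\<close>, the first \<open>j\<close>
   sub-columns are one pivot ahead; each iteration completes a rectangle of size one.\<close>
 let ?ci = "%(j::nat) j'. if j' < j then Suc i else i" and ?wi = "%j i'. if i' < i then l else if i' = i then j else 0"
 define Inv where "Inv t H' sp' \<longleftrightarrow> sp' = sp & skew_vars s Ca Ea l Pa Wa k H' & H' (s + 6) = Fin (int i) &
 (EX j<=l. H' (s + 7) = Fin (int j) & progress s Ca l Wa k pos wpos H H' (?ci j) (?wi j)) &
 strm ?S ?I (ptrs H1) t (ptrs H')" for t H' sp'
 have lay2: "Pa + int k <= Ca" "Ca + int l <= Ea" "Ea + int l <= Wa" using g unfolding geo_def by auto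
 have finI: "finite ?I" by (simp add: skew_ptrs_def)
 have fr: "{s..s+9} <= ?S" by (auto simp: skew_cells_def)
 show ?thesis unfolding col_loop_def
 proof (rule ae_While[where I = Inv and \<mu> = "%H'. nat (int l - int_of (H' (s + 7)))"])
 have "(%j. i) = ?ci 0" "(%i'. if i' < i then l else 0) = ?wi 0" by (auto simp: fun_eq_iff)
 thus "Inv [] H1 sp" unfolding Inv_def using v p by (auto intro!: exI[of _ 0] strm.stop)
 next
 fix t H' sp' assume I: "Inv t H' sp'" and b: "bval ?fr H' (V ''j'' \<prec> V ''l'')"
 then obtain j where j: "j <= l" "H' (s + 7) = Fin (int j)" and pr: "progress s Ca l Wa k pos wpos H H' (?ci j) (?wi j)"
 and v': "sp' = sp" "skew_vars s Ca Ea l Pa Wa k H'" "H' (s + 6) = Fin (int i)"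
 and st: "strm ?S ?I (ptrs H1) t (ptrs H')" unfolding Inv_def by blast
 have jl: "j < l" using b j v' by (simp add: skew_vars_def)
 have wi: "?wi j i' <= l" for i' using jl by auto
 note stat = progress_static[OF g pr wi lay]
 have gj: "pos j i <= pos j (Suc i)" "pos j (Suc i) <= en j" "H (Ea + int j) = Fin (en j)" "en j <= Pa"
 "!!q. pos j i <= q ==> q < pos j (Suc i) ==> H q < H (Pa + int i)"
 "pos j (Suc i) < en j ==> ~ H (pos j (Suc i)) < H (Pa + int i)"
 "wpos i (Suc j) = wpos i j + (pos j (Suc i) - pos j i)" "wpos i l <= Pa"
 "!!q. pos j 0 <= q ==> q < en j ==> ~ (wpos i 0 <= q & q < wpos i l)"
 using g jl i unfolding geo_def by auto
 have p0: "pos j 0 <= pos j i" using geo_pos_mono[OF g jl, of 0 i] i by simp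
 have wm: "wpos i 0 <= wpos i j" "wpos i (Suc j) <= wpos i l"
 using geo_wpos_mono[OF g i, of 0 j] geo_wpos_mono[OF g i, of "Suc j" l] jl by auto
 have cw: "H' (Ca + int j) = Fin (pos j i)" "H' (Wa + int i) = Fin (wpos i j)"
 using pr jl i unfolding progress_def by auto
 let ?P = "%H2 sp2 t2. sp2 = sp' & H2 (Ca + int j) = Fin (pos j (Suc i)) & H2 (Wa + int i) = Fin (wpos i j + (pos j (Suc i) - pos j i)) &
 (ALL r. pos j i <= r --> r < pos j (Suc i) --> H2 (wpos i j + (r - pos j i)) = H' r) &
 (ALL x. x ~= Ca + int j --> x ~= Wa + int i --> x ~: {wpos i j..<wpos i j + (pos j (Suc i) - pos j i)} --> H2 x = H' x) &
 strm ({s..s+9} Un {Pa + int i, Ca + int j, Ea + int j, Wa + int i}) {Ca + int j, Wa + int i}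
 (ptrs H') t2 (ptrs H2)"
 have M: "ae ?fr (WHILE move_guard DO move_body) H' sp' ?P"
 proof (rule move_loop_ae[OF v'(2,3) j(2) cw _ lay2 lay i jl])
 show "H' (Ea + int j) = Fin (en j)" using stat(1)[OF jl] gj by simp
 show "H' q < H' (Pa + int i)" if "pos j i <= q" "q < pos j (Suc i)" for q
 using stat(2)[OF i] stat(3)[OF jl, of q] gj p0 that by auto
 show "~ H' (pos j (Suc i)) < H' (Pa + int i)" if "pos j (Suc i) < en j"
 using stat(2)[OF i] stat(3)[OF jl, of "pos j (Suc i)"] gj p0 that by auto
 show "~ (wpos i j <= q & q < wpos i j + (pos j (Suc i) - pos j i))" if "pos j i <= q" "q < en j" for q
 using gj(9)[of q] gj(7) wm p0 that by auto
 qed (use gj wm in auto)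
 show "ae ?fr ((WHILE move_guard DO move_body);; ''j'' ::= V ''j'' \<oplus> N 1) H' sp' (%H2 sp2 t'.
 Inv (t @ bval_acc ?fr H' (V ''j'' \<prec> V ''l'') @ t') H2 sp2 & nat (int l - int_of (H2 (s + 7))) < nat (int l - int_of (H' (s + 7))))"
 proof (rule ae_Seq_rule[OF M])
 fix H2 sp2 t2 assume P: "?P H2 sp2 t2"
 have un: "H2 x = H' x" if "x ~= Ca + int j" "x ~= Wa + int i" "x ~: {wpos i j..<wpos i (Suc j)}" for x
 using P that gj(7) by metis
 have wlt: "wpos i (Suc j) <= Pa" using wm gj by simp
 have v2: "skew_vars s Ca Ea l Pa Wa k H2" "H2 (s + 6) = Fin (int i)" "H2 (s + 7) = Fin (int j)"
 using un[of s] un[of "s+1"] un[of "s+2"] un[of "s+3"] un[of "s+4"] un[of "s+5"] un[of "s+6"] un[of "s+7"]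
 v' j lay lay2 wlt jl i by (auto simp: skew_vars_def)
 have "progress s (Ca + int j) 1 (Wa + int i) 1 (%j' i'. pos (j + j') (i + i')) (%i' j'. wpos (i + i') (j + j'))
 H' H2 (%_. 1) (%_. 1)"
 unfolding progress_def using P un gj(7) by auto
 hence "progress s Ca l Wa k pos wpos H H2
 (%j'. if j <= j' & j' < j + 1 then i + 1 else ?ci j j') (%i'. if i <= i' & i' < i + 1 then j + 1 else ?wi j i')"
 by (intro progress_step[OF g pr lay order_refl]) (use jl i in auto)
 moreover have "(%j'. if j <= j' & j' < j + 1 then i + 1 else ?ci j j') = ?ci (Suc j)"
 "(%i'. if i <= i' & i' < i + 1 then j + 1 else ?wi j i') = ?wi (Suc j)" by (auto simp: fun_eq_iff)
 ultimately have pr2: "progress s Ca l Wa k pos wpos H H2 (?ci (Suc j)) (?wi (Suc j))" by simp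
 let ?H3 = "H2(s + 7 := Fin (int j + 1))"
 have pr3: "progress s Ca l Wa k pos wpos H ?H3 (?ci (Suc j)) (?wi (Suc j))"
 by (rule progress_cong[OF g pr2 lay]) auto
 have ptr_eq: "ptrs H2 q = ptrs H' q" if "q \<in> ?I - {Ca + int j, Wa + int i}" for q
 using un[of q] that wlt lay2 by (auto simp: skew_ptrs_def)
 have st2: "strm ?S ?I (ptrs H') t2 (ptrs H2)"
 proof (rule strm_mono)
 show "strm ({s..s+9} Un {Pa + int i, Ca + int j, Ea + int j, Wa + int i}) {Ca + int j, Wa + int i}
 (ptrs H') t2 (ptrs H2)" using P by blast
 qed (use jl i ptr_eq in \<open>auto simp: skew_cells_def skew_ptrs_def\<close>)
 have st1: "strm ?S ?I (ptrs H') [Read (s + 7), Read (s + 2)] (ptrs H')"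
 by (rule strm_static) (use fr in auto)
 have st3: "strm ?S ?I (ptrs H2) [Read (s + 7), Write (s + 7)] (ptrs ?H3)"
 by (rule strm_step[OF finI]) (use fr lay lay2 in \<open>auto simp: skew_ptrs_def\<close>)
 have "strm ?S ?I (ptrs H1) (t @ ([Read (s + 7), Read (s + 2)] @ (t2 @ [Read (s + 7), Write (s + 7)]))) (ptrs ?H3)"
 by (rule strm_append[OF st strm_append[OF st1 strm_append[OF st2 st3]]])
 hence "Inv (t @ bval_acc ?fr H' (V ''j'' \<prec> V ''l'') @ t2 @ [Read (s + 7), Write (s + 7)]) ?H3 sp"
 unfolding Inv_def using v2 jl pr3 by (auto simp: skew_vars_def intro!: exI[of _ "Suc j"])
 thus "ae ?fr (''j'' ::= V ''j'' \<oplus> N 1) H2 sp2 (%H3 sp3 t3.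
 Inv (t @ bval_acc ?fr H' (V ''j'' \<prec> V ''l'') @ t2 @ t3) H3 sp3 & nat (int l - int_of (H3 (s + 7))) < nat (int l - int_of (H' (s + 7))))"
 using v2 j jl P v' by (simp add: ae_simps)
 qed
 next
 fix t H' sp' assume I: "Inv t H' sp'" and b: "~ bval ?fr H' (V ''j'' \<prec> V ''l'')"
 then obtain j where j: "j <= l" "H' (s + 7) = Fin (int j)" and pr: "progress s Ca l Wa k pos wpos H H' (?ci j) (?wi j)"
 and v': "sp' = sp" "skew_vars s Ca Ea l Pa Wa k H'" "H' (s + 6) = Fin (int i)"
 and st: "strm ?S ?I (ptrs H1) t (ptrs H')" unfolding Inv_def by blast
 have jl: "j = l" using b j v' by (simp add: skew_vars_def)
 have "progress s Ca l Wa k pos wpos H H' (%j. Suc i) (%i'. if i' < Suc i then l else 0)"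
 using pr unfolding progress_def jl by (auto simp: less_Suc_eq)
 moreover have "strm ?S ?I (ptrs H') (bval_acc ?fr H' (V ''j'' \<prec> V ''l'')) (ptrs H')"
 by (rule strm_static) (use fr in auto)
 ultimately show "sp' = sp &
 skew_vars s Ca Ea l Pa Wa k H' & H' (s + 6) = Fin (int i) &
 progress s Ca l Wa k pos wpos H H' (%j. Suc i) (%i'. if i' < Suc i then l else 0) &
 strm ?S ?I (ptrs H1) (t @ bval_acc ?fr H' (V ''j'' \<prec> V ''l'')) (ptrs H')"
 using v' strm_append[OF st] by blast
 qed
qed

lemma pivot_loop_ae:
 assumes g: "geo H Ca Ea l Pa Wa k pos wpos en" and lay: "Wa + int k <= s"
 and v: "skew_vars s Ca Ea l Pa Wa k H1" "H1 (s + 6) = Fin 0"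
 and p: "progress s Ca l Wa k pos wpos H H1 (%j. 0) (%i. 0)"
 shows "ae (frame SkewTranspose_proc s) pivot_loop H1 sp (%H' sp' t. sp' = sp &
 progress s Ca l Wa k pos wpos H H' (%j. k) (%i. l) &
 strm (skew_cells s 9 Ca Ea l Pa Wa k) (skew_ptrs Ca l Wa k) (ptrs H1) t (ptrs H'))"
proof -
 let ?fr = "frame SkewTranspose_proc s"
 let ?S = "skew_cells s 9 Ca Ea l Pa Wa k" and ?I = "skew_ptrs Ca l Wa k"
 let ?wi = "%i i'. if i' < i then l else 0"
 define Inv where "Inv t H' sp' \<longleftrightarrow> sp' = sp & skew_vars s Ca Ea l Pa Wa k H' &
 (EX i<=k. H' (s + 6) = Fin (int i) & progress s Ca l Wa k pos wpos H H' (%j. i) (?wi i)) &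
 strm ?S ?I (ptrs H1) t (ptrs H')" for t H' sp'
 have lay2: "Pa + int k <= Ca" "Ca + int l <= Ea" "Ea + int l <= Wa" using g unfolding geo_def by auto
 have finI: "finite ?I" by (simp add: skew_ptrs_def)
 have fr: "{s..s+9} <= ?S" by (auto simp: skew_cells_def)
 show ?thesis unfolding pivot_loop_def
 proof (rule ae_While[where I = Inv and \<mu> = "%H'. nat (int k - int_of (H' (s + 6)))"])
 show "Inv [] H1 sp" unfolding Inv_def using v p by (auto intro!: exI[of _ 0] strm.stop)
 next
 fix t H' sp' assume I: "Inv t H' sp'" and b: "bval ?fr H' (V ''i'' \<prec> V ''k'')"
 then obtain i where i: "i <= k" "H' (s + 6) = Fin (int i)" and pr: "progress s Ca l Wa k pos wpos H H' (%j. i) (?wi i)"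
 and v': "sp' = sp" "skew_vars s Ca Ea l Pa Wa k H'"
 and st: "strm ?S ?I (ptrs H1) t (ptrs H')" unfolding Inv_def by blast
 have ik: "i < k" using b i v' by (simp add: skew_vars_def)
 let ?H2 = "H'(s + 7 := Fin 0)"
 have pr2: "progress s Ca l Wa k pos wpos H ?H2 (%j. i) (?wi i)"
 by (rule progress_cong[OF g pr lay]) auto
 have v2: "skew_vars s Ca Ea l Pa Wa k ?H2" "?H2 (s + 6) = Fin (int i)" "?H2 (s + 7) = Fin 0"
 using v' i by (auto simp: skew_vars_def)
 note M = col_loop_ae[OF g lay v2 ik pr2, of sp]
 show "ae ?fr (''j'' ::= N 0;; col_loop;; ''i'' ::= V ''i'' \<oplus> N 1) H' sp' (%H2 sp2 t'.
 Inv (t @ bval_acc ?fr H' (V ''i'' \<prec> V ''k'') @ t') H2 sp2 & nat (int k - int_of (H2 (s + 6))) < nat (int k - int_of (H' (s + 6))))"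
 unfolding ae_Seq ae_Assign v'(1) frame_Skew aval.simps
 proof (rule ae_mono[OF M], elim conjE)
 fix H3 sp3 t3 assume P: "sp3 = sp" "skew_vars s Ca Ea l Pa Wa k H3" "H3 (s + 6) = Fin (int i)"
 "progress s Ca l Wa k pos wpos H H3 (%j. Suc i) (?wi (Suc i))"
 "strm ?S ?I (ptrs ?H2) t3 (ptrs H3)"
 let ?H4 = "H3(s + 6 := Fin (int i + 1))"
 have pr4: "progress s Ca l Wa k pos wpos H ?H4 (%j. Suc i) (?wi (Suc i))"
 by (rule progress_cong[OF g P(4) lay]) auto
 have st1: "strm ?S ?I (ptrs H') [Read (s + 6), Read (s + 5)] (ptrs H')"
 by (rule strm_static) (use fr in auto)
 have st2: "strm ?S ?I (ptrs H') [Write (s + 7)] (ptrs ?H2)"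
 by (rule strm_step[OF finI]) (use fr lay lay2 in \<open>auto simp: skew_ptrs_def\<close>)
 have st4: "strm ?S ?I (ptrs H3) [Read (s + 6), Write (s + 6)] (ptrs ?H4)"
 by (rule strm_step[OF finI]) (use fr lay lay2 in \<open>auto simp: skew_ptrs_def\<close>)
 have "strm ?S ?I (ptrs H1) (t @ ([Read (s + 6), Read (s + 5)] @ ([Write (s + 7)] @ (t3 @ [Read (s + 6), Write (s + 6)])))) (ptrs ?H4)"
 by (rule strm_append[OF st strm_append[OF st1 strm_append[OF st2 strm_append[OF P(5) st4]]]])
 hence "Inv (t @ bval_acc ?fr H' (V ''i'' \<prec> V ''k'') @ (([] @ [Write (s + 7)]) @ t3) @ [Read (s + 6), Write (s + 6)]) ?H4 sp"
 unfolding Inv_def using P pr4 ik by (auto simp: skew_vars_def intro!: exI[of _ "Suc i"])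
 thus "Inv (t @ bval_acc ?fr H' (V ''i'' \<prec> V ''k'') @ ((aval_acc ?fr H' (N 0) @ [Write (s + 7)]) @ t3) @
 aval_acc ?fr H3 (V ''i'' \<oplus> N 1) @ [Write (s + 6)]) (H3(s + 6 := Fin (int_of (H3 (s + 6)) + int_of (Fin 1)))) sp3 &
 nat (int k - int_of ((H3(s + 6 := Fin (int_of (H3 (s + 6)) + int_of (Fin 1)))) (s + 6))) < nat (int k - int_of (H' (s + 6)))"
 using P ik i by simp
 qed
 next
 fix t H' sp' assume I: "Inv t H' sp'" and b: "~ bval ?fr H' (V ''i'' \<prec> V ''k'')"
 then obtain i where i: "i <= k" "H' (s + 6) = Fin (int i)" and pr: "progress s Ca l Wa k pos wpos H H' (%j. i) (?wi i)"
 and v': "sp' = sp" "skew_vars s Ca Ea l Pa Wa k H'"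
 and st: "strm ?S ?I (ptrs H1) t (ptrs H')" unfolding Inv_def by blast
 have ik: "i = k" using b i v' by (simp add: skew_vars_def)
 have "progress s Ca l Wa k pos wpos H H' (%j. k) (%i. l)"
 using pr unfolding progress_def ik by auto
 moreover have "strm ?S ?I (ptrs H') (bval_acc ?fr H' (V ''i'' \<prec> V ''k'')) (ptrs H')"
 by (rule strm_static) (use fr in auto)
 ultimately show "sp' = sp & progress s Ca l Wa k pos wpos H H' (%j. k) (%i. l) &
 strm ?S ?I (ptrs H1) (t @ bval_acc ?fr H' (V ''i'' \<prec> V ''k'')) (ptrs H')"
 using v' strm_append[OF st] by blast
 qed
qed

definition skew_code :: com where
 "skew_code = (IF V ''l'' \<prec> N 4 OR V ''k'' \<prec> N 4 THEN (''i'' ::= N 0;; pivot_loop)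
 ELSE (
 (''hl'' ::= Half (V ''l'');; ''hk'' ::= Half (V ''k''));;
 (Call SkewTranspose
 [V ''C'', V ''E'', V ''hl'',
 V ''P'', V ''W'', V ''hk''];;
 (Call SkewTranspose
 [V ''C'' \<oplus> V ''hl'', V ''E'' \<oplus> V ''hl'', V ''l'' \<ominus> V ''hl'',
 V ''P'', V ''W'', V ''hk''];;
 (Call SkewTranspose
 [V ''C'', V ''E'', V ''hl'',
 V ''P'' \<oplus> V ''hk'', V ''W'' \<oplus> V ''hk'', V ''k'' \<ominus> V ''hk''];;
 Call SkewTranspose
 [V ''C'' \<oplus> V ''hl'', V ''E'' \<oplus> V ''hl'', V ''l'' \<ominus> V ''hl'',
 V ''P'' \<oplus> V ''hk'', V ''W'' \<oplus> V ''hk'', V ''k'' \<ominus> V ''hk''])))))"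

lemma ae_Skew_body:
 "ae fr (body SkewTranspose_proc) H sp Q = ae fr skew_code H sp Q"
 by (cases "bval fr H (V ''l'' \<prec> N 4 OR V ''k'' \<prec> N 4)")
 (simp_all del: bval.simps add: SkewTranspose_proc_def skew_code_def pivot_loop_def col_loop_def
 move_guard_def move_body_def ae_Cond ae_Seq)

section \<open>The cost of the skew transposition\<close>

lemma sum_cells: "(\<Sum>p\<in>{x..<x + int n}. f p) = (\<Sum>j<n. f (x + int j))"
proof -
 have "{x..<x + int n} = (%j. x + int j) ` {..<n}"
 proof (intro equalityI subsetI)
 fix y assume "y \<in> {x..<x + int n}"
 hence "y = x + int (nat (y - x))" "nat (y - x) \<in> {..<n}" by auto
 thus "y \<in> (%j. x + int j) ` {..<n}" by blast
 qed auto
 thus ?thesis by (simp add: sum.reindex inj_on_def)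
qed

lemma sum_lessThan_split:
 fixes f :: "nat => int"
 assumes "h <= l"
 shows "(\<Sum>j<l. f j) = (\<Sum>j<h. f j) + (\<Sum>j<l - h. f (h + j))"
proof -
 have "(\<Sum>j<h + n. f j) = (\<Sum>j<h. f j) + (\<Sum>j<n. f (h + j))" for n
 by (induction n) auto
 from this[of "l - h"] assms show ?thesis by simp
qed

definition moved :: "(nat => nat => addr) => nat => nat => int" where
 "moved pos l k = (\<Sum>j<l. pos j k - pos j 0)"

lemma moved_split:
 assumes "hl <= l" "hk <= k"
 shows "moved pos l k = moved pos hl hk + moved (%j i. pos (hl + j) i) (l - hl) hk +
 moved (%j i. pos j (hk + i)) hl (k - hk) + moved (%j i. pos (hl + j) (hk + i)) (l - hl) (k - hk)"
proof -
 have "moved pos l k = (\<Sum>j<l. pos j hk - pos j 0) + (\<Sum>j<l. pos j k - pos j hk)"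
 unfolding moved_def sum.distrib[symmetric] by (intro sum.cong) auto
 thus ?thesis
 unfolding moved_def sum_lessThan_split[OF assms(1), of "%j. pos j hk - pos j 0"]
 sum_lessThan_split[OF assms(1), of "%j. pos j k - pos j hk"] using assms(2) by simp
qed

text \<open>Double counting over buckets and sub-columns: the write pointers advance in total by as
  much as the read pointers.\<close>

lemma geo_bucket_total:
 assumes g: "geo H Ca Ea l Pa Wa k pos wpos en"
 shows "(\<Sum>i<k. wpos i l - wpos i 0) = moved pos l k"
proof -
 have "wpos i l - wpos i 0 = (\<Sum>j<l. pos j (Suc i) - pos j i)" if "i < k" for i
 proof -
 have "wpos i l - wpos i 0 = (\<Sum>j<l. wpos i (Suc j) - wpos i j)" by (simp add: sum_lessThan_telescope)
 also have "... = (\<Sum>j<l. pos j (Suc i) - pos j i)"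
 using g that unfolding geo_def by (intro sum.cong) auto
 finally show ?thesis .
 qed
 hence "(\<Sum>i<k. wpos i l - wpos i 0) = (\<Sum>i<k. \<Sum>j<l. pos j (Suc i) - pos j i)" by (intro sum.cong) auto
 also have "... = (\<Sum>j<l. \<Sum>i<k. pos j (Suc i) - pos j i)" by (rule sum.swap)
 also have "... = moved pos l k" unfolding moved_def by (intro sum.cong) (auto simp: sum_lessThan_telescope)
 finally show ?thesis .
qed

context cache
begin

text \<open>Unlike a bare cost bound, the description as a stream survives composition. A whole
  recursive computation can therefore be charged as a single stream as soon as its pointers fit into
  the cache.\<close>

definition sq :: "addr set => addr set => real => (vname => addr) => com => mem => addr => (mem => addr => bool) => bool" where
 "sq S I k fr c H sp Q \<longleftrightarrow> ae fr c H sp (%H' sp' t.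
 strm S I (ptrs H) t (ptrs H') & real (cst t) <= k & Q H' sp')"

lemma sq_mono:
 assumes "sq S I k fr c H sp Q" "k <= k'" "!!H' sp'. Q H' sp' ==> Q' H' sp'"
 shows "sq S I k' fr c H sp Q'"
 using assms unfolding sq_def by (auto elim!: ae_mono)

lemma sq_Seq:
 assumes "sq S I k1 fr c1 H sp Q1" "!!H1 sp1. Q1 H1 sp1 ==> sq S I k2 fr c2 H1 sp1 Q"
 shows "sq S I (k1 + k2) fr (c1;; c2) H sp Q"
 unfolding sq_def
proof (rule ae_Seq_rule[OF assms(1)[unfolded sq_def]])
 fix H1 sp1 t1
 assume *: "strm S I (ptrs H) t1 (ptrs H1) & real (cst t1) <= k1 & Q1 H1 sp1"
 hence "ae fr c2 H1 sp1 (%H' sp' t. strm S I (ptrs H1) t (ptrs H') & real (cst t) <= k2 & Q H' sp')"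
 using assms(2) by (auto simp: sq_def)
 thus "ae fr c2 H1 sp1 (%H2 sp2 t2. strm S I (ptrs H) (t1 @ t2) (ptrs H2) &
 real (cst (t1 @ t2)) <= k1 + k2 & Q H2 sp2)"
 proof (rule ae_mono)
 fix H2 sp2 t2
 assume "strm S I (ptrs H1) t2 (ptrs H2) & real (cst t2) <= k2 & Q H2 sp2"
 moreover have "real (cst (t1 @ t2)) <= real (cst t1) + real (cst t2)" using cst_append[of t1 t2] by linarith
 ultimately show "strm S I (ptrs H) (t1 @ t2) (ptrs H2) &
 real (cst (t1 @ t2)) <= k1 + k2 & Q H2 sp2"
 using * strm_append by fastforce
 qed
qed

text \<open>Small sizes pay for ten blocks of frames and arrays and for one stream per pointer. For
  large sizes the negative linear term drives the induction: the four parts have total size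
  \<open>2 * (l + k)\<close> and contribute \<open>- 4 * (l + k)\<close>, so that
  \<open>2 * (l + k)\<close> is left for the calls. The last term counts each moved item twice, once
  for a read and once for a write pointer.\<close>

definition skew_cost :: "nat => nat => int => real" where
 "skew_cost l k e = (if 16 * (l + k) <= B then 20 + 4 * real (l + k)
 else 240 * (real (l + k))^2 / B - 2 * real (l + k)) + 4 * real_of_int e / B"

text \<open>A part of a problem just above the threshold may itself fall below it. The quadratic
  form is still valid there, as long as \<open>B <= 34 * (l + k)\<close>.\<close>

lemma skew_cost_le:
 assumes "B <= 34 * (l + k)"
 shows "skew_cost l k e <= 240 * (real (l + k))^2 / B - 2 * real (l + k) + 4 * real_of_int e / B"
proof (cases "16 * (l + k) <= B")
 case True
 define x where "x = real (l + k)"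
 have B0: "real B \<ge> 1000" using B_large by simp
 have "real B <= real (34 * (l + k))" using assms by (simp only: of_nat_le_iff)
 hence x: "real B <= 34 * x" "x \<ge> 29" using B0 by (simp_all add: x_def)
 have "x * real B <= x * (34 * x)" using x by (intro mult_left_mono) auto
 hence "x <= 34 * (x^2 / B)" using B0 by (simp add: field_simps power2_eq_square)
 hence "20 + 4 * x <= 240 * (x^2 / B) - 2 * x" using x by linarith
 thus ?thesis using True by (simp add: skew_cost_def x_def)
qed (simp add: skew_cost_def)

text \<open>The four squares add up to at most \<open>(l + k)^2 + 2\<close>, so the quadratic terms
  hardly grow, while the linear ones leave \<open>2 * (l + k)\<close>. The 44 more than covers the
  guard, the halving and the overhead of the four calls.\<close>

lemma skew_cost_rec:
 assumes "~ 16 * (l + k) <= B" "l <= k + 1" "k <= l + 1" "hl = l div 2" "hk = k div 2" "e = e1 + e2 + e3 + e4"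
 shows "44 + skew_cost hl hk e1 + skew_cost (l - hl) hk e2 + skew_cost hl (k - hk) e3 + skew_cost (l - hl) (k - hk) e4
 <= skew_cost l k e"
proof -
 have B0: "real B \<ge> 1000" using B_large by simp
 have h: "2 * hl <= l" "l <= 2 * hl + 1" "2 * hk <= k" "k <= 2 * hk + 1" using assms by auto
 have s1: "B <= 34 * (hl + hk)" using assms(1) h B_large by simp
 have "hl <= l - hl" "hk <= k - hk" using h by auto
 with s1 have s: "B <= 34 * (hl + hk)" "B <= 34 * (l - hl + hk)" "B <= 34 * (hl + (k - hk))" "B <= 34 * (l - hl + (k - hk))"
 by (auto simp: distrib_left)
 define a where "a = real hl"
 define a' where "a' = real (l - hl)"
 define b where "b = real hk"
 define b' where "b' = real (k - hk)"
 have al: "a + a' = real l" "b + b' = real k" using h by (auto simp: a_def a'_def b_def b'_def)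
 have sq: "a^2 + a'^2 <= ((real l)^2 + 1) / 2" "b^2 + b'^2 <= ((real k)^2 + 1) / 2"
 using square_halves_le[of l] square_halves_le[of k] assms(4,5) by (simp_all add: a_def a'_def b_def b'_def)
 have cross: "(a + b)^2 + (a' + b)^2 + (a + b')^2 + (a' + b')^2 =
 2 * (a^2 + a'^2) + 2 * (b^2 + b'^2) + 2 * ((a + a') * (b + b'))"
 by (simp add: power2_eq_square algebra_simps)
 have "(a + b)^2 + (a' + b)^2 + (a + b')^2 + (a' + b')^2 <= (real l + real k)^2 + 2"
 unfolding cross al using sq by (simp add: power2_eq_square algebra_simps)
 hence "240 * ((a + b)^2 + (a' + b)^2 + (a + b')^2 + (a' + b')^2) / B <= 240 * ((real l + real k)^2 + 2) / B"
 using B0 by (intro divide_right_mono mult_left_mono) auto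
 also have "... = 240 * (real l + real k)^2 / B + 480 / B" by (simp add: add_divide_distrib)
 also have "480 / B <= 1" using B0 by simp
 finally have Q: "240 * (a + b)^2 / B + 240 * (a' + b)^2 / B + 240 * (a + b')^2 / B + 240 * (a' + b')^2 / B
 <= 240 * (real l + real k)^2 / B + 1" by (simp add: add_divide_distrib)
 have "62 <= l + k" using assms(1) B_large by simp
 hence big: "real l + real k \<ge> 62" by linarith
 have E: "4 * real_of_int e1 / B + 4 * real_of_int e2 / B + 4 * real_of_int e3 / B + 4 * real_of_int e4 / B = 4 * real_of_int e / B"
 using assms(6) by (simp add: add_divide_distrib)
 have "skew_cost hl hk e1 <= 240 * (a + b)^2 / B - 2 * (a + b) + 4 * real_of_int e1 / B"
 using skew_cost_le[OF s(1)] by (simp add: a_def b_def)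
 moreover have "skew_cost (l - hl) hk e2 <= 240 * (a' + b)^2 / B - 2 * (a' + b) + 4 * real_of_int e2 / B"
 using skew_cost_le[OF s(2)] by (simp add: a'_def b_def)
 moreover have "skew_cost hl (k - hk) e3 <= 240 * (a + b')^2 / B - 2 * (a + b') + 4 * real_of_int e3 / B"
 using skew_cost_le[OF s(3)] by (simp add: a_def b'_def)
 moreover have "skew_cost (l - hl) (k - hk) e4 <= 240 * (a' + b')^2 / B - 2 * (a' + b') + 4 * real_of_int e4 / B"
 using skew_cost_le[OF s(4)] by (simp add: a'_def b'_def)
 moreover have "skew_cost l k e = 240 * (real l + real k)^2 / B - 2 * (real l + real k) + 4 * real_of_int e / B"
 using assms(1) by (simp add: skew_cost_def)
 moreover have "x1 <= q1 - 2 * (a + b) + f1 ==> x2 <= q2 - 2 * (a' + b) + f2 ==> x3 <= q3 - 2 * (a + b') + f3 ==>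
 x4 <= q4 - 2 * (a' + b') + f4 ==> y = q - 2 * (real l + real k) + f ==> q1 + q2 + q3 + q4 <= q + 1 ==>
 f1 + f2 + f3 + f4 = f ==> 44 + x1 + x2 + x3 + x4 <= y" for x1 x2 x3 x4 q1 q2 q3 q4 f1 f2 f3 f4 y q f :: real
 using al big unfolding distrib_left by linarith
 ultimately show ?thesis using Q E by blast
qed

text \<open>Each of the five intervals of \<open>skew_cells\<close> meets at most two blocks;
  together with one block for each of the \<open>l + k\<close> pointers they stay in the cache
  throughout.\<close>

lemma sq_small_skew:
 assumes g: "geo H Ca Ea l Pa Wa k pos wpos en" and small: "16 * (l + k) <= B"
 and init: "!!j. j < l ==> H (Ca + int j) = Fin (pos j 0)" "!!i. i < k ==> H (Wa + int i) = Fin (wpos i 0)"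
 and a: "ae fr c H sp (%H' sp' t. progress s Ca l Wa k pos wpos H H' (%_. k) (%_. l) &
 strm (skew_cells s (10 * int l + 10) Ca Ea l Pa Wa k) (skew_ptrs Ca l Wa k) (ptrs H) t (ptrs H'))"
 shows "sq (skew_cells s (10 * int l + 10) Ca Ea l Pa Wa k) (skew_ptrs Ca l Wa k) (skew_cost l k (moved pos l k)) fr c H sp
 (%H' sp'. progress s Ca l Wa k pos wpos H H' (%_. k) (%_. l))"
 unfolding sq_def
proof (rule ae_mono[OF a], elim conjE, intro conjI)
 fix H' sp' t
 let ?S = "skew_cells s (10 * int l + 10) Ca Ea l Pa Wa k" and ?I = "skew_ptrs Ca l Wa k"
 assume p: "progress s Ca l Wa k pos wpos H H' (%_. k) (%_. l)"
 and st: "strm ?S ?I (ptrs H) t (ptrs H')"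
 have lay2: "Pa + int k <= Ca" "Ca + int l <= Ea" "Ea + int l <= Wa" using g unfolding geo_def by auto
 have "(\<Sum>p\<in>?I. ptrs H' p - ptrs H p) =
 (\<Sum>p\<in>{Ca..<Ca + int l}. ptrs H' p - ptrs H p) + (\<Sum>p\<in>{Wa..<Wa + int k}. ptrs H' p - ptrs H p)"
 unfolding skew_ptrs_def by (rule sum.union_disjoint) (use lay2 in auto)
 also have "(\<Sum>p\<in>{Ca..<Ca + int l}. ptrs H' p - ptrs H p) = moved pos l k"
 unfolding sum_cells moved_def using init(1) p by (intro sum.cong) (auto simp: progress_def)
 also have "(\<Sum>p\<in>{Wa..<Wa + int k}. ptrs H' p - ptrs H p) = (\<Sum>i<k. wpos i l - wpos i 0)"
 unfolding sum_cells using init(2) p by (intro sum.cong) (auto simp: progress_def)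
 finally have e: "(\<Sum>p\<in>?I. ptrs H' p - ptrs H p) <= 2 * moved pos l k"
 unfolding geo_bucket_total[OF g] by simp
 have cI: "card ?I <= l + k"
 unfolding skew_ptrs_def using card_Un_le[of "{Ca..<Ca + int l}" "{Wa..<Wa + int k}"] by simp
 have "card (blocks B ?S) <= 10"
 proof -
 have Bi: "16 * (int l + int k) <= int B" "int B \<ge> 1000" using small B_large by auto
 have "card (blocks B ?S) <= card (blocks B {s..s + (10 * int l + 10)}) + card (blocks B {Ca..Ca + int l}) +
 card (blocks B {Ea..Ea + int l}) + card (blocks B {Pa..Pa + int k}) + card (blocks B {Wa..Wa + int k})"
 unfolding skew_cells_def
 by (intro order_trans[OF card_blocks_Un] add_mono order_refl)
 moreover have "card (blocks B {s..s + (10 * int l + 10)}) <= 2" "card (blocks B {Ca..Ca + int l}) <= 2"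
 "card (blocks B {Ea..Ea + int l}) <= 2" "card (blocks B {Pa..Pa + int k}) <= 2" "card (blocks B {Wa..Wa + int k}) <= 2"
 using Bi by (auto intro!: card_blocks_short)
 ultimately show ?thesis by linarith
 qed
 moreover have "10 + card ?I <= K" using cI small B_large K_ge_B by simp
 ultimately have "real (cst t) <= 2 * real 10 + 4 * real (card ?I) + 2 * real_of_int (2 * moved pos l k) / real B"
 by (intro cst_streams[OF st _ _ _ _ e]) (auto simp: skew_ptrs_def skew_cells_def)
 also have "... <= 20 + 4 * real (l + k) + 4 * real_of_int (moved pos l k) / B"
 using cI by simp
 also have "... = skew_cost l k (moved pos l k)" using small by (simp add: skew_cost_def)
 finally show "real (cst t) <= skew_cost l k (moved pos l k)" .
qed

text \<open>Halving keeps \<open>l\<close> and \<open>k\<close> within one of each other, so the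
  base case has \<open>l + k <= 7\<close> and belongs to the small regime.\<close>

lemma Skew_sq:
 assumes "geo H Ca Ea l Pa Wa k pos wpos en" "Wa + int k <= s" "skew_vars s Ca Ea l Pa Wa k H"
 and "!!j. j < l ==> H (Ca + int j) = Fin (pos j 0)" "!!i. i < k ==> H (Wa + int i) = Fin (wpos i 0)"
 and "l <= k + 1" "k <= l + 1"
 shows "sq (skew_cells s (10 * int l + 10) Ca Ea l Pa Wa k) (skew_ptrs Ca l Wa k) (skew_cost l k (moved pos l k))
 (frame SkewTranspose_proc s) (body SkewTranspose_proc) H (s + 10)
 (%H' sp'. progress s Ca l Wa k pos wpos H H' (%_. k) (%_. l))"
 using assms
proof (induction l arbitrary: H Ca Ea Pa Wa k pos wpos en s rule: less_induct)
 case (less l)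
 note g = less.prems(1) and lay = less.prems(2) and v = less.prems(3) and init = less.prems(4,5) and lk = less.prems(6,7)
 let ?fr = "frame SkewTranspose_proc s"
 let ?S = "skew_cells s (10 * int l + 10) Ca Ea l Pa Wa k" and ?I = "skew_ptrs Ca l Wa k"
 let ?e = "moved pos l k"
 let ?PR = "%H' ci wi. progress s Ca l Wa k pos wpos H H' ci wi"
 have Bb: "int B \<ge> 1000" using B_large by simp
 have lay2: "Pa + int k <= Ca" "Ca + int l <= Ea" "Ea + int l <= Wa" using g unfolding geo_def by auto
 have finI: "finite ?I" by (simp add: skew_ptrs_def)
 have fr: "{s..s+10} <= ?S" by (auto simp: skew_cells_def)
 have S9: "skew_cells s 9 Ca Ea l Pa Wa k <= ?S" by (auto simp: skew_cells_def)
 have p0: "?PR H (%_. 0) (%_. 0)" unfolding progress_def using init by auto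
 have sq_body: "sq S I c ?fr (body SkewTranspose_proc) H (s + 10) Q = sq S I c ?fr skew_code H (s + 10) Q" for S I c Q
 unfolding sq_def ae_Skew_body ..
 let ?cond = "V ''l'' \<prec> N 4 OR V ''k'' \<prec> N 4"
 have cond: "bval ?fr H ?cond \<longleftrightarrow> l < 4 \<or> k < 4" using v by (auto simp: skew_vars_def)
 have acc: "addrs (bval_acc ?fr H ?cond) <= {s..s+9}" by auto
 show ?case
 proof (cases "l < 4 \<or> k < 4")
 case True
 have small: "16 * (l + k) <= B" using True lk B_large by auto
 let ?H1 = "H(s + 6 := Fin 0)"
 have v1: "skew_vars s Ca Ea l Pa Wa k ?H1" "?H1 (s + 6) = Fin 0" using v by (auto simp: skew_vars_def)
 have p1: "?PR ?H1 (%_. 0) (%_. 0)" by (rule progress_cong[OF g p0 lay]) auto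
 have "ae ?fr (body SkewTranspose_proc) H (s + 10) (%H' sp' t. ?PR H' (%_. k) (%_. l) &
 strm ?S ?I (ptrs H) t (ptrs H'))"
 unfolding ae_Skew_body skew_code_def ae_Cond if_P[OF cond[THEN iffD2, OF True]] ae_Seq ae_Assign frame_Skew aval.simps
 proof (rule ae_mono[OF pivot_loop_ae[OF g lay v1 p1]], elim conjE, intro conjI)
 fix H' sp' t assume st: "strm (skew_cells s 9 Ca Ea l Pa Wa k) ?I (ptrs ?H1) t (ptrs H')"
 have st3: "strm ?S ?I (ptrs ?H1) t (ptrs H')"
 by (rule strm_mono[OF st S9 order_refl]) auto
 have st1: "strm ?S ?I (ptrs H) (bval_acc ?fr H ?cond) (ptrs H)"
 by (rule strm_static) (use fr acc in auto)
 have st2: "strm ?S ?I (ptrs H) (aval_acc ?fr H (N 0) @ [Write (s + 6)]) (ptrs ?H1)"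
 by (rule strm_step[OF finI]) (use fr lay lay2 in \<open>auto simp: skew_ptrs_def\<close>)
 show "strm ?S ?I (ptrs H) (bval_acc ?fr H ?cond @ (aval_acc ?fr H (N 0) @ [Write (s + 6)]) @ t) (ptrs H')"
 by (rule strm_append[OF st1 strm_append[OF st2 st3]])
 qed
 thus ?thesis by (intro sq_small_skew[OF g small]) (use init in auto)
 next
 case False
 define hl where "hl = l div 2"
 define hk where "hk = k div 2"
 have h: "2 * hl <= l" "l <= 2 * hl + 1" "2 * hk <= k" "k <= 2 * hk + 1" by (auto simp: hl_def hk_def)
 have h2: "int l div 2 = int hl" "int k div 2 = int hk" by (auto simp: hl_def hk_def zdiv_int)
 define VV where "VV H' sp' \<longleftrightarrow> sp' = s + 10 & skew_vars s Ca Ea l Pa Wa k H' & H' (s + 8) = Fin (int hl) & H' (s + 9) = Fin (int hk)"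
 for H' sp'
 \<comment> \<open>All four calls are instances of one rule, for the rectangle of \<open>lo\<close>
   sub-columns from \<open>jo\<close> on and \<open>ko\<close> pivots from \<open>io\<close>
   on.\<close>
 have call: "sq ?S ?I (8 + skew_cost lo ko (moved (%j i. pos (jo + j) (io + i)) lo ko)) ?fr (Call SkewTranspose es) Ha spa
 (%H' sp'. VV H' sp' & ?PR H' (%j. if jo <= j & j < jo + lo then io + ko else ci j) (%i. if io <= i & i < io + ko then jo + lo else wi i))"
 if st: "VV Ha spa" "?PR Ha ci wi"
 and r: "jo + lo <= l" "io + ko <= k" "lo < l" "lo <= ko + 1" "ko <= lo + 1"
 and ci: "!!j. jo <= j ==> j < jo + lo ==> ci j = io"
 and wi: "!!i. io <= i ==> i < io + ko ==> wi i = jo" "!!i. i < k ==> wi i <= l"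
 and es: "map (aval ?fr Ha) es = [Fin (Ca + int jo), Fin (Ea + int jo), Fin (int lo), Fin (Pa + int io), Fin (Wa + int io), Fin (int ko)]"
 and ea: "addrs (concat (map (aval_acc ?fr Ha) es)) <= {s..s+9}"
 for Ha spa es jo lo io ko ci wi
 proof -
 let ?args = "[Fin (Ca + int jo), Fin (Ea + int jo), Fin (int lo), Fin (Pa + int io), Fin (Wa + int io), Fin (int ko)]"
 let ?Hb = "write_list Ha (s + 10) ?args"
 let ?pos = "%j i. pos (jo + j) (io + i)" and ?wpos = "%i j. wpos (io + i) (jo + j)" and ?en = "%j. en (jo + j)"
 have len: "length es = 6" using arg_cong[OF es, of length] by simp
 have b_eq: "?Hb x = Ha x" if "x < s + 10" for x using that by auto
 have bv: "skew_vars (s + 10) (Ca + int jo) (Ea + int jo) lo (Pa + int io) (Wa + int io) ko ?Hb"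
 by (simp add: skew_vars_def)
 have ga: "geo Ha Ca Ea l Pa Wa k pos wpos en"
 by (rule geo_cong[OF g]; rule progress_static[OF g st(2) _ lay]) (use wi in auto)
 have gb: "geo ?Hb Ca Ea l Pa Wa k pos wpos en"
 proof (rule geo_cong[OF ga])
 show "?Hb (Ea + int j) = Ha (Ea + int j)" if "j < l" for j by (rule b_eq) (use lay lay2 that in auto)
 show "?Hb (Pa + int i) = Ha (Pa + int i)" if "i < k" for i by (rule b_eq) (use lay lay2 that in auto)
 show "?Hb q = Ha q" if "j < l" "pos j 0 <= q" "q < en j" for j q
 proof (rule b_eq)
 have "en j <= Pa" using g that unfolding geo_def by auto
 thus "q < s + 10" using that lay lay2 by auto
 qed
 qed
 have gsb: "geo ?Hb (Ca + int jo) (Ea + int jo) lo (Pa + int io) (Wa + int io) ko ?pos ?wpos ?en"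
 by (rule geo_sub[OF gb r(1,2)])
 have Ca_a: "Ha (Ca + int j) = Fin (pos j (ci j))" if "j < l" for j using st(2) that unfolding progress_def by blast
 have Wa_a: "Ha (Wa + int i) = Fin (wpos i (wi i))" if "i < k" for i using st(2) that unfolding progress_def by blast
 have IH: "sq (skew_cells (s + 10) (10 * int lo + 10) (Ca + int jo) (Ea + int jo) lo (Pa + int io) (Wa + int io) ko)
 (skew_ptrs (Ca + int jo) lo (Wa + int io) ko) (skew_cost lo ko (moved ?pos lo ko))
 (frame SkewTranspose_proc (s + 10)) (body SkewTranspose_proc) ?Hb (s + 10 + 10)
 (%H' sp'. progress (s + 10) (Ca + int jo) lo (Wa + int io) ko ?pos ?wpos ?Hb H' (%_. ko) (%_. lo))"
 proof (rule less.IH[OF r(3) gsb _ bv])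
 show "Wa + int io + int ko <= s + 10" using lay r by linarith
 show "?Hb (Ca + int jo + int j) = Fin (pos (jo + j) (io + 0))" if "j < lo" for j
 using b_eq[of "Ca + int jo + int j"] Ca_a[of "jo + j"] ci[of "jo + j"] that r lay lay2 by (simp add: add.assoc)
 show "?Hb (Wa + int io + int i) = Fin (wpos (io + i) (jo + 0))" if "i < ko" for i
 using b_eq[of "Wa + int io + int i"] Wa_a[of "io + i"] wi(1)[of "io + i"] that r lay lay2 by (simp add: add.assoc)
 qed (use r in auto)
 have spa: "spa = s + 10" using st by (simp add: VV_def)
 show ?thesis unfolding sq_def ae_Call es squaresort_prog.simps frame_Skew(11) spa len of_nat_numeral
 proof (rule ae_mono[OF IH[unfolded sq_def]], elim conjE)
 fix H' sp' t
 assume st': "strm (skew_cells (s + 10) (10 * int lo + 10) (Ca + int jo) (Ea + int jo) lo (Pa + int io) (Wa + int io) ko)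
 (skew_ptrs (Ca + int jo) lo (Wa + int io) ko) (ptrs ?Hb) t (ptrs H')"
 and ct: "real (cst t) <= skew_cost lo ko (moved ?pos lo ko)"
 and pb: "progress (s + 10) (Ca + int jo) lo (Wa + int io) ko ?pos ?wpos ?Hb H' (%_. ko) (%_. lo)"
 let ?w = "map (%i. Write (s + 10 + int i)) [0..<6]"
 let ?p = "concat (map (aval_acc ?fr Ha) es)"
 have pa: "progress (s + 10) (Ca + int jo) lo (Wa + int io) ko ?pos ?wpos Ha H' (%_. ko) (%_. lo)"
 by (rule progress_cong[OF gsb pb]) (use b_eq lay r in auto)
 have un: "H' x = Ha x" if "x < s + 10" "x ~: {Ca + int jo..<Ca + int jo + int lo}" "x ~: {Wa + int io..<Wa + int io + int ko}" "Pa <= x" for x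
 proof -
 have "x ~: {wpos (io + i) (jo + 0)..<wpos (io + i) (jo + lo)}" if "i < ko" for i
 proof -
 have "wpos (io + i) (jo + lo) <= wpos (io + i) l" "wpos (io + i) l <= Pa"
 using geo_wpos_mono[OF g, of "io + i" "jo + lo" l] g that r unfolding geo_def by auto
 thus ?thesis using \<open>Pa <= x\<close> by auto
 qed
 thus ?thesis using pa that(1-3) unfolding progress_def by blast
 qed
 have VV': "VV H' (s + 10)"
 using st(1) un[of s] un[of "s+1"] un[of "s+2"] un[of "s+3"] un[of "s+4"] un[of "s+5"] un[of "s+8"] un[of "s+9"] lay lay2 r
 by (auto simp: VV_def skew_vars_def)
 have pr': "?PR H' (%j. if jo <= j & j < jo + lo then io + ko else ci j) (%i. if io <= i & i < io + ko then jo + lo else wi i)"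
 by (rule progress_step[OF g st(2) lay _ r(1,2) ci wi pa]) auto
 have s3: "strm ?S ?I (ptrs Ha) t (ptrs H')"
 proof (rule strm_mono[OF st'])
 show "skew_cells (s + 10) (10 * int lo + 10) (Ca + int jo) (Ea + int jo) lo (Pa + int io) (Wa + int io) ko <= ?S"
 unfolding skew_cells_def by (intro Un_mono) (use r in auto)
 show "skew_ptrs (Ca + int jo) lo (Wa + int io) ko <= ?I" unfolding skew_ptrs_def by (intro Un_mono) (use r in auto)
 show "ptrs Ha q = ptrs ?Hb q" if "q \<in> skew_ptrs (Ca + int jo) lo (Wa + int io) ko" for q
 proof -
 have "q < s + 10" using that lay lay2 r by (auto simp: skew_ptrs_def)
 thus ?thesis using b_eq[of q] by simp
 qed
 show "ptrs Ha q = ptrs H' q" if "q \<in> ?I - skew_ptrs (Ca + int jo) lo (Wa + int io) ko" for q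
 using un[of q] that lay lay2 r by (auto simp: skew_ptrs_def)
 qed auto
 have s1: "strm ?S ?I (ptrs Ha) ?p (ptrs Ha)"
 proof (rule strm_static)
 have "{s..s + 9} <= ?S" using fr by auto
 thus "addrs ?p <= ?S Un ptrs Ha ` ?I" using ea by blast
 qed
 have s2: "strm ?S ?I (ptrs Ha) ?w (ptrs Ha)"
 by (rule strm_static) (use r in \<open>auto simp: skew_cells_def\<close>)
 have "cst (?p @ ?w) <= 8" by (rule cst_call_prefix[OF ea]) (use Bb in auto)
 hence "real (cst ((?p @ ?w) @ t)) <= 8 + skew_cost lo ko (moved ?pos lo ko)"
 using cst_append[of "?p @ ?w" t] ct by linarith
 thus "strm ?S ?I (ptrs Ha) (?p @ ?w @ t) (ptrs H') &
 real (cst (?p @ ?w @ t)) <= 8 + skew_cost lo ko (moved ?pos lo ko) &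
 VV H' (s + 10) & ?PR H' (%j. if jo <= j & j < jo + lo then io + ko else ci j) (%i. if io <= i & i < io + ko then jo + lo else wi i)"
 using VV' pr' strm_append[OF s1 strm_append[OF s2 s3]] by simp
 qed
 qed
 let ?z = "%_::nat. 0::nat"
 \<comment> \<open>The counters after each of the four calls; trivial tests such as
   \<open>0 <= j\<close> keep the shape that the rule for a call produces.\<close>
 let ?c1 = "%j. if 0 <= j & j < 0 + hl then 0 + hk else ?z j" and ?w1 = "%i. if 0 <= i & i < 0 + hk then 0 + hl else ?z i"
 let ?c2 = "%j. if hl <= j & j < hl + (l - hl) then 0 + hk else ?c1 j" and ?w2 = "%i. if 0 <= i & i < 0 + hk then hl + (l - hl) else ?w1 i"
 let ?c3 = "%j. if 0 <= j & j < 0 + hl then hk + (k - hk) else ?c2 j" and ?w3 = "%i. if hk <= i & i < hk + (k - hk) then 0 + hl else ?w2 i"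
 let ?c4 = "%j. if hl <= j & j < hl + (l - hl) then hk + (k - hk) else ?c3 j" and ?w4 = "%i. if hk <= i & i < hk + (k - hk) then hl + (l - hl) else ?w3 i"
 have st0: "sq ?S ?I 4 ?fr (''hl'' ::= Half (V ''l'');; ''hk'' ::= Half (V ''k'')) H (s + 10) (%H' sp'. VV H' sp' & ?PR H' ?z ?z)"
 proof -
 let ?H1 = "H(s + 8 := Fin (int hl), s + 9 := Fin (int hk))"
 have E: "ae ?fr (''hl'' ::= Half (V ''l'');; ''hk'' ::= Half (V ''k'')) H (s + 10) (%H' sp' t. H' = ?H1 & sp' = s + 10 & addrs t <= {s..s+9})"
 using v h2 by (auto simp: ae_simps skew_vars_def)
 show ?thesis unfolding sq_def
 proof (rule ae_mono[OF E], elim conjE)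
 fix H' sp' t assume *: "H' = ?H1" "sp' = s + 10" "addrs t <= {s..s+9}"
 have "?PR ?H1 ?z ?z" by (rule progress_cong[OF g p0 lay]) auto
 moreover have "VV ?H1 (s + 10)" using v by (simp add: VV_def skew_vars_def)
 moreover have "cst t <= 4" by (rule cst_local[OF *(3)]) (use Bb in simp)
 moreover have "strm ?S ?I (ptrs H) t (ptrs ?H1)"
 proof (rule strm_step[OF finI])
 show "addrs t <= ?S Un ptrs H ` ?I" using *(3) order_trans[OF _ fr, of "{s..s + 9}"] by auto
 qed (use lay lay2 in \<open>auto simp: skew_ptrs_def\<close>)
 ultimately show "strm ?S ?I (ptrs H) t (ptrs H') & real (cst t) <= 4 & VV H' sp' & ?PR H' ?z ?z"
 using * by simp
 qed
 qed
 have st1: "sq ?S ?I (8 + skew_cost hl hk (moved (%j i. pos (0 + j) (0 + i)) hl hk)) ?fr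
 (Call SkewTranspose [V ''C'', V ''E'', V ''hl'', V ''P'', V ''W'', V ''hk'']) Ha spa (%H' sp'. VV H' sp' & ?PR H' ?c1 ?w1)"
 if "VV Ha spa & ?PR Ha ?z ?z" for Ha spa
 by (rule call) (use that h lk False in \<open>auto simp: VV_def skew_vars_def\<close>)
 have st2: "sq ?S ?I (8 + skew_cost (l - hl) hk (moved (%j i. pos (hl + j) (0 + i)) (l - hl) hk)) ?fr
 (Call SkewTranspose [V ''C'' \<oplus> V ''hl'', V ''E'' \<oplus> V ''hl'', V ''l'' \<ominus> V ''hl'', V ''P'', V ''W'', V ''hk'']) Ha spa (%H' sp'. VV H' sp' & ?PR H' ?c2 ?w2)"
 if "VV Ha spa & ?PR Ha ?c1 ?w1" for Ha spa
 by (rule call) (use that h lk False in \<open>auto simp: VV_def skew_vars_def\<close>)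
 have st3: "sq ?S ?I (8 + skew_cost hl (k - hk) (moved (%j i. pos (0 + j) (hk + i)) hl (k - hk))) ?fr
 (Call SkewTranspose [V ''C'', V ''E'', V ''hl'', V ''P'' \<oplus> V ''hk'', V ''W'' \<oplus> V ''hk'', V ''k'' \<ominus> V ''hk'']) Ha spa (%H' sp'. VV H' sp' & ?PR H' ?c3 ?w3)"
 if "VV Ha spa & ?PR Ha ?c2 ?w2" for Ha spa
 by (rule call) (use that h lk False in \<open>auto simp: VV_def skew_vars_def\<close>)
 have st4: "sq ?S ?I (8 + skew_cost (l - hl) (k - hk) (moved (%j i. pos (hl + j) (hk + i)) (l - hl) (k - hk))) ?fr
 (Call SkewTranspose [V ''C'' \<oplus> V ''hl'', V ''E'' \<oplus> V ''hl'', V ''l'' \<ominus> V ''hl'', V ''P'' \<oplus> V ''hk'', V ''W'' \<oplus> V ''hk'', V ''k'' \<ominus> V ''hk'']) Ha spa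
 (%H' sp'. VV H' sp' & ?PR H' ?c4 ?w4)"
 if "VV Ha spa & ?PR Ha ?c3 ?w3" for Ha spa
 by (rule call) (use that h lk False in \<open>auto simp: VV_def skew_vars_def\<close>)
 have last: "?PR H' (%_. k) (%_. l)" if "?PR H' ?c4 ?w4" for H'
 proof -
 have c4: "?c4 j = k" if "j < l" for j using h that by auto
 have w4: "?w4 i = l" if "i < k" for i using h that by auto
 show ?thesis using that unfolding progress_def by (simp only: c4 w4 cong: conj_cong imp_cong all_cong) (use c4 w4 in auto)
 qed
 let ?T = "4 + ((8 + skew_cost hl hk (moved (%j i. pos (0 + j) (0 + i)) hl hk)) +
 ((8 + skew_cost (l - hl) hk (moved (%j i. pos (hl + j) (0 + i)) (l - hl) hk)) +
 ((8 + skew_cost hl (k - hk) (moved (%j i. pos (0 + j) (hk + i)) hl (k - hk))) +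
 (8 + skew_cost (l - hl) (k - hk) (moved (%j i. pos (hl + j) (hk + i)) (l - hl) (k - hk))))))"
 have full0: "sq ?S ?I ?T ?fr ((''hl'' ::= Half (V ''l'');; ''hk'' ::= Half (V ''k''));;
 (Call SkewTranspose [V ''C'', V ''E'', V ''hl'', V ''P'', V ''W'', V ''hk''];;
 (Call SkewTranspose [V ''C'' \<oplus> V ''hl'', V ''E'' \<oplus> V ''hl'', V ''l'' \<ominus> V ''hl'', V ''P'', V ''W'', V ''hk''];;
 (Call SkewTranspose [V ''C'', V ''E'', V ''hl'', V ''P'' \<oplus> V ''hk'', V ''W'' \<oplus> V ''hk'', V ''k'' \<ominus> V ''hk''];;
 Call SkewTranspose [V ''C'' \<oplus> V ''hl'', V ''E'' \<oplus> V ''hl'', V ''l'' \<ominus> V ''hl'', V ''P'' \<oplus> V ''hk'', V ''W'' \<oplus> V ''hk'', V ''k'' \<ominus> V ''hk''])))) H (s + 10)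
 (%H' sp'. VV H' sp' & ?PR H' ?c4 ?w4)"
 by (rule sq_Seq, rule st0, rule sq_Seq, erule st1, rule sq_Seq, erule st2, rule sq_Seq, erule st3, erule st4)
 have full: "sq ?S ?I (4 + ?T) ?fr (body SkewTranspose_proc) H (s + 10) (%H' sp'. ?PR H' (%_. k) (%_. l))"
 unfolding sq_def ae_Skew_body skew_code_def ae_Cond
 unfolding if_not_P[of "bval ?fr H ?cond", OF iffD2[OF arg_cong[OF cond, of Not] False]]
 proof (rule ae_mono[OF full0[unfolded sq_def]], elim conjE)
 fix H' sp' t assume *: "strm ?S ?I (ptrs H) t (ptrs H')" "real (cst t) <= ?T" "?PR H' ?c4 ?w4"
 have st1: "strm ?S ?I (ptrs H) (bval_acc ?fr H ?cond) (ptrs H)"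
 by (rule strm_static) (use fr acc in auto)
 have "cst (bval_acc ?fr H ?cond) <= 4" by (rule cst_local[OF acc]) (use Bb in simp)
 hence "real (cst (bval_acc ?fr H ?cond @ t)) <= 4 + ?T"
 using cst_append[of "bval_acc ?fr H ?cond" t] *(2) by linarith
 thus "strm ?S ?I (ptrs H) (bval_acc ?fr H ?cond @ t) (ptrs H') &
 real (cst (bval_acc ?fr H ?cond @ t)) <= 4 + ?T & ?PR H' (%_. k) (%_. l)"
 using last[OF *(3)] strm_append[OF st1 *(1)] by blast
 qed
 show ?thesis
 \<comment> \<open>The recursion has established correctness and the stream. If the pointers fit,
   the added-up cost is replaced by the cost of that single stream.\<close>
 proof (cases "16 * (l + k) <= B")
 case True
 have "ae ?fr (body SkewTranspose_proc) H (s + 10) (%H' sp' t. ?PR H' (%_. k) (%_. l) &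
 strm ?S ?I (ptrs H) t (ptrs H'))"
 by (rule ae_mono[OF full[unfolded sq_def]]) blast
 thus ?thesis by (intro sq_small_skew[OF g True]) (use init in auto)
 next
 case big: False
 have "4 + ?T <= skew_cost l k ?e"
 using skew_cost_rec[OF big lk hl_def hk_def moved_split[of hl l hk k pos]] h by simp
 thus ?thesis by (rule sq_mono[OF full])
 qed
 qed
qed

end

section \<open>The parts of SquareSort\<close>

lemma frame_SquareSort [simp]:
 "frame SquareSort_proc s ''A'' = s" "frame SquareSort_proc s ''D'' = s + 1"
 "frame SquareSort_proc s ''n'' = s + 2" "frame SquareSort_proc s ''m'' = s + 3"
 "frame SquareSort_proc s ''i'' = s + 4" "frame SquareSort_proc s ''j'' = s + 5"
 "frame SquareSort_proc s ''x'' = s + 6" "frame SquareSort_proc s ''s'' = s + 7"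
 "frame SquareSort_proc s ''e'' = s + 8" "frame SquareSort_proc s ''ok'' = s + 9"
 "frame SquareSort_proc s ''pivots'' = s + 10" "frame SquareSort_proc s ''bs'' = s + 11"
 "frame SquareSort_proc s ''C'' = s + 12" "frame SquareSort_proc s ''E'' = s + 13"
 "frame SquareSort_proc s ''W'' = s + 14" "length (frame_vars SquareSort_proc) = 15"
 by (simp_all add: frame_def frame_vars_def SquareSort_proc_def)

section \<open>Loops that scan arrays\<close>

definition min_loop :: com where
 "min_loop = WHILE V ''i'' \<prec> V ''n'' DO (
 ''x'' ::= MinE (V ''x'') ((V ''D'')[[V ''i'']]);;
 ''i'' ::= V ''i'' \<oplus> N 1)"

definition check_loop :: com where
 "check_loop = WHILE V ''i'' \<prec> V ''m'' DO (
 (IF (V ''pivots'')[[V ''i'']] \<doteq> V ''x'' OR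
 (V ''pivots'')[[V ''i'']] \<doteq> (V ''pivots'')[[V ''i'' \<ominus> N 1]]
 THEN ''ok'' ::= N 0 ELSE SKIP);;
 ''i'' ::= V ''i'' \<oplus> N 1)"

definition zero_loop :: com where
 "zero_loop = WHILE V ''i'' \<prec> V ''m'' \<oplus> N 1 DO (
 V ''bs'' \<oplus> V ''i'' :*= N 0;;
 ''i'' ::= V ''i'' \<oplus> N 1)"

definition prefix_loop :: com where
 "prefix_loop = WHILE V ''i'' \<prec> V ''m'' \<oplus> N 1 DO (
 V ''bs'' \<oplus> V ''i'' :*= (V ''bs'')[[V ''i'']] \<oplus> (V ''bs'')[[V ''i'' \<ominus> N 1]];;
 ''i'' ::= V ''i'' \<oplus> N 1)"

definition start_loop :: com where
 "start_loop = WHILE V ''i'' \<prec> V ''m'' DO (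
 V ''C'' \<oplus> V ''i'' :*= V ''D'' \<oplus> MinE (V ''i'' \<odot> V ''m'') (V ''n'');;
 V ''E'' \<oplus> V ''i'' :*= V ''D'' \<oplus> MinE ((V ''i'' \<oplus> N 1) \<odot> V ''m'') (V ''n'');;
 V ''W'' \<oplus> V ''i'' :*= V ''A'' \<oplus> (V ''bs'')[[V ''i'']];;
 ''i'' ::= V ''i'' \<oplus> N 1)"

context cache
begin

lemma aq_static:
 assumes "ae fr c H sp (%H' sp' t. addrs t <= S & Q H' sp')" "finite S" "card (blocks B S) <= b" "b <= K" "S <= U"
 shows "aq U (2 * real b) fr c H sp Q"
 unfolding aq_def
proof (rule ae_mono[OF assms(1)])
 fix H' sp' t assume *: "addrs t <= S & Q H' sp'"
 have "cst t <= 2 * card (blocks B S)" by (rule cst_static) (use * assms in auto)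
 thus "addrs t <= U & real (cst t) <= 2 * real b & Q H' sp'"
 using * assms(3,5) by (auto simp flip: of_nat_mult)
qed

lemma card_blocks_frame: "card (blocks B ({s..s + 14} Un set xs)) <= 2 + length xs"
proof -
 have "card (blocks B {s..s + 14}) <= 2" by (rule card_blocks_short) (use B_large in simp)
 moreover have "card (blocks B (set xs)) <= card (set xs)" unfolding blocks_def by (rule card_image_le) simp
 moreover have "card (set xs) <= length xs" by (rule card_length)
 ultimately show ?thesis using card_blocks_Un[of B "{s..s + 14}" "set xs"] by linarith
qed

lemma aq_frame:
 assumes "ae fr c H sp (%H' sp' t. addrs t <= {s..s + 14} Un set xs & Q H' sp')"
 "{s..s + 14} Un set xs <= U" "length xs <= 10"
 shows "aq U (4 + 2 * real (length xs)) fr c H sp Q"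
proof -
 have "aq U (2 * real (2 + length xs)) fr c H sp Q"
 by (rule aq_static[OF assms(1) _ card_blocks_frame _ assms(2)]) (use assms(3) B_large K_ge_B in auto)
 thus ?thesis by simp
qed

text \<open>\<open>fs\<close> lists the visited addresses as functions of the loop index. None of
  them ever decreases, so the loop is a stream with one pointer for each function; the constant 4
  pays for the two blocks of the frame.\<close>

lemma aq_scan:
 fixes P :: "nat => mem => bool" and fs :: "(nat => addr) list"
 assumes init: "P lo H" "lo <= hi"
 and step: "!!i H'. lo <= i ==> i < hi ==> P i H' ==> bval fr H' b & addrs (bval_acc fr H' b) <= {s..s + 14} &
 ae fr c H' sp (%H'' sp' t. sp' = sp & P (Suc i) H'' & addrs t <= {s..s + 14} Un set (map (%f. f i) fs))"
 and exit: "!!H'. P hi H' ==> ~ bval fr H' b & addrs (bval_acc fr H' b) <= {s..s + 14}"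
 and fs: "!!f i. f \<in> set fs ==> lo <= i ==> i < hi ==> f i <= f (Suc i)" "length fs <= 10"
 "!!f. f \<in> set fs ==> {f lo..f hi} <= U" "{s..s + 14} <= U"
 and e: "sum_list (map (%f. f hi - f lo) fs) <= e"
 shows "aq U (4 + 4 * real (length fs) + 2 * real_of_int e / B) fr (WHILE b DO c) H sp (%H' sp'. sp' = sp & P hi H')"
proof -
 let ?S = "{s..s + 14}" and ?I = "{..<length fs}"
 let ?c = "%i p. (fs ! p) i"
 have "set fs = (!) fs ` ?I" by (auto simp: set_conv_nth)
 hence img: "?c i ` ?I = set (map (%f. f i) fs)" for i
 by (simp add: image_image)
 have loop: "ae fr (WHILE b DO c) H' sp (%H'' sp' t. (sp' = sp & P hi H'') & strm ?S ?I (?c i) t (?c hi))"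
 if "lo <= i" "i <= hi" "P i H'" for i H'
 using that
 proof (induction "hi - i" arbitrary: i H' rule: less_induct)
 case less
 show ?case
 proof (cases "i = hi")
 case True
 hence ex: "~ bval fr H' b" "addrs (bval_acc fr H' b) <= ?S" using exit less.prems by auto
 have "strm ?S ?I (?c hi) (bval_acc fr H' b) (?c hi)" by (rule strm_static) (use ex in auto)
 thus ?thesis by (subst ae_While_unfold) (use ex True less.prems in auto)
 next
 case False
 hence i: "lo <= i" "i < hi" using less.prems by auto
 note st = step[OF i less.prems(3)]
 have "ae fr c H' sp (%H1 sp1 t1. ae fr (WHILE b DO c) H1 sp1 (%H'' sp' t2.
 (sp' = sp & P hi H'') & strm ?S ?I (?c i) (bval_acc fr H' b @ t1 @ t2) (?c hi)))"
 proof (rule ae_mono[OF st[THEN conjunct2, THEN conjunct2]], elim conjE)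
 fix H1 sp1 t1 assume *: "sp1 = sp" "P (Suc i) H1" "addrs t1 <= ?S Un set (map (%f. f i) fs)"
 have "addrs (bval_acc fr H' b @ t1) <= ?S Un ?c i ` ?I"
 unfolding img using * st by (auto simp: image_Un)
 hence s1: "strm ?S ?I (?c i) (bval_acc fr H' b @ t1) (?c (Suc i))"
 by (rule strm_step[rotated]) (use fs(1)[OF _ i] in auto)
 have "ae fr (WHILE b DO c) H1 sp (%H'' sp' t. (sp' = sp & P hi H'') & strm ?S ?I (?c (Suc i)) t (?c hi))"
 by (rule less.hyps) (use i * in auto)
 thus "ae fr (WHILE b DO c) H1 sp1 (%H'' sp' t2.
 (sp' = sp & P hi H'') & strm ?S ?I (?c i) (bval_acc fr H' b @ t1 @ t2) (?c hi))"
 unfolding *(1) by (rule ae_mono) (use strm_append[OF s1] in auto)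
 qed
 thus ?thesis by (subst ae_While_unfold) (use st in simp)
 qed
 qed
 have sum: "(\<Sum>p\<in>?I. ?c hi p - ?c lo p) <= e"
 using e by (simp add: sum_list_sum_nth atLeast0LessThan)
 have b2: "card (blocks B ?S) <= 2" by (rule card_blocks_short) (use B_large in simp)
 have "aq U (2 * real 2 + 4 * real (card ?I) + 2 * real_of_int e / real B) fr (WHILE b DO c) H sp (%H' sp'. sp' = sp & P hi H')"
 by (rule aq_streaming[OF loop[OF order_refl init(2,1)]])
 (use b2 sum fs B_large K_ge_B in \<open>auto simp del: atLeastatMost_subset_iff\<close>)
 thus ?thesis by simp
qed

lemma min_loop_aq:
 assumes v: "H (s + 1) = Fin d" "H (s + 2) = Fin (int n)" and n: "1 <= n" "d + int n <= s"
 and U: "{s..s + 14} <= U" "{d..d + int n} <= U"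
 shows "aq U (14 + 2 * real n / B) (frame SquareSort_proc s)
 ((''x'' ::= (V ''D'')[[N 0]];; ''i'' ::= N 1);; min_loop) H sp
 (%H' sp'. sp' = sp & H' (s + 6) = Min (H ` {d..<d + int n}) & (ALL z. z ~= s + 4 --> z ~= s + 6 --> H' z = H z))"
proof -
 let ?fr = "frame SquareSort_proc s"
 define P where "P i H' \<longleftrightarrow> H' (s + 4) = Fin (int i) & H' (s + 6) = Min (set (arr H d i)) &
 (ALL z. z ~= s + 4 --> z ~= s + 6 --> H' z = H z)" for i H'
 have st1: "aq U (4 + 2 * real (length [d])) ?fr (''x'' ::= (V ''D'')[[N 0]];; ''i'' ::= N 1) H sp
 (%H' sp'. sp' = sp & P 1 H')"
 by (rule aq_frame[where s = s]) (use v n U in \<open>auto simp: ae_simps P_def arr_Suc\<close>)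
 have st2: "aq U (4 + 4 * real (length [%i. d + int i]) + 2 * real_of_int (int n) / B) ?fr min_loop H1 sp1
 (%H' sp'. sp' = sp & P n H')" if "sp1 = sp & P 1 H1" for H1 sp1
 unfolding min_loop_def that[THEN conjunct1]
 proof (rule aq_scan[where P = P and lo = 1 and hi = n and s = s])
 show "P 1 H1" using that by simp
 fix i H' assume i: "1 <= i" "i < n" and Pi: "P i H'"
 have v': "H' (s + 1) = Fin d" "H' (s + 2) = Fin (int n)" "H' (d + int i) = H (d + int i)"
 using Pi v n i by (auto simp: P_def)
 have ne: "set (arr H d i) ~= {}" using i by (auto simp: set_arr)
 have "min (Min (set (arr H d i))) (H (d + int i)) = Min (set (arr H d (Suc i)))"
 using ne by (simp add: arr_Suc Min_insert min.commute)
 thus "bval ?fr H' (V ''i'' \<prec> V ''n'') & addrs (bval_acc ?fr H' (V ''i'' \<prec> V ''n'')) <= {s..s + 14} &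
 ae ?fr (''x'' ::= MinE (V ''x'') ((V ''D'')[[V ''i'']]);; ''i'' ::= V ''i'' \<oplus> N 1) H' sp
 (%H'' sp' t. sp' = sp & P (Suc i) H'' & addrs t <= {s..s + 14} Un set (map (%f. f i) [%i. d + int i]))"
 using v' Pi i by (auto simp: ae_simps P_def)
 next
 fix H' assume "P n H'"
 thus "~ bval ?fr H' (V ''i'' \<prec> V ''n'') & addrs (bval_acc ?fr H' (V ''i'' \<prec> V ''n'')) <= {s..s + 14}"
 using v by (auto simp: P_def)
 qed (use n U in auto)
 have "aq U (4 + 2 * real (length [d]) + (4 + 4 * real (length [%i::nat. d + int i]) + 2 * real_of_int (int n) / B)) ?fr
 ((''x'' ::= (V ''D'')[[N 0]];; ''i'' ::= N 1);; min_loop) H sp (%H' sp'. sp' = sp & P n H')"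
 by (rule aq_Seq, rule st1, erule st2)
 thus ?thesis by (rule aq_mono) (auto simp: P_def set_arr)
qed

lemma check_loop_aq:
 assumes v: "H (s + 3) = Fin (int m)" "H (s + 10) = Fin pv" "H (s + 9) = Fin 1" "H (s + 4) = Fin 1"
 and m: "1 <= m" "s + 15 <= pv"
 and U: "{s..s + 14} <= U" "{pv..pv + int m} <= U"
 shows "aq U (12 + 4 * real m / B) (frame SquareSort_proc s) check_loop H sp
 (%H' sp'. sp' = sp & H' (s + 9) = Fin (if ALL q. 1 <= q --> q < m --> H (pv + int q) ~= H (s + 6) &
 H (pv + int q) ~= H (pv + int q - 1) then 1 else 0) & (ALL z. z ~= s + 4 --> z ~= s + 9 --> H' z = H z))"
proof -
 let ?fr = "frame SquareSort_proc s"
 let ?ok = "%i. ALL q. 1 <= q --> q < i --> H (pv + int q) ~= H (s + 6) & H (pv + int q) ~= H (pv + int q - 1)"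
 define P where "P i H' \<longleftrightarrow> H' (s + 4) = Fin (int i) & H' (s + 9) = Fin (if ?ok i then 1 else 0) &
 (ALL z. z ~= s + 4 --> z ~= s + 9 --> H' z = H z)" for i H'
 \<comment> \<open>The comparison of neighbours takes a second pointer that trails by one
   cell.\<close>
 let ?fs = "[%i. pv + int i, %i. pv + int i - 1]"
 have "aq U (4 + 4 * real (length ?fs) + 2 * real_of_int (2 * int m) / B) ?fr check_loop H sp (%H' sp'. sp' = sp & P m H')"
 unfolding check_loop_def
 proof (rule aq_scan[where P = P and lo = 1 and hi = m and s = s])
 show "P 1 H" using v by (auto simp: P_def)
 fix i H' assume i: "1 <= i" "i < m" and Pi: "P i H'"
 have v': "H' (s + 3) = Fin (int m)" "H' (s + 10) = Fin pv" "H' (s + 6) = H (s + 6)"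
 "H' (pv + int i) = H (pv + int i)" "H' (pv + int i - 1) = H (pv + int i - 1)" "H' (pv + (int i - 1)) = H (pv + int i - 1)"
 using Pi v m i by (auto simp: P_def algebra_simps)
 have okS: "?ok (Suc i) \<longleftrightarrow> ?ok i & H (pv + int i) ~= H (s + 6) & H (pv + int i) ~= H (pv + int i - 1)"
 using i by (auto simp: less_Suc_eq)
 let ?b = "(V ''pivots'')[[V ''i'']] \<doteq> V ''x'' OR (V ''pivots'')[[V ''i'']] \<doteq> (V ''pivots'')[[V ''i'' \<ominus> N 1]]"
 have b: "bval ?fr H' ?b \<longleftrightarrow> ~ (H (pv + int i) ~= H (s + 6) & H (pv + int i) ~= H (pv + int i - 1))"
 using v' Pi by (auto simp: P_def)
 have ab: "addrs (bval_acc ?fr H' ?b) <= {s..s + 14} Un set (map (%f. f i) ?fs)"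
 using v' Pi by (auto simp: P_def)
 have "ae ?fr ((IF ?b THEN ''ok'' ::= N 0 ELSE SKIP);; ''i'' ::= V ''i'' \<oplus> N 1) H' sp
 (%H'' sp' t. sp' = sp & P (Suc i) H'' & addrs t <= {s..s + 14} Un set (map (%f. f i) ?fs))"
 proof (cases "bval ?fr H' ?b")
 case True
 hence "~ ?ok (Suc i)" unfolding okS using b by simp
 thus ?thesis using v' Pi i ab unfolding ae_Seq ae_Cond if_P[OF True]
 by (auto simp del: bval_acc.simps simp: ae_simps P_def image_Un)
 next
 case False
 hence "?ok (Suc i) \<longleftrightarrow> ?ok i" unfolding okS using b by simp
 thus ?thesis using v' Pi i ab unfolding ae_Seq ae_Cond if_not_P[OF False]
 by (simp del: bval_acc.simps add: ae_simps P_def image_Un)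
 qed
 thus "bval ?fr H' (V ''i'' \<prec> V ''m'') & addrs (bval_acc ?fr H' (V ''i'' \<prec> V ''m'')) <= {s..s + 14} &
 ae ?fr ((IF ?b THEN ''ok'' ::= N 0 ELSE SKIP);; ''i'' ::= V ''i'' \<oplus> N 1) H' sp
 (%H'' sp' t. sp' = sp & P (Suc i) H'' & addrs t <= {s..s + 14} Un set (map (%f. f i) ?fs))"
 using v' Pi i by (auto simp: P_def)
 next
 fix H' assume "P m H'"
 thus "~ bval ?fr H' (V ''i'' \<prec> V ''m'') & addrs (bval_acc ?fr H' (V ''i'' \<prec> V ''m'')) <= {s..s + 14}"
 using v by (auto simp: P_def)
 next
 fix f assume f: "f \<in> set ?fs"
 have "{f 1..f m} <= {pv..pv + int m}" using f m by auto
 thus "{f 1..f m} <= U" using U by blast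
 qed (use m U in auto)
 thus ?thesis by (rule aq_mono) (auto simp: P_def)
qed

lemma zero_loop_aq:
 assumes v: "H (s + 3) = Fin (int m)" "H (s + 11) = Fin bs" "H (s + 4) = Fin 0" and bs: "s + 15 <= bs"
 and U: "{s..s + 14} <= U" "{bs..bs + int m + 1} <= U"
 shows "aq U (8 + 2 * (real m + 1) / B) (frame SquareSort_proc s) zero_loop H sp
 (%H' sp'. sp' = sp & (ALL q<=m. H' (bs + int q) = Fin 0) &
 (ALL z. z ~= s + 4 --> z ~: {bs..bs + int m} --> H' z = H z))"
proof -
 let ?fr = "frame SquareSort_proc s"
 define P where "P i H' \<longleftrightarrow> H' (s + 4) = Fin (int i) & (ALL q<i. H' (bs + int q) = Fin 0) &
 (ALL z. z ~= s + 4 --> z ~: {bs..bs + int m} --> H' z = H z)" for i H'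
 let ?fs = "[%i. bs + int i]"
 have "aq U (4 + 4 * real (length ?fs) + 2 * real_of_int (int m + 1) / B) ?fr zero_loop H sp (%H' sp'. sp' = sp & P (Suc m) H')"
 unfolding zero_loop_def
 proof (rule aq_scan[where P = P and lo = 0 and hi = "Suc m" and s = s])
 show "P 0 H" using v by (auto simp: P_def)
 fix i H' assume i: "i < Suc m" and Pi: "P i H'"
 have v': "H' (s + 3) = Fin (int m)" "H' (s + 11) = Fin bs" using Pi v bs i by (auto simp: P_def)
 show "bval ?fr H' (V ''i'' \<prec> V ''m'' \<oplus> N 1) & addrs (bval_acc ?fr H' (V ''i'' \<prec> V ''m'' \<oplus> N 1)) <= {s..s + 14} &
 ae ?fr (V ''bs'' \<oplus> V ''i'' :*= N 0;; ''i'' ::= V ''i'' \<oplus> N 1) H' sp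
 (%H'' sp' t. sp' = sp & P (Suc i) H'' & addrs t <= {s..s + 14} Un set (map (%f. f i) ?fs))"
 using v' Pi i bs by (auto simp: ae_simps P_def less_Suc_eq)
 next
 fix H' assume "P (Suc m) H'"
 thus "~ bval ?fr H' (V ''i'' \<prec> V ''m'' \<oplus> N 1) & addrs (bval_acc ?fr H' (V ''i'' \<prec> V ''m'' \<oplus> N 1)) <= {s..s + 14}"
 using v bs by (auto simp: P_def)
 qed (use U in auto)
 thus ?thesis by (rule aq_mono) (auto simp: P_def less_Suc_eq_le)
qed

lemma prefix_loop_aq:
 assumes v: "H (s + 3) = Fin (int m)" "H (s + 11) = Fin bs" "H (s + 4) = Fin 1" and bs: "s + 15 <= bs"
 and c: "!!q. q <= m ==> H (bs + int q) = Fin (cnt q)"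
 and U: "{s..s + 14} <= U" "{bs..bs + int m + 1} <= U"
 shows "aq U (12 + 4 * (real m + 1) / B) (frame SquareSort_proc s) prefix_loop H sp
 (%H' sp'. sp' = sp & (ALL q<=m. H' (bs + int q) = Fin (\<Sum>r\<le>q. cnt r)) &
 (ALL z. z ~= s + 4 --> z ~: {bs..bs + int m} --> H' z = H z))"
proof -
 let ?fr = "frame SquareSort_proc s"
 define P where "P i H' \<longleftrightarrow> H' (s + 4) = Fin (int i) & (ALL q<=m. H' (bs + int q) = Fin (if q < i then \<Sum>r\<le>q. cnt r else cnt q)) &
 (ALL z. z ~= s + 4 --> z ~: {bs..bs + int m} --> H' z = H z)" for i H'
 let ?fs = "[%i. bs + int i, %i. bs + int i - 1]"
 have "aq U (4 + 4 * real (length ?fs) + 2 * real_of_int (2 * (int m + 1)) / B) ?fr prefix_loop H sp (%H' sp'. sp' = sp & P (Suc m) H')"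
 unfolding prefix_loop_def
 proof (rule aq_scan[where P = P and lo = 1 and hi = "Suc m" and s = s])
 show "P 1 H" using v c by (auto simp: P_def)
 fix i H' assume i: "1 <= i" "i < Suc m" and Pi: "P i H'"
 have v': "H' (s + 3) = Fin (int m)" "H' (s + 11) = Fin bs" using Pi v bs i by (auto simp: P_def)
 have c1: "H' (bs + int i) = Fin (cnt i)" using Pi i by (auto simp: P_def)
 have "bs + int (i - 1) = bs + (int i - 1)" using i by simp
 moreover have "H' (bs + int (i - 1)) = Fin (\<Sum>r\<le>i - 1. cnt r)" using Pi i by (auto simp: P_def simp del: of_nat_diff)
 ultimately have c2: "H' (bs + (int i - 1)) = Fin (\<Sum>r\<le>i - 1. cnt r)" by simp
 have c3: "(\<Sum>r\<le>i. cnt r) = cnt i + (\<Sum>r\<le>i - 1. cnt r)" using i by (cases i) auto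
 show "bval ?fr H' (V ''i'' \<prec> V ''m'' \<oplus> N 1) & addrs (bval_acc ?fr H' (V ''i'' \<prec> V ''m'' \<oplus> N 1)) <= {s..s + 14} &
 ae ?fr (V ''bs'' \<oplus> V ''i'' :*= (V ''bs'')[[V ''i'']] \<oplus> (V ''bs'')[[V ''i'' \<ominus> N 1]];; ''i'' ::= V ''i'' \<oplus> N 1) H' sp
 (%H'' sp' t. sp' = sp & P (Suc i) H'' & addrs t <= {s..s + 14} Un set (map (%f. f i) ?fs))"
 using v' Pi i bs c1 c2 c3 by (auto simp: ae_simps P_def less_Suc_eq)
 next
 fix H' assume "P (Suc m) H'"
 thus "~ bval ?fr H' (V ''i'' \<prec> V ''m'' \<oplus> N 1) & addrs (bval_acc ?fr H' (V ''i'' \<prec> V ''m'' \<oplus> N 1)) <= {s..s + 14}"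
 using v bs by (auto simp: P_def)
 next
 fix f assume f: "f \<in> set ?fs"
 have "{f 1..f (Suc m)} <= {bs..bs + int m + 1}" using f by auto
 thus "{f 1..f (Suc m)} <= U" using U by blast
 qed (use U in auto)
 thus ?thesis by (rule aq_mono) (auto simp: P_def less_Suc_eq_le)
qed

lemma start_loop_aq:
 assumes v: "H s = Fin a" "H (s + 1) = Fin d" "H (s + 2) = Fin (int n)" "H (s + 3) = Fin (int m)" "H (s + 11) = Fin bs"
 "H (s + 12) = Fin Ca" "H (s + 13) = Fin (Ca + int m)" "H (s + 14) = Fin (Ca + 2 * int m)" "H (s + 4) = Fin 0"
 and lay: "s + 15 <= bs" "bs + int m < Ca"
 and c: "!!q. q <= m ==> H (bs + int q) = Fin (st q)"
 and U: "{s..s + 14} <= U" "{bs..Ca + 3 * int m} <= U"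
 shows "aq U (20 + 8 * real m / B) (frame SquareSort_proc s) start_loop H sp
 (%H' sp'. sp' = sp & (ALL q<m. H' (Ca + int q) = Fin (d + min (int (q * m)) (int n)) &
 H' (Ca + int m + int q) = Fin (d + min (int (Suc q * m)) (int n)) & H' (Ca + 2 * int m + int q) = Fin (a + st q)) &
 (ALL z. z ~= s + 4 --> z ~: {Ca..<Ca + 3 * int m} --> H' z = H z))"
proof -
 let ?fr = "frame SquareSort_proc s"
 define P where "P i H' \<longleftrightarrow> H' (s + 4) = Fin (int i) & (ALL q<i. H' (Ca + int q) = Fin (d + min (int (q * m)) (int n)) &
 H' (Ca + int m + int q) = Fin (d + min (int (Suc q * m)) (int n)) & H' (Ca + 2 * int m + int q) = Fin (a + st q)) &
 (ALL z. z ~= s + 4 --> z ~: {Ca..<Ca + 3 * int m} --> H' z = H z)" for i H'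
 let ?fs = "[%i. bs + int i, %i. Ca + int i, %i. Ca + int m + int i, %i. Ca + 2 * int m + int i]"
 have "aq U (4 + 4 * real (length ?fs) + 2 * real_of_int (4 * int m) / B) ?fr start_loop H sp (%H' sp'. sp' = sp & P m H')"
 unfolding start_loop_def
 proof (rule aq_scan[where P = P and lo = 0 and hi = m and s = s])
 show "P 0 H" using v by (auto simp: P_def)
 fix i H' assume i: "i < m" and Pi: "P i H'"
 have v': "H' s = Fin a" "H' (s + 1) = Fin d" "H' (s + 2) = Fin (int n)" "H' (s + 3) = Fin (int m)" "H' (s + 11) = Fin bs"
 "H' (s + 12) = Fin Ca" "H' (s + 13) = Fin (Ca + int m)" "H' (s + 14) = Fin (Ca + 2 * int m)" "H' (s + 4) = Fin (int i)"
 "H' (bs + int i) = Fin (st i)"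
 using Pi v lay i c[of i] by (auto simp: P_def)
 define H'' where "H'' = H'(Ca + int i := Fin (d + min (int i * int m) (int n)),
 Ca + int m + int i := Fin (d + min ((int i + 1) * int m) (int n)), Ca + 2 * int m + int i := Fin (a + st i), s + 4 := Fin (int i + 1))"
 let ?body = "V ''C'' \<oplus> V ''i'' :*= V ''D'' \<oplus> MinE (V ''i'' \<odot> V ''m'') (V ''n'');;
 V ''E'' \<oplus> V ''i'' :*= V ''D'' \<oplus> MinE ((V ''i'' \<oplus> N 1) \<odot> V ''m'') (V ''n'');;
 V ''W'' \<oplus> V ''i'' :*= V ''A'' \<oplus> (V ''bs'')[[V ''i'']];;
 ''i'' ::= V ''i'' \<oplus> N 1"
 have E: "ae ?fr ?body H' sp (%H2 sp' t. H2 = H'' & sp' = sp & addrs t <= {s..s + 14} Un set (map (%f. f i) ?fs))"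
 using v' i lay by (simp add: ae_simps H''_def)
 have "P (Suc i) H''"
 using Pi i lay unfolding P_def H''_def by (auto simp: less_Suc_eq algebra_simps)
 hence "ae ?fr ?body H' sp (%H2 sp' t. sp' = sp & P (Suc i) H2 & addrs t <= {s..s + 14} Un set (map (%f. f i) ?fs))"
 by (intro ae_mono[OF E]) blast
 thus "bval ?fr H' (V ''i'' \<prec> V ''m'') & addrs (bval_acc ?fr H' (V ''i'' \<prec> V ''m'')) <= {s..s + 14} &
 ae ?fr ?body H' sp (%H'' sp' t. sp' = sp & P (Suc i) H'' & addrs t <= {s..s + 14} Un set (map (%f. f i) ?fs))"
 using v' i by auto
 next
 fix H' assume "P m H'"
 thus "~ bval ?fr H' (V ''i'' \<prec> V ''m'') & addrs (bval_acc ?fr H' (V ''i'' \<prec> V ''m'')) <= {s..s + 14}"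
 using v lay by (auto simp: P_def)
 next
 fix f assume f: "f \<in> set ?fs"
 have "{f 0..f m} <= {bs..Ca + 3 * int m}" using f lay by auto
 thus "{f 0..f m} <= U" using U by blast
 qed (use U in auto)
 thus ?thesis by (rule aq_mono) (auto simp: P_def)
qed

end

section \<open>Direct sorting of small inputs\<close>

definition insert_loop :: com where
 "insert_loop = WHILE N 0 \<prec> V ''j'' AND V ''x'' \<prec> (V ''D'')[[V ''j'' \<ominus> N 1]] DO (
 V ''D'' \<oplus> V ''j'' :*= (V ''D'')[[V ''j'' \<ominus> N 1]];;
 ''j'' ::= V ''j'' \<ominus> N 1)"

lemma insert_loop_ae:
 assumes v: "H (s + 1) = Fin d" "H (s + 5) = Fin (int i)" and lay: "d + int i < s"
 and srt: "sorted (arr H d i)"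
 shows "ae (frame SquareSort_proc s) insert_loop H sp (%H' sp' t. sp' = sp &
 (EX j<=i. H' (s + 5) = Fin (int j) &
 (ALL q<j. H' (d + int q) = H (d + int q) & H (d + int q) <= H (s + 6)) &
 (ALL q. j <= q --> q < i --> H' (d + int (Suc q)) = H (d + int q) & H (s + 6) < H (d + int q))) &
 (ALL z. z ~= s + 5 --> z ~: {d..d + int i} --> H' z = H z) & addrs t <= {s..s + 14} Un {d..d + int i})"
proof -
 let ?fr = "frame SquareSort_proc s"
 let ?b = "N 0 \<prec> V ''j'' AND V ''x'' \<prec> (V ''D'')[[V ''j'' \<ominus> N 1]]"
 let ?body = "V ''D'' \<oplus> V ''j'' :*= (V ''D'')[[V ''j'' \<ominus> N 1]];; ''j'' ::= V ''j'' \<ominus> N 1"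
 define Inv where "Inv t H' sp' \<longleftrightarrow> sp' = sp &
 (EX j<=i. H' (s + 5) = Fin (int j) & (ALL q<j. H' (d + int q) = H (d + int q)) &
 (ALL q. j <= q --> q < i --> H' (d + int (Suc q)) = H (d + int q) & H (s + 6) < H (d + int q))) &
 (ALL z. z ~= s + 5 --> z ~: {d..d + int i} --> H' z = H z) & addrs t <= {s..s + 14} Un {d..d + int i}" for t H' sp'
 have common: "EX j<=i. sp' = sp & H' (s + 1) = Fin d & H' (s + 6) = H (s + 6) & H' (s + 5) = Fin (int j) & (ALL q<j. H' (d + int q) = H (d + int q)) &
 (ALL q. j <= q --> q < i --> H' (d + int (Suc q)) = H (d + int q) & H (s + 6) < H (d + int q)) &
 (bval ?fr H' ?b \<longleftrightarrow> 0 < j & H (s + 6) < H (d + int (j - 1))) &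
 addrs (bval_acc ?fr H' ?b) <= {s..s + 14} Un {d..d + int i}" if I: "Inv t H' sp'" for t H' sp'
 proof -
 obtain j where j: "j <= i" "H' (s + 5) = Fin (int j)" "ALL q<j. H' (d + int q) = H (d + int q)"
 "ALL q. j <= q --> q < i --> H' (d + int (Suc q)) = H (d + int q) & H (s + 6) < H (d + int q)"
 and same: "!!z. z ~= s + 5 ==> z ~: {d..d + int i} ==> H' z = H z" and sp: "sp' = sp"
 using I unfolding Inv_def by blast
 have v': "H' (s + 1) = Fin d" "H' (s + 6) = H (s + 6)" using same[of "s + 1"] same[of "s + 6"] v lay by auto
 have pj: "d + (int j - 1) = d + int (j - 1) & H' (d + int (j - 1)) = H (d + int (j - 1))" if "0 < j"
 using that j(3)[rule_format, of "j - 1"] by (simp add: of_nat_diff)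
 have "bval ?fr H' ?b \<longleftrightarrow> 0 < j & H (s + 6) < H (d + int (j - 1))"
 using v' j(2) pj by auto
 moreover have "addrs (bval_acc ?fr H' ?b) <= {s..s + 14} Un {d..d + int i}" using v' j by auto
 ultimately show ?thesis using j v' sp by blast
 qed
 show ?thesis unfolding insert_loop_def
 proof (rule ae_While[where I = Inv and \<mu> = "%H'. nat (int_of (H' (s + 5)))"])
 show "Inv [] H sp" unfolding Inv_def using v by (auto intro!: exI[of _ i])
 next
 fix t H' sp' assume I: "Inv t H' sp'" and b: "bval ?fr H' ?b"
 obtain j where j: "j <= i" "sp' = sp" "H' (s + 1) = Fin d" "H' (s + 6) = H (s + 6)" "H' (s + 5) = Fin (int j)" "!!q. q < j ==> H' (d + int q) = H (d + int q)"
 "!!q. j <= q ==> q < i ==> H' (d + int (Suc q)) = H (d + int q) & H (s + 6) < H (d + int q)"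
 and b': "0 < j" "H (s + 6) < H (d + int (j - 1))"
 and ac: "addrs (bval_acc ?fr H' ?b) <= {s..s + 14} Un {d..d + int i}"
 using common[OF I] b by blast
 have same: "!!z. z ~= s + 5 ==> z ~: {d..d + int i} ==> H' z = H z"
 and at: "addrs t <= {s..s + 14} Un {d..d + int i}" using I unfolding Inv_def by auto
 obtain k where k0: "j = Suc k" using b'(1) by (cases j) auto
 have k: "int j - 1 = int k" "int j = int k + 1" "k < i" using k0 j(1) by auto
 have xk: "H (s + 6) < H (d + int k)" using b'(2) k0 by simp
 define H'' where "H'' = H'(d + int j := H (d + int k), s + 5 := Fin (int k))"
 have E: "ae ?fr ?body H' sp' (%H2 sp2 t'. H2 = H'' & sp2 = sp & addrs t' <= {s..s + 14} Un {d..d + int i})"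
 using j(1,2,3,5) j(6)[of k] k k0 lay by (auto simp: ae_simps H''_def)
 have "H'' (s + 5) = Fin (int k)" by (simp add: H''_def)
 moreover have "H'' (d + int q) = H (d + int q)" if "q < k" for q
 using j(6)[of q] that k0 lay k(2,3) by (simp add: H''_def)
 moreover have "H'' (d + int (Suc q)) = H (d + int q) & H (s + 6) < H (d + int q)" if "k <= q" "q < i" for q
 proof (cases "q = k")
 case True
 thus ?thesis using xk k(2,3) lay by (simp add: H''_def add.commute)
 next
 case False
 hence "H' (d + int (Suc q)) = H (d + int q) & H (s + 6) < H (d + int q)" using j(7)[of q] that k0 by simp
 moreover have "d + int (Suc q) ~= d + int j" "d + int (Suc q) ~= s + 5" using False k(2) lay that by auto
 ultimately show ?thesis by (simp add: H''_def)
 qed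
 moreover have "H'' z = H z" if "z ~= s + 5" "z ~: {d..d + int i}" for z
 using same[OF that] that j(1) by (auto simp: H''_def)
 ultimately have fin: "Inv t' H'' sp" if "addrs t' <= {s..s + 14} Un {d..d + int i}" for t'
 unfolding Inv_def using that k(3) less_imp_le by blast
 show "ae ?fr ?body H' sp' (%H2 sp2 t'. Inv (t @ bval_acc ?fr H' ?b @ t') H2 sp2 &
 nat (int_of (H2 (s + 5))) < nat (int_of (H' (s + 5))))"
 proof (rule ae_mono[OF E], elim conjE)
 fix H2 sp2 t' assume *: "H2 = H''" "sp2 = sp" "addrs t' <= {s..s + 14} Un {d..d + int i}"
 have "addrs (t @ bval_acc ?fr H' ?b @ t') <= {s..s + 14} Un {d..d + int i}"
 unfolding set_append image_Un using * ac at by blast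
 from fin[OF this] * show "Inv (t @ bval_acc ?fr H' ?b @ t') H2 sp2 &
 nat (int_of (H2 (s + 5))) < nat (int_of (H' (s + 5)))"
 using j(5) k(2) by (simp add: H''_def)
 qed
 next
 fix t H' sp' assume I: "Inv t H' sp'" and b: "~ bval ?fr H' ?b"
 obtain j where j: "j <= i" "sp' = sp" "H' (s + 5) = Fin (int j)" "ALL q<j. H' (d + int q) = H (d + int q)"
 "ALL q. j <= q --> q < i --> H' (d + int (Suc q)) = H (d + int q) & H (s + 6) < H (d + int q)"
 and b': "~ (0 < j & H (s + 6) < H (d + int (j - 1)))"
 and ac: "addrs (bval_acc ?fr H' ?b) <= {s..s + 14} Un {d..d + int i}"
 using common[OF I] b by blast
 have same: "ALL z. z ~= s + 5 --> z ~: {d..d + int i} --> H' z = H z"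
 and at: "addrs t <= {s..s + 14} Un {d..d + int i}" using I unfolding Inv_def by auto
 have "H (d + int q) <= H (s + 6)" if "q < j" for q
 proof -
 have "H (d + int q) <= H (d + int (j - 1))" using sorted_arrD[OF srt, of q "j - 1"] that j(1) by simp
 thus ?thesis using b' that by (auto simp: not_less)
 qed
 hence "EX j<=i. H' (s + 5) = Fin (int j) &
 (ALL q<j. H' (d + int q) = H (d + int q) & H (d + int q) <= H (s + 6)) &
 (ALL q. j <= q --> q < i --> H' (d + int (Suc q)) = H (d + int q) & H (s + 6) < H (d + int q))"
 using j by blast
 moreover have "addrs (t @ bval_acc ?fr H' ?b) <= {s..s + 14} Un {d..d + int i}"
 unfolding set_append image_Un using ac at by blast
 ultimately show "sp' = sp &
 (EX j<=i. H' (s + 5) = Fin (int j) &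
 (ALL q<j. H' (d + int q) = H (d + int q) & H (d + int q) <= H (s + 6)) &
 (ALL q. j <= q --> q < i --> H' (d + int (Suc q)) = H (d + int q) & H (s + 6) < H (d + int q))) &
 (ALL z. z ~= s + 5 --> z ~: {d..d + int i} --> H' z = H z) &
 addrs (t @ bval_acc ?fr H' ?b) <= {s..s + 14} Un {d..d + int i}"
 using j(2) same by blast
 qed
qed

text \<open>No cost is claimed here: for \<open>n <= 16\<close> the touched cells lie in six blocks,
  and these bound the cost later.\<close>

lemma DirectSort_ae:
 assumes v: "H s = Fin a" "H (s + 1) = Fin d" "H (s + 2) = Fin (int n)"
 and lay: "a + int n <= s" "d + int n <= s" "{a..<a + int n} Int {d..<d + int n} = {}"
 shows "ae (frame SquareSort_proc s) DirectSort H sp (%H' sp' t. sp' = sp & arr H' d n = sort (arr H a n) &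
 (ALL z. z ~: {s + 3..s + 14} --> z ~: {d..<d + int n} --> H' z = H z) &
 addrs t <= {s..s + 14} Un {a..a + int n} Un {d..d + int n})"
proof -
 let ?fr = "frame SquareSort_proc s"
 let ?U = "{s..s + 14} Un {a..a + int n} Un {d..d + int n}"
 let ?b = "V ''i'' \<prec> V ''n''"
 let ?body = "''x'' ::= (V ''A'')[[V ''i'']];; ''j'' ::= V ''i'';; insert_loop;; V ''D'' \<oplus> V ''j'' :*= V ''x'';; ''i'' ::= V ''i'' \<oplus> N 1"
 define Inv where "Inv t H' sp' \<longleftrightarrow> sp' = sp & (EX i<=n. H' (s + 4) = Fin (int i) & sorted (arr H' d i) & mset (arr H' d i) = mset (arr H a i)) &
 (ALL z. z ~: {s + 3..s + 14} --> z ~: {d..<d + int n} --> H' z = H z) & addrs t <= ?U" for t H' sp'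
 have "ae ?fr (WHILE ?b DO (?body)) (H(s + 4 := Fin 0)) sp (%H' sp' t. sp' = sp & arr H' d n = sort (arr H a n) &
 (ALL z. z ~: {s + 3..s + 14} --> z ~: {d..<d + int n} --> H' z = H z) & addrs t <= ?U)"
 proof (rule ae_While[where I = Inv and \<mu> = "%H'. nat (int n - int_of (H' (s + 4)))"])
 show "Inv [] (H(s + 4 := Fin 0)) sp" unfolding Inv_def by auto
 next
 fix t H' sp' assume I: "Inv t H' sp'" and b: "bval ?fr H' ?b"
 obtain i where i: "i <= n" "sp' = sp" "H' (s + 4) = Fin (int i)" "sorted (arr H' d i)" "mset (arr H' d i) = mset (arr H a i)"
 and same: "!!z. z ~: {s + 3..s + 14} ==> z ~: {d..<d + int n} ==> H' z = H z" and at: "addrs t <= ?U"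
 using I unfolding Inv_def by blast
 have v': "H' s = Fin a" "H' (s + 1) = Fin d" "H' (s + 2) = Fin (int n)"
 using same[of s] same[of "s + 1"] same[of "s + 2"] v lay by auto
 have il: "i < n" using b v' i by simp
 have "a + int i ~: {d..<d + int n}" using lay(3) il by fastforce
 hence xi: "H' (a + int i) = H (a + int i)" using same[of "a + int i"] lay il by auto
 define H1 where "H1 = H'(s + 6 := H (a + int i), s + 5 := Fin (int i))"
 have ar1: "arr H1 d i = arr H' d i" using lay il by (intro arr_cong) (auto simp: H1_def)
 have L: "ae ?fr insert_loop H1 sp (%H' sp' t. sp' = sp &
 (EX j<=i. H' (s + 5) = Fin (int j) &
 (ALL q<j. H' (d + int q) = H1 (d + int q) & H1 (d + int q) <= H1 (s + 6)) &
 (ALL q. j <= q --> q < i --> H' (d + int (Suc q)) = H1 (d + int q) & H1 (s + 6) < H1 (d + int q))) &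
 (ALL z. z ~= s + 5 --> z ~: {d..d + int i} --> H' z = H1 z) & addrs t <= {s..s + 14} Un {d..d + int i})"
 by (rule insert_loop_ae) (use v' lay il ar1 i in \<open>auto simp: H1_def\<close>)
 let ?QQ = "%H2 sp2 t'. Inv (t @ bval_acc ?fr H' ?b @ t') H2 sp2 &
 nat (int n - int_of (H2 (s + 4))) < nat (int n - int_of (H' (s + 4)))"
 show "ae ?fr (?body) H' sp' ?QQ"
 proof -
 have E1: "ae ?fr (''x'' ::= (V ''A'')[[V ''i'']];; ''j'' ::= V ''i'') H' sp' (%H2 sp2 t. H2 = H1 & sp2 = sp & addrs t <= ?U)"
 using v' i xi il by (auto simp: ae_simps H1_def)
 have "ae ?fr ((''x'' ::= (V ''A'')[[V ''i'']];; ''j'' ::= V ''i'');; (insert_loop;; (V ''D'' \<oplus> V ''j'' :*= V ''x'';; ''i'' ::= V ''i'' \<oplus> N 1))) H' sp' ?QQ"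
 proof (rule ae_Seq_rule[OF E1])
 fix H2 sp2 t2 assume t2: "H2 = H1 & sp2 = sp & addrs t2 <= ?U"
 show "ae ?fr (insert_loop;; (V ''D'' \<oplus> V ''j'' :*= V ''x'';; ''i'' ::= V ''i'' \<oplus> N 1)) H2 sp2 (%H3 sp3 t3. ?QQ H3 sp3 (t2 @ t3))"
 unfolding t2[THEN conjunct1] t2[THEN conjunct2, THEN conjunct1]
 proof (rule ae_Seq_rule[OF L])
 fix H3 sp3 t3 assume L3: "sp3 = sp &
 (EX j<=i. H3 (s + 5) = Fin (int j) &
 (ALL q<j. H3 (d + int q) = H1 (d + int q) & H1 (d + int q) <= H1 (s + 6)) &
 (ALL q. j <= q --> q < i --> H3 (d + int (Suc q)) = H1 (d + int q) & H1 (s + 6) < H1 (d + int q))) &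
 (ALL z. z ~= s + 5 --> z ~: {d..d + int i} --> H3 z = H1 z) & addrs t3 <= {s..s + 14} Un {d..d + int i}"
 then obtain j where j: "j <= i" "H3 (s + 5) = Fin (int j)"
 "!!q. q < j ==> H3 (d + int q) = H1 (d + int q) & H1 (d + int q) <= H1 (s + 6)"
 "!!q. j <= q ==> q < i ==> H3 (d + int (Suc q)) = H1 (d + int q) & H1 (s + 6) < H1 (d + int q)" by blast
 have x1: "H1 (s + 6) = H (a + int i)" by (simp add: H1_def)
 have same3: "!!z. z ~= s + 5 ==> z ~: {d..d + int i} ==> H3 z = H1 z" using L3 by blast
 have v3: "H3 (s + 1) = Fin d" "H3 (s + 4) = Fin (int i)" "H3 (s + 5) = Fin (int j)" "H3 (s + 6) = H (a + int i)"
 using same3[of "s + 1"] same3[of "s + 4"] same3[of "s + 6"] j v' i lay il by (auto simp: H1_def)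
 define H4 where "H4 = H3(d + int j := H (a + int i), s + 4 := Fin (int i + 1))"
 let ?L = "arr H1 d i"
 have jj: "j <= i" using j by blast
 have "arr H4 d (Suc i) = take j ?L @ H (a + int i) # drop j ?L"
 proof (rule nth_equalityI)
 show "length (arr H4 d (Suc i)) = length (take j ?L @ H (a + int i) # drop j ?L)" using jj by simp
 fix q assume q: "q < length (arr H4 d (Suc i))"
 consider "q < j" | "q = j" | "j < q" by linarith
 thus "arr H4 d (Suc i) ! q = (take j ?L @ H (a + int i) # drop j ?L) ! q"
 proof cases
 case 1
 thus ?thesis using q jj j lay il by (auto simp: nth_append H4_def)
 next
 case 2
 thus ?thesis using q jj lay il by (auto simp: nth_append H4_def)
 next
 case 3
 then obtain r where r: "q = Suc r" "j <= r" "r < i" using q by (cases q) auto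
 have "H3 (d + int (Suc r)) = H1 (d + int r)" using j r by blast
 moreover have "H4 (d + int (Suc r)) = H3 (d + int (Suc r))" using r lay il by (auto simp: H4_def)
 ultimately show ?thesis using r q jj by (simp add: nth_append nth_Cons' Suc_diff_le)
 qed
 qed
 note a4 = this
 have sL: "sorted ?L" using ar1 i by simp
 have le: "y <= H (a + int i)" if y: "y \<in> set (take j ?L)" for y
 proof -
 obtain q where "q < length (take j ?L)" "take j ?L ! q = y" using y unfolding in_set_conv_nth by blast
 hence "q < j" "y = H1 (d + int q)" using jj by auto
 thus ?thesis using j(3)[of q] x1 by simp
 qed
 have ge: "H (a + int i) <= y" if y: "y \<in> set (drop j ?L)" for y
 proof -
 obtain q where q: "q < length (drop j ?L)" "drop j ?L ! q = y" using y unfolding in_set_conv_nth by blast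
 hence "y = H1 (d + int (j + q))" using jj by (simp del: of_nat_add)
 thus ?thesis using j(4)[of "j + q"] q jj x1 by (simp del: of_nat_add add: less_imp_le)
 qed
 have "sorted (take j ?L)" "sorted (drop j ?L)" using sL by (auto simp: sorted_wrt_take sorted_wrt_drop)
 hence s4: "sorted (arr H4 d (Suc i))" unfolding a4 sorted_append using le ge by (auto intro: order_trans)
 have "mset (arr H4 d (Suc i)) = add_mset (H (a + int i)) (mset ?L)"
 unfolding a4 by simp (metis append_take_drop_id mset_append)
 hence m4: "mset (arr H4 d (Suc i)) = mset (arr H a (Suc i))" using ar1 i by (simp add: arr_Suc)
 have same4: "H4 z = H z" if "z ~: {s + 3..s + 14}" "z ~: {d..<d + int n}" for z
 using same3[of z] same[OF that] that il jj by (auto simp: H4_def H1_def)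
 have E4: "ae ?fr (V ''D'' \<oplus> V ''j'' :*= V ''x'';; ''i'' ::= V ''i'' \<oplus> N 1) H3 sp (%H5 sp5 t5. H5 = H4 & sp5 = sp & addrs t5 <= ?U)"
 using v3 lay il jj by (auto simp: ae_simps H4_def)
 have "{d..d + int i} <= {d..d + int n}" using il by auto
 hence tt: "addrs t3 <= ?U" using L3 by blast
 have "Inv (t @ bval_acc ?fr H' ?b @ (t2 @ (t3 @ t5))) H4 sp &
 nat (int n - int_of (H4 (s + 4))) < nat (int n - int_of (H' (s + 4)))" if "addrs t5 <= ?U" for t5
 proof -
 have g: "addrs (bval_acc ?fr H' ?b) <= ?U" by simp
 have a2: "addrs t2 <= ?U" using t2 by (elim conjE)
 have "addrs (t @ bval_acc ?fr H' ?b @ (t2 @ (t3 @ t5))) <= ?U"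
 unfolding set_append image_Un by (intro Un_least g a2 at tt that)
 moreover have "H4 (s + 4) = Fin (int (Suc i))" by (simp add: H4_def)
 moreover have "Suc i <= n" using il by simp
 ultimately have "Inv (t @ bval_acc ?fr H' ?b @ (t2 @ (t3 @ t5))) H4 sp"
 unfolding Inv_def using s4 m4 same4 by blast
 moreover have "nat (int n - int_of (H4 (s + 4))) < nat (int n - int_of (H' (s + 4)))"
 using \<open>H4 (s + 4) = Fin (int (Suc i))\<close> i(3) il by simp
 ultimately show ?thesis by blast
 qed
 hence "ae ?fr (V ''D'' \<oplus> V ''j'' :*= V ''x'';; ''i'' ::= V ''i'' \<oplus> N 1) H3 sp (%H5 sp5 t5.
 Inv (t @ bval_acc ?fr H' ?b @ (t2 @ (t3 @ t5))) H5 sp5 &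
 nat (int n - int_of (H5 (s + 4))) < nat (int n - int_of (H' (s + 4))))"
 by (intro ae_mono[OF E4]) blast
 thus "ae ?fr (V ''D'' \<oplus> V ''j'' :*= V ''x'';; ''i'' ::= V ''i'' \<oplus> N 1) H3 sp3 (%H5 sp5 t5. ?QQ H5 sp5 (t2 @ (t3 @ t5)))"
 using L3 by simp
 qed
 qed
 thus ?thesis by (simp only: ae_Seq append.assoc)
 qed
 next
 fix t H' sp' assume I: "Inv t H' sp'" and b: "~ bval ?fr H' ?b"
 obtain i where i: "i <= n" "sp' = sp" "H' (s + 4) = Fin (int i)" "sorted (arr H' d i)" "mset (arr H' d i) = mset (arr H a i)"
 and same: "!!z. z ~: {s + 3..s + 14} ==> z ~: {d..<d + int n} ==> H' z = H z" and at: "addrs t <= ?U"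
 using I unfolding Inv_def by blast
 have "H' (s + 2) = Fin (int n)" using same[of "s + 2"] v lay by auto
 hence "i = n" using b i by simp
 hence "arr H' d n = sort (arr H a n)" using i properties_for_sort[of "arr H' d n" "arr H a n"] by simp
 moreover have "addrs (t @ bval_acc ?fr H' ?b) <= ?U" using at by (auto simp: image_Un)
 ultimately show "sp' = sp & arr H' d n = sort (arr H a n) &
 (ALL z. z ~: {s + 3..s + 14} --> z ~: {d..<d + int n} --> H' z = H z) & addrs (t @ bval_acc ?fr H' ?b) <= ?U"
 using i same by blast
 qed
 thus ?thesis unfolding DirectSort_def insert_loop_def[symmetric] ae_Seq ae_Assign frame_SquareSort aval.simps
 by (rule ae_mono) (auto simp: image_Un)
qed

context cache
begin

text \<open>For loops whose iterations start streams of their own, so that each iteration is charged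
  separately.\<close>

lemma aq_for:
 fixes P :: "nat => mem => bool"
 assumes init: "P lo H" "lo <= hi"
 and step: "!!i H'. lo <= i ==> i < hi ==> P i H' ==> bval fr H' b & addrs (bval_acc fr H' b) <= {s..s + 14} &
 aq U k fr c H' sp (%H'' sp'. sp' = sp & P (Suc i) H'')"
 and exit: "!!H'. P hi H' ==> ~ bval fr H' b & addrs (bval_acc fr H' b) <= {s..s + 14}"
 and U: "{s..s + 14} <= U"
 shows "aq U ((4 + k) * real (hi - lo) + 4) fr (WHILE b DO c) H sp (%H' sp'. sp' = sp & P hi H')"
proof -
 have "aq U ((4 + k) * real (hi - i) + 4) fr (WHILE b DO c) H' sp (%H'' sp'. sp' = sp & P hi H'')"
 if "lo <= i" "i <= hi" "P i H'" for i H'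
 using that
 proof (induction "hi - i" arbitrary: i H' rule: less_induct)
 case less
 show ?case
 proof (cases "i = hi")
 case True
 hence ex: "~ bval fr H' b" "addrs (bval_acc fr H' b) <= {s..s + 14}" using exit less.prems by auto
 hence "cst (bval_acc fr H' b) <= 4" using cst_local[of _ s "s + 14"] B_large by simp
 thus ?thesis unfolding aq_def using ex True less.prems U by (subst ae_While_unfold) auto
 next
 case False
 hence i: "lo <= i" "i < hi" using less.prems by auto
 note st = step[OF i less.prems(3)]
 have g: "cst (bval_acc fr H' b) <= 4" using st cst_local[of _ s "s + 14"] B_large by simp
 have ga: "addrs (bval_acc fr H' b) <= U" using st U by blast
 have hi: "real (hi - i) = real (hi - Suc i) + 1" using i by (simp add: of_nat_diff)
 have "ae fr c H' sp (%H1 sp1 t1. ae fr (WHILE b DO c) H1 sp1 (%H'' sp' t2.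
 addrs (bval_acc fr H' b @ t1 @ t2) <= U & real (cst (bval_acc fr H' b @ t1 @ t2)) <= (4 + k) * real (hi - i) + 4 & sp' = sp & P hi H''))"
 proof (rule ae_mono[OF st[THEN conjunct2, THEN conjunct2, unfolded aq_def]], elim conjE)
 fix H1 sp1 t1 assume *: "addrs t1 <= U" "real (cst t1) <= k" "sp1 = sp" "P (Suc i) H1"
 have "aq U ((4 + k) * real (hi - Suc i) + 4) fr (WHILE b DO c) H1 sp (%H'' sp'. sp' = sp & P hi H'')"
 by (rule less.hyps) (use i * in auto)
 thus "ae fr (WHILE b DO c) H1 sp1 (%H'' sp' t2.
 addrs (bval_acc fr H' b @ t1 @ t2) <= U & real (cst (bval_acc fr H' b @ t1 @ t2)) <= (4 + k) * real (hi - i) + 4 & sp' = sp & P hi H'')"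
 unfolding *(3) aq_def
 proof (rule ae_mono, elim conjE)
 fix H'' sp' t2 assume **: "addrs t2 <= U" "real (cst t2) <= (4 + k) * real (hi - Suc i) + 4" "sp' = sp" "P hi H''"
 have "cst (bval_acc fr H' b @ t1 @ t2) <= 4 + (cst t1 + cst t2)"
 using cst_append[of "bval_acc fr H' b" "t1 @ t2"] cst_append[of t1 t2] g by linarith
 hence "real (cst (bval_acc fr H' b @ t1 @ t2)) <= 4 + (real (cst t1) + real (cst t2))" by linarith
 also have "... <= 4 + (k + ((4 + k) * real (hi - Suc i) + 4))" by (intro add_mono order_refl *(2) **(2))
 also have "... = (4 + k) * real (hi - i) + 4" unfolding hi by (simp add: algebra_simps)
 finally show "addrs (bval_acc fr H' b @ t1 @ t2) <= U & real (cst (bval_acc fr H' b @ t1 @ t2)) <= (4 + k) * real (hi - i) + 4 & sp' = sp & P hi H''"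
 using * ** ga by (simp add: image_Un)
 qed
 qed
 thus ?thesis unfolding aq_def by (subst ae_While_unfold) (use st in simp)
 qed
 qed
 from this[OF order_refl init(2,1)] show ?thesis .
qed

end

section \<open>Counting the sizes of the buckets\<close>

text \<open>Bucket \<open>i\<close> is bounded by the pivots \<open>i - 1\<close> and
  \<open>i\<close>, numbered from 1 as in the array \<open>bs\<close>; the test \<open>0 < i\<close>
  keeps entry 0 at zero, where the prefix sums begin.\<close>

definition bucket_count :: "(nat => cell) => (nat => cell) => nat => nat => nat" where
 "bucket_count p f i q = card {q'. q' < q & 0 < i & p (i - 1) <= f q' & f q' < p i}"

lemma bucket_count_Suc:
 "bucket_count p f i (Suc q) = bucket_count p f i q + (if 0 < i & p (i - 1) <= f q & f q < p i then 1 else 0)"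
proof -
 have eq: "{q'. q' < Suc q & 0 < i & p (i - 1) <= f q' & f q' < p i} =
 {q'. q' < q & 0 < i & p (i - 1) <= f q' & f q' < p i} Un (if 0 < i & p (i - 1) <= f q & f q < p i then {q} else {})"
 by (auto simp: less_Suc_eq)
 show ?thesis unfolding bucket_count_def eq by (subst card_Un_disjoint) auto
qed

lemma bucket_count_0 [simp]: "bucket_count p f 0 q = 0" "bucket_count p f i 0 = 0"
 by (auto simp: bucket_count_def)

text \<open>The pivots increase and no item lies below \<open>p 0\<close>, so the buckets up to
  \<open>k\<close> partition the items below pivot \<open>k\<close>.\<close>

lemma bucket_count_sum:
 assumes "!!i. i < k ==> p i <= p (Suc i)" "!!q. q < n ==> p 0 <= f q"
 shows "(\<Sum>i\<le>k. bucket_count p f i n) = card {q. q < n & f q < p k}"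
 using assms(1)
proof (induction k)
 case 0
 have "{q. q < n & f q < p 0} = {}" using assms(2) by (auto simp flip: not_le)
 hence "card {q. q < n & f q < p 0} = 0" by (simp only: card.empty)
 thus ?case by (simp only: atMost_0 sum.insert sum.empty finite.emptyI empty_iff bucket_count_0 not_False_eq_True add_0_right)
next
 case (Suc k)
 have "{q. q < n & f q < p (Suc k)} = {q. q < n & f q < p k} Un {q. q < n & 0 < Suc k & p (Suc k - 1) <= f q & f q < p (Suc k)}"
 using Suc.prems[of k] by (auto simp: not_less)
 moreover have "{q. q < n & f q < p k} Int {q. q < n & 0 < Suc k & p (Suc k - 1) <= f q & f q < p (Suc k)} = {}" by auto
 ultimately have "card {q. q < n & f q < p (Suc k)} = card {q. q < n & f q < p k} + bucket_count p f (Suc k) n"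
 unfolding bucket_count_def by (simp add: card_Un_disjoint)
 thus ?case using Suc by simp
qed

definition advance_loop :: com where
 "advance_loop = WHILE NotB ((V ''D'')[[V ''s'']] \<prec> (V ''pivots'')[[V ''i'']]) DO ''i'' ::= V ''i'' \<oplus> N 1"

definition count_loop :: com where
 "count_loop = WHILE V ''s'' \<prec> V ''e'' DO (
 advance_loop;;
 V ''bs'' \<oplus> V ''i'' :*= (V ''bs'')[[V ''i'']] \<oplus> N 1;;
 ''s'' ::= V ''s'' \<oplus> N 1)"

text \<open>The last pivot exceeds the item, so the search stops at \<open>m\<close> at the latest.
  The pointer into \<open>bs\<close> moves along with the pivot pointer, so that the streams of
  successive items can be joined.\<close>

lemma advance_loop_ae:
 assumes v: "H (s + 1) = Fin d" "H (s + 10) = Fin pv" "H (s + 7) = Fin (int q)" "H (s + 4) = Fin (int i)"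
 and lay: "d + int q < s" "s + 15 <= pv" "1 <= i" "i <= m"
 and p: "H (pv + int (i - 1)) <= H (d + int q)" "H (d + int q) < H (pv + int m)"
 shows "ae (frame SquareSort_proc s) advance_loop H sp (%H' sp' t. sp' = sp & (EX i'. i <= i' & i' <= m &
 H' = H(s + 4 := Fin (int i')) & H (pv + int (i' - 1)) <= H (d + int q) & H (d + int q) < H (pv + int i') &
 strm {s..s + 14} {0::nat, 1, 2} (ptr3 (d + int q) (pv + int i) (bs + int i)) t (ptr3 (d + int q) (pv + int i') (bs + int i'))))"
proof -
 let ?fr = "frame SquareSort_proc s"
 let ?b = "NotB ((V ''D'')[[V ''s'']] \<prec> (V ''pivots'')[[V ''i'']])"
 let ?S = "{s..s + 14}" and ?I = "{0::nat, 1, 2}"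
 define Inv where "Inv t H' sp' \<longleftrightarrow> sp' = sp & (EX i'. i <= i' & i' <= m &
 H' = H(s + 4 := Fin (int i')) & H (pv + int (i' - 1)) <= H (d + int q) &
 strm ?S ?I (ptr3 (d + int q) (pv + int i) (bs + int i)) t (ptr3 (d + int q) (pv + int i') (bs + int i')))" for t H' sp'
 show ?thesis unfolding advance_loop_def
 proof (rule ae_While[where I = Inv and \<mu> = "%H'. nat (int m - int_of (H' (s + 4)))"])
 have "H = H(s + 4 := Fin (int i))" using v by auto
 thus "Inv [] H sp" unfolding Inv_def using lay p by (intro conjI exI[of _ i] refl) (auto intro: strm.stop)
 next
 fix t H' sp' assume I: "Inv t H' sp'" and b: "bval ?fr H' ?b"
 obtain k where k: "i <= k" "k <= m" "H' = H(s + 4 := Fin (int k))" "H (pv + int (k - 1)) <= H (d + int q)"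
 and st: "strm ?S ?I (ptr3 (d + int q) (pv + int i) (bs + int i)) t (ptr3 (d + int q) (pv + int k) (bs + int k))"
 and sp: "sp' = sp" using I unfolding Inv_def by blast
 have le: "H (pv + int k) <= H (d + int q)" using b k v lay by (auto simp: not_less)
 hence km: "k < m" using p(2) k(2) by (cases "k = m") auto
 have E: "ae ?fr (''i'' ::= V ''i'' \<oplus> N 1) H' sp' (%H2 sp2 t'. H2 = H(s + 4 := Fin (int (Suc k))) & sp2 = sp & addrs t' <= ?S)"
 using k sp by (auto simp: ae_simps)
 have ba: "addrs (bval_acc ?fr H' ?b) <= ?S Un {d + int q, pv + int k}" using k v lay by auto
 show "ae ?fr (''i'' ::= V ''i'' \<oplus> N 1) H' sp' (%H2 sp2 t'. Inv (t @ bval_acc ?fr H' ?b @ t') H2 sp2 &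
 nat (int m - int_of (H2 (s + 4))) < nat (int m - int_of (H' (s + 4))))"
 proof (rule ae_mono[OF E], elim conjE)
 fix H2 sp2 t' assume *: "H2 = H(s + 4 := Fin (int (Suc k)))" "sp2 = sp" "addrs t' <= ?S"
 have "addrs (bval_acc ?fr H' ?b @ t') <= ?S Un ptr3 (d + int q) (pv + int k) (bs + int k) ` ?I"
 unfolding image_ptr3 set_append image_Un by (rule Un_least) (use ba * in blast)+
 hence "strm ?S ?I (ptr3 (d + int q) (pv + int k) (bs + int k)) (bval_acc ?fr H' ?b @ t')
 (ptr3 (d + int q) (pv + int (Suc k)) (bs + int (Suc k)))" by (rule strm_step[rotated]) auto
 note s2 = strm_append[OF st this]
 have "Inv (t @ bval_acc ?fr H' ?b @ t') H2 sp2" unfolding Inv_def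
 by (intro conjI exI[of _ "Suc k"]) (use * k km le s2 in simp_all)
 thus "Inv (t @ bval_acc ?fr H' ?b @ t') H2 sp2 &
 nat (int m - int_of (H2 (s + 4))) < nat (int m - int_of (H' (s + 4)))" using * k km by simp
 qed
 next
 fix t H' sp' assume I: "Inv t H' sp'" and b: "~ bval ?fr H' ?b"
 obtain k where k: "i <= k" "k <= m" "H' = H(s + 4 := Fin (int k))" "H (pv + int (k - 1)) <= H (d + int q)"
 and st: "strm ?S ?I (ptr3 (d + int q) (pv + int i) (bs + int i)) t (ptr3 (d + int q) (pv + int k) (bs + int k))"
 and sp: "sp' = sp" using I unfolding Inv_def by blast
 have lt: "H (d + int q) < H (pv + int k)" using b k v lay by auto
 have ba: "addrs (bval_acc ?fr H' ?b) <= ?S Un {d + int q, pv + int k}" using k v lay by auto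
 have "strm ?S ?I (ptr3 (d + int q) (pv + int k) (bs + int k)) (bval_acc ?fr H' ?b) (ptr3 (d + int q) (pv + int k) (bs + int k))"
 proof (rule strm_static)
 show "addrs (bval_acc ?fr H' ?b) <= ?S Un ptr3 (d + int q) (pv + int k) (bs + int k) ` ?I"
 unfolding image_ptr3 using ba by blast
 qed
 from strm_append[OF st this] show "sp' = sp & (EX i'. i <= i' & i' <= m &
 H' = H(s + 4 := Fin (int i')) & H (pv + int (i' - 1)) <= H (d + int q) & H (d + int q) < H (pv + int i') &
 strm ?S ?I (ptr3 (d + int q) (pv + int i) (bs + int i)) (t @ bval_acc ?fr H' ?b) (ptr3 (d + int q) (pv + int i') (bs + int i')))"
 using sp k lt by blast
 qed
qed

text \<open>In a sorted column the bucket index never decreases, hence three pointers run upwards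
  through the column, the pivots and \<open>bs\<close>.\<close>

lemma count_loop_ae:
 fixes p f :: "nat => cell"
 assumes v: "H (s + 1) = Fin d" "H (s + 10) = Fin pv" "H (s + 11) = Fin bs" "H (s + 7) = Fin (int q0)" "H (s + 8) = Fin (int q1)" "H (s + 4) = Fin 1"
 and lay: "q0 <= q1" "d + int q1 <= s" "s + 15 <= pv" "pv + int m < bs" "1 <= m"
 and f: "!!q. q < q1 ==> H (d + int q) = f q" "!!q. q < q1 ==> p 0 <= f q" "!!q. q < q1 ==> f q < p m"
 "!!q q'. q0 <= q ==> q <= q' ==> q' < q1 ==> f q <= f q'"
 and p: "!!i. i <= m ==> H (pv + int i) = p i" "!!i i'. i <= i' ==> i' <= m ==> p i <= p i'"
 and c: "!!i. i <= m ==> H (bs + int i) = Fin (int (bucket_count p f i q0))"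
 shows "ae (frame SquareSort_proc s) count_loop H sp (%H' sp' t. (sp' = sp &
 (ALL i<=m. H' (bs + int i) = Fin (int (bucket_count p f i q1))) &
 (ALL z. z ~= s + 4 --> z ~= s + 7 --> z ~: {bs..bs + int m} --> H' z = H z)) &
 strm {s..s + 14} {0::nat, 1, 2} (ptr3 (d + int q0) (pv + 1) (bs + 1)) t (ptr3 (d + int q1) (pv + int m) (bs + int m)))"
proof -
 let ?fr = "frame SquareSort_proc s"
 let ?S = "{s..s + 14}" and ?I = "{0::nat, 1, 2}"
 let ?b = "V ''s'' \<prec> V ''e''"
 let ?body = "advance_loop;; V ''bs'' \<oplus> V ''i'' :*= (V ''bs'')[[V ''i'']] \<oplus> N 1;; ''s'' ::= V ''s'' \<oplus> N 1"
 define Inv where "Inv t H' sp' \<longleftrightarrow> sp' = sp &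
 (EX q i. q0 <= q & q <= q1 & 1 <= i & i <= m & H' (s + 7) = Fin (int q) & H' (s + 4) = Fin (int i) &
 (ALL q'. q <= q' --> q' < q1 --> p (i - 1) <= f q') &
 (ALL i<=m. H' (bs + int i) = Fin (int (bucket_count p f i q))) &
 strm ?S ?I (ptr3 (d + int q0) (pv + 1) (bs + 1)) t (ptr3 (d + int q) (pv + int i) (bs + int i))) &
 (ALL z. z ~= s + 4 --> z ~= s + 7 --> z ~: {bs..bs + int m} --> H' z = H z)" for t H' sp'
 show ?thesis unfolding count_loop_def
 proof (rule ae_While[where I = Inv and \<mu> = "%H'. nat (int q1 - int_of (H' (s + 7)))"])
 have "strm ?S ?I (ptr3 (d + int q0) (pv + 1) (bs + 1)) [] (ptr3 (d + int q0) (pv + int 1) (bs + int 1))"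
 by (rule strm.stop) auto
 moreover have "ALL q'. q0 <= q' --> q' < q1 --> p (1 - 1) <= f q'" using f(2) by simp
 moreover have "ALL i<=m. H (bs + int i) = Fin (int (bucket_count p f i q0))" using c by blast
 moreover have "H (s + 4) = Fin (int 1)" using v by simp
 ultimately show "Inv [] H sp" unfolding Inv_def using v(4) lay(1,5) by blast
 next
 fix t H' sp' assume I: "Inv t H' sp'" and b: "bval ?fr H' ?b"
 obtain q i where q: "q0 <= q" "q <= q1" "1 <= i" "i <= m" "H' (s + 7) = Fin (int q)" "H' (s + 4) = Fin (int i)"
 and pl: "!!q'. q <= q' ==> q' < q1 ==> p (i - 1) <= f q'"
 and c': "!!i. i <= m ==> H' (bs + int i) = Fin (int (bucket_count p f i q))"
 and st: "strm ?S ?I (ptr3 (d + int q0) (pv + 1) (bs + 1)) t (ptr3 (d + int q) (pv + int i) (bs + int i))"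
 and same: "!!z. z ~= s + 4 ==> z ~= s + 7 ==> z ~: {bs..bs + int m} ==> H' z = H z" and sp: "sp' = sp"
 using I unfolding Inv_def by blast
 have v': "H' (s + 1) = Fin d" "H' (s + 10) = Fin pv" "H' (s + 11) = Fin bs" "H' (s + 8) = Fin (int q1)"
 using same[of "s + 1"] same[of "s + 10"] same[of "s + 11"] same[of "s + 8"] v lay by auto
 have ql: "q < q1" using b v' q by simp
 have fq: "H' (d + int q) = f q" using same[of "d + int q"] f(1)[OF ql] ql lay by auto
 have pk: "H' (pv + int k) = p k" if "k <= m" for k using same[of "pv + int k"] p(1)[OF that] that lay by auto
 have A: "ae ?fr advance_loop H' sp' (%H2 sp2 t2. sp2 = sp' & (EX i'. i <= i' & i' <= m &
 H2 = H'(s + 4 := Fin (int i')) & H' (pv + int (i' - 1)) <= H' (d + int q) & H' (d + int q) < H' (pv + int i') &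
 strm ?S ?I (ptr3 (d + int q) (pv + int i) (bs + int i)) t2 (ptr3 (d + int q) (pv + int i') (bs + int i'))))"
 proof (rule advance_loop_ae)
 have "H' (pv + int (i - 1)) = p (i - 1)" using q by (intro pk) auto
 thus "H' (pv + int (i - 1)) <= H' (d + int q)" unfolding fq using pl[OF order_refl ql] by (simp only:)
 show "H' (d + int q) < H' (pv + int m)" unfolding fq using pk[of m] f(3)[OF ql] by simp
 qed (use v' q ql lay in auto)
 have "ae ?fr (advance_loop;; (V ''bs'' \<oplus> V ''i'' :*= (V ''bs'')[[V ''i'']] \<oplus> N 1;; ''s'' ::= V ''s'' \<oplus> N 1)) H' sp'
 (%H2 sp2 t'. Inv (t @ bval_acc ?fr H' ?b @ t') H2 sp2 & nat (int q1 - int_of (H2 (s + 7))) < nat (int q1 - int_of (H' (s + 7))))"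
 proof (rule ae_Seq_rule[OF A], elim conjE exE)
 fix H2 sp2 t2 k assume sp2: "sp2 = sp'" and k: "i <= k" "k <= m" "H2 = H'(s + 4 := Fin (int k))"
 "H' (pv + int (k - 1)) <= H' (d + int q)" "H' (d + int q) < H' (pv + int k)"
 and st2: "strm ?S ?I (ptr3 (d + int q) (pv + int i) (bs + int i)) t2 (ptr3 (d + int q) (pv + int k) (bs + int k))"
 have pq: "p (k - 1) <= f q" "f q < p k" "1 <= k" using k fq pk[of k] pk[of "k - 1"] q by auto
 define H3 where "H3 = H2(bs + int k := Fin (int (bucket_count p f k q) + 1), s + 7 := Fin (int q + 1))"
 have ck: "H2 (bs + int k) = Fin (int (bucket_count p f k q))" using c'[OF k(2)] k(3) lay by auto
 have E: "ae ?fr (V ''bs'' \<oplus> V ''i'' :*= (V ''bs'')[[V ''i'']] \<oplus> N 1;; ''s'' ::= V ''s'' \<oplus> N 1) H2 sp2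
 (%H4 sp4 t4. H4 = H3 & sp4 = sp & addrs t4 <= ?S Un {bs + int k})"
 using v' q k ck sp sp2 lay by (auto simp: ae_simps H3_def)
 have c3: "H3 (bs + int i') = Fin (int (bucket_count p f i' (Suc q)))" if i': "i' <= m" for i'
 proof (cases "i' = k")
 case True
 thus ?thesis using pq lay by (simp add: H3_def bucket_count_Suc)
 next
 case False
 \<comment> \<open>An item lies in one bucket only, so no other counter changes.\<close>
 have "~ (0 < i' & p (i' - 1) <= f q & f q < p i')"
 proof
 assume *: "0 < i' & p (i' - 1) <= f q & f q < p i'"
 show False
 proof (cases "i' < k")
 case True
 hence "p i' <= p (k - 1)" using k by (intro p(2)) auto
 thus False using * pq by auto
 next
 case False
 hence "p k <= p (i' - 1)" using \<open>i' ~= k\<close> i' by (intro p(2)) auto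
 thus False using * pq by auto
 qed
 qed
 moreover have "H3 (bs + int i') = H' (bs + int i')" using False k(3) lay by (auto simp: H3_def)
 ultimately show ?thesis using c'[OF i'] by (simp add: bucket_count_Suc)
 qed
 have pl3: "p (k - 1) <= f q'" if "Suc q <= q'" "q' < q1" for q'
 using pq f(4)[of q q'] q that by (auto intro: order_trans)
 have same3: "H3 z = H z" if "z ~= s + 4" "z ~= s + 7" "z ~: {bs..bs + int m}" for z
 using same[OF that] that k by (auto simp: H3_def)
 have v3: "H3 (s + 7) = Fin (int (Suc q))" "H3 (s + 4) = Fin (int k)" using k lay by (auto simp: H3_def)
 show "ae ?fr (V ''bs'' \<oplus> V ''i'' :*= (V ''bs'')[[V ''i'']] \<oplus> N 1;; ''s'' ::= V ''s'' \<oplus> N 1) H2 sp2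
 (%H4 sp4 t4. Inv (t @ bval_acc ?fr H' ?b @ (t2 @ t4)) H4 sp4 & nat (int q1 - int_of (H4 (s + 7))) < nat (int q1 - int_of (H' (s + 7))))"
 proof (rule ae_mono[OF E], elim conjE)
 fix H4 sp4 t4 assume *: "H4 = H3" "sp4 = sp" "addrs t4 <= ?S Un {bs + int k}"
 have s1: "strm ?S ?I (ptr3 (d + int q) (pv + int i) (bs + int i)) (bval_acc ?fr H' ?b) (ptr3 (d + int q) (pv + int i) (bs + int i))"
 by (rule strm_static) auto
 have "addrs t4 <= ?S Un ptr3 (d + int q) (pv + int k) (bs + int k) ` ?I"
 unfolding image_ptr3 using *(3) by blast
 hence s4: "strm ?S ?I (ptr3 (d + int q) (pv + int k) (bs + int k)) t4 (ptr3 (d + int (Suc q)) (pv + int k) (bs + int k))"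
 by (rule strm_step[rotated]) auto
 note str = strm_append[OF st strm_append[OF s1 strm_append[OF st2 s4]]]
 have "q0 <= Suc q" "Suc q <= q1" "1 <= k" using q ql pq by auto
 hence "Inv (t @ bval_acc ?fr H' ?b @ (t2 @ t4)) H3 sp"
 unfolding Inv_def using v3 k(2) pl3 c3 str same3 by blast
 thus "Inv (t @ bval_acc ?fr H' ?b @ (t2 @ t4)) H4 sp4 & nat (int q1 - int_of (H4 (s + 7))) < nat (int q1 - int_of (H' (s + 7)))"
 using * v3 q ql by simp
 qed
 qed
 thus "ae ?fr (?body) H' sp' (%H2 sp2 t'. Inv (t @ bval_acc ?fr H' ?b @ t') H2 sp2 &
 nat (int q1 - int_of (H2 (s + 7))) < nat (int q1 - int_of (H' (s + 7))))" by (simp only: ae_Seq append.assoc)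
 next
 fix t H' sp' assume I: "Inv t H' sp'" and b: "~ bval ?fr H' ?b"
 obtain q i where q: "q0 <= q" "q <= q1" "1 <= i" "i <= m" "H' (s + 7) = Fin (int q)" "H' (s + 4) = Fin (int i)"
 and c': "!!i. i <= m ==> H' (bs + int i) = Fin (int (bucket_count p f i q))"
 and st: "strm ?S ?I (ptr3 (d + int q0) (pv + 1) (bs + 1)) t (ptr3 (d + int q) (pv + int i) (bs + int i))"
 and same: "!!z. z ~= s + 4 ==> z ~= s + 7 ==> z ~: {bs..bs + int m} ==> H' z = H z" and sp: "sp' = sp"
 using I unfolding Inv_def by blast
 have "H' (s + 8) = Fin (int q1)" using same[of "s + 8"] v lay by auto
 hence qe: "q = q1" using b q by simp
 have "strm ?S ?I (ptr3 (d + int q) (pv + int i) (bs + int i)) (bval_acc ?fr H' ?b) (ptr3 (d + int q1) (pv + int m) (bs + int m))"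
 by (rule strm_step) (use q qe in auto)
 from strm_append[OF st this]
 show "(sp' = sp & (ALL i<=m. H' (bs + int i) = Fin (int (bucket_count p f i q1))) &
 (ALL z. z ~= s + 4 --> z ~= s + 7 --> z ~: {bs..bs + int m} --> H' z = H z)) &
 strm ?S ?I (ptr3 (d + int q0) (pv + 1) (bs + 1)) (t @ bval_acc ?fr H' ?b) (ptr3 (d + int q1) (pv + int m) (bs + int m))"
 using c' same sp qe by blast
 qed
qed

text \<open>The start of column \<open>j\<close> in an array of \<open>n\<close> cells with columns
  of length \<open>m\<close>; cutting off at \<open>n\<close> shortens the last nonempty column and
  makes those after it empty.\<close>

definition clm :: "nat => nat => nat => nat" where
 "clm n m j = min (j * m) n"

lemma clm_Fin: "min (int j * int m) (int n) = int (clm n m j)" "min ((int j + 1) * int m) (int n) = int (clm n m (Suc j))"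
 by (auto simp: clm_def min_def simp flip: of_nat_mult) (auto simp: algebra_simps simp flip: of_nat_mult of_nat_add)

lemma clm_mono: "j <= j' ==> clm n m j <= clm n m j'"
 unfolding clm_def by (intro min.mono mult_right_mono) auto

lemma clm_le: "clm n m j <= n"
 by (simp add: clm_def)

lemma clm_Suc_diff: "clm n m (Suc j) - clm n m j <= m"
 by (auto simp: clm_def min_def)

definition columns_loop :: com where
 "columns_loop = WHILE V ''j'' \<prec> V ''m'' DO (
 ''s'' ::= MinE (V ''j'' \<odot> V ''m'') (V ''n'');;
 ''e'' ::= MinE ((V ''j'' \<oplus> N 1) \<odot> V ''m'') (V ''n'');;
 ''i'' ::= N 1;;
 count_loop;;
 ''j'' ::= V ''j'' \<oplus> N 1)"

definition bucket_starts_code :: com where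
 "bucket_starts_code = (Alloc ''bs'' (V ''m'' \<oplus> N 1);; ''i'' ::= N 0);; (zero_loop;; (''j'' ::= N 0;; (columns_loop;; (''i'' ::= N 1;; prefix_loop))))"

context cache
begin

text \<open>Each of the \<open>m\<close> columns pays a constant for restarting the pointers and
  \<open>O(m / B)\<close> for its scan of column, pivots and counters.\<close>

lemma columns_loop_aq:
 fixes p f :: "nat => cell"
 assumes v: "H (s + 1) = Fin d" "H (s + 2) = Fin (int n)" "H (s + 3) = Fin (int m)" "H (s + 10) = Fin pv" "H (s + 11) = Fin bs" "H (s + 5) = Fin 0"
 and lay: "d + int n <= s" "s + 15 <= pv" "pv + int m < bs" "1 <= m"
 and f: "!!q. q < n ==> H (d + int q) = f q" "!!q. q < n ==> p 0 <= f q" "!!q. q < n ==> f q < p m"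
 "!!j q q'. clm n m j <= q ==> q <= q' ==> q' < clm n m (Suc j) ==> f q <= f q'"
 and p: "!!i. i <= m ==> H (pv + int i) = p i" "!!i i'. i <= i' ==> i' <= m ==> p i <= p i'"
 and c: "!!i. i <= m ==> H (bs + int i) = Fin 0"
 and U: "{s..s + 14} <= U" "{d..d + int n} <= U" "{pv..pv + int m} <= U" "{bs..bs + int m} <= U"
 shows "aq U ((28 + 6 * real m / B) * real m + 4) (frame SquareSort_proc s) columns_loop H sp (%H' sp'. sp' = sp &
 (ALL i<=m. H' (bs + int i) = Fin (int (bucket_count p f i (clm n m m)))) &
 (ALL z. z ~: {s + 4, s + 5, s + 7, s + 8} --> z ~: {bs..bs + int m} --> H' z = H z))"
proof -
 let ?fr = "frame SquareSort_proc s"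
 define P where "P j H' \<longleftrightarrow> H' (s + 5) = Fin (int j) &
 (ALL i<=m. H' (bs + int i) = Fin (int (bucket_count p f i (clm n m j)))) &
 (ALL z. z ~: {s + 4, s + 5, s + 7, s + 8} --> z ~: {bs..bs + int m} --> H' z = H z)" for j H'
 have "aq U ((4 + (4 + ((16 + 2 * real_of_int (3 * int m) / B) + 4))) * real (m - 0) + 4) ?fr columns_loop H sp (%H' sp'. sp' = sp & P m H')"
 unfolding columns_loop_def
 proof (rule aq_for[where P = P and s = s])
 show "P 0 H" using v c by (auto simp: P_def clm_def)
 fix j H1 assume j: "j < m" and P1: "P j H1"
 have same1: "!!z. z ~: {s + 4, s + 5, s + 7, s + 8} ==> z ~: {bs..bs + int m} ==> H1 z = H z" using P1 unfolding P_def by blast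
 have v1: "H1 (s + 1) = Fin d" "H1 (s + 2) = Fin (int n)" "H1 (s + 3) = Fin (int m)" "H1 (s + 10) = Fin pv" "H1 (s + 11) = Fin bs" "H1 (s + 5) = Fin (int j)"
 using same1[of "s + 1"] same1[of "s + 2"] same1[of "s + 3"] same1[of "s + 10"] same1[of "s + 11"] P1 v lay by (auto simp: P_def)
 define H2 where "H2 = H1(s + 7 := Fin (int (clm n m j)), s + 8 := Fin (int (clm n m (Suc j))), s + 4 := Fin 1)"
 have st1: "aq U (4 + 2 * real (length ([]::addr list))) ?fr (''s'' ::= MinE (V ''j'' \<odot> V ''m'') (V ''n'');;
 ''e'' ::= MinE ((V ''j'' \<oplus> N 1) \<odot> V ''m'') (V ''n'');; ''i'' ::= N 1) H1 sp (%H' sp'. H' = H2 & sp' = sp)"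
 by (rule aq_frame[where s = s]) (use v1 U in \<open>auto simp: ae_simps H2_def clm_Fin\<close>)
 have st2: "aq U (16 + 2 * real_of_int (3 * int m) / B) ?fr count_loop H2 sp (%H' sp'. sp' = sp &
 (ALL i<=m. H' (bs + int i) = Fin (int (bucket_count p f i (clm n m (Suc j))))) &
 (ALL z. z ~= s + 4 --> z ~= s + 7 --> z ~: {bs..bs + int m} --> H' z = H2 z))"
 proof (rule aq_streaming3[OF count_loop_ae])
 show "H2 (s + 1) = Fin d" "H2 (s + 10) = Fin pv" "H2 (s + 11) = Fin bs" "H2 (s + 7) = Fin (int (clm n m j))"
 "H2 (s + 8) = Fin (int (clm n m (Suc j)))" "H2 (s + 4) = Fin 1" using v1 by (auto simp: H2_def)
 show "clm n m j <= clm n m (Suc j)" by (rule clm_mono) simp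
 have cn: "clm n m (Suc j) <= n" by (rule clm_le)
 thus "d + int (clm n m (Suc j)) <= s" using lay by linarith
 fix q assume "q < clm n m (Suc j)"
 hence q: "q < n" using cn by simp
 show "H2 (d + int q) = f q" using same1[of "d + int q"] f(1)[OF q] q lay by (auto simp: H2_def)
 show "p 0 <= f q" "f q < p m" using f(2,3) q by auto
 next
 fix i assume i: "i <= m"
 show "H2 (pv + int i) = p i" using same1[of "pv + int i"] p(1)[OF i] i lay by (auto simp: H2_def)
 show "H2 (bs + int i) = Fin (int (bucket_count p f i (clm n m j)))" using P1 i lay by (auto simp: P_def H2_def)
 next
 show "card (blocks B {s..s + 14}) <= 2" by (rule card_blocks_short) (use B_large in simp)
 have "{d + int (clm n m j)..d + int (clm n m (Suc j))} <= {d..d + int n}" using clm_le[of n m "Suc j"] by auto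
 thus "{d + int (clm n m j)..d + int (clm n m (Suc j))} <= U" using U by blast
 have "{pv + 1..pv + int m} <= {pv..pv + int m}" "{bs + 1..bs + int m} <= {bs..bs + int m}" by auto
 thus "{pv + 1..pv + int m} <= U" "{bs + 1..bs + int m} <= U" using U by blast+
 show "d + int (clm n m (Suc j)) - (d + int (clm n m j)) + (pv + int m - (pv + 1)) + (bs + int m - (bs + 1)) <= 3 * int m"
 using clm_Suc_diff[of n m j] clm_mono[of j "Suc j" n m] by simp
 qed (use lay f p U in auto)
 have st3: "aq U (4 + 2 * real (length ([]::addr list))) ?fr (''j'' ::= V ''j'' \<oplus> N 1) H3 sp3 (%H' sp'. sp' = sp & P (Suc j) H')"
 if h: "sp3 = sp & (ALL i<=m. H3 (bs + int i) = Fin (int (bucket_count p f i (clm n m (Suc j))))) &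
 (ALL z. z ~= s + 4 --> z ~= s + 7 --> z ~: {bs..bs + int m} --> H3 z = H2 z)" for H3 sp3
 proof -
 have same3: "!!z. z ~= s + 4 ==> z ~= s + 7 ==> z ~: {bs..bs + int m} ==> H3 z = H2 z" using h by blast
 have v3: "H3 (s + 5) = Fin (int j)" using same3[of "s + 5"] v1 lay by (auto simp: H2_def)
 let ?H4 = "H3(s + 5 := Fin (int j + 1))"
 have P4: "P (Suc j) ?H4" unfolding P_def
 proof (intro conjI allI impI)
 fix i assume "i <= m"
 thus "?H4 (bs + int i) = Fin (int (bucket_count p f i (clm n m (Suc j))))" using h lay by auto
 next
 fix z assume z: "z ~: {s + 4, s + 5, s + 7, s + 8}" "z ~: {bs..bs + int m}"
 thus "?H4 z = H z" using same3[of z] same1[OF z] by (auto simp: H2_def)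
 qed simp
 show ?thesis by (rule aq_frame[where s = s]) (use h v3 P4 U in \<open>auto simp: ae_simps\<close>)
 qed
 have "aq U (4 + 2 * real (length ([]::addr list)) + ((16 + 2 * real_of_int (3 * int m) / B) + (4 + 2 * real (length ([]::addr list))))) ?fr
 ((''s'' ::= MinE (V ''j'' \<odot> V ''m'') (V ''n'');; ''e'' ::= MinE ((V ''j'' \<oplus> N 1) \<odot> V ''m'') (V ''n'');; ''i'' ::= N 1);;
 (count_loop;; ''j'' ::= V ''j'' \<oplus> N 1)) H1 sp (%H' sp'. sp' = sp & P (Suc j) H')"
 proof (rule aq_Seq[OF st1], elim conjE, hypsubst)
 show "aq U (16 + 2 * real_of_int (3 * int m) / B + (4 + 2 * real (length ([]::addr list)))) ?fr (count_loop;; ''j'' ::= V ''j'' \<oplus> N 1) H2 sp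
 (%H' sp'. sp' = sp & P (Suc j) H')" by (rule aq_Seq[OF st2 st3])
 qed
 hence "aq U (4 + ((16 + 2 * real_of_int (3 * int m) / B) + 4)) ?fr
 (''s'' ::= MinE (V ''j'' \<odot> V ''m'') (V ''n'');; ''e'' ::= MinE ((V ''j'' \<oplus> N 1) \<odot> V ''m'') (V ''n'');; ''i'' ::= N 1;;
 count_loop;; ''j'' ::= V ''j'' \<oplus> N 1) H1 sp (%H' sp'. sp' = sp & P (Suc j) H')"
 unfolding aq_def ae_Seq append.assoc by simp
 thus "bval ?fr H1 (V ''j'' \<prec> V ''m'') & addrs (bval_acc ?fr H1 (V ''j'' \<prec> V ''m'')) <= {s..s + 14} &
 aq U (4 + ((16 + 2 * real_of_int (3 * int m) / B) + 4)) ?fr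
 (''s'' ::= MinE (V ''j'' \<odot> V ''m'') (V ''n'');; ''e'' ::= MinE ((V ''j'' \<oplus> N 1) \<odot> V ''m'') (V ''n'');; ''i'' ::= N 1;;
 count_loop;; ''j'' ::= V ''j'' \<oplus> N 1) H1 sp (%H' sp'. sp' = sp & P (Suc j) H')"
 using v1 j by simp
 next
 fix H1 assume P1: "P m H1"
 hence "H1 (s + 3) = Fin (int m)" using v lay unfolding P_def by auto
 thus "~ bval ?fr H1 (V ''j'' \<prec> V ''m'') & addrs (bval_acc ?fr H1 (V ''j'' \<prec> V ''m'')) <= {s..s + 14}"
 using P1 by (auto simp: P_def)
 qed (use U in auto)
 thus ?thesis by (rule aq_mono) (auto simp: P_def)
qed

end

section \<open>Columns, buckets and the layout of the transposition\<close>

text \<open>The situation after pivot selection, detached from the memory: \<open>p\<close> lists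
  the pivots with both sentinels, \<open>f\<close> the contents of \<open>D\<close>, sorted within
  each column. Buckets are numbered from 0 here, bucket \<open>i\<close> being bounded by
  \<open>p i\<close> and \<open>p (Suc i)\<close>.\<close>

locale bucketing =
 fixes p f :: "nat => cell" and n m :: nat
 assumes m_pos: "1 <= m" and n_le: "n <= m * m"
 and p_low: "q < n ==> p 0 <= f q" and p_high: "q < n ==> f q < p m"
 and p_mono: "i <= i' ==> i' <= m ==> p i <= p i'"
 and f_col: "clm n m j <= q ==> q <= q' ==> q' < clm n m (Suc j) ==> f q <= f q'"
 and f_inj: "inj_on f {..<n}"
begin

abbreviation col :: "nat => nat" where "col \<equiv> clm n m"

definition start :: "nat => nat" where
 "start i = card {q. q < n & f q < p i}"

text \<open>\<open>below\<close> and \<open>inner\<close> are the coordinates of the transposition: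
  the former fixes where the items of a bucket are read, the latter where they are written.\<close>

definition below :: "nat => nat => nat" where
 "below j i = card {q. col j <= q & q < col (Suc j) & f q < p i}"

definition inner :: "nat => nat => nat" where
 "inner i j = card {q. q < col j & p i <= f q & f q < p (Suc i)}"

lemma col_0 [simp]: "col 0 = 0"
 by (simp add: clm_def)

lemma col_m [simp]: "col m = n"
 using n_le by (simp add: clm_def)

lemma start_0 [simp]: "start 0 = 0"
proof -
 have "{q. q < n & f q < p 0} = {}" using p_low by (auto simp flip: not_le)
 thus ?thesis unfolding start_def by (simp only: card.empty)
qed

lemma start_m [simp]: "start m = n"
proof -
 have "{q. q < n & f q < p m} = {..<n}" using p_high by auto
 thus ?thesis unfolding start_def by simp
qed

lemma start_mono: "i <= i' ==> i' <= m ==> start i <= start i'"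
 unfolding start_def using p_mono by (intro card_mono) (auto intro: less_le_trans)

lemma start_le: "i <= m ==> start i <= n"
 using start_mono[of i m] by simp

lemma start_Suc:
 assumes "i < m"
 shows "start (Suc i) = start i + inner i m"
proof -
 have "{q. q < n & f q < p (Suc i)} = {q. q < n & f q < p i} Un {q. q < col m & p i <= f q & f q < p (Suc i)}"
 using p_mono[of i "Suc i"] assms by (auto simp: not_less)
 moreover have "{q. q < n & f q < p i} Int {q. q < col m & p i <= f q & f q < p (Suc i)} = {}" by auto
 ultimately show ?thesis unfolding start_def inner_def by (simp add: card_Un_disjoint)
qed

lemma below_mono: "i <= i' ==> i' <= m ==> below j i <= below j i'"
 unfolding below_def using p_mono by (intro card_mono) (auto intro: less_le_trans)

lemma below_le: "col j + below j i <= col (Suc j)"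
proof -
 have "below j i <= card {col j..<col (Suc j)}" unfolding below_def by (intro card_mono) auto
 thus ?thesis using clm_mono[of j "Suc j" n m] by simp
qed

lemma below_0 [simp]: "below j 0 = 0"
proof -
 have nl: "~ f q < p 0" if "q < col (Suc j)" for q using p_low[of q] that clm_le[of n m "Suc j"] by simp
 have "{q. col j <= q & q < col (Suc j) & f q < p 0} = {}"
 by (auto simp: nl)
 thus ?thesis unfolding below_def by (simp only: card.empty)
qed

lemma below_m: "col j + below j m = col (Suc j)"
proof -
 have "{q. col j <= q & q < col (Suc j) & f q < p m} = {col j..<col (Suc j)}"
 using p_high clm_le[of n m "Suc j"] by auto
 thus ?thesis unfolding below_def using clm_mono[of j "Suc j" n m] by simp
qed

text \<open>The column is sorted, so its items below a pivot form a prefix, and a prefix is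
  determined by its length.\<close>

lemma below_iff:
 assumes q: "col j <= q" "q < col (Suc j)"
 shows "f q < p i \<longleftrightarrow> q < col j + below j i"
proof
 assume l: "f q < p i"
 have "{col j..q} <= {q. col j <= q & q < col (Suc j) & f q < p i}"
 proof
 fix x assume x: "x \<in> {col j..q}"
 hence "f x <= f q" using q by (intro f_col[of j]) auto
 thus "x \<in> {q. col j <= q & q < col (Suc j) & f q < p i}" using x q l by auto
 qed
 hence "card {col j..q} <= below j i" unfolding below_def by (intro card_mono) auto
 thus "q < col j + below j i" using q by simp
next
 assume l: "q < col j + below j i"
 show "f q < p i"
 proof (rule ccontr)
 assume n: "~ f q < p i"
 have "{q. col j <= q & q < col (Suc j) & f q < p i} <= {col j..<q}"
 proof
 fix r assume r: "r \<in> {q. col j <= q & q < col (Suc j) & f q < p i}"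
 hence "~ q <= r" using f_col[of j q r] q n by (auto dest: le_less_trans)
 thus "r \<in> {col j..<q}" using r by simp
 qed
 hence "below j i <= card {col j..<q}" unfolding below_def by (intro card_mono) auto
 thus False using l q by simp
 qed
qed

lemma inner_0 [simp]: "inner i 0 = 0"
 by (simp add: inner_def)

text \<open>Both increments count the items of column \<open>j\<close> that lie in bucket
  \<open>i\<close>; integers avoid truncated subtraction.\<close>

lemma inner_Suc:
 assumes "i < m"
 shows "int (inner i (Suc j)) = int (inner i j) + (int (below j (Suc i)) - int (below j i))"
proof -
 let ?X = "{q. col j <= q & q < col (Suc j) & p i <= f q & f q < p (Suc i)}"
 have fin: "finite {q. col j <= q & q < col (Suc j) & P q}" for P
 by (rule finite_subset[of _ "{..<col (Suc j)}"]) auto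
 have "{q. q < col (Suc j) & p i <= f q & f q < p (Suc i)} = {q. q < col j & p i <= f q & f q < p (Suc i)} Un ?X"
 using clm_mono[of j "Suc j" n m] by auto
 moreover have "{q. q < col j & p i <= f q & f q < p (Suc i)} Int ?X = {}" by auto
 ultimately have 1: "inner i (Suc j) = inner i j + card ?X" unfolding inner_def by (simp add: card_Un_disjoint fin)
 have "{q. col j <= q & q < col (Suc j) & f q < p (Suc i)} = {q. col j <= q & q < col (Suc j) & f q < p i} Un ?X"
 using p_mono[of i "Suc i"] assms by (auto simp: not_less)
 moreover have "{q. col j <= q & q < col (Suc j) & f q < p i} Int ?X = {}" by auto
 ultimately have 2: "below j (Suc i) = below j i + card ?X" unfolding below_def by (simp add: card_Un_disjoint fin)
 show ?thesis using 1 2 by simp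
qed

lemma in_column:
 assumes "q < n"
 obtains j where "j < m" "col j <= q" "q < col (Suc j)"
proof
 have "q < m * m" using assms n_le by simp
 thus "q div m < m" by (simp add: less_mult_imp_div_less)
 have "q div m * m <= q" by simp
 thus "col (q div m) <= q" by (simp add: clm_def min_le_iff_disj)
 have "q < Suc (q div m) * m" using m_pos dividend_less_div_times[of m q] by (simp add: add.commute)
 thus "q < col (Suc (q div m))" using assms by (simp add: clm_def)
qed

definition bucket :: "nat => cell set" where
 "bucket i = {v \<in> f ` {..<n}. p i <= v & v < p (Suc i)}"

lemma card_bucket: "card (bucket i) = inner i m"
proof -
 have "bucket i = f ` {q. q < col m & p i <= f q & f q < p (Suc i)}" by (auto simp: bucket_def)
 moreover have "inj_on f {q. q < col m & p i <= f q & f q < p (Suc i)}"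
 using f_inj by (rule inj_on_subset) auto
 ultimately show ?thesis by (simp add: card_image inner_def)
qed

lemma finite_bucket [simp]: "finite (bucket i)"
 by (simp add: bucket_def)

text \<open>Slots and sources do not overlap because \<open>A\<close> and \<open>D\<close> do not;
  the slots of different buckets are in order because \<open>start\<close> counts all items below a
  pivot.\<close>

lemma skew_geo:
 assumes D: "!!q. q < n ==> H (d + int q) = f q" and P: "!!i. i < m ==> H (Pa + int i) = p (Suc i)"
 and E: "!!j. j < m ==> H (Ea + int j) = Fin (d + int (col (Suc j)))"
 and lay: "Pa + int m <= Ca" "Ca + int m <= Ea" "Ea + int m <= Wa" "d + int n <= Pa" "a + int n <= Pa"
 "{a..<a + int n} Int {d..<d + int n} = {}"
 shows "geo H Ca Ea m Pa Wa m (%j i. d + int (col j + below j i)) (%i j. a + int (start i + inner i j)) (%j. d + int (col (Suc j)))"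
proof -
 have cn: "col (Suc j) <= n" for j by (rule clm_le)
 have W: "start i + inner i m <= n" if "i < m" for i using start_Suc[OF that] start_le[of "Suc i"] that by simp
 show ?thesis unfolding geo_def
 proof (intro conjI allI impI lay)
 fix j assume j: "j < m"
 show "H (Ea + int j) = Fin (d + int (col (Suc j)))" using E j .
 show "d + int (col (Suc j)) <= Pa" using lay cn[of j] by linarith
 fix i assume i: "i < m"
 show "d + int (col j + below j i) <= d + int (col j + below j (Suc i))" using below_mono[of i "Suc i" j] i by simp
 show "d + int (col j + below j (Suc i)) <= d + int (col (Suc j))" using below_le[of j "Suc i"] by linarith
 show "H q < H (Pa + int i)" if q: "d + int (col j + below j i) <= q" "q < d + int (col j + below j (Suc i))" for q
 proof -
 define r where "r = nat (q - d)"
 have r: "q = d + int r" "col j <= r" "r < col j + below j (Suc i)" using q by (auto simp: r_def)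
 hence "r < col (Suc j)" using below_le[of j "Suc i"] by linarith
 thus ?thesis using below_iff[of j r "Suc i"] r D[of r] P[OF i] cn[of j] by simp
 qed
 show "~ H (d + int (col j + below j (Suc i))) < H (Pa + int i)" if "d + int (col j + below j (Suc i)) < d + int (col (Suc j))"
 proof -
 have "col j + below j (Suc i) < col (Suc j)" using that by linarith
 thus ?thesis using below_iff[of j "col j + below j (Suc i)" "Suc i"] D[of "col j + below j (Suc i)"] P[OF i] cn[of j] by simp
 qed
 show "~ (a + int (start i + inner i 0) <= q & q < a + int (start i + inner i m))"
 if q: "d + int (col j + below j 0) <= q" "q < d + int (col (Suc j))" for q
 proof
 assume "a + int (start i + inner i 0) <= q & q < a + int (start i + inner i m)"
 hence "q \<in> {a..<a + int n}" using W[OF i] by auto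
 moreover have "q \<in> {d..<d + int n}" using q cn[of j] by auto
 ultimately show False using lay(6) by blast
 qed
 next
 fix i j assume "i < m" "j < m"
 thus "a + int (start i + inner i (Suc j)) = a + int (start i + inner i j) + (d + int (col j + below j (Suc i)) - (d + int (col j + below j i)))"
 using inner_Suc[of i j] by simp
 next
 fix i i' assume i: "i < m" "i' < m" "i < i'"
 hence "start (Suc i) <= start i'" by (intro start_mono) auto
 thus "a + int (start i + inner i m) <= a + int (start i' + inner i' 0)" using start_Suc[OF i(1)] by simp
 next
 fix i assume "i < m"
 thus "a + int (start i + inner i m) <= Pa" using W[of i] lay by linarith
 qed
qed

text \<open>Every column is emptied completely, since \<open>p m\<close> exceeds all items, and the
  column lengths telescope.\<close>

lemma skew_moved: "moved (%j i. d + int (col j + below j i)) m m = int n"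
proof -
 have "moved (%j i. d + int (col j + below j i)) m m = (\<Sum>j<m. int (col (Suc j)) - int (col j))"
 unfolding moved_def below_m by (intro sum.cong) auto
 also have "... = int n" using sum_lessThan_telescope[of "%j. int (col j)" m] by simp
 finally show ?thesis .
qed

text \<open>Each item of the bucket is found in the target range. Range and bucket have the same
  size, so nothing else is there and no item occurs twice.\<close>

lemma skew_buckets:
 assumes pr: "progress s Ca m Wa m (%j i. d + int (col j + below j i)) (%i j. a + int (start i + inner i j)) H H' (%_. m) (%_. m)"
 and D: "!!q. q < n ==> H (d + int q) = f q" and i: "i < m"
 shows "H' ` {a + int (start i)..<a + int (start (Suc i))} = bucket i" "inj_on H' {a + int (start i)..<a + int (start (Suc i))}"
proof -
 let ?R = "{a + int (start i)..<a + int (start (Suc i))}"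
 have sub: "bucket i <= H' ` ?R"
 proof
 fix v assume "v \<in> bucket i"
 then obtain q where q: "q < n" "v = f q" "p i <= f q" "f q < p (Suc i)" by (auto simp: bucket_def)
 obtain j where j: "j < m" "col j <= q" "q < col (Suc j)" using in_column[OF q(1)] .
 have b1: "q < col j + below j (Suc i)" using below_iff[OF j(2,3), of "Suc i"] q by simp
 have "~ f q < p i" using q(3) by (simp add: not_less)
 hence b2: "col j + below j i <= q" using below_iff[OF j(2,3), of i] by (simp add: not_less)
 let ?y = "a + int (start i + inner i j) + (d + int q - (d + int (col j + below j i)))"
 have mv: "ALL i<m. ALL j<m. i < m --> (ALL r. d + int (col j + below j i) <= r --> r < d + int (col j + below j (Suc i)) -->
 H' (a + int (start i + inner i j) + (r - (d + int (col j + below j i)))) = H r)"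
 using pr unfolding progress_def by blast
 have "H' ?y = H (d + int q)"
 by (rule mv[rule_format, OF i j(1) i]) (use b1 b2 in linarith)+
 moreover have "?y \<in> ?R"
 proof -
 have "int (inner i (Suc j)) = int (inner i j) + (int (below j (Suc i)) - int (below j i))" by (rule inner_Suc[OF i])
 moreover have "inner i (Suc j) <= inner i m"
 unfolding inner_def using clm_mono[of "Suc j" m n m] j by (intro card_mono) auto
 ultimately show ?thesis using start_Suc[OF i] b1 b2 by auto
 qed
 ultimately show "v \<in> H' ` ?R" using q D by (metis image_eqI)
 qed
 have cR: "card ?R = card (bucket i)" using start_Suc[OF i] card_bucket[of i] by simp
 have "card (H' ` ?R) <= card (bucket i)" using cR card_image_le[of ?R H'] by simp
 hence "card (bucket i) = card (H' ` ?R)" using card_mono[OF _ sub] by simp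
 thus eq: "H' ` ?R = bucket i" using card_subset_eq[OF _ sub] by simp
 show "inj_on H' ?R" by (rule eq_card_imp_inj_on) (use cR eq in simp_all)
qed

end

context cache
begin

lemma sq_to_aq:
 assumes "sq S I k fr c H sp Q" "S <= U" "!!H' sp' q. Q H' sp' ==> q \<in> I ==> {ptrs H q..ptrs H' q} <= U"
 shows "aq U k fr c H sp Q"
 unfolding aq_def
proof (rule ae_mono[OF assms(1)[unfolded sq_def]], elim conjE, intro conjI)
 fix H' sp' t assume "strm S I (ptrs H) t (ptrs H')" "Q H' sp'"
 thus "addrs t <= U" using strm_addrs assms(2,3) by blast
qed

text \<open>The 960 is \<open>240 * 2^2\<close>, from the total size \<open>2 * m\<close>.\<close>

lemma skew_cost_bound: "skew_cost m m e <= 20 + 8 * real m + 960 * (real m)^2 / B + 4 * real_of_int e / B"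
proof (cases "16 * (m + m) <= B")
 case True
 have "0 <= 960 * (real m)^2 / B" by simp
 thus ?thesis using True by (simp add: skew_cost_def)
next
 case False
 have "(real (m + m))^2 = 4 * (real m)^2" by (simp add: power2_eq_square)
 thus ?thesis using False by (simp add: skew_cost_def)
qed

lemma BucketStarts_aq:
 assumes b: "bucketing p f n m"
 and v: "H (s + 1) = Fin d" "H (s + 2) = Fin (int n)" "H (s + 3) = Fin (int m)" "H (s + 10) = Fin pv"
 and lay: "d + int n <= s" "s + 15 <= pv" "pv + int m < bs"
 and f: "!!q. q < n ==> H (d + int q) = f q" and p: "!!i. i <= m ==> H (pv + int i) = p i"
 and U: "{s..s + 14} <= U" "{d..d + int n} <= U" "{pv..pv + int m} <= U" "{bs..bs + int m + 1} <= U"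
 shows "aq U (50 + 40 * real m + 6 * (real m)^2 / B) (frame SquareSort_proc s) BucketStarts H bs (%H' sp'. sp' = bs + int m + 1 &
 H' (s + 11) = Fin bs & (ALL i<=m. H' (bs + int i) = Fin (int (bucketing.start p f n i))) &
 (ALL z<bs. z ~: {s + 4, s + 5, s + 7, s + 8, s + 11} --> H' z = H z))"
proof -
 interpret bucketing p f n m by (rule b)
 let ?fr = "frame SquareSort_proc s"
 have U': "{bs..bs + int m} <= U" using U(4) by (auto dest: subsetD)
 \<comment> \<open>\<open>X\<close> records what every stage preserves, so that all stages share one
   frame condition.\<close>
 define X where "X H' \<longleftrightarrow> H' (s + 11) = Fin bs & (ALL z<bs. z ~: {s + 4, s + 5, s + 7, s + 8, s + 11} --> H' z = H z)" for H' :: mem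
 have X: "H' (s + 1) = Fin d" "H' (s + 2) = Fin (int n)" "H' (s + 3) = Fin (int m)" "H' (s + 10) = Fin pv" "H' (s + 11) = Fin bs"
 "!!q. q < n ==> H' (d + int q) = f q" "!!i. i <= m ==> H' (pv + int i) = p i" if "X H'" for H'
 using that v lay f p unfolding X_def by auto
 let ?sp = "bs + int m + 1"
 have st1: "aq U (4 + 2 * real (length ([]::addr list))) ?fr (Alloc ''bs'' (V ''m'' \<oplus> N 1);; ''i'' ::= N 0) H bs
 (%H' sp'. sp' = ?sp & X H' & H' (s + 4) = Fin 0)"
 by (rule aq_frame[where s = s]) (use v lay U in \<open>auto simp: ae_simps X_def\<close>)
 have st2: "aq U (8 + 2 * (real m + 1) / B) ?fr zero_loop H1 sp1
 (%H' sp'. sp' = ?sp & X H' & (ALL i<=m. H' (bs + int i) = Fin 0))"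
 if h: "sp1 = ?sp & X H1 & H1 (s + 4) = Fin 0" for H1 sp1
 by (rule aq_mono[OF zero_loop_aq[where s = s and m = m and bs = bs and U = U]])
 (use h X[of H1] lay U U' in \<open>auto simp: X_def\<close>)
 have st3: "aq U (4 + 2 * real (length ([]::addr list))) ?fr (''j'' ::= N 0) H1 sp1
 (%H' sp'. sp' = ?sp & X H' & (ALL i<=m. H' (bs + int i) = Fin 0) & H' (s + 5) = Fin 0)"
 if h: "sp1 = ?sp & X H1 & (ALL i<=m. H1 (bs + int i) = Fin 0)" for H1 sp1
 by (rule aq_frame[where s = s]) (use h v lay U in \<open>auto simp: ae_simps X_def\<close>)
 have st4: "aq U ((28 + 6 * real m / B) * real m + 4) ?fr columns_loop H1 sp1
 (%H' sp'. sp' = ?sp & X H' & (ALL i<=m. H' (bs + int i) = Fin (int (bucket_count p f i n))))"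
 if h: "sp1 = ?sp & X H1 & (ALL i<=m. H1 (bs + int i) = Fin 0) & H1 (s + 5) = Fin 0" for H1 sp1
 proof -
 have X1: "X H1" using h by blast
 have "aq U ((28 + 6 * real m / B) * real m + 4) ?fr columns_loop H1 sp1 (%H' sp'. sp' = sp1 &
 (ALL i<=m. H' (bs + int i) = Fin (int (bucket_count p f i (clm n m m)))) &
 (ALL z. z ~: {s + 4, s + 5, s + 7, s + 8} --> z ~: {bs..bs + int m} --> H' z = H1 z))"
 by (rule columns_loop_aq[where d = d and pv = pv])
 (use h X[OF X1] lay U U' m_pos p_low p_high p_mono f_col in blast)+
 thus ?thesis by (rule aq_mono) (use h lay in \<open>auto simp: X_def\<close>)
 qed
 have st5: "aq U (4 + 2 * real (length ([]::addr list))) ?fr (''i'' ::= N 1) H1 sp1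
 (%H' sp'. sp' = ?sp & X H' & (ALL i<=m. H' (bs + int i) = Fin (int (bucket_count p f i n))) & H' (s + 4) = Fin 1)"
 if h: "sp1 = ?sp & X H1 & (ALL i<=m. H1 (bs + int i) = Fin (int (bucket_count p f i n)))" for H1 sp1
 by (rule aq_frame[where s = s]) (use h v lay U in \<open>auto simp: ae_simps X_def\<close>)
 have st6: "aq U (12 + 4 * (real m + 1) / B) ?fr prefix_loop H1 sp1
 (%H' sp'. sp' = ?sp & X H' & (ALL i<=m. H' (bs + int i) = Fin (int (start i))))"
 if h: "sp1 = ?sp & X H1 & (ALL i<=m. H1 (bs + int i) = Fin (int (bucket_count p f i n))) & H1 (s + 4) = Fin 1" for H1 sp1
 proof -
 have sum: "(\<Sum>r\<le>i. int (bucket_count p f r n)) = int (start i)" if "i <= m" for i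
 proof -
 have "(\<Sum>r\<le>i. bucket_count p f r n) = start i"
 unfolding start_def by (rule bucket_count_sum) (use that p_mono p_low in auto)
 thus ?thesis by (simp flip: of_nat_sum)
 qed
 have "aq U (12 + 4 * (real m + 1) / B) ?fr prefix_loop H1 sp1 (%H' sp'. sp' = sp1 &
 (ALL q<=m. H' (bs + int q) = Fin (\<Sum>r\<le>q. int (bucket_count p f r n))) &
 (ALL z. z ~= s + 4 --> z ~: {bs..bs + int m} --> H' z = H1 z))"
 by (rule prefix_loop_aq) (use h X[of H1] lay U in auto)
 thus ?thesis by (rule aq_mono) (use h lay sum in \<open>auto simp: X_def\<close>)
 qed
 have full: "aq U (4 + 2 * real (length ([]::addr list)) + (8 + 2 * (real m + 1) / B + (4 + 2 * real (length ([]::addr list)) +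
 ((28 + 6 * real m / B) * real m + 4 + (4 + 2 * real (length ([]::addr list)) + (12 + 4 * (real m + 1) / B)))))) ?fr bucket_starts_code H bs
 (%H' sp'. sp' = ?sp & X H' & (ALL i<=m. H' (bs + int i) = Fin (int (start i))))"
 unfolding bucket_starts_code_def
 by (rule aq_Seq, rule st1, rule aq_Seq, erule st2, rule aq_Seq, erule st3, rule aq_Seq, erule st4, rule aq_Seq, erule st5, erule st6)
 have code: "aq U k ?fr bucket_starts_code H bs Q = aq U k ?fr BucketStarts H bs Q" for k Q
 proof -
 have "ae ?fr bucket_starts_code H bs Q' = ae ?fr BucketStarts H bs Q'" for Q'
 unfolding bucket_starts_code_def BucketStarts_def zero_loop_def prefix_loop_def columns_loop_def count_loop_def
 advance_loop_def ae_Seq append.assoc ..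
 thus ?thesis unfolding aq_def .
 qed
 have B0: "real B \<ge> 1000" using B_large by simp
 have "c / B * (real m + 1) <= 1 * (real m + 1)" if "c <= 4" for c using B0 that by (intro mult_right_mono) auto
 from this[of 2] this[of 4] have h: "2 * (real m + 1) / B <= real m + 1" "4 * (real m + 1) / B <= real m + 1" by simp_all
 have w: "(28 + 6 * real m / B) * real m = 28 * real m + 6 * (real m)^2 / B" by (simp add: power2_eq_square algebra_simps)
 have "4 + 2 * real (length ([]::addr list)) + (8 + x + (4 + 2 * real (length ([]::addr list)) +
 (w + 4 + (4 + 2 * real (length ([]::addr list)) + (12 + y))))) <= 50 + 40 * real m + 6 * (real m)^2 / B"
 if "x <= real m + 1" "y <= real m + 1" "w = 28 * real m + 6 * (real m)^2 / B" for x y w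
 using that by simp
 note this = this[OF h w]
 from aq_mono[OF full[unfolded code] order_refl this] show ?thesis by (auto simp: X_def elim!: aq_mono)
qed

text \<open>The bound \<open>Ca + 13 * int m + 10\<close> on the stack consists of three arrays of
  \<open>m\<close> cells and the range \<open>10 * m + 10\<close> of the transposition. Moving all
  \<open>n\<close> items costs only \<open>O(n / B)\<close> beyond the terms in
  \<open>m\<close>.\<close>

lemma MoveToBuckets_aq:
 assumes b: "bucketing p f n m"
 and v: "H s = Fin a" "H (s + 1) = Fin d" "H (s + 2) = Fin (int n)" "H (s + 3) = Fin (int m)" "H (s + 10) = Fin pv" "H (s + 11) = Fin bs"
 and lay: "a + int n <= s" "d + int n <= s" "{a..<a + int n} Int {d..<d + int n} = {}" "s + 15 <= pv" "pv + int m < bs" "Ca = bs + int m + 1"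
 and f: "!!q. q < n ==> H (d + int q) = f q" and p: "!!i. i <= m ==> H (pv + int i) = p i"
 and st: "!!i. i <= m ==> H (bs + int i) = Fin (int (bucketing.start p f n i))"
 and U: "{s..s + 14} <= U" "{a..a + int n} <= U" "{d..d + int n} <= U" "{pv..Ca + 13 * int m + 10} <= U"
 shows "aq U (60 + 20 * real m + 960 * (real m)^2 / B + 4 * real n / B) (frame SquareSort_proc s) MoveToBuckets H Ca
 (%H' sp'. sp' = Ca + 3 * int m &
 (ALL i<m. H' ` {a + int (bucketing.start p f n i)..<a + int (bucketing.start p f n (Suc i))} = bucketing.bucket p f n i &
 inj_on H' {a + int (bucketing.start p f n i)..<a + int (bucketing.start p f n (Suc i))}) &
 (ALL z<Ca. z ~: {a..<a + int n} --> z ~: {s + 4, s + 12, s + 13, s + 14} --> H' z = H z))"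
proof -
 interpret bucketing p f n m by (rule b)
 let ?fr = "frame SquareSort_proc s"
 let ?sp = "Ca + 3 * int m"
 have Bb: "int B \<ge> 1000" using B_large by simp
 define X where "X H' \<longleftrightarrow> H' (s + 12) = Fin Ca & H' (s + 13) = Fin (Ca + int m) & H' (s + 14) = Fin (Ca + 2 * int m) &
 (ALL z<Ca. z ~: {s + 4, s + 12, s + 13, s + 14} --> H' z = H z)" for H' :: mem
 have X: "H' s = Fin a" "H' (s + 1) = Fin d" "H' (s + 2) = Fin (int n)" "H' (s + 3) = Fin (int m)" "H' (s + 10) = Fin pv" "H' (s + 11) = Fin bs"
 "H' (s + 12) = Fin Ca" "H' (s + 13) = Fin (Ca + int m)" "H' (s + 14) = Fin (Ca + 2 * int m)"
 "!!q. q < n ==> H' (d + int q) = f q" "!!i. i <= m ==> H' (pv + int i) = p i" "!!i. i <= m ==> H' (bs + int i) = Fin (int (start i))"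
 if "X H'" for H'
 using that v lay f p st unfolding X_def by auto
 have st1: "aq U (4 + 2 * real (length ([]::addr list))) ?fr (Alloc ''C'' (V ''m'');; Alloc ''E'' (V ''m'');; Alloc ''W'' (V ''m'');; ''i'' ::= N 0) H Ca
 (%H' sp'. sp' = ?sp & X H' & H' (s + 4) = Fin 0)"
 by (rule aq_frame[where s = s]) (use v lay U in \<open>auto simp: ae_simps X_def\<close>)
 let ?CE = "%H'. ALL q<m. H' (Ca + int q) = Fin (d + int (col q)) & H' (Ca + int m + int q) = Fin (d + int (col (Suc q))) &
 H' (Ca + 2 * int m + int q) = Fin (a + int (start q))"
 have st2: "aq U (20 + 8 * real m / B) ?fr start_loop H1 sp1 (%H' sp'. sp' = ?sp & X H' & ?CE H')"
 if h: "sp1 = ?sp & X H1 & H1 (s + 4) = Fin 0" for H1 sp1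
 proof -
 have X1: "X H1" using h by blast
 have U4: "{bs..Ca + 3 * int m} <= U" by (rule order_trans[OF _ U(4)]) (use lay in auto)
 have "aq U (20 + 8 * real m / B) ?fr start_loop H1 sp1
 (%H' sp'. sp' = sp1 & (ALL q<m. H' (Ca + int q) = Fin (d + min (int (q * m)) (int n)) &
 H' (Ca + int m + int q) = Fin (d + min (int (Suc q * m)) (int n)) & H' (Ca + 2 * int m + int q) = Fin (a + int (start q))) &
 (ALL z. z ~= s + 4 --> z ~: {Ca..<Ca + 3 * int m} --> H' z = H1 z))"
 by (rule start_loop_aq[where bs = bs]) (use X[OF X1] h lay U U4 in auto)
 thus ?thesis
 proof (rule aq_mono)
 fix H' sp'
 assume q: "sp' = sp1 & (ALL q<m. H' (Ca + int q) = Fin (d + min (int (q * m)) (int n)) &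
 H' (Ca + int m + int q) = Fin (d + min (int (Suc q * m)) (int n)) & H' (Ca + 2 * int m + int q) = Fin (a + int (start q))) &
 (ALL z. z ~= s + 4 --> z ~: {Ca..<Ca + 3 * int m} --> H' z = H1 z)"
 have m1: "min (int (q * m)) (int n) = int (col q)" for q unfolding clm_def by (simp only: of_nat_min)
 have "?CE H'" using q unfolding m1 by blast
 moreover have "X H'" using X1 q lay unfolding X_def by auto
 ultimately show "sp' = ?sp & X H' & ?CE H'" using q h by blast
 qed auto
 qed
 let ?pos = "%j i. d + int (col j + below j i)" and ?wpos = "%i j. a + int (start i + inner i j)"
 let ?Q = "%H' sp'. sp' = ?sp & (ALL i<m. H' ` {a + int (start i)..<a + int (start (Suc i))} = bucket i &
 inj_on H' {a + int (start i)..<a + int (start (Suc i))}) &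
 (ALL z<Ca. z ~: {a..<a + int n} --> z ~: {s + 4, s + 12, s + 13, s + 14} --> H' z = H z)"
 let ?es = "[V ''C'', V ''E'', V ''m'', V ''pivots'' \<oplus> N 1, V ''W'', V ''m'']"
 have st3: "aq U (8 + skew_cost m m (int n)) ?fr (Call SkewTranspose ?es) H1 sp1 ?Q"
 if h: "sp1 = ?sp & X H1 & ?CE H1" for H1 sp1
 proof -
 have X1: "X H1" and CE: "?CE H1" using h by blast+
 note X1s = X[OF X1]
 let ?args = "[Fin Ca, Fin (Ca + int m), Fin (int m), Fin (pv + 1), Fin (Ca + 2 * int m), Fin (int m)]"
 define Hb where "Hb = write_list H1 ?sp ?args"
 have args: "map (aval ?fr H1) ?es = ?args" using X1s by simp
 have beq: "Hb x = H1 x" if "x < ?sp" for x using that by (simp add: Hb_def)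
 have vb: "skew_vars ?sp Ca (Ca + int m) m (pv + 1) (Ca + 2 * int m) m Hb" by (simp add: Hb_def skew_vars_def)
 have Db: "Hb (d + int q) = f q" if "q < n" for q using beq[of "d + int q"] X1s(10)[OF that] that lay by auto
 have C0: "Hb (Ca + int j) = Fin (?pos j 0)" if "j < m" for j using beq[of "Ca + int j"] CE that by simp
 have E0: "Hb (Ca + int m + int j) = Fin (d + int (col (Suc j)))" if "j < m" for j using beq[of "Ca + int m + int j"] CE that by simp
 have W0: "Hb (Ca + 2 * int m + int i) = Fin (?wpos i 0)" if "i < m" for i using beq[of "Ca + 2 * int m + int i"] CE that by simp
 have P0: "Hb (pv + 1 + int i) = p (Suc i)" if "i < m" for i
 using beq[of "pv + 1 + int i"] X1s(11)[of "Suc i"] that lay by (simp add: add.assoc)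
 have g: "geo Hb Ca (Ca + int m) m (pv + 1) (Ca + 2 * int m) m ?pos ?wpos (%j. d + int (col (Suc j)))"
 by (rule skew_geo) (use Db P0 E0 lay in auto)
 have S: "sq (skew_cells ?sp (10 * int m + 10) Ca (Ca + int m) m (pv + 1) (Ca + 2 * int m) m) (skew_ptrs Ca m (Ca + 2 * int m) m)
 (skew_cost m m (moved ?pos m m)) (frame SkewTranspose_proc ?sp) (body SkewTranspose_proc) Hb (?sp + 10)
 (%H' sp'. progress ?sp Ca m (Ca + 2 * int m) m ?pos ?wpos Hb H' (%_. m) (%_. m))"
 by (rule Skew_sq[OF g _ vb]) (use C0 W0 in auto)
 have "aq U (skew_cost m m (int n)) (frame SkewTranspose_proc ?sp) (body SkewTranspose_proc) Hb (?sp + 10)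
 (%H' sp'. progress ?sp Ca m (Ca + 2 * int m) m ?pos ?wpos Hb H' (%_. m) (%_. m))"
 proof (rule sq_to_aq[OF S[unfolded skew_moved]])
 have "skew_cells ?sp (10 * int m + 10) Ca (Ca + int m) m (pv + 1) (Ca + 2 * int m) m <= {pv..Ca + 13 * int m + 10}"
 unfolding skew_cells_def using lay by auto
 thus "skew_cells ?sp (10 * int m + 10) Ca (Ca + int m) m (pv + 1) (Ca + 2 * int m) m <= U" using U(4) by blast
 fix H' sp' q
 assume pr: "progress ?sp Ca m (Ca + 2 * int m) m ?pos ?wpos Hb H' (%_. m) (%_. m)" and q: "q \<in> skew_ptrs Ca m (Ca + 2 * int m) m"
 consider j where "j < m" "q = Ca + int j" | i where "i < m" "q = Ca + 2 * int m + int i"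
 proof -
 have "q = Ca + int (nat (q - Ca)) & nat (q - Ca) < m \<or> q = Ca + 2 * int m + int (nat (q - (Ca + 2 * int m))) & nat (q - (Ca + 2 * int m)) < m"
 using q by (auto simp: skew_ptrs_def)
 thus ?thesis using that by blast
 qed
 thus "{ptrs Hb q..ptrs H' q} <= U"
 proof cases
 case 1
 have "H' q = Fin (?pos j m)" using pr 1 unfolding progress_def by blast
 moreover have "?pos j m <= d + int n" using below_m[of j] clm_le[of n m "Suc j"] by simp
 ultimately have "{ptrs Hb q..ptrs H' q} <= {d..d + int n}" using C0[of j] 1 by auto
 thus ?thesis using U(3) by blast
 next
 case 2
 have "H' q = Fin (?wpos i m)" using pr 2 unfolding progress_def by blast
 moreover have "?wpos i m <= a + int n" using start_Suc[of i] start_le[of "Suc i"] 2 by simp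
 ultimately have "{ptrs Hb q..ptrs H' q} <= {a..a + int n}" using W0[of i] 2 by auto
 thus ?thesis using U(2) by blast
 qed
 qed
 hence A: "aq U (skew_cost m m (int n)) (frame SkewTranspose_proc ?sp) (body SkewTranspose_proc) Hb (?sp + 10) (%H' sp'. ?Q H' ?sp)"
 proof (rule aq_mono[OF _ order_refl order_refl])
 fix H' sp'
 assume pr: "progress ?sp Ca m (Ca + 2 * int m) m ?pos ?wpos Hb H' (%_. m) (%_. m)"
 have "H' z = H z" if z: "z < Ca" "z ~: {a..<a + int n}" "z ~: {s + 4, s + 12, s + 13, s + 14}" for z
 proof -
 have "z ~: {?wpos i 0..<?wpos i m}" if i: "i < m" for i
 using z(2) start_Suc[OF i] start_le[of "Suc i"] i by auto
 hence "H' z = Hb z" using pr z unfolding progress_def by auto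
 also have "... = H1 z" using z by (intro beq) auto
 also have "... = H z" using X1 z unfolding X_def by blast
 finally show ?thesis .
 qed
 thus "?Q H' ?sp" using skew_buckets[OF pr Db] by blast
 qed
 show ?thesis
 proof (rule aq_Call[where f = s and g = "s + 14"])
 show "aq U (skew_cost m m (int n)) (frame (squaresort_prog SkewTranspose) sp1) (body (squaresort_prog SkewTranspose))
 (write_list H1 sp1 (map (aval ?fr H1) ?es)) (sp1 + int (length (frame_vars (squaresort_prog SkewTranspose)))) (%H' sp'. ?Q H' sp1)"
 unfolding args using A h by (simp add: Hb_def del: write_list.simps)
 have "{sp1..<sp1 + int (length ?es)} <= {pv..Ca + 13 * int m + 10}" using h lay by auto
 thus "{sp1..<sp1 + int (length ?es)} <= U" using U(4) by blast
 qed (use U Bb in auto)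
 qed
 have full: "aq U (4 + 2 * real (length ([]::addr list)) + (20 + 8 * real m / B) + (8 + skew_cost m m (int n))) ?fr MoveToBuckets H Ca ?Q"
 unfolding MoveToBuckets_def start_loop_def[symmetric]
 by (rule aq_Seq, rule aq_Seq, rule st1, erule st2, erule st3)
 have "8 / B * real m <= 1 * real m" using B_large by (intro mult_right_mono) auto
 hence "4 + 2 * real (length ([]::addr list)) + (20 + 8 * real m / B) + (8 + skew_cost m m (int n)) <= 60 + 20 * real m + 960 * (real m)^2 / B + 4 * real n / B"
 using skew_cost_bound[of m "int n"] by simp
 thus ?thesis by (intro aq_mono[OF full]) auto
qed

end

section \<open>Random pivots\<close>

text \<open>Sampling with replacement makes all these lists of indices equally likely, so
  expectations become averages over \<open>n ^ r\<close> lists.\<close>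

definition samples :: "nat => nat => nat list set" where
 "samples n r = {js. set js <= {..<n} & length js = r}"

lemma finite_samples [simp]: "finite (samples n r)"
 unfolding samples_def by (rule finite_lists_length_eq) simp

lemma card_samples: "card (samples n r) = n ^ r"
 unfolding samples_def by (simp add: card_lists_length_eq)

lemma sum_samples_Suc:
 fixes G :: "nat list => 'a::comm_monoid_add"
 shows "(\<Sum>js\<in>samples n (Suc r). G js) = (\<Sum>j<n. \<Sum>js\<in>samples n r. G (j # js))"
proof -
 have "samples n (Suc r) = (%(j, js). j # js) ` ({..<n} \<times> samples n r)"
 by (auto simp: samples_def length_Suc_conv image_iff)
 moreover have "inj_on (%(j, js). j # js) ({..<n} \<times> samples n r)" by (auto simp: inj_on_def)
 ultimately show ?thesis by (simp add: sum.reindex sum.cartesian_product case_prod_unfold)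
qed

text \<open>The Weierstrass product inequality, which here plays the part of a union bound for
  collisions.\<close>

lemma prod_one_minus_ge:
 fixes x :: "nat => real"
 assumes "!!i. i < r ==> 0 <= x i" "!!i. i < r ==> x i <= 1"
 shows "1 - (\<Sum>i<r. x i) <= (\<Prod>i<r. 1 - x i)"
 using assms
proof (induction r)
 case (Suc r)
 have IH: "1 - (\<Sum>i<r. x i) <= (\<Prod>i<r. 1 - x i)" using Suc by simp
 have "(\<Prod>i<r. 1 - x i) <= 1" using Suc.prems by (intro prod_le_1) auto
 hence "(\<Prod>i<r. 1 - x i) * x r <= 1 * x r" using Suc.prems(1)[of r] by (intro mult_right_mono) auto
 thus ?case using IH by (simp add: algebra_simps)
qed simp

text \<open>Let \<open>r = m - 1\<close>. Counting from 0, sample \<open>i\<close> must avoid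
  \<open>i + 1\<close> values, namely its predecessors and the minimum. The failure probabilities
  add up to \<open>r * (r + 1) / (2 * n)\<close>, which is at most 2/3 because
  \<open>r^2 < n\<close> and \<open>4 \<le> r\<close>.\<close>

lemma accepted_samples:
 assumes n: "17 <= n" and m: "(m - 1)^2 < n" "n <= m^2" and j0: "j0 < n"
 shows "real (n ^ (m - 1)) <= 3 * real (card {js \<in> samples n (m - 1). distinct js & j0 ~: set js})"
proof -
 define r where "r = m - 1"
 have r4: "4 <= r"
 proof (rule ccontr)
 assume "~ 4 <= r"
 hence "m <= 4" by (simp add: r_def)
 hence "m^2 <= 4^2" by (intro power_mono) auto
 thus False using n m by simp
 qed
 have rn: "r^2 < n" using m by (simp add: r_def)
 have "r * 4 <= r^2" using r4 by (simp add: power2_eq_square)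
 hence r_n: "4 * r < n" using rn by linarith
 let ?A = "{..<n} - {j0}"
 have cA: "card ?A = n - 1" using j0 by simp
 have "{js \<in> samples n (m - 1). distinct js & j0 ~: set js} = {js. length js = r & distinct js & set js <= ?A}"
 by (auto simp: samples_def r_def)
 hence "card {js \<in> samples n (m - 1). distinct js & j0 ~: set js} = \<Prod>{n - 1 - r + 1..n - 1}"
 using card_lists_distinct_length_eq[of ?A r] r_n cA by simp
 also have "{n - 1 - r + 1..n - 1} = (%i. n - 1 - i) ` {..<r}"
 proof (intro equalityI subsetI)
 fix y assume "y \<in> {n - 1 - r + 1..n - 1}"
 hence "y = n - 1 - (n - 1 - y)" "n - 1 - y \<in> {..<r}" using r_n by auto
 thus "y \<in> (%i. n - 1 - i) ` {..<r}" by blast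
 qed (use r_n in auto)
 also have "\<Prod>((%i. n - 1 - i) ` {..<r}) = (\<Prod>i<r. n - 1 - i)"
 by (subst prod.reindex) (use r_n in \<open>auto simp: inj_on_def\<close>)
 finally have "real (card {js \<in> samples n (m - 1). distinct js & j0 ~: set js}) = (\<Prod>i<r. real (n - 1 - i))" by simp
 also have "... = (\<Prod>i<r. real n * (1 - (real i + 1) / real n))"
 using r_n by (intro prod.cong) (auto simp: field_simps of_nat_diff)
 also have "... = real n ^ r * (\<Prod>i<r. 1 - (real i + 1) / real n)" by (simp add: prod.distrib)
 finally have eq: "real (card {js \<in> samples n (m - 1). distinct js & j0 ~: set js}) = real n ^ r * (\<Prod>i<r. 1 - (real i + 1) / real n)" .
 have gauss: "(\<Sum>i<r. real i + 1) = real r * (real r + 1) / 2" by (induction r) (auto simp: field_simps)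
 have "real (r * 4) <= real (r^2)" "real (r^2) <= real n" using \<open>r * 4 <= r^2\<close> rn by (simp_all only: of_nat_le_iff)
 hence "real r * 4 <= real r * real r" "real r * real r <= real n" by (simp_all add: power2_eq_square)
 hence "real r * (real r + 1) / 2 <= 2 / 3 * real n" by (simp add: distrib_left)
 hence "(\<Sum>i<r. (real i + 1) / real n) <= 2 / 3"
 using n unfolding sum_divide_distrib[symmetric] gauss by (simp add: field_simps)
 moreover have "1 - (\<Sum>i<r. (real i + 1) / real n) <= (\<Prod>i<r. 1 - (real i + 1) / real n)"
 by (rule prod_one_minus_ge) (use r_n in auto)
 ultimately have "1 / 3 <= (\<Prod>i<r. 1 - (real i + 1) / real n)" by linarith
 hence "real n ^ r * (1 / 3) <= real n ^ r * (\<Prod>i<r. 1 - (real i + 1) / real n)" by (intro mult_left_mono) auto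
 thus ?thesis unfolding eq by (simp add: r_def)
qed

text \<open>A discrete form of integrating a power: by Bernoulli's inequality
  \<open>(r + 1) * k ^ r\<close> is at most the difference of the powers \<open>r + 1\<close> of
  \<open>k + 1\<close> and \<open>k\<close>. These differences telescope over \<open>k < n\<close>,
  and the term for \<open>k = n\<close> is added separately.\<close>

lemma sum_powers_le:
 fixes n r :: nat
 assumes "1 <= n"
 shows "(real r + 1) * (\<Sum>k=1..n. real k ^ r) <= real n ^ (r + 1) + (real r + 1) * real n ^ r"
proof -
 have step: "(real r + 1) * real k ^ r <= real (k + 1) ^ (r + 1) - real k ^ (r + 1)" for k
 proof -
 have "1 + real (r + 1) * (1 / real k) <= (1 + 1 / real k) ^ (r + 1)" if "k > 0"
 by (rule Bernoulli_inequality) (use that in \<open>simp add: field_simps\<close>)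
 hence "real k ^ (r + 1) * (1 + real (r + 1) * (1 / real k)) <= real k ^ (r + 1) * (1 + 1 / real k) ^ (r + 1)" if "k > 0"
 using that by (intro mult_left_mono) auto
 also have "real k ^ (r + 1) * (1 + 1 / real k) ^ (r + 1) = real (k + 1) ^ (r + 1)" if "k > 0"
 proof -
 have "real k * (1 + 1 / real k) = real (k + 1)" using that by (simp add: field_simps)
 thus ?thesis by (simp only: power_mult_distrib[symmetric])
 qed
 also have "real k ^ (r + 1) * (1 + real (r + 1) * (1 / real k)) = real k ^ (r + 1) + (real r + 1) * real k ^ r" if "k > 0"
 using that by (simp add: field_simps)
 finally have "real k ^ (r + 1) + (real r + 1) * real k ^ r <= real (k + 1) ^ (r + 1)" if "k > 0"
 using that by simp
 thus ?thesis by (cases "k > 0") (auto simp: power_0_left)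
 qed
 have "(\<Sum>k=1..<n. (real r + 1) * real k ^ r) <= (\<Sum>k=1..<n. real (Suc k) ^ (r + 1) - real k ^ (r + 1))"
 using step by (intro sum_mono) simp
 also have "... = real n ^ (r + 1) - real 1 ^ (r + 1)" using sum_Suc_diff'[of 1 n "%k. real k ^ (r + 1)"] assms by simp
 finally have "(real r + 1) * (\<Sum>k=1..<n. real k ^ r) <= real n ^ (r + 1)" by (simp add: sum_distrib_left)
 moreover have "(\<Sum>k=1..n. real k ^ r) = (\<Sum>k=1..<n. real k ^ r) + real n ^ r"
 using assms by (simp add: atLeastLessThan_eq_atLeastAtMost_diff sum.last_plus add.commute)
 ultimately show ?thesis by (simp add: distrib_left)
qed

text \<open>The interval of values is open below and closed above because a pivot belongs to the
  bucket that it begins.\<close>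

definition unseparated :: "(nat => cell) => nat => nat list => (nat \<times> nat) set" where
 "unseparated f n js = {(u, v). u < n & v < n & f u <= f v & (\<forall>j\<in>set js. ~ (f u < f j & f j <= f v))}"

lemma finite_unseparated [simp]: "finite (unseparated f n js)"
 by (rule finite_subset[of _ "{..<n} \<times> {..<n}"]) (auto simp: unseparated_def)

text \<open>After exchanging the sums, a pair with \<open>d\<close> items in its interval is
  unseparated for \<open>(n - d) ^ r\<close> samples. For fixed \<open>u\<close> the values of
  \<open>d\<close> are distinct, so the sum over \<open>v\<close> is at most the sum of
  \<open>k ^ r\<close> for \<open>k\<close> from 1 to \<open>n\<close>.\<close>

lemma sum_unseparated:
 assumes inj: "inj_on f {..<n}" and n: "1 <= n"
 shows "(\<Sum>js\<in>samples n r. real (card (unseparated f n js))) <= real n ^ r * (real n * (real n / (real r + 1) + 1))"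
proof -
 let ?d = "%u v. card {w. w < n & f u < f w & f w <= f v}"
 let ?P = "{(u, v). u < n & v < n & f u <= f v}"
 have finP: "finite ?P" by (rule finite_subset[of _ "{..<n} \<times> {..<n}"]) auto
 have fin: "finite {w. w < n & Q w}" for Q by simp
 have cnt: "card {js \<in> samples n r. (u, v) \<in> unseparated f n js} = (n - ?d u v) ^ r" if "(u, v) \<in> ?P" for u v
 proof -
 let ?W = "{w. w < n & f u < f w & f w <= f v}"
 have "{js \<in> samples n r. (u, v) \<in> unseparated f n js} = {js. set js <= {..<n} - ?W & length js = r}"
 using that by (auto simp: samples_def unseparated_def)
 moreover have "card ({..<n} - ?W) = n - card ?W" by (subst card_Diff_subset) auto
 ultimately show ?thesis by (simp add: card_lists_length_eq)
 qed
 have "(\<Sum>js\<in>samples n r. card (unseparated f n js)) = (\<Sum>js\<in>samples n r. \<Sum>x\<in>?P. if x \<in> unseparated f n js then 1 else 0)"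
 proof (rule sum.cong[OF refl])
 fix js
 have "unseparated f n js = {x \<in> ?P. x \<in> unseparated f n js}" by (auto simp: unseparated_def)
 hence "card (unseparated f n js) = card {x \<in> ?P. x \<in> unseparated f n js}" by simp
 also have "... = (\<Sum>x\<in>?P. if x \<in> unseparated f n js then 1 else 0)"
 by (simp only: sum.If_cases[OF finP]) (simp add: Int_def)
 finally show "card (unseparated f n js) = (\<Sum>x\<in>?P. if x \<in> unseparated f n js then 1 else 0)" .
 qed
 also have "... = (\<Sum>x\<in>?P. \<Sum>js\<in>samples n r. if x \<in> unseparated f n js then 1 else 0)" by (rule sum.swap)
 also have "... = (\<Sum>(u, v)\<in>?P. (n - ?d u v) ^ r)"
 proof (rule sum.cong[OF refl], clarify)
 fix u v assume uv: "u < n" "v < n" "f u <= f v"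
 have "(\<Sum>js\<in>samples n r. if (u, v) \<in> unseparated f n js then 1 else 0) = card {js \<in> samples n r. (u, v) \<in> unseparated f n js}"
 by (simp only: sum.If_cases[OF finite_samples]) (simp add: Int_def)
 thus "(\<Sum>js\<in>samples n r. if (u, v) \<in> unseparated f n js then 1 else 0) = (n - ?d u v) ^ r" using cnt uv by simp
 qed
 also have "... = (\<Sum>u<n. \<Sum>v\<in>{v. v < n & f u <= f v}. (n - ?d u v) ^ r)"
 proof -
 have "?P = Sigma {..<n} (%u. {v. v < n & f u <= f v})" by auto
 thus ?thesis by (simp add: sum.Sigma)
 qed
 also have "... <= (\<Sum>u<n. \<Sum>k=1..n. k ^ r)"
 proof (rule sum_mono)
 fix u assume u: "u \<in> {..<n}"
 let ?V = "{v. v < n & f u <= f v}"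
 have mono: "?d u v < ?d u v'" if "v \<in> ?V" "v' \<in> ?V" "f v < f v'" for v v'
 proof (rule psubset_card_mono)
 show "{w. w < n & f u < f w & f w <= f v} \<subset> {w. w < n & f u < f w & f w <= f v'}"
 proof (rule psubsetI)
 show "{w. w < n & f u < f w & f w <= f v} <= {w. w < n & f u < f w & f w <= f v'}"
 using that(3) by auto
 have "v' \<in> {w. w < n & f u < f w & f w <= f v'}" "v' ~: {w. w < n & f u < f w & f w <= f v}"
 using that by auto
 thus "{w. w < n & f u < f w & f w <= f v} ~= {w. w < n & f u < f w & f w <= f v'}" by blast
 qed
 qed simp
 have injd: "inj_on (%v. n - ?d u v) ?V"
 proof (rule inj_onI)
 fix v v' assume v: "v \<in> ?V" "v' \<in> ?V" and eq: "n - ?d u v = n - ?d u v'"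
 have le: "?d u v <= n" for v using card_mono[of "{..<n}" "{w. w < n & f u < f w & f w <= f v}"] by auto
 have "?d u v = ?d u v'" using eq le[of v] le[of v'] by linarith
 hence "~ f v < f v'" "~ f v' < f v" using mono[OF v] mono[OF v(2,1)] by fastforce+
 hence "f v = f v'" by simp
 thus "v = v'" using inj v by (auto dest: inj_onD)
 qed
 have rng: "(%v. n - ?d u v) ` ?V <= {1..n}"
 proof clarsimp
 fix v assume "v < n" "f u <= f v"
 have "{w. w < n & f u < f w & f w <= f v} \<subset> {..<n}" using u by auto
 hence "?d u v < card {..<n}" by (rule psubset_card_mono[rotated]) simp
 thus "Suc 0 <= n - ?d u v" by simp
 qed
 have "(\<Sum>v\<in>?V. (n - ?d u v) ^ r) = (\<Sum>k\<in>(%v. n - ?d u v) ` ?V. k ^ r)" by (simp add: sum.reindex[OF injd])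
 also have "... <= (\<Sum>k=1..n. k ^ r)" by (rule sum_mono2) (use rng in auto)
 finally show "(\<Sum>v\<in>?V. (n - ?d u v) ^ r) <= (\<Sum>k=1..n. k ^ r)" .
 qed
 finally have "(\<Sum>js\<in>samples n r. card (unseparated f n js)) <= n * (\<Sum>k=1..n. k ^ r)" by simp
 hence "real (\<Sum>js\<in>samples n r. card (unseparated f n js)) <= real (n * (\<Sum>k=1..n. k ^ r))" by (simp only: of_nat_le_iff)
 hence 1: "(\<Sum>js\<in>samples n r. real (card (unseparated f n js))) <= real n * (\<Sum>k=1..n. real k ^ r)" by simp
 have "(\<Sum>k=1..n. real k ^ r) <= (real n ^ (r + 1) + (real r + 1) * real n ^ r) / (real r + 1)"
 using sum_powers_le[OF n, of r] by (simp add: pos_le_divide_eq mult.commute add_pos_nonneg)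
 also have "... = real n ^ r * (real n / (real r + 1) + 1)" by (simp add: field_simps)
 finally have "real n * (\<Sum>k=1..n. real k ^ r) <= real n * (real n ^ r * (real n / (real r + 1) + 1))" by (intro mult_left_mono) auto
 thus ?thesis using 1 by (simp add: mult_ac)
qed

definition bucket_squares :: "cell set => (nat => cell) => nat => nat" where
 "bucket_squares X p m = (\<Sum>i<m. (card {v \<in> X. p i <= v & v < p (Suc i)})^2)"

text \<open>A square counts the ordered pairs within a bucket. Every sampled value is a bucket
  boundary, so such a pair or its reversal is unseparated; hence the factor 2.\<close>

lemma bucket_squares_le:
 assumes inj: "inj_on f {..<n}" and mono: "!!i i'. i < i' ==> i' <= m ==> p i < p i'"
 and js: "!!j. j \<in> set js ==> EX i. i <= m & p i = f j"
 shows "bucket_squares (f ` {..<n}) p m <= 2 * card (unseparated f n js)"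
proof -
 let ?b = "%i. {q. q < n & p i <= f q & f q < p (Suc i)}"
 have cb: "card {v \<in> f ` {..<n}. p i <= v & v < p (Suc i)} = card (?b i)" for i
 proof -
 have "{v \<in> f ` {..<n}. p i <= v & v < p (Suc i)} = f ` ?b i" by auto
 moreover have "inj_on f (?b i)" using inj by (rule inj_on_subset) auto
 ultimately show ?thesis by (simp add: card_image)
 qed
 have le: "p i <= p i'" if "i <= i'" "i' <= m" for i i' using mono[of i i'] that by (cases "i = i'") auto
 have disj: "?b i Int ?b i' = {}" if "i < m" "i' < m" "i < i'" for i i'
 proof -
 have "p (Suc i) <= p i'" using that by (intro le) auto
 thus ?thesis by auto
 qed
 have "bucket_squares (f ` {..<n}) p m = (\<Sum>i<m. card (?b i \<times> ?b i))"
 unfolding bucket_squares_def cb by (simp add: card_cartesian_product power2_eq_square)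
 also have "... = card (\<Union>i<m. ?b i \<times> ?b i)"
 proof (rule card_UN_disjoint[symmetric])
 show "\<forall>i\<in>{..<m}. \<forall>j\<in>{..<m}. i ~= j --> ?b i \<times> ?b i Int ?b j \<times> ?b j = {}"
 proof (intro ballI impI)
 fix i j assume "i \<in> {..<m}" "j \<in> {..<m}" "i ~= j"
 hence "?b i Int ?b j = {}" using disj[of i j] disj[of j i] by (cases "i < j") auto
 thus "?b i \<times> ?b i Int ?b j \<times> ?b j = {}" by blast
 qed
 qed auto
 also have "... <= card (unseparated f n js Un (%(u, v). (v, u)) ` unseparated f n js)"
 proof (rule card_mono)
 have key: "(u, v) \<in> unseparated f n js" if i: "i < m" and u: "u \<in> ?b i" and v: "v \<in> ?b i" and uv: "f u <= f v" for i u v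
 unfolding unseparated_def
 proof (clarsimp, intro conjI ballI)
 show "u < n" "v < n" "f u <= f v" using u v uv by auto
 fix j assume "j \<in> set js"
 then obtain k where k: "k <= m" "p k = f j" using js by blast
 show "f u < f j --> ~ f j <= f v"
 proof (intro impI notI)
 assume "f u < f j" "f j <= f v"
 hence "p i < p k" "p k < p (Suc i)" using u v k by auto
 moreover have "p k <= p i \<or> p (Suc i) <= p k" using le[of k i] le[of "Suc i" k] k i by (cases "k <= i") auto
 ultimately show False by auto
 qed
 qed
 show "(\<Union>i<m. ?b i \<times> ?b i) <= unseparated f n js Un (%(u, v). (v, u)) ` unseparated f n js"
 proof clarify
 fix i u v assume h: "i < m" "u < n" "p i <= f u" "f u < p (Suc i)" "v < n" "p i <= f v" "f v < p (Suc i)"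
 "(u, v) ~: (%(u, v). (v, u)) ` unseparated f n js"
 show "(u, v) \<in> unseparated f n js"
 proof (cases "f u <= f v")
 case True
 thus ?thesis using key[of i u v] h by auto
 next
 case False
 hence "(v, u) \<in> unseparated f n js" using key[of i v u] h by auto
 thus ?thesis using h(8) by (auto simp: image_iff)
 qed
 qed
 qed simp
 also have "... <= card (unseparated f n js) + card ((%(u, v). (v, u)) ` unseparated f n js)" by (rule card_Un_le)
 also have "card ((%(u, v). (v, u)) ` unseparated f n js) <= card (unseparated f n js)" by (rule card_image_le) simp
 finally show ?thesis by simp
qed

lemma wpp_spmf_of_set:
 assumes "finite A" "A ~= {}"
 shows "wpp (spmf_of_set A) f = ennreal (1 / real (card A)) * (\<Sum>x\<in>A. f x)"
proof -
 have "wpp (spmf_of_set A) f = (\<integral>\<^sup>+ x. f x \<partial>measure_pmf (pmf_of_set A))"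
 using assms by (simp add: wpp_def spmf_of_set_def spmf_of_pmf_def)
 also have "... = (\<Sum>x\<in>A. f x) / card A" by (rule nn_integral_pmf_of_set[OF assms(2,1)])
 also have "... = ennreal (1 / real (card A)) * (\<Sum>x\<in>A. f x)"
 proof -
 have c: "0 < real (card A)" using assms by (simp add: card_gt_0_iff)
 have "ennreal (1 / real (card A)) = inverse (ennreal (real (card A)))"
 using c by (simp add: inverse_ennreal inverse_eq_divide)
 thus ?thesis by (simp add: divide_ennreal_def mult.commute ennreal_of_nat_eq_real_of_nat)
 qed
 finally show ?thesis .
qed

lemma ew_Random:
 assumes "int_of (aval fr H e) = int n" "1 <= n"
 shows "ew fr (Random x e) H sp f =
 ennreal (1 / real n) * (\<Sum>j<n. f (H(fr x := Fin (int j))) sp (aval_acc fr H e @ [Write (fr x)]))"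
proof -
 have img: "{0..<int n} = int ` {..<n}" by (simp add: image_int_atLeastLessThan lessThan_atLeast0)
 have "ew fr (Random x e) H sp f = wpp (spmf_of_set {0..<int n}) (%r. f (H(fr x := Fin r)) sp (aval_acc fr H e @ [Write (fr x)]))"
 unfolding ew_def exec_Random assms(1) wpp_map by simp
 also have "... = ennreal (1 / real (card {0..<int n})) * (\<Sum>r\<in>{0..<int n}. f (H(fr x := Fin r)) sp (aval_acc fr H e @ [Write (fr x)]))"
 by (rule wpp_spmf_of_set) (use assms(2) in auto)
 also have "(\<Sum>r\<in>{0..<int n}. f (H(fr x := Fin r)) sp (aval_acc fr H e @ [Write (fr x)])) =
 (\<Sum>j<n. f (H(fr x := Fin (int j))) sp (aval_acc fr H e @ [Write (fr x)]))"
 unfolding img by (simp add: sum.reindex inj_on_def)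
 finally show ?thesis by simp
qed

section \<open>One round of pivot sampling and the retry loop\<close>

definition sample_loop :: com where
 "sample_loop = WHILE V ''i'' \<prec> V ''m'' DO (
 Random ''j'' (V ''n'');;
 V ''pivots'' \<oplus> V ''i'' :*= (V ''D'')[[V ''j'']];;
 ''i'' ::= V ''i'' \<oplus> N 1)"

definition sort_check :: com where
 "sort_check = Call MergeSort [V ''pivots'' \<oplus> N 1, V ''m'' \<ominus> N 1];;
 ''ok'' ::= N 1;;
 ''i'' ::= N 1;;
 check_loop"

lemma samples_0: "samples n 0 = {[]}"
 by (auto simp: samples_def)

text \<open>This justifies that a round compares only neighbours once the samples are
  sorted.\<close>

lemma sorted_distinct_iff_adjacent:
 fixes xs :: "'a::linorder list"
 assumes "sorted xs"
 shows "distinct xs \<longleftrightarrow> (ALL q. Suc q < length xs --> xs ! Suc q ~= xs ! q)"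
proof
 assume "distinct xs"
 thus "ALL q. Suc q < length xs --> xs ! Suc q ~= xs ! q" by (simp add: nth_eq_iff_index_eq)
next
 assume adj: "ALL q. Suc q < length xs --> xs ! Suc q ~= xs ! q"
 have "xs ! q < xs ! Suc q" if "Suc q < length xs" for q
 proof -
 have "xs ! q <= xs ! Suc q" using assms that by (simp add: sorted_iff_nth_Suc)
 moreover have "xs ! Suc q ~= xs ! q" using adj that by blast
 ultimately show ?thesis by (simp add: less_le)
 qed
 hence "sorted_wrt (<) xs" by (subst sorted_wrt_iff_nth_Suc_transp) (auto intro: transpI)
 thus "distinct xs" by (simp add: strict_sorted_iff)
qed

definition pivot_round :: com where
 "pivot_round = ''i'' ::= N 1;; sample_loop;; Call MergeSort [V ''pivots'' \<oplus> N 1, V ''m'' \<ominus> N 1];;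
 ''ok'' ::= N 1;; ''i'' ::= N 1;; check_loop"

lemma ew_pivot_round: "ew fr pivot_round H sp f = ew fr (''i'' ::= N 1;; (sample_loop;; sort_check)) H sp f"
 by (simp add: ew_Seq pivot_round_def sort_check_def)

context cache
begin

text \<open>The cost bound charges four blocks per sample, two for the frame and one each for the
  random source cell and the pivot cell; the final 4 is for the last guard.\<close>

definition sampled :: "addr => addr => addr => nat => nat => nat list => mem => mem => access list => bool" where
 "sampled s d pv n i js H H' t \<longleftrightarrow>
 (ALL k<length js. H' (pv + int i + int k) = H (d + int (js ! k))) &
 (ALL z. z ~= s + 4 --> z ~= s + 5 --> z ~: {pv + int i..<pv + int i + int (length js)} --> H' z = H z) &
 addrs t <= {s..s + 14} Un {pv..pv + int i + int (length js)} Un {d..d + int n} & cst t <= 8 * length js + 4"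

text \<open>The sampled indices determine the relevant effect of the loop, so a bound
  \<open>G js\<close> for each list of indices may be averaged.\<close>

lemma ew_sample:
 assumes "H (s + 1) = Fin d" "H (s + 2) = Fin (int n)" "H (s + 3) = Fin (int m)" "H (s + 10) = Fin pv"
 "H (s + 4) = Fin (int i)" "i + r = m" "1 <= n" "d + int n <= s" "s + 15 <= pv"
 and "!!js H' t. js \<in> samples n r ==> sampled s d pv n i js H H' t ==> F H' sp t <= G js"
 shows "ew (frame SquareSort_proc s) sample_loop H sp F <= ennreal (1 / real n ^ r) * (\<Sum>js\<in>samples n r. G js)"
 using assms
proof (induction r arbitrary: i H F G)
 case 0
 let ?fr = "frame SquareSort_proc s"
 let ?a = "bval_acc ?fr H (V ''i'' \<prec> V ''m'')"
 have "cst ?a <= 4" by (rule cst_local[of _ s "s + 14"]) (use B_large in auto)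
 hence "F H sp ?a <= G []" by (intro 0) (auto simp: samples_0 sampled_def)
 moreover have "ew ?fr sample_loop H sp F = F H sp ?a"
 unfolding sample_loop_def by (subst ew_While_unfold) (use 0 in simp)
 ultimately show ?case by (simp add: samples_0)
next
 case (Suc r)
 let ?fr = "frame SquareSort_proc s"
 let ?a = "bval_acc ?fr H (V ''i'' \<prec> V ''m'')"
 note v = Suc.prems(1-9)
 define H' where "H' j = H(s + 5 := Fin (int j), pv + int i := H (d + int j), s + 4 := Fin (int i + 1))" for j
 define t' where "t' j = [Read (s + 2), Write (s + 5), Read (s + 10), Read (s + 4), Read (s + 1), Read (s + 5), Read (d + int j),
 Write (pv + int i), Read (s + 4), Write (s + 4)]" for j
 have body: "ew ?fr (Random ''j'' (V ''n'');; V ''pivots'' \<oplus> V ''i'' :*= (V ''D'')[[V ''j'']];; ''i'' ::= V ''i'' \<oplus> N 1) H sp f =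
 ennreal (1 / real n) * (\<Sum>j<n. f (H' j) sp (t' j))" for f
 proof -
 have "ew ?fr (V ''pivots'' \<oplus> V ''i'' :*= (V ''D'')[[V ''j'']]) (H(s + 5 := Fin (int j))) sp h =
 h (H(s + 5 := Fin (int j), pv + int i := H (d + int j))) sp [Read (s + 10), Read (s + 4), Read (s + 1), Read (s + 5), Read (d + int j), Write (pv + int i)]"
 if "j < n" for j h
 unfolding ew_def exec_Store using v that by simp
 thus ?thesis
 unfolding ew_Seq using v
 by (subst ew_Random[where n = n]) (auto simp: ew_Assign H'_def t'_def intro!: sum.cong)
 qed
 have IH: "ew ?fr sample_loop (H' j) sp (%H2 sp2 t2. F H2 sp2 (?a @ t' j @ t2)) <=
 ennreal (1 / real n ^ r) * (\<Sum>js\<in>samples n r. G (j # js))" if j: "j < n" for j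
 proof (rule Suc.IH[where i = "Suc i"])
 fix js H2 t2 assume js: "js \<in> samples n r" and sm: "sampled s d pv n (Suc i) js (H' j) H2 t2"
 have len: "length js = r" using js by (simp add: samples_def)
 have un: "H2 z = H' j z" if "z ~= s + 4" "z ~= s + 5" "z ~: {pv + int (Suc i)..<pv + int (Suc i) + int r}" for z
 using sm that unfolding sampled_def len by blast
 show "F H2 sp (?a @ t' j @ t2) <= G (j # js)"
 proof (rule Suc.prems(10))
 show "j # js \<in> samples n (Suc r)" using js j by (auto simp: samples_def)
 have val: "H2 (pv + int i + int k) = H (d + int ((j # js) ! k))" if k: "k < Suc r" for k
 proof (cases k)
 case 0
 have "H2 (pv + int i) = H' j (pv + int i)" by (rule un) (use v in auto)
 thus ?thesis using 0 v by (simp add: H'_def)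
 next
 case (Suc k')
 have "js ! k' < n" using js k Suc by (auto simp: samples_def dest: nth_mem)
 moreover have "H2 (pv + int (Suc i) + int k') = H' j (d + int (js ! k'))"
 using sm k Suc unfolding sampled_def len by simp
 ultimately show ?thesis using v Suc by (simp add: H'_def algebra_simps)
 qed
 have un': "H2 z = H z" if "z ~= s + 4" "z ~= s + 5" "z ~: {pv + int i..<pv + int i + int (Suc r)}" for z
 using un[of z] that by (auto simp: H'_def)
 have ad: "addrs (?a @ t' j) <= {s..s + 14} Un set [pv + int i, d + int j]" by (auto simp: t'_def)
 have "card (blocks B ({s..s + 14} Un set [pv + int i, d + int j])) <= 4"
 using card_blocks_frame[of s "[pv + int i, d + int j]"] by simp
 moreover have "cst (?a @ t' j) <= 2 * card (blocks B ({s..s + 14} Un set [pv + int i, d + int j]))"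
 by (rule cst_static[OF ad]) (use calculation K_ge_B B_large in auto)
 moreover have "cst ((?a @ t' j) @ t2) <= cst (?a @ t' j) + cst t2" by (rule cst_append)
 moreover have "cst t2 <= 8 * r + 4" using sm unfolding sampled_def len by blast
 ultimately have c: "cst (?a @ t' j @ t2) <= 8 * length (j # js) + 4" unfolding append_assoc by (simp add: len)
 have "addrs t2 <= {s..s + 14} Un {pv..pv + int (Suc i) + int r} Un {d..d + int n}"
 using sm unfolding sampled_def len by blast
 moreover have "addrs (?a @ t' j) <= {s..s + 14} Un {pv..pv + int (Suc i) + int r} Un {d..d + int n}"
 using ad j by auto
 ultimately have "addrs (?a @ t' j @ t2) <= {s..s + 14} Un {pv..pv + int i + int (length (j # js))} Un {d..d + int n}"
 by (auto simp: len)
 thus "sampled s d pv n i (j # js) H H2 (?a @ t' j @ t2)"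
 unfolding sampled_def using val un' c len by auto
 qed
 qed (use v in \<open>auto simp: H'_def\<close>)
 have "ew ?fr sample_loop H sp F =
 ennreal (1 / real n) * (\<Sum>j<n. ew ?fr sample_loop (H' j) sp (%H2 sp2 t2. F H2 sp2 (?a @ t' j @ t2)))"
 unfolding sample_loop_def by (subst ew_While_unfold, subst body) (use v in simp)
 also have "... <= ennreal (1 / real n) * (\<Sum>j<n. ennreal (1 / real n ^ r) * (\<Sum>js\<in>samples n r. G (j # js)))"
 by (intro mult_left_mono sum_mono IH) auto
 also have "... = ennreal (1 / real n ^ Suc r) * (\<Sum>js\<in>samples n (Suc r). G js)"
 unfolding sum_samples_Suc sum_distrib_left[symmetric] mult.assoc[symmetric]
 by (subst ennreal_mult'[symmetric]) auto
 finally show ?case .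
qed

text \<open>The first neighbour comparison is with the sentinel \<open>Minf\<close>, which differs
  from every sample because samples are \<open>Fin\<close> values. The comparisons thus amount to
  distinctness of the samples.\<close>

lemma sort_check_aq:
 assumes v: "H (s + 3) = Fin (int m)" "H (s + 10) = Fin pv" "H pv = Minf" and m: "2 <= m" "s + 15 <= pv"
 and F: "set (arr H (pv + 1) (m - 1)) <= range Fin"
 and U: "{s..s + 14} <= U" "{pv..pv + 12 * int m + 20} <= U"
 shows "aq U (140 + 4 * real m / B + 100 * (real m)^2 / B) (frame SquareSort_proc s) sort_check H (pv + int m + 1)
 (%H' sp'. sp' = pv + int m + 1 & sorted (arr H' (pv + 1) (m - 1)) &
 mset (arr H' (pv + 1) (m - 1)) = mset (arr H (pv + 1) (m - 1)) &
 H' (s + 9) = Fin (if distinct (arr H (pv + 1) (m - 1)) & H (s + 6) ~: set (arr H (pv + 1) (m - 1)) then 1 else 0) &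
 (ALL z<pv + int m + 1. z ~= s + 4 --> z ~= s + 9 --> z ~: {pv + 1..<pv + int m} --> H' z = H z))"
proof -
 let ?fr = "frame SquareSort_proc s" and ?sp = "pv + int m + 1"
 let ?xs = "%H. arr H (pv + 1) (m - 1)"
 let ?es = "[V ''pivots'' \<oplus> N 1, V ''m'' \<ominus> N 1]"
 define Q1 where "Q1 H1 sp1 \<longleftrightarrow> sp1 = ?sp & sorted (?xs H1) & mset (?xs H1) = mset (?xs H) &
 (ALL z<?sp. z ~: {pv + 1..<pv + int m} --> H1 z = H z)" for H1 sp1
 define Q2 where "Q2 H1 sp1 \<longleftrightarrow> sp1 = ?sp & sorted (?xs H1) & mset (?xs H1) = mset (?xs H) & H1 (s + 9) = Fin 1 &
 H1 (s + 4) = Fin 1 & (ALL z<?sp. z ~= s + 4 --> z ~= s + 9 --> z ~: {pv + 1..<pv + int m} --> H1 z = H z)" for H1 sp1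
 have Bb: "int B \<ge> 1000" using B_large by simp
 have st1: "aq U (8 + (100 + 100 * (real (m - 1))^2 / B)) ?fr (Call MergeSort ?es) H ?sp Q1"
 proof (rule aq_Call[where f = s and g = "s + 14"])
 let ?Hb = "write_list H ?sp [Fin (pv + 1), Fin (int (m - 1))]"
 have args: "map (aval ?fr H) ?es = [Fin (pv + 1), Fin (int (m - 1))]" using v m by (simp add: of_nat_diff)
 have eq: "?xs ?Hb = ?xs H" by (rule arr_cong) (use m in auto)
 have "aq (msort_space (pv + 1) (m - 1) ?sp) (100 + 100 * (real (m - 1))^2 / B) (frame MergeSort_proc ?sp) (body MergeSort_proc) ?Hb (?sp + 7)
 (%H' sp'. (ALL y<?sp. y ~: {pv + 1..<pv + 1 + int (m - 1)} --> H' y = ?Hb y) &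
 sorted (?xs H') & mset (?xs H') = mset (?xs ?Hb))"
 by (rule MergeSort_aq) (use m in auto)
 hence "aq U (100 + 100 * (real (m - 1))^2 / B) (frame MergeSort_proc ?sp) (body MergeSort_proc) ?Hb (?sp + 7) (%H' sp'. Q1 H' ?sp)"
 proof (rule aq_mono)
 have "msort_space (pv + 1) (m - 1) ?sp <= {pv..pv + 12 * int m + 20}" using m by (auto simp: msort_space_def of_nat_diff)
 thus "msort_space (pv + 1) (m - 1) ?sp <= U" using U by blast
 qed (use m eq in \<open>auto simp: Q1_def\<close>)
 thus "aq U (100 + 100 * (real (m - 1))^2 / B) (frame (squaresort_prog MergeSort) ?sp) (body (squaresort_prog MergeSort))
 (write_list H ?sp (map (aval ?fr H) ?es)) (?sp + int (length (frame_vars (squaresort_prog MergeSort)))) (%H' sp'. Q1 H' ?sp)"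
 unfolding args by (simp add: frame_vars_def MergeSort_proc_def del: write_list.simps)
 have "{?sp..<?sp + int (length ?es)} <= {pv..pv + 12 * int m + 20}" using m by auto
 thus "{?sp..<?sp + int (length ?es)} <= U" using U by blast
 qed (use U Bb in auto)
 have st2: "aq U (4 + 2 * real (length ([]::addr list))) ?fr (''ok'' ::= N 1) H1 sp1 (%H' sp'. sp' = sp1 & H' = H1(s + 9 := Fin 1))" for H1 sp1
 by (rule aq_frame[where s = s]) (use U in \<open>auto simp: ae_simps\<close>)
 have st3: "aq U (4 + 2 * real (length ([]::addr list))) ?fr (''i'' ::= N 1) H2 sp2 Q2"
 if "Q1 H1 sp1" "sp2 = sp1 & H2 = H1(s + 9 := Fin 1)" for H1 sp1 H2 sp2
 proof (rule aq_frame[where s = s])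
 have "?xs (H1(s + 9 := Fin 1, s + 4 := Fin 1)) = ?xs H1" by (rule arr_cong) (use m in auto)
 thus "ae ?fr (''i'' ::= N 1) H2 sp2 (%H' sp' t. addrs t <= {s..s + 14} Un set [] & Q2 H' sp')"
 using that by (auto simp: ae_simps Q1_def Q2_def)
 qed (use U in auto)
 have st4: "aq U (12 + 4 * real m / B) ?fr check_loop H1 sp1 (%H' sp'. sp' = ?sp & sorted (?xs H') &
 mset (?xs H') = mset (?xs H) &
 H' (s + 9) = Fin (if distinct (?xs H) & H (s + 6) ~: set (?xs H) then 1 else 0) &
 (ALL z<?sp. z ~= s + 4 --> z ~= s + 9 --> z ~: {pv + 1..<pv + int m} --> H' z = H z))" if Q: "Q2 H1 sp1" for H1 sp1
 proof -
 let ?ok = "ALL q. 1 <= q --> q < m --> H1 (pv + int q) ~= H1 (s + 6) & H1 (pv + int q) ~= H1 (pv + int q - 1)"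
 have un: "H1 z = H z" if "z < ?sp" "z ~= s + 4" "z ~= s + 9" "z ~: {pv + 1..<pv + int m}" for z
 using Q that unfolding Q2_def by blast
 have v1: "H1 (s + 3) = Fin (int m)" "H1 (s + 10) = Fin pv" "H1 pv = Minf" "H1 (s + 6) = H (s + 6)"
 using v m un[of "s + 3"] un[of "s + 10"] un[of pv] un[of "s + 6"] by simp_all
 have Q': "H1 (s + 9) = Fin 1" "H1 (s + 4) = Fin 1" "sorted (?xs H1)" "mset (?xs H1) = mset (?xs H)" "sp1 = ?sp"
 using Q by (auto simp: Q2_def)
 have set_eq: "set (?xs H1) = set (?xs H)" using Q'(4) by (rule mset_eq_setD)
 have nth: "?xs H1 ! q = H1 (pv + 1 + int q)" if "q < m - 1" for q using that by (simp add: nth_arr)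
 have len: "length (?xs H1) = m - 1" by simp
 have ok: "?ok \<longleftrightarrow> distinct (?xs H) & H (s + 6) ~: set (?xs H)"
 proof -
 have "distinct (?xs H) \<longleftrightarrow> distinct (?xs H1)" using Q'(4) by (metis mset_eq_imp_distinct_iff)
 also have "... \<longleftrightarrow> (ALL q. Suc q < m - 1 --> H1 (pv + 1 + int (Suc q)) ~= H1 (pv + 1 + int q))"
 unfolding sorted_distinct_iff_adjacent[OF Q'(3)] len using nth by auto
 finally have D: "distinct (?xs H) \<longleftrightarrow> (ALL q. Suc q < m - 1 --> H1 (pv + 1 + int (Suc q)) ~= H1 (pv + 1 + int q))" .
 have S: "H (s + 6) ~: set (?xs H) \<longleftrightarrow> (ALL q<m - 1. H1 (pv + 1 + int q) ~= H1 (s + 6))"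
 unfolding set_eq[symmetric] v1(4)[symmetric] in_set_conv_nth len using nth by auto
 show ?thesis
 proof
 assume ok: ?ok
 have "H1 (pv + 1 + int (Suc q)) ~= H1 (pv + 1 + int q)" if "Suc q < m - 1" for q
 using ok[rule_format, of "Suc (Suc q)"] that by (simp add: algebra_simps)
 moreover have "H1 (pv + 1 + int q) ~= H1 (s + 6)" if "q < m - 1" for q
 using ok[rule_format, of "Suc q"] that by (simp add: algebra_simps)
 ultimately show "distinct (?xs H) & H (s + 6) ~: set (?xs H)" unfolding D S by blast
 next
 assume R: "distinct (?xs H) & H (s + 6) ~: set (?xs H)"
 show ?ok
 proof (intro allI impI)
 fix q assume q: "1 <= q" "q < m"
 then obtain q' where q': "q = Suc q'" by (cases q) auto
 have e1: "H1 (pv + int q) = H1 (pv + 1 + int q')" by (simp add: q' algebra_simps)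
 have "q' < m - 1" using q q' by simp
 hence a: "H1 (pv + int q) ~= H1 (s + 6)" unfolding e1 using R[unfolded S] by blast
 have "H1 (pv + int q) ~= H1 (pv + int q - 1)"
 proof (cases q')
 case 0
 have "?xs H1 ! 0 \<in> range Fin" using F set_eq len m nth_mem[of 0 "?xs H1"] by auto
 hence "H1 (pv + 1) \<in> range Fin" using nth[of 0] m by simp
 thus ?thesis using v1(3) q' 0 by auto
 next
 case (Suc q2)
 hence "H1 (pv + 1 + int (Suc q2)) ~= H1 (pv + 1 + int q2)" using R[unfolded D] \<open>q' < m - 1\<close> by blast
 thus ?thesis by (simp add: q' Suc algebra_simps)
 qed
 thus "H1 (pv + int q) ~= H1 (s + 6) & H1 (pv + int q) ~= H1 (pv + int q - 1)" using a by blast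
 qed
 qed
 qed
 have "{pv..pv + int m} <= {pv..pv + 12 * int m + 20}" by auto
 hence "{pv..pv + int m} <= U" using U by blast
 hence "aq U (12 + 4 * real m / B) ?fr check_loop H1 sp1 (%H' sp'. sp' = sp1 & H' (s + 9) = Fin (if ?ok then 1 else 0) &
 (ALL z. z ~= s + 4 --> z ~= s + 9 --> H' z = H1 z))"
 by (intro check_loop_aq) (use v1 Q' m U in auto)
 thus ?thesis
 proof (rule aq_mono)
 fix H' sp' assume h: "sp' = sp1 & H' (s + 9) = Fin (if ?ok then 1 else 0) & (ALL z. z ~= s + 4 --> z ~= s + 9 --> H' z = H1 z)"
 hence e: "?xs H' = ?xs H1" by (intro arr_cong) (use m in auto)
 show "sp' = ?sp & sorted (?xs H') & mset (?xs H') = mset (?xs H) &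
 H' (s + 9) = Fin (if distinct (?xs H) & H (s + 6) ~: set (?xs H) then 1 else 0) &
 (ALL z<?sp. z ~= s + 4 --> z ~= s + 9 --> z ~: {pv + 1..<pv + int m} --> H' z = H z)"
 unfolding e ok[symmetric] using h Q' un by simp
 qed auto
 qed
 have full: "aq U (8 + (100 + 100 * (real (m - 1))^2 / B) + (4 + 2 * real (length ([]::addr list))) + (4 + 2 * real (length ([]::addr list))) +
 (12 + 4 * real m / B)) ?fr sort_check H ?sp (%H' sp'. sp' = ?sp & sorted (?xs H') &
 mset (?xs H') = mset (?xs H) &
 H' (s + 9) = Fin (if distinct (?xs H) & H (s + 6) ~: set (?xs H) then 1 else 0) &
 (ALL z<?sp. z ~= s + 4 --> z ~= s + 9 --> z ~: {pv + 1..<pv + int m} --> H' z = H z))"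
 unfolding sort_check_def
 proof (rule aq_Seq)
 have st12: "aq U (8 + (100 + 100 * (real (m - 1))^2 / B) + (4 + 2 * real (length ([]::addr list)))) ?fr
 (Call MergeSort ?es;; ''ok'' ::= N 1) H ?sp (%H2 sp2. EX H1 sp1. Q1 H1 sp1 & sp2 = sp1 & H2 = H1(s + 9 := Fin 1))"
 by (rule aq_Seq, rule st1, rule aq_mono[OF st2]) auto
 show "aq U (8 + (100 + 100 * (real (m - 1))^2 / B) + (4 + 2 * real (length ([]::addr list))) + (4 + 2 * real (length ([]::addr list)))) ?fr
 (Call MergeSort ?es;; ''ok'' ::= N 1;; ''i'' ::= N 1) H ?sp Q2"
 by (rule aq_Seq, rule st12) (use st3 in blast)
 qed (erule st4)
 have "(real (m - 1))^2 <= (real m)^2" by (intro power_mono) auto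
 hence "100 * (real (m - 1))^2 / B <= 100 * (real m)^2 / B" by (intro divide_right_mono) auto
 thus ?thesis by (intro aq_mono[OF full]) auto
qed


text \<open>Excluding the minimum of \<open>X\<close> makes the lowest bucket nonempty, just as each
  further bucket contains its own lower pivot.\<close>

definition good_pivots :: "cell set => addr => nat => mem => bool" where
 "good_pivots X pv m H \<longleftrightarrow> H pv = Minf & H (pv + int m) = Pinf &
 (ALL i i'. i < i' --> i' <= m --> H (pv + int i) < H (pv + int i')) &
 (ALL i. 1 <= i --> i < m --> H (pv + int i) \<in> X - {Min X})"

text \<open>The effect of a round in terms of its sampled indices: \<open>j0\<close> stands for the
  index of the minimum, so acceptance is a property of \<open>js\<close> alone and can be
  counted.\<close>

definition round_post :: "addr => addr => addr => nat => nat => nat => mem => nat list => mem => bool" where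
 "round_post s d pv n m j0 H js H' \<longleftrightarrow>
 (ALL z<pv. z ~= s + 4 --> z ~= s + 5 --> z ~= s + 9 --> H' z = H z) & H' pv = Minf & H' (pv + int m) = Pinf &
 (if distinct js & j0 ~: set js
 then H' (s + 9) = Fin 1 & good_pivots (H ` {d..<d + int n}) pv m H' &
 bucket_squares (H ` {d..<d + int n}) (%i. H' (pv + int i)) m <= 2 * card (unseparated (%j. H (d + int j)) n js)
 else H' (s + 9) = Fin 0)"

lemma image_shift: "f ` {d..<d + int n} = (%j. f (d + int j)) ` {..<n}"
proof -
 have "{d..<d + int n} = (%j. d + int j) ` {..<n}"
 proof (intro equalityI subsetI)
 fix z assume z: "z \<in> {d..<d + int n}"
 hence "z = d + int (nat (z - d))" "nat (z - d) \<in> {..<n}" by auto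
 thus "z \<in> (%j. d + int j) ` {..<n}" by (rule image_eqI)
 qed auto
 thus ?thesis by (simp add: image_image)
qed

lemma inj_shift: "inj_on f {d..<d + int n} ==> inj_on (%j. f (d + int j)) {..<n}"
 by (rule inj_onI) (auto dest!: inj_onD)

text \<open>Injectivity on \<open>D\<close> translates the tests on values into tests on
  indices.\<close>

lemma round_post_sort:
 assumes sm: "sampled s d pv n 1 js H H1 t" and js: "js \<in> samples n (m - 1)"
 and inj: "inj_on H {d..<d + int n}" and Fn: "H ` {d..<d + int n} <= range Fin"
 and x: "H (s + 6) = Min (H ` {d..<d + int n})" and j0: "j0 < n" "H (d + int j0) = H (s + 6)"
 and p: "H pv = Minf" "H (pv + int m) = Pinf" and m: "2 <= m" "s + 15 <= pv"
 and so: "sorted (arr H' (pv + 1) (m - 1))" "mset (arr H' (pv + 1) (m - 1)) = mset (arr H1 (pv + 1) (m - 1))"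
 and ok: "H' (s + 9) = Fin (if distinct (arr H1 (pv + 1) (m - 1)) & H1 (s + 6) ~: set (arr H1 (pv + 1) (m - 1)) then 1 else 0)"
 and un: "!!z. z < pv + int m + 1 ==> z ~= s + 4 ==> z ~= s + 9 ==> z ~: {pv + 1..<pv + int m} ==> H' z = H1 z"
 shows "round_post s d pv n m j0 H js H'"
proof -
 define f where "f j = H (d + int j)" for j
 let ?X = "H ` {d..<d + int n}" and ?xs = "arr H' (pv + 1) (m - 1)"
 have fe: "f = (%j. H (d + int j))" by (rule ext) (rule f_def)
 have Xf: "?X = f ` {..<n}" unfolding f_def by (rule image_shift)
 have injf: "inj_on f {..<n}" unfolding f_def by (rule inj_shift[OF inj])
 have len: "length js = m - 1" and jn: "set js <= {..<n}" using js by (auto simp: samples_def)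
 have un1: "H1 z = H z" if "z ~= s + 4" "z ~= s + 5" "z ~: {pv + 1..<pv + int m}" for z
 using sm that m unfolding sampled_def len by (simp add: of_nat_diff)
 have arr1: "arr H1 (pv + 1) (m - 1) = map f js"
 by (rule nth_equalityI) (use sm len in \<open>auto simp: sampled_def f_def nth_arr\<close>)
 have x1: "H1 (s + 6) = f j0" using un1[of "s + 6"] j0 m by (simp add: f_def)
 have dj: "distinct (map f js) \<longleftrightarrow> distinct js" using inj_on_subset[OF injf jn] by (simp add: distinct_map)
 have mj: "f j0 ~: set (map f js) \<longleftrightarrow> j0 ~: set js"
 using inj_on_image_mem_iff[OF injf, of j0 "set js"] j0(1) jn by simp
 have ok': "H' (s + 9) = Fin (if distinct js & j0 ~: set js then 1 else 0)" using ok unfolding arr1 x1 dj mj .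
 have low: "ALL z<pv. z ~= s + 4 --> z ~= s + 5 --> z ~= s + 9 --> H' z = H z"
 proof (intro allI impI)
 fix z assume z: "z < pv" "z ~= s + 4" "z ~= s + 5" "z ~= s + 9"
 have "H' z = H1 z" by (rule un) (use z in auto)
 also have "H1 z = H z" by (rule un1) (use z in auto)
 finally show "H' z = H z" .
 qed
 have ends: "H' pv = Minf" "H' (pv + int m) = Pinf"
 using un[of pv] un1[of pv] un[of "pv + int m"] un1[of "pv + int m"] p m by auto
 show ?thesis
 proof (cases "distinct js & j0 ~: set js")
 case False
 show ?thesis unfolding round_post_def if_not_P[OF False] by (intro conjI low ends ok'[unfolded if_not_P[OF False]])
 next
 case True
 have ms: "mset ?xs = mset (map f js)" using so(2) unfolding arr1 .
 have st: "set ?xs = f ` set js" using mset_eq_setD[OF ms] by simp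
 have "distinct ?xs" using mset_eq_imp_distinct_iff[OF ms] dj True by simp
 with so(1) have "sorted ?xs & distinct ?xs" by (rule conjI)
 hence sw: "sorted_wrt (<) ?xs" unfolding strict_sorted_iff .
 have inc: "?xs ! i < ?xs ! i'" if "i < i'" "i' < m - 1" for i i'
 by (rule sorted_wrt_nth_less[OF sw]) (use that in auto)
 have nth: "H' (pv + int i) = ?xs ! (i - 1)" if "1 <= i" "i < m" for i
 using that by (simp add: nth_arr of_nat_diff)
 have inX: "H' (pv + int i) \<in> f ` set js" if "1 <= i" "i < m" for i
 unfolding st[symmetric] nth[OF that] by (rule nth_mem) (use that in simp)
 have mn: "Min ?X = f j0" using x j0 by (simp add: f_def)
 have "f j0 ~: f ` set js" using mj True by simp
 hence sub: "f ` set js <= ?X - {Min ?X}" unfolding mn unfolding Xf using image_mono[OF jn, of f] by blast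
 have lt: "H' (pv + int i) < H' (pv + int i')" if i: "i < i'" "i' <= m" for i i'
 proof -
 have fin: "EX c. H' (pv + int q) = Fin c" if "1 <= q" "q < m" for q
 using subsetD[OF Fn] subsetD[OF sub inX[OF that]] by blast
 consider "i = 0" "i' = m" | "i = 0" "i' < m" | "0 < i" "i' = m" | "0 < i" "i' < m" using i by linarith
 thus ?thesis
 proof cases
 case 2
 thus ?thesis using ends fin[of i'] i by auto
 next
 case 3
 thus ?thesis using ends fin[of i] i by auto
 next
 case 4
 hence "1 <= i" "i < m" "1 <= i'" "i - 1 < i' - 1" "i' - 1 < m - 1" using i by auto
 thus ?thesis unfolding nth[OF \<open>1 <= i\<close> \<open>i < m\<close>] nth[OF \<open>1 <= i'\<close> \<open>i' < m\<close>] using inc by blast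
 qed (use ends in auto)
 qed
 have mem: "H' (pv + int i) \<in> ?X - {Min ?X}" if "1 <= i" "i < m" for i using subsetD[OF sub inX[OF that]] .
 have good: "good_pivots ?X pv m H'" unfolding good_pivots_def by (intro conjI allI impI ends lt mem)
 have "bucket_squares ?X (%i. H' (pv + int i)) m <= 2 * card (unseparated f n js)"
 unfolding Xf
 proof (rule bucket_squares_le[OF injf])
 show "H' (pv + int i) < H' (pv + int i')" if "i < i'" "i' <= m" for i i'
 using lt that .
 fix j assume "j \<in> set js"
 hence "f j \<in> set ?xs" unfolding st by blast
 then obtain q where q: "q < m - 1" "?xs ! q = f j" unfolding in_set_conv_nth by auto
 thus "EX i<=m. H' (pv + int i) = f j" using nth[of "Suc q"] by (intro exI[of _ "Suc q"]) auto
 qed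
 hence bsq: "bucket_squares ?X (%i. H' (pv + int i)) m <= 2 * card (unseparated (%j. H (d + int j)) n js)"
 unfolding fe .
 show ?thesis unfolding round_post_def if_P[OF True] by (intro conjI low ends good bsq ok'[unfolded if_P[OF True]])
 qed
qed

definition round_cost :: "nat => real" where
 "round_cost m = 160 + 8 * real m + 4 * real m / B + 100 * (real m)^2 / B"

lemma ew_round:
 assumes v: "H (s + 1) = Fin d" "H (s + 2) = Fin (int n)" "H (s + 3) = Fin (int m)" "H (s + 10) = Fin pv"
 and inj: "inj_on H {d..<d + int n}" and Fn: "H ` {d..<d + int n} <= range Fin"
 and x: "H (s + 6) = Min (H ` {d..<d + int n})" and j0: "j0 < n" "H (d + int j0) = H (s + 6)"
 and p: "H pv = Minf" "H (pv + int m) = Pinf" and m: "2 <= m" "s + 15 <= pv" "d + int n <= s"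
 and U: "{s..s + 14} <= U" "{d..d + int n} <= U" "{pv..pv + 12 * int m + 20} <= U"
 and G: "!!js H' t. js \<in> samples n (m - 1) ==> round_post s d pv n m j0 H js H' ==> addrs t <= U ==>
 real (cst t) <= round_cost m ==> h H' (pv + int m + 1) t <= G js"
 shows "ew (frame SquareSort_proc s) pivot_round H (pv + int m + 1) h
 <= ennreal (1 / real n ^ (m - 1)) * (\<Sum>js\<in>samples n (m - 1). G js)"
proof -
 let ?fr = "frame SquareSort_proc s" and ?sp = "pv + int m + 1" and ?H1 = "H(s + 4 := Fin 1)"
 have 1: "ew ?fr pivot_round H ?sp h =
 ew ?fr sample_loop ?H1 ?sp (%H1 sp1 t1. ew ?fr sort_check H1 sp1 (%H2 sp2 t2. h H2 sp2 (([] @ [Write (s + 4)]) @ t1 @ t2)))"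
 by (simp add: ew_pivot_round ew_Seq ew_Assign)
 show ?thesis unfolding 1
 proof (rule ew_sample[where i = 1 and d = d and pv = pv and m = m])
 fix js H1 t1 assume js: "js \<in> samples n (m - 1)" and sm: "sampled s d pv n 1 js ?H1 H1 t1"
 have len: "length js = m - 1" using js by (simp add: samples_def)
 have sm': "sampled s d pv n 1 js H H1 t1"
 proof -
 have "js ! k < n" if "k < length js" for k using js nth_mem[OF that] by (auto simp: samples_def)
 thus ?thesis using sm m unfolding sampled_def by fastforce
 qed
 have ad1: "addrs t1 <= U"
 proof -
 have "{pv..pv + int 1 + int (m - 1)} <= {pv..pv + 12 * int m + 20}" by auto
 thus ?thesis using sm U unfolding sampled_def len by blast
 qed
 have un1: "H1 z = H z" if "z ~= s + 4" "z ~= s + 5" "z < pv + 1" for z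
 using sm' that unfolding sampled_def by simp
 have a: "aq U (140 + 4 * real m / B + 100 * (real m)^2 / B) ?fr sort_check H1 ?sp
 (%H' sp'. sp' = ?sp & sorted (arr H' (pv + 1) (m - 1)) &
 mset (arr H' (pv + 1) (m - 1)) = mset (arr H1 (pv + 1) (m - 1)) &
 H' (s + 9) = Fin (if distinct (arr H1 (pv + 1) (m - 1)) & H1 (s + 6) ~: set (arr H1 (pv + 1) (m - 1)) then 1 else 0) &
 (ALL z<pv + int m + 1. z ~= s + 4 --> z ~= s + 9 --> z ~: {pv + 1..<pv + int m} --> H' z = H1 z))"
 proof (rule sort_check_aq)
 show "set (arr H1 (pv + 1) (m - 1)) <= range Fin"
 proof
 fix y assume "y \<in> set (arr H1 (pv + 1) (m - 1))"
 then obtain k where k: "k < m - 1" "y = H1 (pv + 1 + int k)" by (auto simp: in_set_conv_nth nth_arr)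
 hence "y = H (d + int (js ! k))" using sm' len unfolding sampled_def by simp
 moreover have "js ! k \<in> set js" by (rule nth_mem) (use k len in simp)
 hence "js ! k < n" using js by (auto simp: samples_def)
 ultimately show "y \<in> range Fin" using Fn by (auto simp: image_subset_iff)
 qed
 qed (use un1[of "s + 3"] un1[of "s + 10"] un1[of pv] v p m U in auto)
 show "ew ?fr sort_check H1 ?sp (%H2 sp2 t2. h H2 sp2 (([] @ [Write (s + 4)]) @ t1 @ t2)) <= G js"
 proof (rule ew_ae_le[OF a[unfolded aq_def]], elim conjE)
 fix H' sp' t
 assume h: "addrs t <= U" "real (cst t) <= 140 + 4 * real m / B + 100 * (real m)^2 / B" "sp' = ?sp" "sorted (arr H' (pv + 1) (m - 1))"
 "mset (arr H' (pv + 1) (m - 1)) = mset (arr H1 (pv + 1) (m - 1))"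
 "H' (s + 9) = Fin (if distinct (arr H1 (pv + 1) (m - 1)) & H1 (s + 6) ~: set (arr H1 (pv + 1) (m - 1)) then 1 else 0)"
 "ALL z<pv + int m + 1. z ~= s + 4 --> z ~= s + 9 --> z ~: {pv + 1..<pv + int m} --> H' z = H1 z"
 have rp: "round_post s d pv n m j0 H js H'"
 by (rule round_post_sort[OF sm' js inj Fn x j0 p m(1,2) h(4-6)]) (use h(7) in blast)
 have "cst [Write (s + 4)] <= 4" by (rule cst_local[of _ s "s + 14"]) (use B_large in auto)
 moreover have "cst t1 <= 8 * (m - 1) + 4" using sm unfolding sampled_def len by blast
 moreover have "cst ([Write (s + 4)] @ t1 @ t) <= cst [Write (s + 4)] + (cst t1 + cst t)"
 using cst_append[of "[Write (s + 4)]" "t1 @ t"] cst_append[of t1 t] by linarith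
 ultimately have "real (cst ([Write (s + 4)] @ t1 @ t)) <= 8 * real m + 8 + real (cst t)" by linarith
 hence c: "real (cst ([Write (s + 4)] @ t1 @ t)) <= round_cost m" using h(2) unfolding round_cost_def by linarith
 have "addrs ([Write (s + 4)] @ t1 @ t) <= U" using h(1) ad1 U(1) by auto
 from G[OF js rp this c] show "h H' sp' (([] @ [Write (s + 4)]) @ t1 @ t) <= G js" unfolding h(3) append_Nil .
 qed
 qed (use v m j0 in auto)
qed

lemma ew_Seq_aq:
 assumes "aq U k fr c1 H sp Q" "!!H1 sp1. Q H1 sp1 ==> ew fr c2 H1 sp1 (pc U R G) <= f"
 shows "ew fr (c1;; c2) H sp (pc U R G) <= ennreal k + f"
proof (rule ew_Seq_pc[where Q = Q and F = "%_. f"])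
 show "ew fr c1 H sp (pc U Q (%_. f)) <= ennreal k + f"
 by (rule ew_of_ae_pc) (rule ae_mono[OF assms(1)[unfolded aq_def]], auto)
qed (rule assms(2))

text \<open>The charge for the buckets is due only in an accepted round, but it is bounded by its
  average over all samples, which avoids conditional distributions. Per unit of \<open>a2\<close>
  this average is at most \<open>2 * n * (n / m + 1)\<close>, hence at most
  \<open>4 * n * m\<close>; the retry loop multiplies it by 3.\<close>

lemma ew_retry_pivots:
 assumes v: "H (s + 1) = Fin d" "H (s + 2) = Fin (int n)" "H (s + 3) = Fin (int m)" "H (s + 10) = Fin pv" "H (s + 9) = Fin 0"
 and inj: "inj_on H {d..<d + int n}" and Fn: "H ` {d..<d + int n} <= range Fin"
 and x: "H (s + 6) = Min (H ` {d..<d + int n})"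
 and p: "H pv = Minf" "H (pv + int m) = Pinf"
 and m: "17 <= n" "(m - 1)^2 < n" "n <= m^2" "s + 15 <= pv" "d + int n <= s"
 and U: "{s..s + 14} <= U" "{d..d + int n} <= U" "{pv..pv + 12 * int m + 20} <= U" and a2: "0 <= a2"
 defines "X \<equiv> H ` {d..<d + int n}"
 shows "ew (frame SquareSort_proc s) (WHILE V ''ok'' \<doteq> N 0 DO pivot_round) H (pv + int m + 1)
 (pc U (%H' sp'. sp' = pv + int m + 1 & good_pivots X pv m H' &
 (ALL z<pv. z ~= s + 4 --> z ~= s + 5 --> z ~= s + 9 --> H' z = H z))
 (%H'. ennreal (a2 * real (bucket_squares X (%i. H' (pv + int i)) m))))
 <= ennreal (3 * (8 + round_cost m + 4 * a2 * real n * real m))"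
proof -
 let ?fr = "frame SquareSort_proc s" and ?b = "V ''ok'' \<doteq> N 0" and ?sp = "pv + int m + 1"
 let ?c = pivot_round
 let ?F = "%H'. ennreal (a2 * real (bucket_squares X (%i. H' (pv + int i)) m))"
 define f where "f j = H (d + int j)" for j
 define r where "r = m - 1"
 have m2: "5 <= m"
 proof (rule ccontr)
 assume "~ 5 <= m"
 hence "m^2 <= 4^2" by (intro power_mono) auto
 thus False using m by simp
 qed
 have Xf: "X = f ` {..<n}" unfolding X_def f_def by (rule image_shift)
 have injf: "inj_on f {..<n}" unfolding f_def by (rule inj_shift[OF inj])
 have "Min X \<in> X" unfolding Xf by (rule Min_in) (use m in auto)
 then obtain j0 where j0: "j0 < n" "f j0 = Min X" unfolding Xf by auto
 define acc where "acc js \<longleftrightarrow> distinct js & j0 ~: set js" for js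
 \<comment> \<open>After a rejected round the inner pivots are arbitrary; only the sentinels and the
   cells below the pivot array are tracked.\<close>
 define Inv where "Inv H' \<longleftrightarrow> (ALL z<pv. z ~= s + 4 --> z ~= s + 5 --> z ~= s + 9 --> H' z = H z) & H' pv = Minf &
 H' (pv + int m) = Pinf & (H' (s + 9) = Fin 0 \<or> H' (s + 9) = Fin 1 & good_pivots X pv m H')" for H'
 have b: "bval ?fr H' ?b \<longleftrightarrow> H' (s + 9) = Fin 0" for H' by simp
 have round: "ew ?fr ?c H' ?sp h <= ennreal (1 / real n ^ r) * (\<Sum>js\<in>samples n r. G js)"
 if I: "Inv H'" and G: "!!js H'' t. js \<in> samples n r ==> Inv H'' ==> (acc js \<longleftrightarrow> H'' (s + 9) ~= Fin 0) ==>
 (acc js ==> bucket_squares X (%i. H'' (pv + int i)) m <= 2 * card (unseparated f n js)) ==>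
 addrs t <= U ==> real (cst t) <= round_cost m ==> h H'' ?sp t <= G js" for H' h G
 proof -
 have un: "H' z = H z" if "z < pv" "z ~= s + 4" "z ~= s + 5" "z ~= s + 9" for z using I that unfolding Inv_def by blast
 have ld: "H' z = H z" if "z \<in> {d..<d + int n}" for z by (rule un) (use that m in auto)
 have img: "H' ` {d..<d + int n} = X" unfolding X_def using ld by (intro image_cong) auto
 have inj': "inj_on H' {d..<d + int n}" using inj ld inj_on_cong[of "{d..<d + int n}" H' H] by blast
 have f': "(%j. H' (d + int j)) j = f j" if "j < n" for j using ld[of "d + int j"] that by (simp add: f_def)
 have unsep: "unseparated (%j. H' (d + int j)) n js = unseparated f n js" if "set js <= {..<n}" for js
 proof -
 have "f j = H' (d + int j)" if "j \<in> set js" for j using f'[of j] that \<open>set js <= {..<n}\<close> by auto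
 thus ?thesis unfolding unseparated_def using f' by auto
 qed
 show ?thesis unfolding r_def
 proof (rule ew_round[where U = U and ?j0.0 = j0 and d = d])
 show "H' (d + int j0) = H' (s + 6)" using f'[OF j0(1)] j0(2) un[of "s + 6"] x m by (simp add: X_def)
 show "H' (s + 6) = Min (H' ` {d..<d + int n})" unfolding img using un[of "s + 6"] x m by (simp add: X_def)
 show "H' ` {d..<d + int n} <= range Fin" unfolding img using Fn by (simp add: X_def)
 fix js H'' t assume js: "js \<in> samples n (m - 1)" and rp: "round_post s d pv n m j0 H' js H''"
 and t: "addrs t <= U" "real (cst t) <= round_cost m"
 have jn: "set js <= {..<n}" using js by (simp add: samples_def)
 have un'': "H'' z = H z" if "z < pv" "z ~= s + 4" "z ~= s + 5" "z ~= s + 9" for z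
 using rp un[OF that] that unfolding round_post_def by auto
 show "h H'' ?sp t <= G js"
 proof (rule G)
 show "js \<in> samples n r" using js by (simp add: r_def)
 show "Inv H''" unfolding Inv_def using rp un'' unfolding round_post_def img by (auto split: if_splits)
 show "acc js \<longleftrightarrow> H'' (s + 9) ~= Fin 0" using rp unfolding round_post_def acc_def by (auto split: if_splits)
 show "bucket_squares X (%i. H'' (pv + int i)) m <= 2 * card (unseparated f n js)" if "acc js"
 using rp that unfolding round_post_def img unsep[OF jn] acc_def by auto
 qed (fact t)+
 qed (use I un[of "s + 1"] un[of "s + 2"] un[of "s + 3"] un[of "s + 10"] v m m2 inj' j0 U in \<open>auto simp: Inv_def\<close>)
 qed
 have n0: "0 < real n" using m by simp
 have pos: "0 <= round_cost m" unfolding round_cost_def by simp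
 define a where "a = round_cost m + 4 * a2 * real n * real m"
 have step: "ew ?fr ?c H' ?sp (pc U (%H' sp'. Inv H' & sp' = ?sp) (%H'. if bval ?fr H' ?b then 0 else ?F H')) <= ennreal a"
 if I: "Inv H'" for H'
 proof -
 let ?u = "%js. real (card (unseparated f n js))"
 have "ew ?fr ?c H' ?sp (pc U (%H' sp'. Inv H' & sp' = ?sp) (%H'. if bval ?fr H' ?b then 0 else ?F H')) <=
 ennreal (1 / real n ^ r) * (\<Sum>js\<in>samples n r. ennreal (round_cost m + 2 * a2 * ?u js))"
 proof (rule round[OF I])
 fix js H'' t assume h: "js \<in> samples n r" "Inv H''" "acc js \<longleftrightarrow> H'' (s + 9) ~= Fin 0"
 "acc js ==> bucket_squares X (%i. H'' (pv + int i)) m <= 2 * card (unseparated f n js)" "addrs t <= U" "real (cst t) <= round_cost m"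
 have "(if bval ?fr H'' ?b then 0 else ?F H'') <= ennreal (2 * a2 * ?u js)"
 proof (cases "acc js")
 case True
 hence "real (bucket_squares X (%i. H'' (pv + int i)) m) <= real (2 * card (unseparated f n js))"
 using h(4) by (simp only: of_nat_le_iff)
 hence "a2 * real (bucket_squares X (%i. H'' (pv + int i)) m) <= a2 * (2 * ?u js)" by (intro mult_left_mono a2) simp
 thus ?thesis using True h(3) by (simp add: mult_ac ennreal_leI)
 qed (use h(3) in simp)
 moreover have "of_nat (cst t) <= ennreal (round_cost m)"
 unfolding ennreal_of_nat_eq_real_of_nat using h(6) by (rule ennreal_leI)
 ultimately have "of_nat (cst t) + (if bval ?fr H'' ?b then 0 else ?F H'') <= ennreal (round_cost m) + ennreal (2 * a2 * ?u js)"
 by (intro add_mono)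
 thus "pc U (%H' sp'. Inv H' & sp' = ?sp) (%H'. if bval ?fr H' ?b then 0 else ?F H') H'' ?sp t <= ennreal (round_cost m + 2 * a2 * ?u js)"
 unfolding pc_def using h(2,5) pos a2 by (simp add: ennreal_plus)
 qed
 also have "(\<Sum>js\<in>samples n r. ennreal (round_cost m + 2 * a2 * ?u js)) = ennreal (\<Sum>js\<in>samples n r. round_cost m + 2 * a2 * ?u js)"
 using pos a2 by (intro sum_ennreal) auto
 also have "ennreal (1 / real n ^ r) * ... = ennreal (1 / real n ^ r * (\<Sum>js\<in>samples n r. round_cost m + 2 * a2 * ?u js))"
 by (rule ennreal_mult'[symmetric]) simp
 also have "... <= ennreal a"
 proof (rule ennreal_leI)
 have nm: "real n / (real r + 1) + 1 <= 2 * real m"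
 proof -
 have "real r + 1 = real m" using m2 by (simp add: r_def of_nat_diff)
 moreover have "real n <= real (m^2)" using m by (simp only: of_nat_le_iff)
 hence "real n / real m <= real m" using m2 by (simp add: divide_le_eq power2_eq_square)
 ultimately show ?thesis using m2 by simp
 qed
 have "(\<Sum>js\<in>samples n r. round_cost m + 2 * a2 * ?u js) = real n ^ r * round_cost m + 2 * a2 * (\<Sum>js\<in>samples n r. ?u js)"
 by (simp add: sum.distrib card_samples sum_distrib_left)
 also have "... <= real n ^ r * round_cost m + 2 * a2 * (real n ^ r * (real n * (real n / (real r + 1) + 1)))"
 using sum_unseparated[OF injf, of r] m a2 by (intro add_left_mono mult_left_mono) auto
 also have "... <= real n ^ r * round_cost m + 2 * a2 * (real n ^ r * (real n * (2 * real m)))"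
 using nm a2 by (intro add_left_mono mult_left_mono) auto
 also have "... = real n ^ r * a" by (simp add: a_def algebra_simps)
 finally show "1 / real n ^ r * (\<Sum>js\<in>samples n r. round_cost m + 2 * a2 * ?u js) <= a"
 using n0 by (simp add: divide_le_eq mult.commute)
 qed
 finally show ?thesis .
 qed
 have prob: "ew ?fr ?c H' ?sp (%H' sp' t. if bval ?fr H' ?b then 1 else 0) <= ennreal (2/3)" if I: "Inv H'" for H'
 proof -
 have "ew ?fr ?c H' ?sp (%H' sp' t. if bval ?fr H' ?b then 1 else 0) <=
 ennreal (1 / real n ^ r) * (\<Sum>js\<in>samples n r. ennreal (if acc js then 0 else 1))"
 by (rule round[OF I]) simp
 also have "(\<Sum>js\<in>samples n r. ennreal (if acc js then 0 else 1)) = ennreal (\<Sum>js\<in>samples n r. if acc js then 0 else 1)"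
 by (rule sum_ennreal) simp
 also have "(\<Sum>js\<in>samples n r. if acc js then 0 else 1 :: real) = real (card (samples n r)) - real (card {js \<in> samples n r. acc js})"
 proof -
 have "(\<Sum>js\<in>samples n r. if acc js then 0 else 1 :: real) = (\<Sum>js\<in>samples n r. 1 - (if acc js then 1 else 0))"
 by (rule sum.cong) auto
 also have "... = real (card (samples n r)) - (\<Sum>js\<in>samples n r. if acc js then 1 else 0)" by (simp add: sum_subtractf)
 also have "(\<Sum>js\<in>samples n r. if acc js then 1 else 0 :: real) = real (card {js \<in> samples n r. acc js})"
 by (simp only: sum.If_cases[OF finite_samples]) (simp add: Int_def)
 finally show ?thesis .
 qed
 also have "ennreal (1 / real n ^ r) * ennreal (real (card (samples n r)) - real (card {js \<in> samples n r. acc js})) =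
 ennreal (1 / real n ^ r * (real (card (samples n r)) - real (card {js \<in> samples n r. acc js})))"
 by (rule ennreal_mult'[symmetric]) simp
 also have "... <= ennreal (2/3)"
 proof (rule ennreal_leI)
 have "real (n ^ r) <= 3 * real (card {js \<in> samples n r. acc js})"
 using accepted_samples[OF m(1-3) j0(1)] unfolding r_def acc_def .
 thus "1 / real n ^ r * (real (card (samples n r)) - real (card {js \<in> samples n r. acc js})) <= 2/3"
 using n0 by (simp add: card_samples divide_le_eq)
 qed
 finally show ?thesis .
 qed
 have "ew ?fr (WHILE ?b DO ?c) H ?sp (pc U (%H' sp'. Inv H' & sp' = ?sp & ~ bval ?fr H' ?b) ?F) <= 3 * (2 * of_nat 4 + ennreal a)"
 proof (rule ew_retry)
 show "Inv H" unfolding Inv_def using p v by simp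
 have "cst (bval_acc ?fr H' ?b) <= 4" for H' by (rule cst_local[of _ s "s + 14"]) (use B_large in auto)
 thus "addrs (bval_acc ?fr H' ?b) <= U & cst (bval_acc ?fr H' ?b) <= 4" for H' using U by auto
 qed (use v step prob in auto)
 also have "3 * (2 * of_nat 4 + ennreal a) = ennreal (3 * (8 + a))"
 proof -
 have "0 <= a" unfolding a_def using pos a2 by simp
 hence "ennreal (3 * (8 + a)) = ennreal 3 * (ennreal 8 + ennreal a)" by (simp only: ennreal_mult ennreal_plus)
 thus ?thesis by simp
 qed
 finally show ?thesis unfolding a_def add.assoc
 by (rule ew_pc_mono) (auto simp: Inv_def)
qed

lemma ChoosePivots_ew:
 assumes v: "H (s + 1) = Fin d" "H (s + 2) = Fin (int n)" "H (s + 3) = Fin (int m)"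
 and inj: "inj_on H {d..<d + int n}" and Fn: "H ` {d..<d + int n} <= range Fin"
 and m: "17 <= n" "(m - 1)^2 < n" "n <= m^2" "s + 15 <= pv" "d + int n <= s"
 and U: "{s..s + 14} <= U" "{d..d + int n} <= U" "{pv..pv + 12 * int m + 20} <= U" and a2: "0 <= a2"
 shows "ew (frame SquareSort_proc s) ChoosePivots H pv
 (pc U (%H' sp'. sp' = pv + int m + 1 & H' (s + 10) = Fin pv & good_pivots (H ` {d..<d + int n}) pv m H' &
 (ALL z<pv. z ~: {s + 4, s + 5, s + 6, s + 9, s + 10} --> H' z = H z))
 (%H'. ennreal (a2 * real (bucket_squares (H ` {d..<d + int n}) (%i. H' (pv + int i)) m))))
 <= ennreal (600 + 2 * real n / B + 40 * real m + 300 * (real m)^2 / B + 12 * a2 * real n * real m)"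
proof -
 let ?fr = "frame SquareSort_proc s" and ?X = "H ` {d..<d + int n}"
 let ?Q = "%H' sp'. sp' = pv + int m + 1 & H' (s + 10) = Fin pv & good_pivots ?X pv m H' &
 (ALL z<pv. z ~: {s + 4, s + 5, s + 6, s + 9, s + 10} --> H' z = H z)"
 let ?F = "%H'. ennreal (a2 * real (bucket_squares ?X (%i. H' (pv + int i)) m))"
 let ?pre = "((''x'' ::= (V ''D'')[[N 0]];; ''i'' ::= N 1);; min_loop);; (Alloc ''pivots'' (V ''m'' \<oplus> N 1);;
 V ''pivots'' :*= Const Minf;; V ''pivots'' \<oplus> V ''m'' :*= Const Pinf;; ''ok'' ::= N 0)"
 let ?loop = "WHILE V ''ok'' \<doteq> N 0 DO pivot_round"
 have m0: "1 <= m" using m by (cases m) auto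
 have code: "ew ?fr ChoosePivots H pv h = ew ?fr (?pre;; ?loop) H pv h" for h
 unfolding ChoosePivots_def min_loop_def[symmetric] sample_loop_def[symmetric] check_loop_def[symmetric] pivot_round_def[symmetric]
 by (simp add: ew_Seq)
 define P where "P H' sp' \<longleftrightarrow> sp' = pv + int m + 1 & H' (s + 6) = Min ?X & H' (s + 9) = Fin 0 & H' (s + 10) = Fin pv &
 H' pv = Minf & H' (pv + int m) = Pinf & (ALL z<pv. z ~: {s + 4, s + 6, s + 9, s + 10} --> H' z = H z)" for H' sp'
 have pm: "pv \<in> {pv..pv + 12 * int m + 20}" "pv + int m \<in> {pv..pv + 12 * int m + 20}" by auto
 have pre: "aq U ((14 + 2 * real n / B) + (4 + 2 * real (length [pv, pv + int m]))) ?fr ?pre H pv P"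
 proof (rule aq_Seq)
 show "aq U (14 + 2 * real n / B) ?fr ((''x'' ::= (V ''D'')[[N 0]];; ''i'' ::= N 1);; min_loop) H pv
 (%H' sp'. sp' = pv & H' (s + 6) = Min ?X & (ALL z. z ~= s + 4 --> z ~= s + 6 --> H' z = H z))"
 by (rule min_loop_aq) (use v m U in auto)
 fix H1 sp1 assume h: "sp1 = pv & H1 (s + 6) = Min ?X & (ALL z. z ~= s + 4 --> z ~= s + 6 --> H1 z = H z)"
 hence v1: "H1 (s + 3) = Fin (int m)" "sp1 = pv" "H1 (s + 6) = Min ?X" using v by auto
 have un: "H1 z = H z" if "z ~= s + 4" "z ~= s + 6" for z using h that by blast
 show "aq U (4 + 2 * real (length [pv, pv + int m])) ?fr (Alloc ''pivots'' (V ''m'' \<oplus> N 1);;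
 V ''pivots'' :*= Const Minf;; V ''pivots'' \<oplus> V ''m'' :*= Const Pinf;; ''ok'' ::= N 0) H1 sp1 P"
 proof (rule aq_frame[where s = s])
 show "ae ?fr (Alloc ''pivots'' (V ''m'' \<oplus> N 1);; V ''pivots'' :*= Const Minf;; V ''pivots'' \<oplus> V ''m'' :*= Const Pinf;; ''ok'' ::= N 0) H1 sp1
 (%H' sp' t. addrs t <= {s..s + 14} Un set [pv, pv + int m] & P H' sp')"
 using v1 m m0 un by (auto simp: ae_simps P_def)
 qed (use pm U in auto)
 qed
 have loop: "ew ?fr ?loop H1 sp1 (pc U ?Q ?F) <= ennreal (3 * (8 + round_cost m + 4 * a2 * real n * real m))" if P1: "P H1 sp1" for H1 sp1
 proof -
 have un: "H1 z = H z" if "z < pv" "z ~: {s + 4, s + 6, s + 9, s + 10}" for z using P1 that unfolding P_def by blast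
 have ld: "H1 z = H z" if "z \<in> {d..<d + int n}" for z by (rule un) (use that m in auto)
 have img: "H1 ` {d..<d + int n} = ?X" using ld by (intro image_cong) auto
 have inj': "inj_on H1 {d..<d + int n}" using inj ld inj_on_cong[of "{d..<d + int n}" H1 H] by blast
 have sp: "sp1 = pv + int m + 1" using P1 by (simp add: P_def)
 have "ew ?fr ?loop H1 (pv + int m + 1)
 (pc U (%H' sp'. sp' = pv + int m + 1 & good_pivots (H1 ` {d..<d + int n}) pv m H' &
 (ALL z<pv. z ~= s + 4 --> z ~= s + 5 --> z ~= s + 9 --> H' z = H1 z))
 (%H'. ennreal (a2 * real (bucket_squares (H1 ` {d..<d + int n}) (%i. H' (pv + int i)) m))))
 <= ennreal (3 * (8 + round_cost m + 4 * a2 * real n * real m))"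
 proof (rule ew_retry_pivots)
 show "H1 ` {d..<d + int n} <= range Fin" unfolding img by (rule Fn)
 show "H1 (s + 6) = Min (H1 ` {d..<d + int n})" unfolding img using P1 by (simp add: P_def)
 qed (use P1 v un[of "s + 1"] un[of "s + 2"] un[of "s + 3"] inj' m U a2 in \<open>auto simp: P_def\<close>)
 thus ?thesis unfolding sp img
 proof (rule ew_pc_mono)
 fix H' sp' assume h: "sp' = pv + int m + 1 & good_pivots ?X pv m H' &
 (ALL z<pv. z ~= s + 4 --> z ~= s + 5 --> z ~= s + 9 --> H' z = H1 z)"
 hence "H' (s + 10) = H1 (s + 10)" using m by auto
 thus "?Q H' sp'" using h un P1 by (auto simp: P_def)
 qed auto
 qed
 have "ew ?fr ChoosePivots H pv (pc U ?Q ?F) <=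
 ennreal ((14 + 2 * real n / B) + (4 + 2 * real (length [pv, pv + int m]))) + ennreal (3 * (8 + round_cost m + 4 * a2 * real n * real m))"
 unfolding code by (rule ew_Seq_aq[OF pre]) (rule loop)
 also have "... = ennreal (22 + 2 * real n / B + 3 * (8 + round_cost m + 4 * a2 * real n * real m))"
 using a2 by (subst ennreal_plus[symmetric]) (auto simp: round_cost_def intro!: add_nonneg_nonneg)
 also have "... <= ennreal (600 + 2 * real n / B + 40 * real m + 300 * (real m)^2 / B + 12 * a2 * real n * real m)"
 proof (rule ennreal_leI)
 have "4 / B * real m <= 1 * real m" using B_large by (intro mult_right_mono) auto
 hence q: "4 * real m / B <= real m" by simp
 show "22 + 2 * real n / B + 3 * (8 + round_cost m + 4 * a2 * real n * real m) <=
 600 + 2 * real n / B + 40 * real m + 300 * (real m)^2 / B + 12 * a2 * real n * real m"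
 unfolding round_cost_def distrib_left using q by simp
 qed
 finally show ?thesis .
qed

end

section \<open>The recurrence for the expected cost\<close>

definition sort_post :: "nat => mem => addr => addr => addr => mem => bool" where
 "sort_post n H a d s H' \<longleftrightarrow> arr H' d n = sort (arr H a n) &
 (ALL z<s. z ~: {a..<a + int n} --> z ~: {d..<d + int n} --> H' z = H z)"

text \<open>The \<open>11 * int n\<close> cells hold local arrays and nested calls. The factor lets
  the bound reproduce itself, since \<open>4 * m <= n + 3\<close> and a bucket has at most
  \<open>n + 1 - m\<close> items.\<close>

definition sort_space :: "addr => addr => addr => nat => addr set" where
 "sort_space a d s n = {a..a + int n} Un {d..d + int n} Un {s..s + 15 + 11 * int n}"

lemma inj_on_arr: "inj_on H {x..<x + int n} \<longleftrightarrow> distinct (arr H x n)"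
proof
 assume "inj_on H {x..<x + int n}"
 hence "inj_on (%i. H (x + int i)) {..<n}" by (auto intro!: inj_onI dest: inj_onD)
 thus "distinct (arr H x n)" unfolding arr_def by (simp add: distinct_map lessThan_atLeast0)
next
 assume d: "distinct (arr H x n)"
 have "card (H ` {x..<x + int n}) = card {x..<x + int n}"
 using distinct_card[OF d] by (simp add: set_arr)
 thus "inj_on H {x..<x + int n}" by (intro eq_card_imp_inj_on) auto
qed

lemma valid_input_segment:
 assumes "valid_input n H a d s" "lo <= hi" "hi <= n" "s <= s'"
 and "!!z. z \<in> {a + int lo..<a + int hi} ==> H' z = H z"
 shows "valid_input (hi - lo) H' (a + int lo) (d + int lo) s'"
proof -
 let ?I = "{a + int lo..<a + int lo + int (hi - lo)}"
 have I: "?I = {a + int lo..<a + int hi}" using assms by (simp add: of_nat_diff)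
 have sub: "?I <= {a..<a + int n}" unfolding I using assms by auto
 have "inj_on H ?I" using assms(1) unfolding valid_input_def by (blast intro: inj_on_subset[OF _ sub])
 hence "inj_on H' ?I" using assms(5) inj_on_cong[of ?I H' H] unfolding I by blast
 moreover have "H' ` ?I = H ` ?I" using assms(5) unfolding I by (intro image_cong) auto
 moreover have "H ` ?I <= range Fin" using assms(1) sub unfolding valid_input_def by blast
 moreover have "?I Int {d + int lo..<d + int lo + int (hi - lo)} = {}"
 proof -
 have "{d + int lo..<d + int lo + int (hi - lo)} <= {d..<d + int n}" using assms by auto
 thus ?thesis using assms(1) sub unfolding valid_input_def by blast
 qed
 ultimately show ?thesis using assms unfolding valid_input_def by (simp add: of_nat_diff)
qed

text \<open>The last fact fits the local arrays of \<open>O(m)\<close> cells into the stack space;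
  it follows from \<open>4 \<le> m - 1\<close> and \<open>(m - 1)^2 < n\<close>.\<close>

lemma ceil_sqrt_bounds:
 fixes n :: nat
 assumes "17 <= n"
 obtains m :: nat where "\<lceil>sqrt (real n)\<rceil> = int m" "(m - 1)^2 < n" "n <= m^2" "5 <= m" "4 * m <= n + 3"
proof -
 define m where "m = nat \<lceil>sqrt (real n)\<rceil>"
 have "0 < sqrt (real n)" using assms by simp
 hence c: "\<lceil>sqrt (real n)\<rceil> = int m" unfolding m_def by linarith
 have up: "sqrt (real n) <= real m" using c by linarith
 have lo: "real m - 1 < sqrt (real n)" using c by linarith
 have "(sqrt (real n))^2 <= (real m)^2" using up by (intro power_mono) auto
 hence "real n <= real (m^2)" by simp
 hence n2: "n <= m^2" by (simp only: of_nat_le_iff)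
 have m5: "5 <= m"
 proof (rule ccontr)
 assume "~ 5 <= m"
 hence "m^2 <= 4^2" by (intro power_mono) auto
 thus False using n2 assms by simp
 qed
 have "(real m - 1)^2 < (sqrt (real n))^2" using lo m5 by (intro power_strict_mono) auto
 hence "real ((m - 1)^2) < real n" using m5 by (simp add: of_nat_diff)
 hence m1: "(m - 1)^2 < n" by (simp only: of_nat_less_iff)
 have "4 * (m - 1) <= (m - 1)^2" using m5 by (simp add: power2_eq_square)
 hence "4 * m <= n + 3" using m1 by linarith
 with c m1 n2 m5 show ?thesis by (rule that)
qed

context cache
begin

text \<open>Postcondition and space bound are part of the cost, so finiteness includes that the
  input gets sorted within its space.\<close>

definition sort_run :: "nat => mem => addr => addr => addr => ennreal" where
 "sort_run n H a d s = ew (frame SquareSort_proc s) (body SquareSort_proc) (write_list H s [Fin a, Fin d, Fin (int n)]) (s + 15)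
 (pc (sort_space a d s n) (%H' sp'. sort_post n H a d s H') (%_. 0))"

text \<open>The worst case is taken over all memories and placements, because nested calls run at
  other addresses.\<close>

definition sort_cost :: "nat => ennreal" where
 "sort_cost n = (SUP (H, a, d, s) \<in> {(H, a, d, s). valid_input n H a d s}. sort_run n H a d s)"

lemma sort_run_le: "valid_input n H a d s ==> sort_run n H a d s <= sort_cost n"
 unfolding sort_cost_def by (rule SUP_upper2[of "(H, a, d, s)"]) auto

lemma sort_cost_leI:
 assumes "!!H a d s. valid_input n H a d s ==> sort_run n H a d s <= k"
 shows "sort_cost n <= k"
 unfolding sort_cost_def by (rule SUP_least) (use assms in auto)

lemma ew_of_aq: "aq U k fr c H sp Q ==> ew fr c H sp (pc U Q (%_. 0)) <= ennreal k"
 using ew_of_ae_pc[of fr c H sp U Q k "%_. 0" 0] unfolding aq_def by (simp add: conj_commute conj_left_commute)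

lemma ew_Seq_const:
 assumes "ew fr c1 H sp (pc U Q (%_. 0)) <= b1" "!!H1 sp1. Q H1 sp1 ==> ew fr c2 H1 sp1 (pc U R G) <= b2"
 shows "ew fr (c1;; c2) H sp (pc U R G) <= b1 + b2"
proof (rule ew_Seq_pc[where Q = Q and F = "%_. b2"])
 have "ew fr c1 H sp (pc U Q (%_. b2)) = b2 + ew fr c1 H sp (pc U Q (%_. 0))"
 using ew_pc_add_const[of fr c1 H sp U Q b2 "%_. 0"] by simp
 thus "ew fr c1 H sp (pc U Q (%_. b2)) <= b1 + b2" using assms(1) by (simp add: add.commute add_left_mono)
qed (rule assms(2))

text \<open>The bound \<open>k i\<close> depends on the index because the iterations recurse on
  parts of different sizes.\<close>

lemma ew_for:
 fixes P :: "nat => mem => bool"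
 assumes init: "P 0 H"
 and step: "!!i H'. i < hi ==> P i H' ==> bval fr H' b & addrs (bval_acc fr H' b) <= {s..s + 14} &
 ew fr c H' sp (pc U (%H'' sp'. sp' = sp & P (Suc i) H'') (%_. 0)) <= k i"
 and exit: "!!H'. P hi H' ==> ~ bval fr H' b & addrs (bval_acc fr H' b) <= {s..s + 14}"
 and U: "{s..s + 14} <= U"
 shows "ew fr (WHILE b DO c) H sp (pc U (%H' sp'. sp' = sp & P hi H') (%_. 0)) <= (\<Sum>i<hi. 4 + k i) + 4"
proof -
 let ?h = "pc U (%H' sp'. sp' = sp & P hi H') (%_. 0)"
 have guard: "addrs (bval_acc fr H' b) <= U" "of_nat (cst (bval_acc fr H' b)) <= (4::ennreal)"
 if "addrs (bval_acc fr H' b) <= {s..s + 14}" for H'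
 proof -
 have "cst (bval_acc fr H' b) <= 4" using that cst_local[of _ s "s + 14"] B_large by simp
 hence "of_nat (cst (bval_acc fr H' b)) <= (of_nat 4::ennreal)" by (rule of_nat_mono)
 thus "of_nat (cst (bval_acc fr H' b)) <= (4::ennreal)" by simp
 qed (use that U in blast)
 have "ew fr (WHILE b DO c) H' sp ?h <= (\<Sum>j=i..<hi. 4 + k j) + 4" if "i <= hi" "P i H'" for i H'
 using that
 proof (induction "hi - i" arbitrary: i H')
 case 0
 hence ex: "~ bval fr H' b" "addrs (bval_acc fr H' b) <= {s..s + 14}" "P hi H'" "i = hi" using exit by auto
 have "ew fr (WHILE b DO c) H' sp ?h = ?h H' sp (bval_acc fr H' b)" by (subst ew_While_unfold) (use ex in simp)
 also have "... <= 4" unfolding pc_def using ex guard[OF ex(2)] by simp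
 finally show ?case using ex by simp
 next
 case (Suc x)
 hence i: "i < hi" by simp
 note st = step[OF i Suc.prems(2)]
 have IH: "ew fr (WHILE b DO c) H1 sp1 ?h <= (\<Sum>j=Suc i..<hi. 4 + k j) + 4" if "sp1 = sp & P (Suc i) H1" for H1 sp1
 using Suc.hyps(1)[of "Suc i" H1] Suc.hyps(2) i that by simp
 have seq: "ew fr (c;; WHILE b DO c) H' sp ?h <= k i + ((\<Sum>j=Suc i..<hi. 4 + k j) + 4)"
 by (rule ew_Seq_const[OF st[THEN conjunct2, THEN conjunct2] IH])
 have "ew fr (WHILE b DO c) H' sp ?h = ew fr (c;; WHILE b DO c) H' sp (%H2 sp2 t. ?h H2 sp2 (bval_acc fr H' b @ t))"
 by (subst ew_While_unfold) (use st in \<open>simp add: ew_Seq\<close>)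
 also have "... <= of_nat (cst (bval_acc fr H' b)) + (k i + ((\<Sum>j=Suc i..<hi. 4 + k j) + 4))"
 by (rule ew_prefix_pc[OF _ seq]) (use guard st in blast)
 also have "... <= 4 + (k i + ((\<Sum>j=Suc i..<hi. 4 + k j) + 4))" using guard st by (intro add_right_mono) blast
 also have "... = (\<Sum>j=i..<hi. 4 + k j) + 4" using i by (simp add: sum.atLeast_Suc_lessThan add.assoc)
 finally show ?case .
 qed
 from this[OF _ init] show ?thesis by (simp add: lessThan_atLeast0)
qed

section \<open>Recursive calls on columns and on buckets\<close>

lemma SquareSort_call_ew:
 assumes args: "map (aval fr H) es = [Fin a, Fin d, Fin (int n)]" and acc: "addrs (concat (map (aval_acc fr H) es)) <= {s..s + 14}"
 and val: "valid_input n H a d sp" and U: "{s..s + 14} <= U" "sort_space a d sp n <= U"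
 shows "ew fr (Call SquareSort es) H sp (pc U (%H' sp'. sp' = sp & sort_post n H a d sp H') (%_. 0)) <= 8 + sort_cost n"
proof -
 have len: "length es = 3" using arg_cong[OF args, of length] by simp
 let ?t = "concat (map (aval_acc fr H) es) @ map (%i. Write (sp + int i)) [0..<length es]"
 have c: "cst ?t <= 8" by (rule cst_call_prefix[OF acc]) (use B_large len in auto)
 have "{sp..<sp + 3} <= sort_space a d sp n" unfolding sort_space_def by auto
 hence "sp + int k \<in> U" if "k < 3" for k
 proof -
 have "sp + int k \<in> {sp..<sp + 3}" using that by simp
 thus ?thesis using \<open>{sp..<sp + 3} <= sort_space a d sp n\<close> U(2) by blast
 qed
 hence ad: "addrs ?t <= U" using acc U(1) len by (auto simp: image_Un)
 let ?run = "ew (frame SquareSort_proc sp) (body SquareSort_proc) (write_list H sp [Fin a, Fin d, Fin (int n)]) (sp + 15)"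
 have "?run (pc (sort_space a d sp n) (%H' sp'. sort_post n H a d sp H') (%_. 0)) <= sort_cost n"
 using sort_run_le[OF val] unfolding sort_run_def .
 hence r: "?run (pc U (%H' sp'. sort_post n H a d sp H') (%_. 0)) <= sort_cost n"
 by (rule ew_pc_mono) (use U in auto)
 have "ew fr (Call SquareSort es) H sp (pc U (%H' sp'. sp' = sp & sort_post n H a d sp H') (%_. 0)) =
 ?run (%H' sp' t. pc U (%H' sp'. sort_post n H a d sp H') (%_. 0) H' sp' (?t @ t))"
 unfolding ew_Call args by (simp add: pc_def)
 also have "... <= of_nat (cst ?t) + sort_cost n" by (rule ew_prefix_pc[OF ad r])
 also have "... <= of_nat 8 + sort_cost n" using c by (intro add_right_mono of_nat_mono)
 finally show ?thesis by simp
qed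

text \<open>The common loop body of the two recursive phases; they differ only in the expressions
  \<open>es\<close> and \<open>ee\<close> for the ends of the segment.\<close>

lemma sort_segment_ew:
 fixes hi lo i :: nat
 assumes v: "H s = Fin a" "H (s + 1) = Fin d" "H (s + 4) = Fin (int i)"
 and e1: "aval (frame SquareSort_proc s) H es = Fin (int lo)" "addrs (aval_acc (frame SquareSort_proc s) H es) <= {s..s + 14} Un set xs"
 and e2: "aval (frame SquareSort_proc s) (H(s + 7 := Fin (int lo))) ee = Fin (int hi)"
 "addrs (aval_acc (frame SquareSort_proc s) (H(s + 7 := Fin (int lo))) ee) <= {s..s + 14} Un set xs"
 and val: "valid_input (hi - lo) H (a + int lo) (d + int lo) s" and lay: "lo <= hi" "s + 15 <= sp" "length xs <= 2"
 and U: "{s..s + 14} Un set xs <= U" "sort_space (a + int lo) (d + int lo) sp (hi - lo) <= U"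
 shows "ew (frame SquareSort_proc s) (''s'' ::= es;; ''e'' ::= ee;;
 Call SquareSort [V ''A'' \<oplus> V ''s'', V ''D'' \<oplus> V ''s'', V ''e'' \<ominus> V ''s''];; ''i'' ::= V ''i'' \<oplus> N 1) H sp
 (pc U (%H' sp'. sp' = sp & H' (s + 4) = Fin (int (Suc i)) &
 arr H' (d + int lo) (hi - lo) = sort (arr H (a + int lo) (hi - lo)) &
 (ALL z<sp. z ~: {s + 4, s + 7, s + 8} --> z ~: {a + int lo..<a + int hi} --> z ~: {d + int lo..<d + int hi} --> H' z = H z)) (%_. 0))
 <= 20 + sort_cost (hi - lo)"
proof -
 let ?fr = "frame SquareSort_proc s"
 let ?es = "[V ''A'' \<oplus> V ''s'', V ''D'' \<oplus> V ''s'', V ''e'' \<ominus> V ''s'']"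
 define H1 where "H1 = H(s + 7 := Fin (int lo), s + 8 := Fin (int hi))"
 have ad: "a + int hi <= s" "d + int hi <= s" using val lay by (auto simp: valid_input_def of_nat_diff)
 have st1: "aq U (4 + 2 * real (length xs)) ?fr (''s'' ::= es;; ''e'' ::= ee) H sp (%H' sp'. sp' = sp & H' = H1)"
 proof (rule aq_frame[where s = s])
 show "ae ?fr (''s'' ::= es;; ''e'' ::= ee) H sp (%H' sp' t. addrs t <= {s..s + 14} Un set xs & sp' = sp & H' = H1)"
 using e1 e2 by (auto simp: ae_simps H1_def)
 qed (use U lay in auto)
 have val1: "valid_input (hi - lo) H1 (a + int lo) (d + int lo) sp"
 using valid_input_segment[OF val, of 0 "hi - lo" sp H1] lay ad by (auto simp: H1_def)
 have st2: "ew ?fr (Call SquareSort ?es) H1 sp (pc U (%H' sp'. sp' = sp & sort_post (hi - lo) H1 (a + int lo) (d + int lo) sp H') (%_. 0)) <= 8 + sort_cost (hi - lo)"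
 by (rule SquareSort_call_ew[where s = s]) (use v lay val1 U in \<open>auto simp: H1_def of_nat_diff\<close>)
 let ?post = "%H' sp'. sp' = sp & H' (s + 4) = Fin (int (Suc i)) &
 arr H' (d + int lo) (hi - lo) = sort (arr H (a + int lo) (hi - lo)) &
 (ALL z<sp. z ~: {s + 4, s + 7, s + 8} --> z ~: {a + int lo..<a + int hi} --> z ~: {d + int lo..<d + int hi} --> H' z = H z)"
 have st3: "ew ?fr (''i'' ::= V ''i'' \<oplus> N 1) H2 sp2 (pc U ?post (%_. 0)) <= ennreal (4 + 2 * real (length ([]::addr list)))"
 if h: "sp2 = sp & sort_post (hi - lo) H1 (a + int lo) (d + int lo) sp H2" for H2 sp2
 proof (rule ew_of_aq, rule aq_frame[where s = s])
 have un: "H2 z = H1 z" if "z < sp" "z ~: {a + int lo..<a + int hi}" "z ~: {d + int lo..<d + int hi}" for z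
 using h that lay unfolding sort_post_def by (simp add: of_nat_diff)
 have i4: "H2 (s + 4) = Fin (int i)" using un[of "s + 4"] v ad lay by (simp add: H1_def)
 have "arr H1 (a + int lo) (hi - lo) = arr H (a + int lo) (hi - lo)"
 by (rule arr_cong) (use ad lay in \<open>auto simp: H1_def\<close>)
 moreover have "arr (H2(s + 4 := x)) (d + int lo) (hi - lo) = arr H2 (d + int lo) (hi - lo)" for x
 by (rule arr_cong) (use ad lay in auto)
 ultimately have A: "arr (H2(s + 4 := x)) (d + int lo) (hi - lo) = sort (arr H (a + int lo) (hi - lo))" for x
 using h unfolding sort_post_def by simp
 have un': "H2 z = H z" if "z < sp" "z ~: {s + 4, s + 7, s + 8}" "z ~: {a + int lo..<a + int hi}" "z ~: {d + int lo..<d + int hi}" for z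
 using un[of z] that by (auto simp: H1_def)
 show "ae ?fr (''i'' ::= V ''i'' \<oplus> N 1) H2 sp2 (%H' sp' t. addrs t <= {s..s + 14} Un set [] & ?post H' sp')"
 unfolding ae_Assign using h i4 A un' by (simp add: add.commute)
 qed (use U in auto)
 have "ew ?fr (''s'' ::= es;; ''e'' ::= ee;; Call SquareSort ?es;; ''i'' ::= V ''i'' \<oplus> N 1) H sp (pc U ?post (%_. 0)) <=
 (ennreal (4 + 2 * real (length xs)) + (8 + sort_cost (hi - lo))) + ennreal (4 + 2 * real (length ([]::addr list)))"
 proof (rule ew_Seq_const)
 show "ew ?fr (''s'' ::= es;; ''e'' ::= ee;; Call SquareSort ?es) H sp
 (pc U (%H' sp'. sp' = sp & sort_post (hi - lo) H1 (a + int lo) (d + int lo) sp H') (%_. 0)) <= ennreal (4 + 2 * real (length xs)) + (8 + sort_cost (hi - lo))"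
 by (rule ew_Seq_aq[OF st1]) (use st2 in simp)
 qed (rule st3)
 also have "... <= (ennreal 8 + (8 + sort_cost (hi - lo))) + ennreal 4"
 using lay by (intro add_mono ennreal_leI order_refl) auto
 also have "... = 20 + sort_cost (hi - lo)" by (simp add: add.assoc[symmetric] add.commute)
 finally show ?thesis .
qed

text \<open>A recursive call may permute its part of \<open>A\<close>, so the invariant keeps only
  those columns of \<open>A\<close> that are still to come.\<close>

lemma SortColumns_ew:
 assumes v: "H s = Fin a" "H (s + 1) = Fin d" "H (s + 2) = Fin (int n)" "H (s + 3) = Fin (int m)"
 and val: "valid_input n H a d s" and m: "n <= m * m"
 and U: "{s..s + 14} <= U" "!!j. j < m ==> sort_space (a + int (clm n m j)) (d + int (clm n m j)) (s + 15) (clm n m (Suc j) - clm n m j) <= U"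
 shows "ew (frame SquareSort_proc s) SortColumns H (s + 15) (pc U (%H' sp'. sp' = s + 15 & mset (arr H' d n) = mset (arr H a n) &
 (ALL j<m. sorted (arr H' (d + int (clm n m j)) (clm n m (Suc j) - clm n m j))) &
 (ALL z<s + 15. z ~: {s + 4, s + 7, s + 8} --> z ~: {a..<a + int n} --> z ~: {d..<d + int n} --> H' z = H z)) (%_. 0))
 <= (\<Sum>j<m. 24 + sort_cost (clm n m (Suc j) - clm n m j)) + 8"
proof -
 let ?fr = "frame SquareSort_proc s" and ?col = "clm n m"
 have ad: "a + int n <= s" "d + int n <= s" "{a..<a + int n} Int {d..<d + int n} = {}" using val by (auto simp: valid_input_def)
 define P where "P i H' \<longleftrightarrow> H' (s + 4) = Fin (int i) & mset (arr H' d (?col i)) = mset (arr H a (?col i)) &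
 (ALL j<i. sorted (arr H' (d + int (?col j)) (?col (Suc j) - ?col j))) &
 (ALL z. a + int (?col i) <= z --> z < a + int n --> H' z = H z) &
 (ALL z<s + 15. z ~: {s + 4, s + 7, s + 8} --> z ~: {a..<a + int n} --> z ~: {d..<d + int n} --> H' z = H z)" for i H'
 let ?body = "''s'' ::= MinE (V ''i'' \<odot> V ''m'') (V ''n'');; ''e'' ::= MinE ((V ''i'' \<oplus> N 1) \<odot> V ''m'') (V ''n'');;
 Call SquareSort [V ''A'' \<oplus> V ''s'', V ''D'' \<oplus> V ''s'', V ''e'' \<ominus> V ''s''];; ''i'' ::= V ''i'' \<oplus> N 1"
 have st1: "aq U (4 + 2 * real (length ([]::addr list))) ?fr (''i'' ::= N 0) H (s + 15) (%H' sp'. sp' = s + 15 & P 0 H')"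
 by (rule aq_frame[where s = s]) (use ad U in \<open>auto simp: ae_simps P_def clm_def\<close>)
 have loop: "ew ?fr (WHILE V ''i'' \<prec> V ''m'' DO (?body)) H0 (s + 15) (pc U (%H' sp'. sp' = s + 15 & P m H') (%_. 0)) <=
 (\<Sum>j<m. 4 + (20 + sort_cost (?col (Suc j) - ?col j))) + 4" if P0: "P 0 H0" for H0
 proof (rule ew_for[where P = P and s = s])
 fix i H' assume i: "i < m" and Pi: "P i H'"
 let ?lo = "?col i" and ?hi = "?col (Suc i)"
 have lh: "?lo <= ?hi" "?hi <= n" by (auto intro: clm_mono clm_le)
 have un: "H' z = H z" if "z < s + 15" "z ~: {s + 4, s + 7, s + 8}" "z ~: {a..<a + int n}" "z ~: {d..<d + int n}" for z
 using Pi that unfolding P_def by blast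
 have v': "H' s = Fin a" "H' (s + 1) = Fin d" "H' (s + 2) = Fin (int n)" "H' (s + 3) = Fin (int m)" "H' (s + 4) = Fin (int i)"
 using un[of s] un[of "s + 1"] un[of "s + 2"] un[of "s + 3"] v ad Pi by (auto simp: P_def)
 have tail: "H' z = H z" if "a + int ?lo <= z" "z < a + int n" for z using Pi that unfolding P_def by blast
 have val': "valid_input (?hi - ?lo) H' (a + int ?lo) (d + int ?lo) s"
 by (rule valid_input_segment[OF val]) (use lh tail in auto)
 have dj: "z ~: {d..<d + int n}" if "z \<in> {a..<a + int n}" for z using ad(3) that by blast
 have "ew ?fr (?body) H' (s + 15) (pc U (%H'' sp'. sp' = s + 15 & H'' (s + 4) = Fin (int (Suc i)) &
 arr H'' (d + int ?lo) (?hi - ?lo) = sort (arr H' (a + int ?lo) (?hi - ?lo)) &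
 (ALL z<s + 15. z ~: {s + 4, s + 7, s + 8} --> z ~: {a + int ?lo..<a + int ?hi} --> z ~: {d + int ?lo..<d + int ?hi} --> H'' z = H' z)) (%_. 0)) <= 20 + sort_cost (?hi - ?lo)"
 by (rule sort_segment_ew[where xs = "[]"]) (use v' val' lh U(1) U(2)[OF i] clm_Fin[of i m n] in auto)
 hence "ew ?fr (?body) H' (s + 15) (pc U (%H'' sp'. sp' = s + 15 & P (Suc i) H'') (%_. 0)) <= 20 + sort_cost (?hi - ?lo)"
 proof (rule ew_pc_mono, goal_cases)
 case (2 H'' sp')
 have un'': "H'' z = H' z" if "z < s + 15" "z ~: {s + 4, s + 7, s + 8}" "z ~: {a + int ?lo..<a + int ?hi}" "z ~: {d + int ?lo..<d + int ?hi}" for z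
 using 2 that by blast
 have "arr H'' d ?lo = arr H' d ?lo"
 proof (rule arr_cong, rule un'')
 fix z assume z: "d <= z" "z < d + int ?lo"
 hence "z \<in> {d..<d + int n}" using lh by auto
 hence "z ~: {a..<a + int n}" using dj by blast
 thus "z ~: {a + int ?lo..<a + int ?hi}" using lh by auto
 qed (use lh ad in auto)
 moreover have ta: "arr H' (a + int ?lo) (?hi - ?lo) = arr H (a + int ?lo) (?hi - ?lo)"
 by (rule arr_cong, rule tail) (use lh in auto)
 moreover have "mset (arr H' d ?lo) = mset (arr H a ?lo)" using Pi by (simp add: P_def)
 ultimately have ms: "mset (arr H'' d ?hi) = mset (arr H a ?hi)"
 unfolding arr_append[OF lh(1)] using 2 by simp
 have so: "sorted (arr H'' (d + int (?col j)) (?col (Suc j) - ?col j))" if "j < Suc i" for j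
 proof (cases "j = i")
 case True
 thus ?thesis using 2 by simp
 next
 case False
 hence j: "j < i" using that by simp
 have c: "?col j <= ?col (Suc j)" "?col (Suc j) <= ?lo" using j by (auto intro: clm_mono)
 have "arr H'' (d + int (?col j)) (?col (Suc j) - ?col j) = arr H' (d + int (?col j)) (?col (Suc j) - ?col j)"
 proof (rule arr_cong, rule un'')
 fix z assume z: "d + int (?col j) <= z" "z < d + int (?col j) + int (?col (Suc j) - ?col j)"
 hence "z \<in> {d..<d + int n}" using lh c by auto
 hence "z ~: {a..<a + int n}" using dj by blast
 thus "z ~: {a + int ?lo..<a + int ?hi}" using lh by auto
 qed (use lh c ad in auto)
 thus ?thesis using Pi j by (simp add: P_def)
 qed
 have tl: "H'' z = H z" if "a + int ?hi <= z" "z < a + int n" for z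
 proof -
 have "z ~: {d..<d + int n}" using dj[of z] that by auto
 hence "H'' z = H' z" by (intro un'') (use that lh ad in auto)
 thus ?thesis using tail[of z] that lh by auto
 qed
 have un2: "H'' z = H z" if "z < s + 15" "z ~: {s + 4, s + 7, s + 8}" "z ~: {a..<a + int n}" "z ~: {d..<d + int n}" for z
 proof -
 have "H'' z = H' z" by (rule un'') (use that lh in auto)
 thus ?thesis using un[OF that] by simp
 qed
 have "H'' (s + 4) = Fin (int (Suc i))" "sp' = s + 15" using 2 by simp_all
 thus ?case unfolding P_def using ms so tl un2 by blast
 qed auto
 thus "bval ?fr H' (V ''i'' \<prec> V ''m'') & addrs (bval_acc ?fr H' (V ''i'' \<prec> V ''m'')) <= {s..s + 14} &
 ew ?fr (?body) H' (s + 15) (pc U (%H'' sp'. sp' = s + 15 & P (Suc i) H'') (%_. 0)) <= 20 + sort_cost (?hi - ?lo)"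
 using v' i by simp
 next
 fix H' assume Pm: "P m H'"
 have "H' (s + 3) = H (s + 3)" using Pm ad unfolding P_def by auto
 thus "~ bval ?fr H' (V ''i'' \<prec> V ''m'') & addrs (bval_acc ?fr H' (V ''i'' \<prec> V ''m'')) <= {s..s + 14}"
 using v Pm by (auto simp: P_def)
 qed (use P0 U in auto)
 have full: "ew ?fr SortColumns H (s + 15) (pc U (%H' sp'. sp' = s + 15 & P m H') (%_. 0)) <=
 ennreal (4 + 2 * real (length ([]::addr list))) + ((\<Sum>j<m. 4 + (20 + sort_cost (?col (Suc j) - ?col j))) + 4)"
 unfolding SortColumns_def by (rule ew_Seq_aq[OF st1]) (use loop in auto)
 have cm: "?col m = n" using m by (simp add: clm_def)
 have eq: "ennreal (4 + 2 * real (length ([]::addr list))) + ((\<Sum>j<m. 4 + (20 + sort_cost (?col (Suc j) - ?col j))) + 4) =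
 (\<Sum>j<m. 24 + sort_cost (?col (Suc j) - ?col j)) + 8"
 by (simp add: add.assoc[symmetric] add.commute)
 show ?thesis using full unfolding eq by (rule ew_pc_mono) (auto simp: P_def cm)
qed

text \<open>When the loop reaches bucket \<open>i\<close>, the sorted prefix of \<open>D\<close>
  consists of exactly the items below pivot \<open>i\<close>. Sets suffice here: the items are
  distinct and the final length is known.\<close>

lemma SortBuckets_ew:
 assumes b: "bucketing p f n m"
 and v: "H s = Fin a" "H (s + 1) = Fin d" "H (s + 3) = Fin (int m)" "H (s + 11) = Fin bs"
 and st: "!!i. i <= m ==> H (bs + int i) = Fin (int (bucketing.start p f n i))"
 and ad: "a + int n <= s" "d + int n <= s" "{a..<a + int n} Int {d..<d + int n} = {}" and lay: "s + 15 <= bs" "bs + int m < sp"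
 and bu: "!!i. i < m ==> H ` {a + int (bucketing.start p f n i)..<a + int (bucketing.start p f n (Suc i))} = bucketing.bucket p f n i"
 "!!i. i < m ==> inj_on H {a + int (bucketing.start p f n i)..<a + int (bucketing.start p f n (Suc i))}"
 and Fn: "f ` {..<n} <= range Fin"
 and U: "{s..s + 14} <= U" "{bs..bs + int m} <= U"
 "!!i. i < m ==> sort_space (a + int (bucketing.start p f n i)) (d + int (bucketing.start p f n i)) sp (bucketing.start p f n (Suc i) - bucketing.start p f n i) <= U"
 shows "ew (frame SquareSort_proc s) SortBuckets H sp (pc U (%H' sp'. sorted (arr H' d n) & set (arr H' d n) = f ` {..<n} &
 (ALL z<sp. z ~: {s + 4, s + 7, s + 8} --> z ~: {a..<a + int n} --> z ~: {d..<d + int n} --> H' z = H z)) (%_. 0))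
 <= (\<Sum>i<m. 24 + sort_cost (bucketing.start p f n (Suc i) - bucketing.start p f n i)) + 8"
proof -
 interpret bucketing p f n m by (rule b)
 let ?fr = "frame SquareSort_proc s" and ?X = "f ` {..<n}"
 define P where "P i H' \<longleftrightarrow> H' (s + 4) = Fin (int i) & sorted (arr H' d (start i)) & set (arr H' d (start i)) = {v \<in> ?X. v < p i} &
 (ALL z. a + int (start i) <= z --> z < a + int n --> H' z = H z) &
 (ALL z<sp. z ~: {s + 4, s + 7, s + 8} --> z ~: {a..<a + int n} --> z ~: {d..<d + int n} --> H' z = H z)" for i H'
 let ?body = "''s'' ::= (V ''bs'')[[V ''i'']];; ''e'' ::= (V ''bs'')[[V ''i'' \<oplus> N 1]];;
 Call SquareSort [V ''A'' \<oplus> V ''s'', V ''D'' \<oplus> V ''s'', V ''e'' \<ominus> V ''s''];; ''i'' ::= V ''i'' \<oplus> N 1"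
 have X0: "{v \<in> ?X. v < p 0} = {}" using p_low by (auto simp flip: not_le)
 have Xm: "{v \<in> ?X. v < p m} = ?X" using p_high by auto
 have dj: "z ~: {d..<d + int n}" if "z \<in> {a..<a + int n}" for z using ad(3) that by blast
 have st1: "aq U (4 + 2 * real (length ([]::addr list))) ?fr (''i'' ::= N 0) H sp (%H' sp'. sp' = sp & P 0 H')"
 proof (rule aq_frame[where s = s])
 have "P 0 (H(s + 4 := Fin 0))" unfolding P_def X0 using ad by auto
 thus "ae ?fr (''i'' ::= N 0) H sp (%H' sp' t. addrs t <= {s..s + 14} Un set [] & sp' = sp & P 0 H')"
 by (simp add: ae_Assign)
 qed (use U in auto)
 have loop: "ew ?fr (WHILE V ''i'' \<prec> V ''m'' DO (?body)) H0 sp (pc U (%H' sp'. sp' = sp & P m H') (%_. 0)) <=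
 (\<Sum>j<m. 4 + (20 + sort_cost (start (Suc j) - start j))) + 4" if P0: "P 0 H0" for H0
 proof (rule ew_for[where P = P and s = s])
 fix i H' assume i: "i < m" and Pi: "P i H'"
 let ?lo = "start i" and ?hi = "start (Suc i)"
 have lh: "?lo <= ?hi" "?hi <= n" using start_mono[of i "Suc i"] start_le[of "Suc i"] i by auto
 have un: "H' z = H z" if "z < sp" "z ~: {s + 4, s + 7, s + 8}" "z ~: {a..<a + int n}" "z ~: {d..<d + int n}" for z
 using Pi that unfolding P_def by blast
 have v': "H' s = Fin a" "H' (s + 1) = Fin d" "H' (s + 3) = Fin (int m)" "H' (s + 11) = Fin bs" "H' (s + 4) = Fin (int i)"
 "H' (bs + int i) = Fin (int ?lo)" "H' (bs + (int i + 1)) = Fin (int ?hi)"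
 using un[of s] un[of "s + 1"] un[of "s + 3"] un[of "s + 11"] un[of "bs + int i"] un[of "bs + (int i + 1)"]
 st[of i] st[of "Suc i"] v ad Pi lay i by (auto simp: P_def add.commute add.left_commute)
 have tail: "H' z = H z" if "a + int ?lo <= z" "z < a + int n" for z using Pi that unfolding P_def by blast
 let ?I = "{a + int ?lo..<a + int ?lo + int (?hi - ?lo)}"
 have I: "?I = {a + int ?lo..<a + int ?hi}" using lh by (simp add: of_nat_diff)
 have tI: "H' z = H z" if "z \<in> ?I" for z using tail that lh unfolding I by auto
 have "H' ` ?I = H ` ?I" by (rule image_cong[OF refl tI])
 hence img: "H' ` ?I = bucket i" using bu(1)[OF i] unfolding I by simp
 have "inj_on H' ?I" using bu(2)[OF i] tI inj_on_cong[of ?I H' H] unfolding I by blast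
 moreover have "bucket i <= range Fin" using Fn unfolding bucket_def by blast
 moreover have "?I Int {d + int ?lo..<d + int ?lo + int (?hi - ?lo)} = {}"
 proof -
 have "?I <= {a..<a + int n}" "{d + int ?lo..<d + int ?lo + int (?hi - ?lo)} <= {d..<d + int n}" using lh by auto
 thus ?thesis using ad(3) by blast
 qed
 ultimately have val': "valid_input (?hi - ?lo) H' (a + int ?lo) (d + int ?lo) s"
 unfolding valid_input_def img using lh ad by (simp add: of_nat_diff)
 have bsU: "bs + int i \<in> U" "bs + (int i + 1) \<in> U" using U(2) i by auto
 have "ew ?fr (?body) H' sp (pc U (%H'' sp'. sp' = sp & H'' (s + 4) = Fin (int (Suc i)) &
 arr H'' (d + int ?lo) (?hi - ?lo) = sort (arr H' (a + int ?lo) (?hi - ?lo)) &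
 (ALL z<sp. z ~: {s + 4, s + 7, s + 8} --> z ~: {a + int ?lo..<a + int ?hi} --> z ~: {d + int ?lo..<d + int ?hi} --> H'' z = H' z)) (%_. 0)) <= 20 + sort_cost (?hi - ?lo)"
 by (rule sort_segment_ew[where xs = "[bs + int i, bs + (int i + 1)]"]) (use v' val' lh lay U(1) bsU U(3)[OF i] in auto)
 hence "ew ?fr (?body) H' sp (pc U (%H'' sp'. sp' = sp & P (Suc i) H'') (%_. 0)) <= 20 + sort_cost (?hi - ?lo)"
 proof (rule ew_pc_mono, goal_cases)
 case (2 H'' sp')
 have un'': "H'' z = H' z" if "z < sp" "z ~: {s + 4, s + 7, s + 8}" "z ~: {a + int ?lo..<a + int ?hi}" "z ~: {d + int ?lo..<d + int ?hi}" for z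
 using 2 that by blast
 have lo_eq: "arr H'' d ?lo = arr H' d ?lo"
 proof (rule arr_cong, rule un'')
 fix z assume z: "d <= z" "z < d + int ?lo"
 hence "z \<in> {d..<d + int n}" using lh by auto
 hence "z ~: {a..<a + int n}" using dj by blast
 thus "z ~: {a + int ?lo..<a + int ?hi}" using lh by auto
 qed (use lh ad lay in auto)
 have new: "sorted (arr H'' (d + int ?lo) (?hi - ?lo))" "set (arr H'' (d + int ?lo) (?hi - ?lo)) = bucket i"
 using 2 img by (simp_all add: set_arr)
 have old: "sorted (arr H' d ?lo)" "set (arr H' d ?lo) = {v \<in> ?X. v < p i}" using Pi by (simp_all add: P_def)
 have bi: "bucket i = {v \<in> ?X. p i <= v & v < p (Suc i)}" by (auto simp: bucket_def)
 have app: "arr H'' d ?hi = arr H' d ?lo @ arr H'' (d + int ?lo) (?hi - ?lo)"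
 unfolding arr_append[OF lh(1)] lo_eq ..
 have "\<forall>x\<in>set (arr H' d ?lo). \<forall>y\<in>set (arr H'' (d + int ?lo) (?hi - ?lo)). x <= y"
 unfolding old(2) new(2) bi by (auto intro: less_imp_le less_le_trans)
 hence so: "sorted (arr H'' d ?hi)" unfolding app sorted_append using old new by blast
 have "set (arr H'' d ?hi) = {v \<in> ?X. v < p i} Un {v \<in> ?X. p i <= v & v < p (Suc i)}"
 unfolding app set_append old(2) new(2) bi ..
 also have "... = {v \<in> ?X. v < p (Suc i)}" using p_mono[of i "Suc i"] i by (auto intro: less_le_trans)
 finally have se: "set (arr H'' d ?hi) = {v \<in> ?X. v < p (Suc i)}" .
 have tl: "H'' z = H z" if "a + int ?hi <= z" "z < a + int n" for z
 proof -
 have "z ~: {d..<d + int n}" using dj[of z] that by auto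
 hence "H'' z = H' z" by (intro un'') (use that lh ad lay in auto)
 thus ?thesis using tail[of z] that lh by auto
 qed
 have un2: "H'' z = H z" if "z < sp" "z ~: {s + 4, s + 7, s + 8}" "z ~: {a..<a + int n}" "z ~: {d..<d + int n}" for z
 proof -
 have "H'' z = H' z" by (rule un'') (use that lh in auto)
 thus ?thesis using un[OF that] by simp
 qed
 have "H'' (s + 4) = Fin (int (Suc i))" "sp' = sp" using 2 by simp_all
 thus ?case unfolding P_def using so se tl un2 by blast
 qed auto
 thus "bval ?fr H' (V ''i'' \<prec> V ''m'') & addrs (bval_acc ?fr H' (V ''i'' \<prec> V ''m'')) <= {s..s + 14} &
 ew ?fr (?body) H' sp (pc U (%H'' sp'. sp' = sp & P (Suc i) H'') (%_. 0)) <= 20 + sort_cost (?hi - ?lo)"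
 using v' i by simp
 next
 fix H' assume Pm: "P m H'"
 have "H' (s + 3) = H (s + 3)" using Pm ad lay unfolding P_def by auto
 thus "~ bval ?fr H' (V ''i'' \<prec> V ''m'') & addrs (bval_acc ?fr H' (V ''i'' \<prec> V ''m'')) <= {s..s + 14}"
 using v Pm by (auto simp: P_def)
 qed (use P0 U in auto)
 have full: "ew ?fr SortBuckets H sp (pc U (%H' sp'. sp' = sp & P m H') (%_. 0)) <=
 ennreal (4 + 2 * real (length ([]::addr list))) + ((\<Sum>j<m. 4 + (20 + sort_cost (start (Suc j) - start j))) + 4)"
 unfolding SortBuckets_def by (rule ew_Seq_aq[OF st1]) (use loop in auto)
 have eq: "ennreal (4 + 2 * real (length ([]::addr list))) + ((\<Sum>j<m. 4 + (20 + sort_cost (start (Suc j) - start j))) + 4) =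
 (\<Sum>j<m. 24 + sort_cost (start (Suc j) - start j)) + 8"
 by (simp add: add.assoc[symmetric] add.commute)
 show ?thesis using full unfolding eq
 proof (rule ew_pc_mono, goal_cases)
 case (2 H' sp')
 thus ?case unfolding P_def start_m Xm by blast
 qed auto
qed

end

section \<open>One level of the recursion\<close>

context cache
begin

text \<open>The random choice is over. For fixed pivots the linear and constant parts of the
  induction hypothesis add up to \<open>A1 * n + A3 * m\<close>, while the squared bucket sizes are
  left in the bound, to be averaged in the pivot phase.\<close>

lemma sort_after_pivots_ew:
 assumes v: "H s = Fin a" "H (s + 1) = Fin d" "H (s + 2) = Fin (int n)" "H (s + 3) = Fin (int m)" "H (s + 10) = Fin pv"
 and ad: "a + int n <= s" "d + int n <= s" "{a..<a + int n} Int {d..<d + int n} = {}" and pv: "pv = s + 15"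
 and inj: "inj_on H {d..<d + int n}" and Fn: "H ` {d..<d + int n} <= range Fin"
 and col: "!!j. j < m ==> sorted (arr H (d + int (clm n m j)) (clm n m (Suc j) - clm n m j))"
 and gp: "good_pivots (H ` {d..<d + int n}) pv m H"
 and m: "n <= m^2" "5 <= m" "4 * m <= n + 3" and A: "0 <= A1" "0 <= A2" "0 <= A3"
 and IH: "!!b. b < n ==> sort_cost b <= ennreal (A1 * real b + A2 * (real b)^2 + A3)"
 shows "ew (frame SquareSort_proc s) (BucketStarts;; MoveToBuckets;; SortBuckets) H (pv + int m + 1)
 (pc (sort_space a d s n) (%H' sp'. sorted (arr H' d n) & set (arr H' d n) = H ` {d..<d + int n} &
 (ALL z<s. z ~: {a..<a + int n} --> z ~: {d..<d + int n} --> H' z = H z)) (%_. 0))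
 <= ennreal (118 + 84 * real m + 966 * (real m)^2 / B + 4 * real n / B + A1 * real n + A3 * real m +
 A2 * real (bucket_squares (H ` {d..<d + int n}) (%i. H (pv + int i)) m))"
proof -
 let ?fr = "frame SquareSort_proc s" and ?U = "sort_space a d s n"
 define f where "f q = H (d + int q)" for q
 define p where "p i = H (pv + int i)" for i
 have fe: "f = (%q. H (d + int q))" by (rule ext) (rule f_def)
 have X: "H ` {d..<d + int n} = f ` {..<n}" unfolding fe by (rule image_shift)
 define bs where "bs = pv + int m + 1"
 define Ca where "Ca = bs + int m + 1"
 have gp1: "p 0 = Minf" "p m = Pinf" using gp unfolding good_pivots_def p_def by auto
 have lt: "p i < p i'" if "i < i'" "i' <= m" for i i' using gp that unfolding good_pivots_def p_def by blast
 have mem: "p i \<in> f ` {..<n} - {Min (f ` {..<n})}" if "1 <= i" "i < m" for i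
 using gp that unfolding good_pivots_def p_def X by blast
 have fFin: "EX c. f q = Fin c" if "q < n" for q using Fn that unfolding X by auto
 have b: "bucketing p f n m"
 proof
 show "1 <= m" using m by simp
 show "n <= m * m" using m by (simp add: power2_eq_square)
 show "p 0 <= f q" if "q < n" for q using fFin[OF that] gp1 by auto
 show "f q < p m" if "q < n" for q using fFin[OF that] gp1 by auto
 show "p i <= p i'" if "i <= i'" "i' <= m" for i i' using lt[of i i'] that by (cases "i = i'") auto
 show "inj_on f {..<n}" unfolding fe by (rule inj_shift[OF inj])
 fix j q q' assume q: "clm n m j <= q" "q <= q'" "q' < clm n m (Suc j)"
 have j: "j < m"
 proof (rule ccontr)
 assume "~ j < m"
 hence "m * m <= j * m" by (intro mult_le_mono1) simp
 hence "n <= j * m" using m(1) unfolding power2_eq_square by linarith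
 hence "clm n m j = n" by (simp add: clm_def)
 thus False using q clm_le[of n m "Suc j"] by simp
 qed
 have "H (d + int (clm n m j) + int (q - clm n m j)) <= H (d + int (clm n m j) + int (q' - clm n m j))"
 by (rule sorted_arrD[OF col[OF j]]) (use q in auto)
 thus "f q <= f q'" using q by (simp add: f_def of_nat_diff)
 qed
 interpret bucketing p f n m by (rule b)
 have bsz: "start (Suc i) - start i = card (bucket i)" if "i < m" for i
 using start_Suc[OF that] card_bucket[of i] by simp
 have sum_start: "(\<Sum>i<k. start (Suc i) - start i) = start k" if "k <= m" for k
 using that
 proof (induction k)
 case (Suc k)
 thus ?case using start_mono[of k "Suc k"] by simp
 qed simp
 \<comment> \<open>The lowest bucket contains the minimum, every other one its own lower
   pivot.\<close>
 have ne: "1 <= start (Suc i) - start i" if i: "i < m" for i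
 proof -
 have "EX v. v \<in> bucket i"
 proof (cases "i = 0")
 case True
 let ?mn = "Min (f ` {..<n})"
 have "0 \<in> {..<n}" using m by simp
 hence fin: "finite (f ` {..<n})" "f ` {..<n} ~= {}" by blast+
 have "?mn \<in> f ` {..<n}" by (rule Min_in[OF fin])
 moreover have "?mn < p 1" using mem[of 1] m Min_le[OF fin(1), of "p 1"] by (auto simp: less_le)
 ultimately show ?thesis using True p_low unfolding bucket_def by auto
 next
 case False
 thus ?thesis using mem[of i] lt[of i "Suc i"] i unfolding bucket_def by auto
 qed
 hence "bucket i ~= {}" by blast
 thus ?thesis unfolding bsz[OF i] by (simp add: Suc_le_eq card_gt_0_iff)
 qed
 \<comment> \<open>The other \<open>m - 1\<close> buckets hold at least one item each. This makes
   every bucket smaller than \<open>n\<close> and keeps the stack of its call within that of the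
   caller.\<close>
 have small: "(start (Suc i) - start i) + m <= n + 1" if i: "i < m" for i
 proof -
 have "(\<Sum>k\<in>{..<m} - {i}. 1) <= (\<Sum>k\<in>{..<m} - {i}. start (Suc k) - start k)" by (rule sum_mono) (use ne in auto)
 hence "m - 1 <= (\<Sum>k\<in>{..<m} - {i}. start (Suc k) - start k)" using i by simp
 moreover have "(\<Sum>k<m. start (Suc k) - start k) = (start (Suc i) - start i) + (\<Sum>k\<in>{..<m} - {i}. start (Suc k) - start k)"
 by (rule sum.remove) (use i in auto)
 ultimately show ?thesis using sum_start[of m] m by simp
 qed
 have f1: "{s..s + 14} <= ?U" "{a..a + int n} <= ?U" "{d..d + int n} <= ?U" unfolding sort_space_def by auto
 have f2: "{s..s + 15 + 11 * int n} <= ?U" unfolding sort_space_def by auto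
 have m4: "4 * int m <= int n + 3" using m(3) by linarith
 have f3: "{x..y} <= ?U" if "s <= x" "y <= s + 15 + 11 * int n" for x y
 proof -
 have "{x..y} <= {s..s + 15 + 11 * int n}" using that by auto
 thus ?thesis using f2 by blast
 qed
 have st1: "aq ?U (50 + 40 * real m + 6 * (real m)^2 / B) ?fr BucketStarts H bs (%H' sp'. sp' = bs + int m + 1 &
 H' (s + 11) = Fin bs & (ALL i<=m. H' (bs + int i) = Fin (int (start i))) &
 (ALL z<bs. z ~: {s + 4, s + 5, s + 7, s + 8, s + 11} --> H' z = H z))"
 proof (rule BucketStarts_aq[OF b, where d = d and pv = pv])
 show "{pv..pv + int m} <= ?U" "{bs..bs + int m + 1} <= ?U" by (rule f3; use pv m4 m(2) in \<open>simp add: bs_def\<close>)+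
 qed (use v ad pv f1 in \<open>auto simp: f_def p_def bs_def\<close>)
 define Q2 where "Q2 H' sp' \<longleftrightarrow> sp' = Ca + 3 * int m &
 (ALL i<m. H' ` {a + int (start i)..<a + int (start (Suc i))} = bucket i & inj_on H' {a + int (start i)..<a + int (start (Suc i))}) &
 H' s = Fin a & H' (s + 1) = Fin d & H' (s + 3) = Fin (int m) & H' (s + 11) = Fin bs &
 (ALL i<=m. H' (bs + int i) = Fin (int (start i))) & (ALL z<s. z ~: {a..<a + int n} --> H' z = H z)" for H' sp'
 have st2: "aq ?U (60 + 20 * real m + 960 * (real m)^2 / B + 4 * real n / B) ?fr MoveToBuckets H1 sp1 Q2"
 if h: "sp1 = bs + int m + 1 & H1 (s + 11) = Fin bs & (ALL i<=m. H1 (bs + int i) = Fin (int (start i))) &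
 (ALL z<bs. z ~: {s + 4, s + 5, s + 7, s + 8, s + 11} --> H1 z = H z)" for H1 sp1
 proof -
 have un: "H1 z = H z" if "z < bs" "z ~: {s + 4, s + 5, s + 7, s + 8, s + 11}" for z using h that by blast
 have st: "H1 (bs + int i) = Fin (int (start i))" if "i <= m" for i using h that by blast
 have v1: "H1 s = Fin a" "H1 (s + 1) = Fin d" "H1 (s + 2) = Fin (int n)" "H1 (s + 3) = Fin (int m)" "H1 (s + 10) = Fin pv" "H1 (s + 11) = Fin bs"
 using v un[of s] un[of "s + 1"] un[of "s + 2"] un[of "s + 3"] un[of "s + 10"] h pv by (auto simp: bs_def)
 have sp: "sp1 = Ca" using h by (simp add: Ca_def)
 have "aq ?U (60 + 20 * real m + 960 * (real m)^2 / B + 4 * real n / B) ?fr MoveToBuckets H1 Ca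
 (%H' sp'. sp' = Ca + 3 * int m &
 (ALL i<m. H' ` {a + int (start i)..<a + int (start (Suc i))} = bucket i & inj_on H' {a + int (start i)..<a + int (start (Suc i))}) &
 (ALL z<Ca. z ~: {a..<a + int n} --> z ~: {s + 4, s + 12, s + 13, s + 14} --> H' z = H1 z))"
 proof (rule MoveToBuckets_aq[OF b, where a = a and d = d and pv = pv and bs = bs])
 show "{pv..Ca + 13 * int m + 10} <= ?U" by (rule f3) (use pv m4 m(2) in \<open>simp_all add: bs_def Ca_def\<close>)
 show "H1 (d + int q) = f q" if "q < n" for q using un[of "d + int q"] that ad pv by (simp add: f_def bs_def)
 show "H1 (pv + int i) = p i" if "i <= m" for i using un[of "pv + int i"] that pv by (simp add: p_def bs_def)
 show "Ca = bs + int m + 1" by (rule Ca_def)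
 qed (use v1 ad pv f1 st in \<open>auto simp: bs_def\<close>)
 thus ?thesis unfolding sp
 proof (rule aq_mono)
 fix H' sp' assume g: "sp' = Ca + 3 * int m &
 (ALL i<m. H' ` {a + int (start i)..<a + int (start (Suc i))} = bucket i & inj_on H' {a + int (start i)..<a + int (start (Suc i))}) &
 (ALL z<Ca. z ~: {a..<a + int n} --> z ~: {s + 4, s + 12, s + 13, s + 14} --> H' z = H1 z)"
 have un': "H' z = H1 z" if "z < Ca" "z ~: {a..<a + int n}" "z ~: {s + 4, s + 12, s + 13, s + 14}" for z using g that by blast
 have c: "H' s = Fin a" "H' (s + 1) = Fin d" "H' (s + 3) = Fin (int m)" "H' (s + 11) = Fin bs"
 using v1 un'[of s] un'[of "s + 1"] un'[of "s + 3"] un'[of "s + 11"] ad pv by (auto simp: bs_def Ca_def)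
 have c2: "H' (bs + int i) = Fin (int (start i))" if "i <= m" for i
 using un'[of "bs + int i"] st[OF that] that ad pv by (simp add: bs_def Ca_def)
 have c3: "H' z = H z" if "z < s" "z ~: {a..<a + int n}" for z
 using un'[of z] un[of z] that pv by (simp add: bs_def Ca_def)
 show "Q2 H' sp'" unfolding Q2_def using g c c2 c3 by blast
 qed auto
 qed
 let ?T = "(\<Sum>i<m. 24 + sort_cost (start (Suc i) - start i)) + 8"
 let ?final = "%H' sp'. sorted (arr H' d n) & set (arr H' d n) = H ` {d..<d + int n} &
 (ALL z<s. z ~: {a..<a + int n} --> z ~: {d..<d + int n} --> H' z = H z)"
 have st3: "ew ?fr SortBuckets H2 sp2 (pc ?U ?final (%_. 0)) <= ?T" if Q: "Q2 H2 sp2" for H2 sp2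
 proof -
 have sp2: "sp2 = Ca + 3 * int m" using Q unfolding Q2_def by blast
 have bu: "H2 ` {a + int (start i)..<a + int (start (Suc i))} = bucket i" "inj_on H2 {a + int (start i)..<a + int (start (Suc i))}" if "i < m" for i
 using Q that unfolding Q2_def by blast+
 have low: "H2 z = H z" if "z < s" "z ~: {a..<a + int n}" for z using Q that unfolding Q2_def by blast
 have "ew ?fr SortBuckets H2 sp2 (pc ?U (%H' sp'. sorted (arr H' d n) & set (arr H' d n) = f ` {..<n} &
 (ALL z<sp2. z ~: {s + 4, s + 7, s + 8} --> z ~: {a..<a + int n} --> z ~: {d..<d + int n} --> H' z = H2 z)) (%_. 0)) <= ?T"
 proof (rule SortBuckets_ew[OF b, where a = a and d = d and bs = bs])
 show "{bs..bs + int m} <= ?U" by (rule f3) (use pv m4 m(2) in \<open>simp_all add: bs_def\<close>)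
 show "f ` {..<n} <= range Fin" using Fn unfolding X .
 fix i assume i: "i < m"
 have le: "start i <= start (Suc i)" "start (Suc i) <= n" using start_mono[of i "Suc i"] start_le[of "Suc i"] i by auto
 have "int (start (Suc i) - start i) + int m <= int n + 1" using small[OF i] by linarith
 \<comment> \<open>As \<open>sp2\<close> is \<open>s + 17 + 5 * m\<close>, the claim reduces to
   \<open>28 \<le> 6 * m\<close>, which follows from \<open>5 \<le> m\<close>.\<close>
 hence "sp2 + 15 + 11 * int (start (Suc i) - start i) <= s + 15 + 11 * int n" using m(2) pv by (simp add: sp2 Ca_def bs_def)
 hence "{sp2..sp2 + 15 + 11 * int (start (Suc i) - start i)} <= ?U" by (intro f3) (use pv in \<open>simp_all add: sp2 Ca_def bs_def\<close>)
 moreover have "{a + int (start i)..a + int (start i) + int (start (Suc i) - start i)} <= {a..a + int n}"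
 "{d + int (start i)..d + int (start i) + int (start (Suc i) - start i)} <= {d..d + int n}" using le by auto
 ultimately show "sort_space (a + int (start i)) (d + int (start i)) sp2 (start (Suc i) - start i) <= ?U"
 unfolding sort_space_def[of "a + int (start i)"] using f1 by blast
 qed (use Q ad pv bu f1 in \<open>auto simp: Q2_def bs_def Ca_def\<close>)
 thus ?thesis
 proof (rule ew_pc_mono, goal_cases)
 case (2 H' sp')
 have "H' z = H z" if "z < s" "z ~: {a..<a + int n}" "z ~: {d..<d + int n}" for z
 proof -
 have "z < sp2" using that pv by (simp add: sp2 Ca_def bs_def)
 hence "H' z = H2 z" using 2 that by auto
 thus ?thesis using low that by simp
 qed
 thus ?case using 2 unfolding X by blast
 qed auto
 qed
 have full: "ew ?fr (BucketStarts;; MoveToBuckets;; SortBuckets) H bs (pc ?U ?final (%_. 0)) <=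
 ennreal (50 + 40 * real m + 6 * (real m)^2 / B + (60 + 20 * real m + 960 * (real m)^2 / B + 4 * real n / B)) + ?T"
 by (rule ew_Seq_aq[OF aq_Seq[OF st1 st2] st3])
 have "?T <= (\<Sum>i<m. ennreal (24 + (A1 * real (start (Suc i) - start i) + A2 * (real (start (Suc i) - start i))^2 + A3))) + 8"
 proof (intro add_right_mono sum_mono)
 fix i assume "i \<in> {..<m}"
 hence "start (Suc i) - start i < n" using small[of i] m by auto
 from IH[OF this] have "24 + sort_cost (start (Suc i) - start i) <= ennreal 24 + ennreal (A1 * real (start (Suc i) - start i) + A2 * (real (start (Suc i) - start i))^2 + A3)"
 by (simp add: add_left_mono)
 also have "... = ennreal (24 + (A1 * real (start (Suc i) - start i) + A2 * (real (start (Suc i) - start i))^2 + A3))"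
 using A by (intro ennreal_plus[symmetric]) auto
 finally show "24 + sort_cost (start (Suc i) - start i) <= ennreal (24 + (A1 * real (start (Suc i) - start i) + A2 * (real (start (Suc i) - start i))^2 + A3))" .
 qed
 also have "... = ennreal (\<Sum>i<m. 24 + (A1 * real (start (Suc i) - start i) + A2 * (real (start (Suc i) - start i))^2 + A3)) + ennreal 8"
 using A by (subst sum_ennreal) auto
 also have "(\<Sum>i<m. 24 + (A1 * real (start (Suc i) - start i) + A2 * (real (start (Suc i) - start i))^2 + A3)) =
 24 * real m + A1 * real n + A2 * real (bucket_squares (H ` {d..<d + int n}) (%i. H (pv + int i)) m) + A3 * real m"
 proof -
 have s1: "(\<Sum>i<m. real (start (Suc i) - start i)) = real n"
 using sum_start[of m] by (simp flip: of_nat_sum)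
 have "bucket_squares (H ` {d..<d + int n}) (%i. H (pv + int i)) m = (\<Sum>i<m. (start (Suc i) - start i)^2)"
 unfolding bucket_squares_def X by (intro sum.cong) (auto simp: bsz bucket_def p_def)
 hence s2: "real (bucket_squares (H ` {d..<d + int n}) (%i. H (pv + int i)) m) = (\<Sum>i<m. (real (start (Suc i) - start i))^2)" by simp
 have "(\<Sum>i<m. 24 + (A1 * real (start (Suc i) - start i) + A2 * (real (start (Suc i) - start i))^2 + A3)) =
 24 * real m + (A1 * (\<Sum>i<m. real (start (Suc i) - start i)) + A2 * (\<Sum>i<m. (real (start (Suc i) - start i))^2) + A3 * real m)"
 by (simp add: sum.distrib sum_distrib_left del: of_nat_diff)
 thus ?thesis unfolding s1 s2 by simp
 qed
 finally have T: "?T <= ennreal (24 * real m + A1 * real n + A2 * real (bucket_squares (H ` {d..<d + int n}) (%i. H (pv + int i)) m) + A3 * real m) + ennreal 8" .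
 have "ennreal (50 + 40 * real m + 6 * (real m)^2 / B + (60 + 20 * real m + 960 * (real m)^2 / B + 4 * real n / B)) + ?T <=
 ennreal (50 + 40 * real m + 6 * (real m)^2 / B + (60 + 20 * real m + 960 * (real m)^2 / B + 4 * real n / B)) +
 (ennreal (24 * real m + A1 * real n + A2 * real (bucket_squares (H ` {d..<d + int n}) (%i. H (pv + int i)) m) + A3 * real m) + ennreal 8)"
 by (rule add_left_mono[OF T])
 also have "... = ennreal ((50 + 40 * real m + 6 * (real m)^2 / B + (60 + 20 * real m + 960 * (real m)^2 / B + 4 * real n / B)) +
 ((24 * real m + A1 * real n + A2 * real (bucket_squares (H ` {d..<d + int n}) (%i. H (pv + int i)) m) + A3 * real m) + 8))"
 using A by (simp only: ennreal_plus[symmetric] add_nonneg_nonneg mult_nonneg_nonneg of_nat_0_le_iff zero_le_numeral divide_nonneg_nonneg zero_le_power2)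
 also have "... = ennreal (118 + 84 * real m + 966 * (real m)^2 / B + 4 * real n / B + A1 * real n + A3 * real m +
 A2 * real (bucket_squares (H ` {d..<d + int n}) (%i. H (pv + int i)) m))"
 by (rule arg_cong[where f = ennreal]) (simp add: add_divide_distrib[symmetric])
 finally show ?thesis using full unfolding bs_def by (rule order_trans[rotated])
qed

text \<open>Three intervals of at most two blocks each, with two IOs per block, and 4 for the
  guard.\<close>

lemma sort_cost_direct:
 assumes "n <= 16"
 shows "sort_cost n <= ennreal 16"
proof (rule sort_cost_leI)
 fix H a d s assume val: "valid_input n H a d s"
 let ?fr = "frame SquareSort_proc s" and ?H = "write_list H s [Fin a, Fin d, Fin (int n)]"
 let ?S = "{s..s + 14} Un {a..a + int n} Un {d..d + int n}"
 have ad: "a + int n <= s" "d + int n <= s" "{a..<a + int n} Int {d..<d + int n} = {}" using val by (auto simp: valid_input_def)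
 have U: "?S <= sort_space a d s n" unfolding sort_space_def by auto
 have eqa: "arr ?H a n = arr H a n" by (rule arr_cong) (use ad in auto)
 have D: "ae ?fr DirectSort ?H (s + 15) (%H' sp' t. sp' = s + 15 & arr H' d n = sort (arr ?H a n) &
 (ALL z. z ~: {s + 3..s + 14} --> z ~: {d..<d + int n} --> H' z = ?H z) & addrs t <= ?S)"
 by (rule DirectSort_ae) (use ad in auto)
 have c: "card (blocks B ?S) <= 6"
 proof -
 have "card (blocks B {s..s + 14}) <= 2" "card (blocks B {a..a + int n}) <= 2" "card (blocks B {d..d + int n}) <= 2"
 by (rule card_blocks_short; use B_large assms in simp)+
 thus ?thesis using card_blocks_Un[of B "{s..s + 14} Un {a..a + int n}" "{d..d + int n}"] card_blocks_Un[of B "{s..s + 14}" "{a..a + int n}"] by linarith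
 qed
 have "aq (sort_space a d s n) (2 * real 6) ?fr DirectSort ?H (s + 15) (%H' sp'. sort_post n H a d s H')"
 proof (rule aq_static[where S = ?S])
 show "ae ?fr DirectSort ?H (s + 15) (%H' sp' t. addrs t <= ?S & sort_post n H a d s H')"
 proof (rule ae_mono[OF D], elim conjE)
 fix H' sp' t assume h: "arr H' d n = sort (arr ?H a n)" "ALL z. z ~: {s + 3..s + 14} --> z ~: {d..<d + int n} --> H' z = ?H z" "addrs t <= ?S"
 have "H' z = H z" if "z < s" "z ~: {d..<d + int n}" for z using h(2) that by auto
 thus "addrs t <= ?S & sort_post n H a d s H'" unfolding sort_post_def using h(1,3) unfolding eqa by blast
 qed
 qed (use c U B_large K_ge_B in auto)
 hence "aq (sort_space a d s n) (4 + 2 * real 6) ?fr (body SquareSort_proc) ?H (s + 15) (%H' sp'. sort_post n H a d s H')"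
 unfolding SquareSort_proc_def proc.sel
 by (intro aq_Cond[where f = s and g = "s + 14"]) (use assms U B_large in \<open>auto simp: SquareSort_proc_def[symmetric]\<close>)
 from ew_of_aq[OF this] show "sort_run n H a d s <= ennreal 16" unfolding sort_run_def by simp
qed

text \<open>The columns remain a plain sum because their sizes are fixed. Only the bucket sizes are
  random, and for them the induction hypothesis has a shape whose sum over the buckets has a known
  bound in expectation: the squares contribute \<open>12 * A2 * n * m\<close>.\<close>

lemma sort_cost_rec:
 assumes n: "17 <= n" and m: "\<lceil>sqrt (real n)\<rceil> = int m" "(m - 1)^2 < n" "n <= m^2" "5 <= m" "4 * m <= n + 3"
 and A: "0 <= A1" "0 <= A2" "0 <= A3"
 and IH: "!!b. b < n ==> sort_cost b <= ennreal (A1 * real b + A2 * (real b)^2 + A3)"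
 shows "sort_cost n <= (\<Sum>j<m. sort_cost (clm n m (Suc j) - clm n m j)) +
 ennreal (A1 * real n + A3 * real m + 12 * A2 * real n * real m + 800 + 200 * real m + 6 * real n / B + 1300 * (real m)^2 / B)"
proof (rule sort_cost_leI)
 fix H a d s assume val: "valid_input n H a d s"
 let ?fr = "frame SquareSort_proc s" and ?U = "sort_space a d s n"
 let ?post = "%H' sp'. sort_post n H a d s H'"
 define Hb where "Hb = write_list H s [Fin a, Fin d, Fin (int n)]"
 define Hc where "Hc = Hb(s + 3 := Fin (int m))"
 have ad: "a + int n <= s" "d + int n <= s" "{a..<a + int n} Int {d..<d + int n} = {}" using val by (auto simp: valid_input_def)
 have bv: "Hb s = Fin a" "Hb (s + 1) = Fin d" "Hb (s + 2) = Fin (int n)" by (simp_all add: Hb_def)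
 have cv: "Hc s = Fin a" "Hc (s + 1) = Fin d" "Hc (s + 2) = Fin (int n)" "Hc (s + 3) = Fin (int m)" using bv by (simp_all add: Hc_def)
 have clow: "Hc z = H z" if "z < s" for z using that by (simp add: Hc_def Hb_def)
 have valc: "valid_input n Hc a d s" using valid_input_segment[OF val, of 0 n s Hc] clow ad by simp
 have m4: "4 * int m <= int n + 3" using m(5) by linarith
 have f1: "{s..s + 14} <= ?U" "{a..a + int n} <= ?U" "{d..d + int n} <= ?U" unfolding sort_space_def by auto
 have f3: "{x..y} <= ?U" if "s <= x" "y <= s + 15 + 11 * int n" for x y unfolding sort_space_def using that by auto
 let ?cm = "''m'' ::= CeilSqrt (V ''n'')" and ?rest = "BucketStarts;; MoveToBuckets;; SortBuckets"
 let ?S = "\<Sum>j<m. 24 + sort_cost (clm n m (Suc j) - clm n m j)"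
 have E0: "aq ?U (4 + 2 * real (length ([]::addr list))) ?fr ?cm Hb (s + 15) (%H' sp'. sp' = s + 15 & H' = Hc)"
 by (rule aq_frame[where s = s]) (use bv m(1) f1 in \<open>auto simp: ae_simps Hc_def\<close>)
 define Q1 where "Q1 H1 sp1 \<longleftrightarrow> sp1 = s + 15 & mset (arr H1 d n) = mset (arr Hc a n) &
 (ALL j<m. sorted (arr H1 (d + int (clm n m j)) (clm n m (Suc j) - clm n m j))) &
 (ALL z<s + 15. z ~: {s + 4, s + 7, s + 8} --> z ~: {a..<a + int n} --> z ~: {d..<d + int n} --> H1 z = Hc z)" for H1 sp1
 have E1: "ew ?fr SortColumns Hc (s + 15) (pc ?U Q1 (%_. 0)) <= ?S + 8"
 unfolding Q1_def
 proof (rule SortColumns_ew[OF cv valc])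
 show "n <= m * m" using m(3) by (simp add: power2_eq_square)
 fix j assume j: "j < m"
 have le: "clm n m j <= clm n m (Suc j)" "clm n m (Suc j) <= n" "clm n m (Suc j) - clm n m j <= m"
 by (auto intro: clm_mono clm_le clm_Suc_diff)
 have "{s + 15..s + 15 + 15 + 11 * int (clm n m (Suc j) - clm n m j)} <= ?U"
 by (rule f3) (use le(3) m4 m(4) in auto)
 moreover have "{a + int (clm n m j)..a + int (clm n m j) + int (clm n m (Suc j) - clm n m j)} <= {a..a + int n}"
 "{d + int (clm n m j)..d + int (clm n m j) + int (clm n m (Suc j) - clm n m j)} <= {d..d + int n}" using le by auto
 ultimately show "sort_space (a + int (clm n m j)) (d + int (clm n m j)) (s + 15) (clm n m (Suc j) - clm n m j) <= ?U"
 unfolding sort_space_def[of "a + int (clm n m j)"] using f1 by blast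
 qed (rule f1)
 \<comment> \<open>\<open>k0\<close> is the cost after pivot selection without the squares,
   \<open>k1\<close> the cost of pivot selection with the expected squares included.\<close>
 define k0 where "k0 = 118 + 84 * real m + 966 * (real m)^2 / B + 4 * real n / B + A1 * real n + A3 * real m"
 define k1 where "k1 = 600 + 2 * real n / B + 40 * real m + 300 * (real m)^2 / B + 12 * A2 * real n * real m"
 have k0: "0 <= k0" "0 <= k1" unfolding k0_def k1_def using A by simp_all
 have E2: "ew ?fr (ChoosePivots;; ?rest) H1 sp1 (pc ?U ?post (%_. 0)) <= ennreal k0 + ennreal k1" if Q: "Q1 H1 sp1" for H1 sp1
 proof -
 define X where "X = H1 ` {d..<d + int n}"
 have un: "H1 z = Hc z" if "z < s + 15" "z ~: {s + 4, s + 7, s + 8}" "z ~: {a..<a + int n}" "z ~: {d..<d + int n}" for z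
 using Q that unfolding Q1_def by blast
 have v1: "H1 s = Fin a" "H1 (s + 1) = Fin d" "H1 (s + 2) = Fin (int n)" "H1 (s + 3) = Fin (int m)"
 using un[of s] un[of "s + 1"] un[of "s + 2"] un[of "s + 3"] cv ad by auto
 have ms: "mset (arr H1 d n) = mset (arr H a n)"
 proof -
 have "arr Hc a n = arr H a n" by (rule arr_cong) (use clow ad in auto)
 thus ?thesis using Q unfolding Q1_def by simp
 qed
 have Xa: "X = set (arr H a n)" using mset_eq_setD[OF ms] by (simp add: X_def set_arr)
 have da: "distinct (arr H a n)" using val unfolding inj_on_arr[symmetric] valid_input_def by blast
 have inj1: "inj_on H1 {d..<d + int n}" unfolding inj_on_arr using mset_eq_imp_distinct_iff[OF ms] da by blast
 have XF: "X <= range Fin" using val unfolding Xa set_arr valid_input_def by blast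
 have sp1: "sp1 = s + 15" using Q by (simp add: Q1_def)
 let ?Q2 = "%H' sp'. sp' = s + 15 + int m + 1 & H' (s + 10) = Fin (s + 15) & good_pivots X (s + 15) m H' &
 (ALL z<s + 15. z ~: {s + 4, s + 5, s + 6, s + 9, s + 10} --> H' z = H1 z)"
 \<comment> \<open>The part of the later cost that depends on the random pivots is charged to the
   pivot phase, where its expectation is taken.\<close>
 let ?F = "%H'. ennreal (A2 * real (bucket_squares X (%i. H' (s + 15 + int i)) m))"
 have P: "ew ?fr ChoosePivots H1 (s + 15) (pc ?U ?Q2 ?F) <= ennreal k1"
 unfolding X_def k1_def
 proof (rule ChoosePivots_ew)
 show "H1 ` {d..<d + int n} <= range Fin" using XF unfolding X_def .
 show "{s + 15..s + 15 + 12 * int m + 20} <= ?U" by (rule f3) (use m4 m(4) in auto)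
 show "inj_on H1 {d..<d + int n}" by (rule inj1)
 qed (use v1 n m(2,3) ad(2) f1 A in simp_all)
 have R: "ew ?fr ?rest H2 sp2 (pc ?U ?post (%_. 0)) <= ennreal k0 + ?F H2" if Q2: "?Q2 H2 sp2" for H2 sp2
 proof -
 have un2: "H2 z = H1 z" if "z < s + 15" "z ~: {s + 4, s + 5, s + 6, s + 9, s + 10}" for z using Q2 that by blast
 have D2: "H2 z = H1 z" if "z \<in> {d..<d + int n}" for z by (rule un2) (use that ad in auto)
 have X2: "H2 ` {d..<d + int n} = X" unfolding X_def by (rule image_cong[OF refl D2])
 have inj2: "inj_on H2 {d..<d + int n}" using inj1 D2 inj_on_cong[of "{d..<d + int n}" H2 H1] by blast
 have "ew ?fr ?rest H2 (s + 15 + int m + 1) (pc ?U (%H' sp'. sorted (arr H' d n) & set (arr H' d n) = H2 ` {d..<d + int n} &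
 (ALL z<s. z ~: {a..<a + int n} --> z ~: {d..<d + int n} --> H' z = H2 z)) (%_. 0))
 <= ennreal (118 + 84 * real m + 966 * (real m)^2 / B + 4 * real n / B + A1 * real n + A3 * real m +
 A2 * real (bucket_squares (H2 ` {d..<d + int n}) (%i. H2 (s + 15 + int i)) m))"
 proof (rule sort_after_pivots_ew)
 show "H2 ` {d..<d + int n} <= range Fin" unfolding X2 by (rule XF)
 show "good_pivots (H2 ` {d..<d + int n}) (s + 15) m H2" unfolding X2 using Q2 by blast
 show "H2 (s + 10) = Fin (s + 15)" using Q2 by blast
 show "sort_cost b <= ennreal (A1 * real b + A2 * (real b)^2 + A3)" if "b < n" for b by (rule IH[OF that])
 show "inj_on H2 {d..<d + int n}" by (rule inj2)
 show "{a..<a + int n} Int {d..<d + int n} = {}" by (rule ad(3))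
 fix j assume j: "j < m"
 have le: "clm n m j <= clm n m (Suc j)" "clm n m (Suc j) <= n" by (auto intro: clm_mono clm_le)
 have "arr H2 (d + int (clm n m j)) (clm n m (Suc j) - clm n m j) = arr H1 (d + int (clm n m j)) (clm n m (Suc j) - clm n m j)"
 by (rule arr_cong, rule D2) (use le in auto)
 thus "sorted (arr H2 (d + int (clm n m j)) (clm n m (Suc j) - clm n m j))" using Q j unfolding Q1_def by simp
 qed (use v1 un2[of s] un2[of "s + 1"] un2[of "s + 2"] un2[of "s + 3"] ad(1,2) m(3-5) A in auto)
 also have "... = ennreal k0 + ?F H2" unfolding X2 k0_def[symmetric] using k0 A by (intro ennreal_plus) auto
 finally have main: "ew ?fr ?rest H2 (s + 15 + int m + 1) (pc ?U (%H' sp'. sorted (arr H' d n) & set (arr H' d n) = H2 ` {d..<d + int n} &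
 (ALL z<s. z ~: {a..<a + int n} --> z ~: {d..<d + int n} --> H' z = H2 z)) (%_. 0)) <= ennreal k0 + ?F H2" .
 have sp2: "sp2 = s + 15 + int m + 1" using Q2 by blast
 show ?thesis unfolding sp2 using main
 proof (rule ew_pc_mono, goal_cases)
 case (2 H' sp')
 have se: "set (arr H' d n) = set (arr H a n)" using 2 unfolding X2 Xa by blast
 \<comment> \<open>\<open>n\<close> cells with \<open>n\<close> different values cannot repeat one,
   so sortedness and the set of values determine the array.\<close>
 have "card (set (arr H' d n)) = n" unfolding se using distinct_card[OF da] by simp
 hence "distinct (arr H' d n)" by (intro card_distinct) simp
 hence "arr H' d n = sort (arr H a n)" using 2 se da by (intro sorted_distinct_set_unique) auto
 moreover have "H' z = H z" if z: "z < s" "z ~: {a..<a + int n}" "z ~: {d..<d + int n}" for z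
 proof -
 have "H' z = H2 z" using 2 z by blast
 also have "... = H1 z" by (rule un2) (use z in auto)
 also have "... = Hc z" by (rule un) (use z in auto)
 also have "... = H z" by (rule clow[OF z(1)])
 finally show ?thesis .
 qed
 ultimately show ?case unfolding sort_post_def by blast
 qed auto
 qed
 have "ew ?fr ChoosePivots H1 (s + 15) (pc ?U ?Q2 (%H'. ennreal k0 + ?F H')) <= ennreal k0 + ennreal k1"
 unfolding ew_pc_add_const by (rule add_left_mono[OF P])
 thus ?thesis unfolding sp1 by (rule ew_Seq_pc) (rule R)
 qed
 have full: "ew ?fr (?cm;; SortColumns;; (ChoosePivots;; ?rest)) Hb (s + 15) (pc ?U ?post (%_. 0)) <=
 (ennreal (4 + 2 * real (length ([]::addr list))) + (?S + 8)) + (ennreal k0 + ennreal k1)"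
 proof (rule ew_Seq_const)
 show "ew ?fr (?cm;; SortColumns) Hb (s + 15) (pc ?U Q1 (%_. 0)) <= ennreal (4 + 2 * real (length ([]::addr list))) + (?S + 8)"
 by (rule ew_Seq_aq[OF E0]) (use E1 in simp)
 qed (rule E2)
 let ?b = "V ''n'' \<prec> N 17"
 have cst4: "cst (bval_acc ?fr Hb ?b) <= 4" "addrs (bval_acc ?fr Hb ?b) <= ?U"
 using cst_local[of "bval_acc ?fr Hb ?b" s "s + 14"] B_large f1 by auto
 have "sort_run n H a d s = ew ?fr (?cm;; SortColumns;; (ChoosePivots;; ?rest)) Hb (s + 15) (%H' sp' t. pc ?U ?post (%_. 0) H' sp' (bval_acc ?fr Hb ?b @ t))"
 proof -
 have "~ bval ?fr Hb ?b" using bv n by simp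
 hence "sort_run n H a d s = ew ?fr (?cm;; SortColumns;; ChoosePivots;; BucketStarts;; MoveToBuckets;; SortBuckets) Hb (s + 15)
 (%H' sp' t. pc ?U ?post (%_. 0) H' sp' (bval_acc ?fr Hb ?b @ t))"
 unfolding sort_run_def Hb_def[symmetric] by (subst (2) SquareSort_proc_def) (simp add: ew_Cond)
 thus ?thesis by (simp only: ew_Seq append_assoc)
 qed
 also have "... <= of_nat (cst (bval_acc ?fr Hb ?b)) + ((ennreal (4 + 2 * real (length ([]::addr list))) + (?S + 8)) + (ennreal k0 + ennreal k1))"
 by (rule ew_prefix_pc[OF cst4(2) full])
 also have "... <= of_nat 4 + ((ennreal (4 + 2 * real (length ([]::addr list))) + (?S + 8)) + (ennreal k0 + ennreal k1))"
 by (intro add_right_mono of_nat_mono cst4(1))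
 also have "... = (\<Sum>j<m. sort_cost (clm n m (Suc j) - clm n m j)) + ennreal (16 + 24 * real m + k0 + k1)"
 proof -
 have S: "?S = ennreal (24 * real m) + (\<Sum>j<m. sort_cost (clm n m (Suc j) - clm n m j))"
 proof -
 have "ennreal (24 * real m) = ennreal 24 * ennreal (real m)" by (rule ennreal_mult) simp_all
 also have "... = (\<Sum>j<m. 24)" by (simp add: mult.commute flip: ennreal_of_nat_eq_real_of_nat)
 finally show ?thesis by (simp only: sum.distrib)
 qed
 have P: "ennreal (16 + 24 * real m + k0 + k1) = ennreal 16 + ennreal (24 * real m) + ennreal k0 + ennreal k1"
 using k0 by (simp only: ennreal_plus add_nonneg_nonneg mult_nonneg_nonneg of_nat_0_le_iff zero_le_numeral)
 have c: "of_nat 4 + ennreal (4 + 2 * real (length ([]::addr list))) + 8 = ennreal 16" by simp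
 have rearrange: "a + ((b + ((x + y) + e)) + (k + k')) = y + (z + x + k + k')" if "a + b + e = z" for a b e k k' x y z :: ennreal
 unfolding that[symmetric] by (simp only: add_ac)
 show ?thesis unfolding S P by (rule rearrange[OF c])
 qed
 also have "... <= (\<Sum>j<m. sort_cost (clm n m (Suc j) - clm n m j)) + ennreal (A1 * real n + A3 * real m + 12 * A2 * real n * real m + 800 + 200 * real m + 6 * real n / B + 1300 * (real m)^2 / B)"
 proof (intro add_left_mono ennreal_leI)
 have n6: "2 * real n / B + 4 * real n / B = 6 * real n / B" "0 <= real m" by (simp_all add: add_divide_distrib[symmetric])
 have u3: "966 * (real m)^2 / B + 300 * (real m)^2 / B <= 1300 * (real m)^2 / B"
 unfolding add_divide_distrib[symmetric] by (intro divide_right_mono) auto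
 have gen: "16 + 24 * r + (118 + 84 * r + u + v + a1 + a3) + (600 + v' + 40 * r + u' + a2) <= a1 + a3 + a2 + 800 + 200 * r + v'' + u''"
 if "0 <= r" "u + u' <= u''" "v' + v = v''" for r u u' u'' v v' v'' a1 a2 a3 :: real using that by linarith
 show "16 + 24 * real m + k0 + k1 <= A1 * real n + A3 * real m + 12 * A2 * real n * real m + 800 + 200 * real m + 6 * real n / B + 1300 * (real m)^2 / B"
 unfolding k0_def k1_def by (rule gen[OF n6(2) u3 n6(1)])
 qed
 finally show "sort_run n H a d s <= (\<Sum>j<m. sort_cost (clm n m (Suc j) - clm n m j)) +
 ennreal (A1 * real n + A3 * real m + 12 * A2 * real n * real m + 800 + 200 * real m + 6 * real n / B + 1300 * (real m)^2 / B)" .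
qed

end

section \<open>Solving the recurrence\<close>

context cache
begin

text \<open>With \<open>A1 = A2 = 0\<close> and \<open>A3\<close> the sum of all smaller costs the
  recurrence yields nothing but finiteness. That is already enough for termination and for the space
  bound of every run.\<close>

lemma sort_cost_finite: "sort_cost n < \<top>"
proof (induction n rule: less_induct)
 case (less n)
 show ?case
 proof (cases "n <= 16")
 case True
 thus ?thesis using sort_cost_direct[OF True] by (rule_tac le_less_trans) auto
 next
 case False
 hence n: "17 <= n" by simp
 obtain m where m: "\<lceil>sqrt (real n)\<rceil> = int m" "(m - 1)^2 < n" "n <= m^2" "5 <= m" "4 * m <= n + 3"
 using ceil_sqrt_bounds[OF n] .
 define A3 where "A3 = (\<Sum>b<n. enn2real (sort_cost b))"
 have IH: "sort_cost b <= ennreal (0 * real b + 0 * (real b)^2 + A3)" if b: "b < n" for b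
 proof -
 have "sort_cost b = ennreal (enn2real (sort_cost b))" using less[OF b] by simp
 also have "... <= ennreal A3" unfolding A3_def by (intro ennreal_leI member_le_sum) (use b in auto)
 finally show ?thesis by simp
 qed
 have A3: "0 <= A3" unfolding A3_def by (intro sum_nonneg) simp
 have "(\<Sum>j<m. sort_cost (clm n m (Suc j) - clm n m j)) < \<top>"
 proof -
 have "sort_cost (clm n m (Suc j) - clm n m j) < \<top>" for j
 by (rule less) (use clm_Suc_diff[of n m j] m n in linarith)
 thus ?thesis by (simp add: ennreal_sum_less_top)
 qed
 thus ?thesis using sort_cost_rec[OF n m order_refl order_refl A3 IH] by (rule_tac le_less_trans) auto
 qed
qed

lemma card_blocks_le:
 assumes "0 <= k"
 shows "real (card (blocks B {x..x + k})) <= real_of_int k / B + 2"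
proof -
 have "int (card (blocks B {x..x + k})) <= k div int B + 2"
 using card_blocks_interval[of B x "x + k"] B_large assms by simp
 hence "real_of_int (int (card (blocks B {x..x + k}))) <= real_of_int (k div int B + 2)" by (simp only: of_int_le_iff)
 moreover have "real_of_int (k div int B) <= real_of_int k / real_of_int (int B)" by (rule real_of_int_div4)
 ultimately show ?thesis by simp
qed

text \<open>Finiteness of the cost confines every run to \<open>sort_space\<close>, about
  \<open>13 * n\<close> cells. Once their blocks fit, each of them is loaded and evicted once,
  whatever the order of the accesses.\<close>

lemma sort_cost_fits:
 assumes "13 * real n / B + 8 <= real K"
 shows "sort_cost n <= ennreal (26 * real n / B + 14)"
proof (rule sort_cost_leI)
 fix H a d s assume val: "valid_input n H a d s"
 let ?U = "sort_space a d s n"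
 have "real (card (blocks B ?U)) <= 13 * real n / B + 7"
 proof -
 have "card (blocks B ?U) <= card (blocks B {a..a + int n}) + card (blocks B {d..d + int n}) + card (blocks B {s..s + (15 + 11 * int n)})"
 unfolding sort_space_def
 using card_blocks_Un[of B "{a..a + int n} Un {d..d + int n}" "{s..s + 15 + 11 * int n}"] card_blocks_Un[of B "{a..a + int n}" "{d..d + int n}"]
 by (simp add: add.assoc)
 hence "real (card (blocks B ?U)) <= real (card (blocks B {a..a + int n})) + real (card (blocks B {d..d + int n})) + real (card (blocks B {s..s + (15 + 11 * int n)}))"
 by linarith
 moreover have "real_of_int (15 + 11 * int n) / B = 15 / B + 11 * real n / B" by (simp add: add_divide_distrib)
 moreover have "15 / real B <= 1" using B_large by simp
 moreover have "real_of_int (int n) / B + real_of_int (int n) / B + 11 * real n / B = 13 * real n / B" by (simp add: add_divide_distrib[symmetric])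
 ultimately show ?thesis
 using card_blocks_le[of "int n" a] card_blocks_le[of "int n" d] card_blocks_le[of "15 + 11 * int n" s] by linarith
 qed
 hence c: "card (blocks B ?U) <= K" "2 * real (card (blocks B ?U)) <= 26 * real n / B + 14" using assms by linarith+
 have fin: "finite ?U" unfolding sort_space_def by simp
 have "sort_run n H a d s < \<top>" using sort_run_le[OF val] sort_cost_finite by (rule le_less_trans)
 hence "ae (frame SquareSort_proc s) (body SquareSort_proc) (write_list H s [Fin a, Fin d, Fin (int n)]) (s + 15)
 (%H' sp' t. addrs t <= ?U & sort_post n H a d s H')"
 unfolding sort_run_def by (rule ae_of_ew) (simp add: pc_def)
 thus "sort_run n H a d s <= ennreal (26 * real n / B + 14)"
 unfolding sort_run_def
 proof (rule ew_ae_le)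
 fix H' sp' t assume h: "addrs t <= ?U & sort_post n H a d s H'"
 have "cst t <= 2 * card (blocks B ?U)" by (rule cst_static) (use h fin c in auto)
 hence "real (cst t) <= 26 * real n / B + 14" using c(2) by linarith
 hence "of_nat (cst t) <= ennreal (26 * real n / B + 14)" unfolding ennreal_of_nat_eq_real_of_nat by (rule ennreal_leI)
 thus "pc ?U (%H' sp'. sort_post n H a d s H') (%_. 0) H' sp' t <= ennreal (26 * real n / B + 14)"
 unfolding pc_def using h by simp
 qed
qed

lemma sum_columns_le:
 assumes "n <= m * m" "0 <= k" "0 <= e"
 and "!!j. j < m ==> sort_cost (clm n m (Suc j) - clm n m j) <= ennreal (k * real (clm n m (Suc j) - clm n m j) + e)"
 shows "(\<Sum>j<m. sort_cost (clm n m (Suc j) - clm n m j)) <= ennreal (k * real n + e * real m)"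
proof -
 have "(\<Sum>j<m. sort_cost (clm n m (Suc j) - clm n m j)) <= (\<Sum>j<m. ennreal (k * real (clm n m (Suc j) - clm n m j) + e))"
 by (rule sum_mono) (use assms(4) in auto)
 also have "... = ennreal (\<Sum>j<m. k * real (clm n m (Suc j) - clm n m j) + e)" using assms by (intro sum_ennreal) auto
 also have "(\<Sum>j<m. k * real (clm n m (Suc j) - clm n m j) + e) = k * (\<Sum>j<m. real (clm n m (Suc j) - clm n m j)) + e * real m"
 by (simp add: sum.distrib sum_distrib_left mult.commute del: of_nat_diff)
 also have "(\<Sum>j<m. real (clm n m (Suc j) - clm n m j)) = real n"
 proof -
 have "(\<Sum>j<i. clm n m (Suc j) - clm n m j) = clm n m i" for i
 proof (induction i)
 case (Suc i)
 have "clm n m i <= clm n m (Suc i)" by (rule clm_mono) simp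
 thus ?case using Suc by simp
 qed (simp add: clm_def)
 hence "(\<Sum>j<m. clm n m (Suc j) - clm n m j) = n" using assms(1) by (simp add: clm_def)
 thus ?thesis by (simp flip: of_nat_sum)
 qed
 finally show ?thesis .
qed

text \<open>The logarithm has base \<open>exp l\<close>. The maximum with 1 makes the bound linear
  for inputs that fit, and 14 is the additive constant of those inputs.\<close>

definition log_bound :: "real => real => real" where
 "log_bound l b = 16000 * b / B * (2 * max (ln b / l) 1 - 1) + 14"

lemma log_bound_small:
 assumes "0 < l" "ln b <= l"
 shows "log_bound l b = 16000 * b / B + 14"
proof -
 have "ln b / l <= 1" using assms by simp
 thus ?thesis unfolding log_bound_def by (simp add: max_absorb2)
qed

text \<open>Let \<open>x\<close> be the logarithm of \<open>n\<close> to base \<open>L\<close>. In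
  units of \<open>16000 * n / B\<close>, two phases on sizes near \<open>sqrt n\<close> cost
  \<open>2 * (2 * (x / 2) - 1) = 2 * x - 2\<close>, one unit below the allowed
  \<open>2 * x - 1\<close>, and this unit pays for all other work. The maximum with 1 spoils the
  calculation when \<open>x\<close> is close to 1, so that range is handled by comparison with
  inputs that fit.\<close>

lemma sort_cost_log:
 fixes L :: real
 assumes KL: "13 * L / B + 8 <= real K" and BL: "(real B)^2 / 28 <= L" and l: "1000 <= ln L" and Bb: "22400 <= real B"
 shows "sort_cost n <= ennreal (log_bound (ln L) (real n))"
proof (induction n rule: less_induct)
 case (less n)
 define l where "l = ln L"
 have l0: "1000 <= l" using l by (simp add: l_def)
 have B0: "0 < real B" using Bb by simp
 have "0 < (real B)^2 / 28" using B0 by simp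
 hence L0: "0 < L" using BL by linarith
 have fits: "sort_cost b <= ennreal (26 * real b / B + 14)" if "real b <= L" for b
 proof (rule sort_cost_fits)
 have "13 * real b / B <= 13 * L / B" using that by (intro divide_right_mono) auto
 thus "13 * real b / B + 8 <= real K" using KL by linarith
 qed
 show ?case
 proof (cases "real n <= L")
 case True
 have "ln (real n) <= l" if "0 < n" unfolding l_def using True that L0 by simp
 moreover have "ln (real 0) <= l" using l0 by simp
 ultimately have "ln (real n) <= l" by (cases "n = 0") auto
 hence "log_bound l (real n) = 16000 * real n / B + 14" using l0 by (intro log_bound_small) auto
 moreover have "26 * real n / B <= 16000 * real n / B" by (intro divide_right_mono) auto
 ultimately have "26 * real n / B + 14 <= log_bound l (real n)" by linarith
 thus ?thesis using fits[OF True] unfolding l_def by (meson ennreal_leI order_trans)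
 next
 case False
 hence nL: "L < real n" by simp
 have sq: "22400 * real B <= (real B)^2" using Bb by (simp add: power2_eq_square)
 have nB: "800 <= real n / B"
 proof -
 have "800 * real B <= (real B)^2 / 28" using sq by simp
 hence "800 * real B <= real n" using BL nL by linarith
 thus ?thesis using B0 by (simp add: le_divide_eq)
 qed
 have n17: "17 <= n"
 proof -
 have "800 * real B <= real n" using nB B0 by (simp add: le_divide_eq)
 hence "17 <= real n" using Bb by linarith
 thus ?thesis by linarith
 qed
 obtain m where m: "\<lceil>sqrt (real n)\<rceil> = int m" "(m - 1)^2 < n" "n <= m^2" "5 <= m" "4 * m <= n + 3"
 using ceil_sqrt_bounds[OF n17] .
 define w where "w = sqrt (real n)"
 have w2: "w * w = real n" by (simp add: w_def)
 have w4: "4 <= w" unfolding w_def by (rule real_le_rsqrt) (use n17 in auto)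
 have mw: "real m <= 5/4 * w" using m(1) w4 unfolding w_def by linarith
 \<comment> \<open>\<open>B^2 / 36 \<le> B^2 / 28 \<le> L < n\<close> gives
   \<open>B / 6 \<le> sqrt n\<close>.\<close>
 have wB: "w <= 6 * (real n / B)"
 proof -
 have "real B / 6 <= w" unfolding w_def
 proof (rule real_le_rsqrt)
 have "(real B / 6)^2 = (real B)^2 / 36" by (simp add: power_divide)
 also have "... <= (real B)^2 / 28" by (intro divide_left_mono) auto
 finally show "(real B / 6)^2 <= real n" using BL nL by linarith
 qed
 hence "real B / 6 * w <= w * w" using w4 by (intro mult_right_mono) auto
 thus ?thesis unfolding w2 using B0 by (simp add: field_simps)
 qed
 have mB: "real m <= 15/2 * (real n / B)" using mw wB by linarith
 have m2B: "(real m)^2 / B <= 25/16 * (real n / B)"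
 proof -
 have "(real m)^2 <= (5/4 * w)^2" using mw by (intro power_mono) auto
 also have "... = 25/16 * real n" using w2 by (simp add: power2_eq_square)
 finally have "(real m)^2 / B <= 25/16 * real n / B" by (intro divide_right_mono) auto
 thus ?thesis by simp
 qed
 define R where "R = 800 + 200 * real m + 6 * real n / B + 1300 * (real m)^2 / B"
 \<comment> \<open>The \<open>28 * m\<close> collects the additive constants 14 of the
   \<open>m\<close> columns and of the \<open>m\<close> buckets.\<close>
 have R: "R + 28 * real m <= 3800 * (real n / B)"
 proof -
 have "1300 * (real m)^2 / B <= 1300 * (25/16 * (real n / B))" using m2B by simp
 thus ?thesis unfolding R_def using mB nB by simp
 qed
 define x where "x = ln (real n) / l"
 have n0: "0 < real n" using n17 by simp
 have "l <= ln (real n)" unfolding l_def using nL L0 by simp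
 hence x1: "1 <= x" unfolding x_def using l0 by (simp add: le_divide_eq)
 have xl: "ln (real n) = x * l" using l0 by (simp add: x_def)
 have lnw: "ln w = x * l / 2" unfolding w_def using n0 xl by (simp add: ln_sqrt)
 have Gn: "log_bound l (real n) = 16000 * (2 * x - 1) * (real n / B) + 14"
 unfolding log_bound_def x_def[symmetric] using x1 by (simp add: max_absorb1)
 have nn: "n <= m * m" using m(3) by (simp add: power2_eq_square)
 \<comment> \<open>The closing calculation for any coefficients. The bound for a bucket may come
   from the induction hypothesis or, if the bucket fits, from \<open>fits\<close>.\<close>
 have fin: "sort_cost n <= ennreal (log_bound l (real n))"
 if k: "0 <= k" "0 <= A1" "0 <= A2"
 and cols: "!!b. b <= m ==> sort_cost b <= ennreal (k * real b + 14)"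
 and bks: "!!b. b < n ==> log_bound l (real b) <= A1 * real b + A2 * (real b)^2 + 14 \<or> sort_cost b <= ennreal (A1 * real b + A2 * (real b)^2 + 14)"
 and tot: "k * real n + A1 * real n + 12 * A2 * real n * real m + 3800 * (real n / B) <= 16000 * (2 * x - 1) * (real n / B)"
 for k A1 A2
 proof -
 have IH: "sort_cost b <= ennreal (A1 * real b + A2 * (real b)^2 + 14)" if b: "b < n" for b
 using bks[OF b] less[OF b] unfolding l_def[symmetric] by (meson ennreal_leI order_trans)
 have "sort_cost n <= (\<Sum>j<m. sort_cost (clm n m (Suc j) - clm n m j)) +
 ennreal (A1 * real n + 14 * real m + 12 * A2 * real n * real m + 800 + 200 * real m + 6 * real n / B + 1300 * (real m)^2 / B)"
 by (rule sort_cost_rec[OF n17 m]) (use k IH in auto)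
 also have "(\<Sum>j<m. sort_cost (clm n m (Suc j) - clm n m j)) <= ennreal (k * real n + 14 * real m)"
 by (rule sum_columns_le[OF nn k(1)]) (use cols clm_Suc_diff in auto)
 also have "ennreal (k * real n + 14 * real m) + ennreal (A1 * real n + 14 * real m + 12 * A2 * real n * real m + 800 + 200 * real m + 6 * real n / B + 1300 * (real m)^2 / B) =
 ennreal ((k * real n + 14 * real m) + (A1 * real n + 14 * real m + 12 * A2 * real n * real m + 800 + 200 * real m + 6 * real n / B + 1300 * (real m)^2 / B))"
 using k by (intro ennreal_plus[symmetric]) auto
 also have "... <= ennreal (log_bound l (real n))" unfolding Gn by (rule ennreal_leI) (use tot R in \<open>simp add: R_def\<close>)
 finally show ?thesis by (simp add: add_right_mono)
 qed
 have "sort_cost n <= ennreal (log_bound l (real n))"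
 \<comment> \<open>Below 7/4 the columns fit into the cache; from 7/4 on, replacing
   \<open>x / 2\<close> by its maximum with 1 still leaves half a unit of slack.\<close>
 proof (cases "x < 7/4")
 case True
 \<comment> \<open>Here \<open>sqrt n\<close> is at most the power 7/8 of \<open>L\<close>, and
   \<open>l / 8 \<ge> 125\<close> exceeds the bound 99 on \<open>ln 100\<close>.\<close>
 have wL: "100 * w <= L"
 proof -
 have "ln (100 * w) = ln 100 + x * l / 2" using w4 lnw by (simp add: ln_mult)
 moreover have "ln (100::real) <= 99" using ln_le_minus_one[of "100::real"] by simp
 moreover have "x * l <= 7/4 * l" using True l0 by (intro mult_right_mono) auto
 ultimately have "ln (100 * w) <= ln L" using l0 unfolding l_def by linarith
 thus ?thesis using w4 L0 by (subst (asm) ln_le_cancel_iff) auto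
 qed
 have mL: "real m <= L / 80" using mw wL by linarith
 show ?thesis
 \<comment> \<open>A bucket that does not fit has \<open>b / L > 1\<close>, so its cost of at most
   \<open>40000 * b / B\<close> is dominated by a quadratic term; the 40000 is
   \<open>16000 * (2 * (7/4) - 1)\<close>.\<close>
 proof (rule fin[where k = "26 / B" and ?A1.0 = "26 / B" and ?A2.0 = "40000 / (B * L)"])
 fix b :: nat assume "b <= m"
 hence "real b <= real m" by simp
 hence "real b <= L" using mL L0 by linarith
 thus "sort_cost b <= ennreal (26 / B * real b + 14)" using fits[of b] by simp
 next
 fix b :: nat assume b: "b < n"
 show "log_bound l (real b) <= 26 / B * real b + 40000 / (B * L) * (real b)^2 + 14 \<or> sort_cost b <= ennreal (26 / B * real b + 40000 / (B * L) * (real b)^2 + 14)"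
 proof (cases "real b <= L")
 case True
 have "0 <= 40000 / (B * L) * (real b)^2" using L0 by simp
 hence "26 * real b / B + 14 <= 26 / B * real b + 40000 / (B * L) * (real b)^2 + 14" by simp
 thus ?thesis using fits[OF True] by (meson ennreal_leI order_trans)
 next
 case False
 hence bL: "1 <= real b / L" "0 < real b" using L0 by (auto simp: le_divide_eq)
 have "ln (real b) <= ln (real n)" using b bL by simp
 hence "ln (real b) / l <= x" unfolding x_def using l0 by (intro divide_right_mono) auto
 hence "ln (real b) / l <= 7/4" using \<open>x < 7/4\<close> by linarith
 hence "max (ln (real b) / l) 1 <= 7/4" by (rule max.boundedI) simp
 hence "2 * max (ln (real b) / l) 1 - 1 <= 5/2" by linarith
 hence "16000 * real b / B * (2 * max (ln (real b) / l) 1 - 1) <= 16000 * real b / B * (5/2)" by (intro mult_left_mono) auto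
 also have "... = 40000 * real b / B * 1" by simp
 also have "... <= 40000 * real b / B * (real b / L)" using bL(1) by (intro mult_left_mono) auto
 also have "... = 40000 / (B * L) * (real b)^2" by (simp add: power2_eq_square)
 finally have "log_bound l (real b) <= 40000 / (B * L) * (real b)^2 + 14" unfolding log_bound_def by simp
 moreover have "0 <= 26 / B * real b" by simp
 ultimately have "log_bound l (real b) <= 26 / B * real b + 40000 / (B * L) * (real b)^2 + 14" by linarith
 thus ?thesis by blast
 qed
 next
 have "480000 * (real m / L) <= 6000" using mL L0 by (simp add: divide_le_eq)
 hence "480000 * (real m / L) * (real n / B) <= 6000 * (real n / B)" by (intro mult_right_mono) auto
 moreover have "12 * (40000 / (B * L)) * real n * real m = 480000 * (real m / L) * (real n / B)" by (simp add: mult_ac)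
 moreover have "26 / B * real n = 26 * (real n / B)" by simp
 moreover have "16000 * 1 * (real n / B) <= 16000 * (2 * x - 1) * (real n / B)" using x1 by (intro mult_right_mono mult_left_mono) auto
 moreover have "0 <= real n / B" by simp
 ultimately show "26 / B * real n + 26 / B * real n + 12 * (40000 / (B * L)) * real n * real m + 3800 * (real n / B) <= 16000 * (2 * x - 1) * (real n / B)"
 by linarith
 qed (use L0 in auto)
 next
 case False
 define y where "y = max (x / 2) 1"
 have lb: "log_bound l (real b) <= 16000 / B * (2 * y - 1) * real b + 16000 / B * (2 * z) * real b + 14"
 if "1 <= b ==> ln (real b) / l <= x / 2 + z" "0 <= z" for b :: nat and z
 proof (cases "1 <= b")
 case True
 hence "max (ln (real b) / l) 1 <= y + z" unfolding y_def using that by auto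
 hence "16000 * real b / B * (2 * max (ln (real b) / l) 1 - 1) <= 16000 * real b / B * (2 * (y + z) - 1)" by (intro mult_left_mono) auto
 also have "... = 16000 / B * (2 * y - 1) * real b + 16000 / B * (2 * z) * real b" by (simp add: algebra_simps add_divide_distrib diff_divide_distrib)
 finally show ?thesis unfolding log_bound_def by simp
 qed (simp add: log_bound_def not_le)
 have wl: "0 < w * l" using w4 l0 by simp
 have y1: "1 <= y" unfolding y_def by simp
 have mn: "m < n" using m(4,5) by linarith
 show ?thesis
 proof (rule fin[where k = "16000 / B * (2 * y - 1) + 16000 / B * (1 / 2000)" and ?A1.0 = "16000 / B * (2 * y - 1)" and ?A2.0 = "32000 / (B * (w * l))"])
 fix b :: nat assume b: "b <= m"
 \<comment> \<open>Rounding makes \<open>m\<close> larger than \<open>sqrt n\<close> by a factor of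
   at most 5/4, which shifts the logarithm by at most \<open>1/4\<close> divided by
   \<open>l\<close>.\<close>
 have z: "ln (real b) / l <= x / 2 + 1 / 4000" if "1 <= b"
 proof -
 have "real b <= 5/4 * w" using b mw by linarith
 hence "ln (real b) <= ln (5/4 * w)" using that by simp
 also have "... = ln (5/4) + ln w" using w4 by (intro ln_mult_pos) auto
 finally have "ln (real b) <= 1/4 + x * l / 2" unfolding lnw using ln_le_minus_one[of "5/4::real"] by simp
 also have "... <= (x / 2 + 1 / 4000) * l" using l0 by (simp add: algebra_simps)
 finally show ?thesis using l0 by (simp add: divide_le_eq)
 qed
 have "log_bound l (real b) <= 16000 / B * (2 * y - 1) * real b + 16000 / B * (2 * (1 / 4000)) * real b + 14" by (rule lb[OF z]) auto
 hence "log_bound l (real b) <= (16000 / B * (2 * y - 1) + 16000 / B * (1 / 2000)) * real b + 14" by (simp add: distrib_right)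
 thus "sort_cost b <= ennreal ((16000 / B * (2 * y - 1) + 16000 / B * (1 / 2000)) * real b + 14)"
 using less[of b] b mn unfolding l_def[symmetric] by (meson ennreal_leI order_trans le_less_trans)
 next
 fix b :: nat assume b: "b < n"
 have z: "ln (real b) / l <= x / 2 + real b / (w * l)" if "1 <= b"
 proof -
 have "real b = w * (real b / w)" using w4 by simp
 hence "ln (real b) = ln (w * (real b / w))" by simp
 also have "... = ln w + ln (real b / w)" using w4 that by (intro ln_mult_pos) auto
 also have "... <= x * l / 2 + real b / w" using ln_le_minus_one[of "real b / w"] w4 that lnw by simp
 also have "... = (x / 2 + real b / (w * l)) * l" using l0 by (simp add: distrib_right)
 finally show ?thesis using l0 by (simp add: divide_le_eq)
 qed
 have "log_bound l (real b) <= 16000 / B * (2 * y - 1) * real b + 16000 / B * (2 * (real b / (w * l))) * real b + 14"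
 by (rule lb[OF z]) (use wl in auto)
 also have "16000 / B * (2 * (real b / (w * l))) * real b = 32000 / (B * (w * l)) * (real b)^2" by (simp add: power2_eq_square)
 finally show "log_bound l (real b) <= 16000 / B * (2 * y - 1) * real b + 32000 / (B * (w * l)) * (real b)^2 + 14 \<or>
 sort_cost b <= ennreal (16000 / B * (2 * y - 1) * real b + 32000 / (B * (w * l)) * (real b)^2 + 14)" by blast
 next
 \<comment> \<open>The quadratic part contributes \<open>12 * 32000 / 800 = 480\<close> units of
   \<open>n / B\<close>; it is small because \<open>l\<close> is large.\<close>
 have "real m / (w * l) <= 1 / 800"
 proof -
 have "800 * real m <= w * 1000" using mw by linarith
 also have "... <= w * l" using l0 w4 by (intro mult_left_mono) auto
 finally show ?thesis using wl by (simp add: divide_le_eq)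
 qed
 hence q: "384000 * (real m / (w * l)) * (real n / B) <= 480 * (real n / B)" by (intro mult_right_mono) auto
 have e1: "12 * (32000 / (B * (w * l))) * real n * real m = 384000 * (real m / (w * l)) * (real n / B)" by (simp add: mult_ac)
 have e2: "(16000 / B * (2 * y - 1) + 16000 / B * (1 / 2000)) * real n + 16000 / B * (2 * y - 1) * real n = (16000 * (4 * y - 2) + 8) * (real n / B)"
 using B0 by (simp add: field_simps)
 \<comment> \<open>For \<open>y = 1\<close> this is exactly \<open>7/4 \<le> x\<close>, the origin
   of the threshold.\<close>
 have "4 * y - 2 <= 2 * x - 3/2" unfolding y_def using False by auto
 hence "(16000 * (4 * y - 2) + 8 + 480 + 3800) * (real n / B) <= 16000 * (2 * x - 1) * (real n / B)" by (intro mult_right_mono) auto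
 thus "(16000 / B * (2 * y - 1) + 16000 / B * (1 / 2000)) * real n + 16000 / B * (2 * y - 1) * real n +
 12 * (32000 / (B * (w * l))) * real n * real m + 3800 * (real n / B) <= 16000 * (2 * x - 1) * (real n / B)"
 unfolding e1 e2 using q unfolding distrib_right[of _ 3800] distrib_right[of _ 480] by linarith
 qed (use y1 wl in auto)
 qed
 thus ?thesis unfolding l_def .
 qed
qed

section \<open>Bounds for complete runs of SquareSort\<close>

lemma squaresort_run_ew:
 assumes "valid_input n H a d s"
 shows "ew (%_. s) (Call SquareSort [N a, N d, N (int n)]) H s
 (pc (sort_space a d s n) (%H' sp'. sp' = s & sort_post n H a d s H') (%_. 0)) <= 8 + sort_cost n"
 by (rule SquareSort_call_ew[where s = s]) (use assms in \<open>auto simp: sort_space_def\<close>)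

text \<open>The cost \<open>cst\<close> also empties the cache at the end and so dominates
  \<open>opt_ios\<close>; the 8 pays for passing the arguments.\<close>

lemma squaresort_T_le:
 assumes "K = M div B"
 shows "squaresort_T M B n <= 8 + sort_cost n"
 unfolding squaresort_T_def
proof (rule SUP_least, clarify)
 fix H a d s assume val: "valid_input n H a d s"
 have "expected_ios M B (squaresort_run n H a d s) = ew (%_. s) (Call SquareSort [N a, N d, N (int n)]) H s (%H' sp' t. of_nat (opt_ios M B t))"
 unfolding expected_ios_def squaresort_run_def ew_def wpp_def by (simp add: case_prod_unfold)
 also have "... <= ew (%_. s) (Call SquareSort [N a, N d, N (int n)]) H s
 (pc (sort_space a d s n) (%H' sp'. sp' = s & sort_post n H a d s H') (%_. 0))"
 proof (rule ew_mono)
 fix H' sp' t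
 have "opt_ios M B t <= cst t" using opt_ios_le_serves[of M B t "cst t"] serves_cst[of t] unfolding assms by blast
 thus "of_nat (opt_ios M B t) <= pc (sort_space a d s n) (%H' sp'. sp' = s & sort_post n H a d s H') (%_. 0) H' sp' t"
 unfolding pc_def by (auto intro: of_nat_mono)
 qed
 also have "... <= 8 + sort_cost n" by (rule squaresort_run_ew[OF val])
 finally show "expected_ios M B (squaresort_run n H a d s) <= 8 + sort_cost n" .
qed

lemma aux_space_le:
 assumes val: "valid_input n H a d s" and t: "(H', sp, t) \<in> set_spmf (squaresort_run n H a d s)"
 shows "aux_space s t <= 16 + 11 * int n"
proof -
 have "8 + sort_cost n < \<top>" using sort_cost_finite by simp
 hence "ew (%_. s) (Call SquareSort [N a, N d, N (int n)]) H s
 (pc (sort_space a d s n) (%H' sp'. sp' = s & sort_post n H a d s H') (%_. 0)) < \<top>"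
 by (rule le_less_trans[OF squaresort_run_ew[OF val]])
 hence "ae (%_. s) (Call SquareSort [N a, N d, N (int n)]) H s (%H' sp' t. addrs t <= sort_space a d s n)"
 by (rule ae_of_ew) (simp add: pc_def)
 from AS_set_spmf[OF this[unfolded ae_def] t[unfolded squaresort_run_def]] have sub: "addrs t <= sort_space a d s n" by simp
 have "addr_of y + 1 - s <= 16 + 11 * int n" if "y \<in> set t" for y
 proof -
 have "addr_of y \<in> sort_space a d s n" using sub that by blast
 thus ?thesis using val unfolding sort_space_def valid_input_def by auto
 qed
 thus ?thesis unfolding aux_space_def by (subst Max_le_iff) auto
qed

end

text \<open>The space does not depend on the cache, so any parameters that the locale admits serve
  to invoke the analysis. The 12 comes from \<open>16 + 11 * n \<le> 12 * n\<close> for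
  \<open>n \<ge> 16\<close>.\<close>

lemma space_const_12: "squaresort_space_const 12"
 unfolding squaresort_space_const_def
proof (intro allI impI)
 fix n :: nat and H a d s H' sp t
 assume n: "16 <= n" and val: "valid_input n H a d s" and t: "(H', sp, t) \<in> set_spmf (squaresort_run n H a d s)"
 interpret cache 1000 1000 by unfold_locales auto
 have "aux_space s t <= 16 + 11 * int n" by (rule aux_space_le[OF val t])
 hence "aux_space s t <= 12 * int n" using n by linarith
 hence "real_of_int (aux_space s t) <= real_of_int (12 * int n)" by (simp only: of_int_le_iff)
 thus "real_of_int (aux_space s t) <= 12 * real n" by simp
qed

text \<open>About \<open>\<alpha>\<close> only \<open>6 \<le> \<alpha> \<le> B\<close> is known, so
  the base \<open>M / 28\<close> of the analysis is compared with \<open>M / \<alpha>\<close>: the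
  logarithm of the latter is at most twice that of the former. Since
  \<open>2 * (2 * X) - 1 \<le> 3 * (2 * X - 1)\<close> for \<open>X \<ge> 1\<close>, the constant
  16000 becomes 48000.\<close>

lemma squaresort_T_log:
 fixes M B n :: nat and \<alpha> :: real
 assumes \<alpha>: "6 <= \<alpha>" "\<alpha> <= real B" and B: "exp 600 + 30000 <= real B" and M: "B^2 <= M" and n: "1 <= n"
 shows "squaresort_T M B n <= ennreal (48000 * real n / B * (2 * max (log (real M / \<alpha>) (real n)) 1 - 1) + 3000)"
proof -
 have e0: "0 < exp (600::real)" by simp
 have B3: "30000 <= real B" using B e0 by linarith
 have MB: "B * B <= M" using M by (simp add: power2_eq_square)
 have B0: "0 < B" using B3 by (cases B) auto
 have KB: "B <= M div B" using div_le_mono[OF MB, of B] B0 by simp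
 interpret cache "M div B" B by unfold_locales (use B3 KB in auto)
 have rM: "(real B)^2 <= real M" using M by (simp flip: of_nat_power)
 have "0 < B * B" using B0 by simp
 hence M0: "0 < real M" using MB by linarith
 \<comment> \<open>\<open>exp 600\<close> is chosen so that \<open>ln M \<ge> 1200\<close> and hence
   \<open>ln (M / 28) \<ge> 1000\<close>.\<close>
 have "exp 600 <= real B" using B by linarith
 hence lnB: "600 <= ln (real B)" using B0 by (simp add: ln_ge_iff)
 have "ln ((real B)^2) <= ln (real M)" using rM M0 B0 by simp
 hence lnM: "1200 <= ln (real M)" using lnB B0 by (simp add: ln_realpow)
 define l where "l = ln (real M / 28)"
 have l: "l = ln (real M) - ln 28" unfolding l_def using M0 by (simp add: ln_div)
 have l28: "ln (28::real) <= 27" using ln_le_minus_one[of "28::real"] by simp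
 have l0: "1000 <= l" using l l28 lnM by linarith
 have MdB: "real M / B - 1 <= real (M div B)"
 proof -
 have "M mod B < B" using B0 by simp
 hence "M < (M div B + 1) * B" using div_mult_mod_eq[of M B] unfolding distrib_right by linarith
 hence "real M < real ((M div B + 1) * B)" by (simp only: of_nat_less_iff)
 hence "real M / B < real (M div B) + 1" using B0 by (simp add: divide_less_eq distrib_right add.commute del: of_nat_div)
 thus ?thesis by linarith
 qed
 have MBB: "30000 <= real M / B"
 proof -
 have "real B * real B <= real M" using rM by (simp add: power2_eq_square)
 hence "real B <= real M / B" using B0 by (simp add: le_divide_eq)
 thus ?thesis using B3 by linarith
 qed
 have "sort_cost n <= ennreal (log_bound (ln (real M / 28)) (real n))"
 \<comment> \<open>An input of \<open>M / 28\<close> items takes at most 13/28 of the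
   \<open>M / B\<close> blocks, up to an additive constant.\<close>
 proof (rule sort_cost_log)
 have "13 * (real M / 28) / B = 13 / 28 * (real M / B)" by simp
 thus "13 * (real M / 28) / B + 8 <= real (M div B)" using MdB MBB by linarith
 qed (use rM l0 B3 in \<open>auto simp: l_def\<close>)
 hence "8 + sort_cost n <= ennreal 8 + ennreal (log_bound l (real n))" unfolding l_def by (simp add: add_left_mono)
 also have "... = ennreal (8 + log_bound l (real n))"
 proof (rule ennreal_plus[symmetric])
 have "0 <= 16000 * real n / B * (2 * max (ln (real n) / l) 1 - 1)" by (intro mult_nonneg_nonneg) auto
 thus "0 <= log_bound l (real n)" unfolding log_bound_def by linarith
 qed simp
 also have "... <= ennreal (48000 * real n / B * (2 * max (log (real M / \<alpha>) (real n)) 1 - 1) + 3000)"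
 proof (rule ennreal_leI)
 define X where "X = max (log (real M / \<alpha>) (real n)) 1"
 have "real B * 1 < real B * real B" using B3 by (intro mult_strict_left_mono) auto
 hence "\<alpha> < real M" using \<alpha> rM unfolding power2_eq_square by linarith
 hence la: "0 < ln (real M / \<alpha>)" using \<alpha> by simp
 have "ln (real M / \<alpha>) = ln (real M) - ln \<alpha>" using \<alpha> M0 by (simp add: ln_div)
 moreover have "0 <= ln \<alpha>" using \<alpha> by simp
 ultimately have "ln (real M / \<alpha>) <= 2 * l" using l l28 lnM by linarith
 hence "ln (real n) / (2 * l) <= ln (real n) / ln (real M / \<alpha>)" using la n l0 by (intro divide_left_mono) auto
 hence "ln (real n) / l <= 2 * log (real M / \<alpha>) (real n)" unfolding log_def using l0 by simp
 hence X: "max (ln (real n) / l) 1 <= 2 * X" "1 <= X" unfolding X_def by auto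
 define r where "r = 16000 * real n / B"
 have e: "48000 * real n / B = 3 * r" unfolding r_def by simp
 have "r * (2 * max (ln (real n) / l) 1 - 1) <= r * (3 * (2 * X - 1))"
 using X by (intro mult_left_mono) (auto simp: r_def)
 also have "... = 3 * r * (2 * X - 1)" by (simp only: mult_ac)
 finally show "8 + log_bound l (real n) <= 48000 * real n / B * (2 * X - 1) + 3000"
 unfolding e log_bound_def r_def[symmetric] by linarith
 qed
 finally show ?thesis using squaresort_T_le[OF refl, of n] by (rule order_trans[rotated])
qed

text \<open>The condition \<open>M / B \<le> n\<close> makes the logarithm at least 1 and, as
  \<open>B \<le> M / B\<close>, also gives \<open>n / B \<ge> 1\<close>. The additive constant is
  therefore absorbed: \<open>99000 = 2 * 48000 + 3000\<close>.\<close>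

lemma squaresort_T_nlogn:
 fixes M B n :: nat and \<alpha> :: real
 assumes \<alpha>: "6 <= \<alpha>" "\<alpha> <= real B" and B: "exp 600 + 30000 <= real B" and M: "B^2 <= M" and n: "real M / real B <= real n"
 shows "squaresort_T M B n <= ennreal (99000 * (real n / real B * log (real M / real B) (real n)))"
proof -
 have e0: "0 < exp (600::real)" by simp
 have B3: "30000 <= real B" using B e0 by linarith
 have rM: "(real B)^2 <= real M" using M by (simp flip: of_nat_power)
 hence "real B * real B <= real M" by (simp add: power2_eq_square)
 hence MB: "real B <= real M / B" using B3 by (simp add: le_divide_eq)
 hence nB: "real B <= real n" using n by linarith
 have n1: "1 <= n" using nB B3 by linarith
 define y where "y = log (real M / B) (real n)"
 have lMB: "0 < ln (real M / B)" using MB B3 by (intro ln_gt_zero) linarith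
 have "ln (real M / B) <= ln (real n)" using n MB B3 by (subst ln_le_cancel_iff) auto
 hence y1: "1 <= y" unfolding y_def log_def using lMB by (simp add: le_divide_eq)
 have "real M / B <= real M / \<alpha>" using \<alpha> by (intro divide_left_mono) auto
 hence "ln (real M / B) <= ln (real M / \<alpha>)" using MB B3 by (subst ln_le_cancel_iff) (auto intro: less_le_trans)
 hence "log (real M / \<alpha>) (real n) <= y" unfolding y_def log_def using lMB n1 by (intro divide_left_mono mult_pos_pos) auto
 hence "max (log (real M / \<alpha>) (real n)) 1 <= y" using y1 by simp
 hence f1: "48000 * real n / B * (2 * max (log (real M / \<alpha>) (real n)) 1 - 1) <= 48000 * real n / B * (2 * y)" by (intro mult_left_mono) auto
 have "1 <= real n / B" using nB B3 by (simp add: le_divide_eq)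
 hence "1 * 1 <= real n / B * y" using y1 by (intro mult_mono) auto
 hence f2: "3000 <= 3000 * (real n / B * y)" by simp
 have "48000 * real n / B * (2 * y) + 3000 * (real n / B * y) = 99000 * (real n / B * y)" by simp
 hence "48000 * real n / B * (2 * max (log (real M / \<alpha>) (real n)) 1 - 1) + 3000 <= 99000 * (real n / B * y)"
 using add_mono[OF f1 f2] by (rule subst)
 thus ?thesis using squaresort_T_log[OF \<alpha> B M n1] unfolding y_def by (meson ennreal_leI order_trans)
qed

text \<open>The first conjunct shows that space constants exist, so the second, stated for each of
  them, is not vacuous. The asymptotic claim is made for \<open>M / B \<le> n\<close>, where its
  logarithm is at least 1.\<close>

theorem theorem3:
  shows "(\<exists>cS>1. squaresort_space_const cS) \<and>
    (\<forall>cS>1. squaresort_space_const cS \<longrightarrow>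
      (\<exists>\<alpha> c \<beta>. \<alpha> = 2 * (cS + 2) \<and> 1 < \<alpha> \<and> 64 \<le> c \<and> \<alpha> < \<beta> \<and>
        (\<forall>B M n :: nat. \<beta> < real B \<longrightarrow> B\<^sup>2 \<le> M \<longrightarrow> 1 \<le> n \<longrightarrow>
          squaresort_T M B n \<le> ennreal
            (c * real n / real B * (2 * max (log (real M / \<alpha>) (real n)) 1 - 1) + c / 16)) \<and>
        (\<exists>K>0. \<forall>B M n :: nat. \<beta> < real B \<longrightarrow> B\<^sup>2 \<le> M \<longrightarrow> real M / real B \<le> real n \<longrightarrow>
          squaresort_T M B n \<le> ennreal
            (K * (real n / real B * log (real M / real B) (real n))))))"
proof (intro conjI allI impI)
  show "\<exists>cS>1. squaresort_space_const cS" using space_const_12 by (intro exI[of _ 12]) simp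
  fix cS :: real assume cS: "1 < cS" "squaresort_space_const cS"
  define \<alpha> where "\<alpha> = 2 * (cS + 2)"
  \<comment> \<open>The summand \<open>\<alpha>\<close> guarantees \<open>\<alpha> \<le> B\<close>;
    the other two guarantee that \<open>B\<close> is large enough for the analysis.\<close>
  define \<beta> where "\<beta> = \<alpha> + exp 600 + 30000"
  have \<alpha>: "6 \<le> \<alpha>" using cS by (simp add: \<alpha>_def)
  have e0: "0 < exp (600::real)" by simp
  have B: "\<alpha> \<le> real B" "exp 600 + 30000 \<le> real B" if "\<beta> < real B" for B :: nat
    using that \<alpha> e0 unfolding \<beta>_def by linarith+
  have 1: "squaresort_T M B n \<le> ennreal (48000 * real n / real B * (2 * max (log (real M / \<alpha>) (real n)) 1 - 1) + 48000 / 16)"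
    if "\<beta> < real B" "B\<^sup>2 \<le> M" "1 \<le> n" for B M n
    using squaresort_T_log[OF \<alpha> B[OF that(1)] that(2,3)] by simp
  have 2: "squaresort_T M B n \<le> ennreal (99000 * (real n / real B * log (real M / real B) (real n)))"
    if "\<beta> < real B" "B\<^sup>2 \<le> M" "real M / real B \<le> real n" for B M n
    by (rule squaresort_T_nlogn[OF \<alpha> B[OF that(1)] that(2,3)])
  have less: "\<alpha> < \<beta>" using e0 unfolding \<beta>_def by linarith
  show "\<exists>\<alpha> c \<beta>. \<alpha> = 2 * (cS + 2) \<and> 1 < \<alpha> \<and> 64 \<le> c \<and> \<alpha> < \<beta> \<and>
        (\<forall>B M n :: nat. \<beta> < real B \<longrightarrow> B\<^sup>2 \<le> M \<longrightarrow> 1 \<le> n \<longrightarrow>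
          squaresort_T M B n \<le> ennreal
            (c * real n / real B * (2 * max (log (real M / \<alpha>) (real n)) 1 - 1) + c / 16)) \<and>
        (\<exists>K>0. \<forall>B M n :: nat. \<beta> < real B \<longrightarrow> B\<^sup>2 \<le> M \<longrightarrow> real M / real B \<le> real n \<longrightarrow>
          squaresort_T M B n \<le> ennreal
            (K * (real n / real B * log (real M / real B) (real n))))"
  proof (rule exI[of _ \<alpha>], rule exI[of _ "48000::real"], rule exI[of _ \<beta>], intro conjI)
    show "\<alpha> = 2 * (cS + 2)" by (rule \<alpha>_def)
    show "1 < \<alpha>" using \<alpha> by simp
    show "\<forall>B M n :: nat. \<beta> < real B \<longrightarrow> B\<^sup>2 \<le> M \<longrightarrow> 1 \<le> n \<longrightarrow>
          squaresort_T M B n \<le> ennreal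
            (48000 * real n / real B * (2 * max (log (real M / \<alpha>) (real n)) 1 - 1) + 48000 / 16)" by (intro allI impI) (rule 1)
    show "\<exists>K>0. \<forall>B M n :: nat. \<beta> < real B \<longrightarrow> B\<^sup>2 \<le> M \<longrightarrow> real M / real B \<le> real n \<longrightarrow>
          squaresort_T M B n \<le> ennreal (K * (real n / real B * log (real M / real B) (real n)))"
    proof (rule exI[of _ "99000::real"], intro conjI allI impI)
      show "0 < (99000::real)" by simp
    qed (rule 2)
  qed (use less in simp_all)
qed

end
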